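(* Let $\xi$ denote the real root of the polynomial $20\xi^3+4\xi^2-1$, and put $$C=\frac{19+75\xi-12\xi^2}{8+60\xi},$$ so that $\xi=0.312383\ldots$ and $C=1.542749\ldots$. Then for large values of $k$, one has $\widetilde G(k)<Ck^2+O(k)$; that is, there exist absolute constants $A$ and $k_0$ such that $\widetilde G(k)<Ck^2+Ak$ for all natural numbers $k\ge k_0$.
   Context: Write $e(z)=e^{2\pi i z}$. For natural numbers $s,k$, let $R_{s,k}(n)$ denote the number of representations of the natural number $n$ as the sum of $s$ $k$th powers of positive integers. Put $$\mathfrak S_{s,k}(n)=\sum_{q=1}^\infty\ \sum_{\substack{1\le a\le q\\ (a,q)=1}}\Bigl(q^{-1}\sum_{r=1}^q e(ar^k/q)\Bigr)^s e(-na/q).$$ Then $\widetilde G(k)$ denotes the least integer $t$ with the property that, for all integers $s\ge t$, and all sufficiently large natural numbers $n$, one has the asymptotic formula $$R_{s,k}(n)=\frac{\Gamma(1+1/k)^s}{\Gamma(s/k)}\mathfrak S_{s,k}(n)\,n^{s/k-1}+o(n^{s/k-1})\qquad (n\to\infty).$$ *)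

theory Defs
  imports "HOL-Analysis.Analysis" "HOL-Library.Landau_Symbols"
begin

definition expi :: "real \<Rightarrow> complex" where
  "expi z = exp (2 * of_real pi * \<i> * of_real z)"

text \<open>Representations are counted as ordered \<open>s\<close>-tuples.\<close>

definition rep_count :: "nat \<Rightarrow> nat \<Rightarrow> nat \<Rightarrow> nat" where
  "rep_count s k n =
     card {xs :: nat list. length xs = s \<and> (\<forall>x\<in>set xs. 0 < x) \<and> (\<Sum>x\<leftarrow>xs. x ^ k) = n}"

definition singular_term :: "nat \<Rightarrow> nat \<Rightarrow> nat \<Rightarrow> nat \<Rightarrow> complex" where
  "singular_term s k n q =
     (\<Sum>a\<in>{a \<in> {1..q}. coprime a q}.
        (inverse (of_nat q) * (\<Sum>r=1..q. expi (real (a * r ^ k) / real q))) ^ s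
          * expi (- (real n * real a / real q)))"

text \<open>The index is shifted because the series runs over \<open>q \<ge> 1\<close>.\<close>

definition singular_series :: "nat \<Rightarrow> nat \<Rightarrow> nat \<Rightarrow> complex" where
  "singular_series s k n = (\<Sum>q. singular_term s k n (Suc q))"

text \<open>
  The value of \<^const>\<open>suminf\<close> on a divergent series is meaningless, so convergence of the
  singular series (for all large \<open>n\<close>) is made an explicit part of the validity of the
  asymptotic formula.
\<close>

definition asymptotic_formula :: "nat \<Rightarrow> nat \<Rightarrow> bool" where
  "asymptotic_formula s k \<longleftrightarrow>
     (\<forall>\<^sub>F n in sequentially. summable (\<lambda>q. singular_term s k n (Suc q))) \<and>
     (\<lambda>n. of_nat (rep_count s k n)
            - of_real (Gamma (1 + 1 / real k) ^ s / Gamma (real s / real k))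
              * singular_series s k n * of_real (real n powr (real s / real k - 1)))
       \<in> o[sequentially](\<lambda>n. complex_of_real (real n powr (real s / real k - 1)))"

definition Gtilde_admissible :: "nat \<Rightarrow> nat \<Rightarrow> bool" where
  "Gtilde_admissible k t \<longleftrightarrow> 1 \<le> t \<and> (\<forall>s\<ge>t. asymptotic_formula s k)"

text \<open>Meaningful only if some admissible \<open>t\<close> exists; otherwise the value is unspecified.\<close>

definition Gtilde :: "nat \<Rightarrow> nat" where
  "Gtilde k = (LEAST t. Gtilde_admissible k t)"

lemma xi_ex1: "\<exists>!x::real. 20 * x ^ 3 + 4 * x ^ 2 - 1 = 0"
proof -
  have "\<exists>x\<ge>0. x \<le> (1::real) \<and> 20 * x ^ 3 + 4 * x ^ 2 - 1 = 0"
    by (rule IVT') (auto intro!: continuous_intros)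
  then obtain x :: real where x: "20 * x ^ 3 + 4 * x ^ 2 - 1 = 0" by blast
  have pos: "y > 0" if "20 * y ^ 3 + 4 * y ^ 2 - 1 = 0" for y :: real
  proof (rule ccontr)
    assume "\<not> y > 0"
    define z where "z = - y"
    have z: "z \<ge> 0" using \<open>\<not> y > 0\<close> by (simp add: z_def)
    have "20 * z ^ 3 - 4 * z ^ 2 + 1 = 0"
      using that by (simp add: z_def)
    moreover have "20 * z ^ 3 - 4 * z ^ 2 + 1 = 20 * (z * (z - 1/5)\<^sup>2) + 4 * (z - 1/10)\<^sup>2 + 24/25"
      by (simp add: power2_eq_square power3_eq_cube field_simps)
    moreover have "z * (z - 1/5)\<^sup>2 \<ge> 0" using z by simp
    ultimately show False using zero_le_power2[of "z - 1/10"] by linarith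
  qed
  have mono: "20 * u ^ 3 + 4 * u ^ 2 < 20 * v ^ 3 + 4 * v ^ 2" if "0 < u" "u < v" for u v :: real
    using that power_strict_mono[of u v 3] power_strict_mono[of u v 2] by simp
  show ?thesis
  proof (rule ex1I[of _ x])
    fix y :: real assume y: "20 * y ^ 3 + 4 * y ^ 2 - 1 = 0"
    show "y = x"
      using mono[of x y] mono[of y x] pos[OF x] pos[OF y] x y by (cases x y rule: linorder_cases) auto
  qed (rule x)
qed

end

theory Submission
  imports Defs "HOL-Computational_Algebra.Polynomial" "HOL-Computational_Algebra.Primes"
begin

text \<open>
  The full Vinogradov mean value theorem makes \<open>k\<^sup>2 + k + 1\<close> an admissible number of variables, and
  since \<open>C > 1\<close> this is more than enough.

  The mean value theorem \<open>\<integral> |f| ^ (k(k+1)) \<lless> P ^ (k\<^sup>2 + \<epsilon>)\<close> for the Weyl sum \<open>f\<close> follows from a congruence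
  version, modulo powers of a prime \<open>p > k\<close>, of the decoupling theorem for the moment curve, with the
  induction of Guo, Li, Yung and Zorin-Kranich: a sum over a residue class modulo \<open>p\<close> is compared
  with a sum over a transversal class modulo \<open>p\<^sup>b\<close>; the latter has constant modulus under many
  shifts of the parameter, so that decoupling in lower degree applies to the former, and Hoelder's
  inequality closes a recursion in \<open>b\<close> that improves every positive decoupling exponent.

  Given the mean value theorem, the circle method works for \<open>s > k\<^sup>2 + k\<close>: a power saving of \<open>f\<close> on
  the minor arcs, however small, suffices, and Weyl differencing provides one.  Restricted to narrow
  major arcs, the mean value theorem also bounds the \<open>k(k+1)\<close>-th moment of the normalised Gauss sums,
  which yields the absolute convergence of the singular series.
\<close>

text \<open>The prime p depends on k alone while the scale N grows. A loss of a bounded power of p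
  is therefore a constant, p^N can be taken within the factor p of P, and a decoupling exponent
  \<epsilon> becomes a power P^\<epsilon> in the mean value. Degree k uses all lower degrees with
  every positive exponent, so the induction on the degree encloses the improvement of the exponent.

  The obstacle in passing from degree l to l' < l is that the phases constant on the transversal
  class are those whose derivative contains (x - c)^(l-l'); they are not polynomials of degree l'.
  On a class modulo p away from c this factor is a unit modulo p. Hence only the derivative of a
  phase is prescribed, up to such a unit, and p > K allows it to be integrated over the integers.

  The exponent l(l+1) is the one at which the mixed moments interpolate with matching exponents. In
  the circle method the parameter Q is about P^(1/10): every saving is a fixed power of Q, so the
  P^\<epsilon> of the mean value is affordable once \<epsilon> is small.\<close>

lemma Holder_sum_weighted:
  fixes a b :: "'a \<Rightarrow> real"
  assumes nonneg: "\<And>i. i \<in> I \<Longrightarrow> a i \<ge> 0" "\<And>i. i \<in> I \<Longrightarrow> b i \<ge> 0"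
    and t: "0 < t" "t < 1"
  shows "(\<Sum>i\<in>I. a i powr (1 - t) * b i powr t) \<le> (\<Sum>i\<in>I. a i) powr (1 - t) * (\<Sum>i\<in>I. b i) powr t"
proof (cases "finite I")
  case True
  define A B where "A = (\<Sum>i\<in>I. a i)" and "B = (\<Sum>i\<in>I. b i)"
  have "A \<ge> 0" "B \<ge> 0" using nonneg by (auto simp: A_def B_def intro: sum_nonneg)
  show ?thesis
  proof (cases "A = 0 \<or> B = 0")
    case True
    then have "\<forall>i\<in>I. a i = 0 \<or> b i = 0"
      using \<open>finite I\<close> nonneg by (auto simp: A_def B_def sum_nonneg_eq_0_iff)
    then have "(\<Sum>i\<in>I. a i powr (1 - t) * b i powr t) = 0"
      by (intro sum.neutral) auto
    then show ?thesis by simp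
  next
    case False
    with \<open>A \<ge> 0\<close> \<open>B \<ge> 0\<close> have pos: "A > 0" "B > 0" by auto
    have *: "a i powr (1 - t) * b i powr t
        \<le> A powr (1 - t) * B powr t * ((1 - t) * (a i / A) + t * (b i / B))" if "i \<in> I" for i
    proof (cases "a i = 0 \<or> b i = 0")
      case True
      have "0 \<le> A powr (1 - t) * B powr t * ((1 - t) * (a i / A) + t * (b i / B))"
        using pos nonneg that t by (intro mult_nonneg_nonneg add_nonneg_nonneg) auto
      with True show ?thesis by auto
    next
      case False
      then have ab: "a i > 0" "b i > 0" using nonneg[OF that] by auto
      have "(a i / A) powr (1 - t) * (b i / B) powr t \<le> (1 - t) * (a i / A) + t * (b i / B)"
        using ab pos t by (intro Youngs_inequality_0) auto
      then have "A powr (1 - t) * B powr t * ((a i / A) powr (1 - t) * (b i / B) powr t)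
         \<le> A powr (1 - t) * B powr t * ((1 - t) * (a i / A) + t * (b i / B))"
        by (intro mult_left_mono) auto
      then show ?thesis using ab pos by (simp add: powr_divide field_simps)
    qed
    have "(\<Sum>i\<in>I. a i powr (1 - t) * b i powr t)
       \<le> (\<Sum>i\<in>I. A powr (1 - t) * B powr t * ((1 - t) * (a i / A) + t * (b i / B)))"
      by (rule sum_mono) (rule *)
    also have "\<dots> = A powr (1 - t) * B powr t * ((1 - t) * (A / A) + t * (B / B))"
      unfolding A_def B_def by (simp only: sum_distrib_left [symmetric] sum.distrib sum_divide_distrib)
    also have "\<dots> = A powr (1 - t) * B powr t" using pos by simp
    finally show ?thesis by (simp add: A_def B_def)
  qed
qed auto

lemma powr_inverse_power:
  fixes x :: real
  assumes "x \<ge> 0" "s \<ge> 1"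
  shows "(x powr (1 / real s)) ^ s = x"
  using assms by (cases "x = 0") (auto simp: powr_realpow [symmetric] powr_powr)

text \<open>Jensen's inequality for \<open>x ^ s\<close>: the sum over \<open>T\<close> is
  \<open>S\<close> times the convex combination, with weights \<open>n t / S\<close>, of the
  normalised terms \<open>g t w / n t\<close>, whose \<open>s\<close>-th moments are at most 1.
  Terms of norm 0 vanish identically.\<close>

lemma Minkowski_sum:
  fixes g :: "'t \<Rightarrow> 'w \<Rightarrow> real"
  assumes T: "finite T" and W: "finite W" and nonneg: "\<And>t w. t \<in> T \<Longrightarrow> w \<in> W \<Longrightarrow> g t w \<ge> 0"
    and s: "s \<ge> 1"
  shows "(\<Sum>w\<in>W. (\<Sum>t\<in>T. g t w) ^ s) powr (1 / real s) \<le> (\<Sum>t\<in>T. (\<Sum>w\<in>W. g t w ^ s) powr (1 / real s))"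
proof -
  define n where "n t = (\<Sum>w\<in>W. g t w ^ s) powr (1 / real s)" for t
  have n_pow: "n t ^ s = (\<Sum>w\<in>W. g t w ^ s)" if "t \<in> T" for t
    unfolding n_def using s nonneg[OF that] by (intro powr_inverse_power sum_nonneg) auto
  have n0: "n t \<ge> 0" for t by (simp add: n_def)
  have zero: "g t w = 0" if "t \<in> T" "w \<in> W" "n t = 0" for t w
  proof -
    have "(\<Sum>w\<in>W. g t w ^ s) = 0" using n_pow[OF that(1)] that(3) s by (simp add: power_0_left)
    then have "g t w ^ s = 0" using W nonneg that by (subst (asm) sum_nonneg_eq_0_iff) auto
    then show ?thesis by simp
  qed
  define S where "S = (\<Sum>t\<in>T. n t)"
  have "S \<ge> 0" by (auto simp: S_def n0 intro: sum_nonneg)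
  show ?thesis
  proof (cases "S = 0")
    case True
    then have "\<forall>t\<in>T. n t = 0" using T n0 by (simp add: S_def sum_nonneg_eq_0_iff)
    then have "(\<Sum>w\<in>W. (\<Sum>t\<in>T. g t w) ^ s) = 0" using zero s by (intro sum.neutral) simp
    then have "(\<Sum>w\<in>W. (\<Sum>t\<in>T. g t w) ^ s) powr (1 / real s) = 0" by simp
    then show ?thesis by (simp add: sum_nonneg)
  next
    case False
    with \<open>S \<ge> 0\<close> have S: "S > 0" by simp
    have "T \<noteq> {}" using S by (auto simp: S_def)
    have convex: "convex_on {0::real..} (\<lambda>x. x ^ s)"
      by (cases "even s") (auto intro: convex_power_odd convex_on_subset[OF convex_power_even])
    have pw: "(\<Sum>t\<in>T. g t w) ^ s \<le> S ^ s * (\<Sum>t\<in>T. (n t / S) * (g t w / n t) ^ s)" if "w \<in> W" for w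
    proof -
      have eq: "(\<Sum>t\<in>T. g t w) = S * (\<Sum>t\<in>T. (n t / S) *\<^sub>R (g t w / n t))"
        unfolding sum_distrib_left using S zero that by (intro sum.cong) auto
      have "(\<Sum>t\<in>T. (n t / S) *\<^sub>R (g t w / n t)) ^ s \<le> (\<Sum>t\<in>T. (n t / S) * (g t w / n t) ^ s)"
        using S n0 T \<open>T \<noteq> {}\<close> nonneg that
        by (intro convex_on_sum[where C = "{0..}" and f = "\<lambda>x. x ^ s"])
           (auto simp: S_def convex simp flip: sum_divide_distrib)
      then show ?thesis unfolding eq power_mult_distrib using S by (intro mult_left_mono) auto
    qed
    have "(\<Sum>w\<in>W. (\<Sum>t\<in>T. g t w) ^ s) \<le> (\<Sum>w\<in>W. S ^ s * (\<Sum>t\<in>T. (n t / S) * (g t w / n t) ^ s))"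
      by (rule sum_mono) (rule pw)
    also have "\<dots> = S ^ s * (\<Sum>t\<in>T. (n t / S) * ((\<Sum>w\<in>W. g t w ^ s) / n t ^ s))"
      by (subst sum.swap[of _ W, symmetric] | simp add: sum_distrib_left sum_divide_distrib power_divide sum.swap[of _ W T])+
    also have "\<dots> \<le> S ^ s * (\<Sum>t\<in>T. (n t / S) * 1)"
      using S n0 n_pow by (intro mult_left_mono sum_mono) auto
    also have "\<dots> = S ^ s" using S by (simp add: S_def flip: sum_divide_distrib)
    finally have "(\<Sum>w\<in>W. (\<Sum>t\<in>T. g t w) ^ s) powr (1 / real s) \<le> (S ^ s) powr (1 / real s)"
      using nonneg by (intro powr_mono2) (auto intro!: sum_nonneg zero_le_power)
    also have "\<dots> = S" using S s by (simp add: powr_realpow [symmetric] powr_powr)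
    finally show ?thesis by (simp add: S_def n_def)
  qed
qed

section \<open>Integer polynomials: antiderivatives and affine substitutions\<close>

lemma pderiv_sum: "pderiv (sum f A) = (\<Sum>x\<in>A. pderiv (f x))"
  by (induction A rule: infinite_finite_induct) (auto simp: pderiv_add)

text \<open>Integration divides the coefficient of degree j by j + 1, and every such divisor is at
  most \<open>K\<close>, hence divides \<open>fact K\<close>.\<close>

lemma exists_antiderivative_fact:
  fixes R :: "int poly"
  assumes "degree R < K"
  shows "\<exists>G. pderiv G = smult (fact K) R"
proof
  let ?G = "\<Sum>j\<le>degree R. monom (fact K div int (Suc j) * coeff R j) (Suc j)"
  have "pderiv ?G = (\<Sum>j\<le>degree R. monom (fact K * coeff R j) j)"
    unfolding pderiv_sum
  proof (intro sum.cong refl)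
    fix j assume "j \<in> {..degree R}"
    then have "int (Suc j) dvd fact K"
      using assms by (subst of_nat_fact [symmetric], subst int_dvd_int_iff) (auto intro: dvd_fact)
    then have "int (Suc j) * (fact K div int (Suc j) * coeff R j) = fact K * coeff R j"
      by (metis dvd_mult_div_cancel mult.assoc)
    then show "pderiv (monom (fact K div int (Suc j) * coeff R j) (Suc j)) = monom (fact K * coeff R j) j"
      by (simp only: pderiv_monom of_nat_id diff_Suc_1)
  qed
  also have "\<dots> = smult (fact K) R"
  proof (rule poly_eqI)
    fix i
    show "coeff (\<Sum>j\<le>degree R. monom (fact K * coeff R j) j) i = coeff (smult (fact K) R) i"
      by (cases "i \<le> degree R") (simp_all add: coeff_sum coeff_eq_0)
  qed
  finally show "pderiv ?G = smult (fact K) R" .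
qed

lemma pderiv_eq_imp_eq_add_const:
  fixes G H :: "int poly"
  assumes "pderiv G = pderiv H"
  shows "\<exists>c. G = H + [:c:]"
proof -
  have "pderiv (G - H) = 0" using assms by (simp add: pderiv_diff)
  then obtain c where "G - H = [:c:]" by (metis pderiv_iszero)
  then show ?thesis by (intro exI[of _ c]) (simp add: algebra_simps)
qed

text \<open>\<open>R\<close> is r((x - c)/m) with denominators cleared: multiplication by m^(l-1)
  leaves the integral power m^(l-1-j) in degree j.\<close>

lemma exists_poly_rescale:
  fixes r :: "int poly"
  assumes "degree r < l"
  shows "\<exists>R. degree R < l \<and> pcompose R [:c, m:] = smult (m ^ (l - 1)) r"
proof -
  let ?S = "\<Sum>j<l. monom (coeff r j * m ^ (l - 1 - j)) j"
  let ?R = "pcompose ?S [:- c, 1:]"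
  have "degree ?S \<le> l - 1" using assms
    by (intro degree_sum_le) (auto intro: order_trans[OF degree_monom_le])
  then have "degree ?R < l" using assms by (simp add: degree_pcompose)
  moreover have "pcompose ?R [:c, m:] = smult (m ^ (l - 1)) r"
  proof (subst poly_eq_poly_eq_iff [symmetric], rule ext)
    fix y
    have r: "poly r y = (\<Sum>j<l. coeff r j * y ^ j)"
      using assms by (intro poly_altdef[THEN trans] sum.mono_neutral_left) (auto simp: coeff_eq_0)
    have "poly (pcompose ?R [:c, m:]) y = (\<Sum>j<l. coeff r j * m ^ (l - 1 - j) * (m * y) ^ j)"
      by (simp add: poly_pcompose poly_sum poly_monom algebra_simps)
    also have "\<dots> = (\<Sum>j<l. m ^ (l - 1) * (coeff r j * y ^ j))"
    proof (intro sum.cong refl)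
      fix j assume "j \<in> {..<l}"
      then have "m ^ (l - 1) = m ^ (l - 1 - j) * m ^ j" by (simp flip: power_add)
      then show "coeff r j * m ^ (l - 1 - j) * (m * y) ^ j = m ^ (l - 1) * (coeff r j * y ^ j)"
        by (simp add: power_mult_distrib)
    qed
    finally show "poly (pcompose ?R [:c, m:]) y = poly (smult (m ^ (l - 1)) r) y"
      by (simp add: r sum_distrib_left)
  qed
  ultimately show ?thesis by blast
qed

lemma norm_expi [simp]: "norm (expi z) = 1"
  by (simp add: expi_def norm_exp_eq_Re)

lemma expi_0 [simp]: "expi 0 = 1"
  by (simp add: expi_def)

lemma expi_add: "expi (x + y) = expi x * expi y"
  by (simp add: expi_def ring_distribs exp_add)

lemma expi_of_int [simp]: "expi (of_int n) = 1"
  unfolding expi_def by (metis exp_2pi_1_int mult.assoc mult.commute of_real_of_int_eq)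

section \<open>Congruence decoupling\<close>

definition exp_sum :: "('w \<Rightarrow> int \<Rightarrow> complex) \<Rightarrow> int set \<Rightarrow> 'w \<Rightarrow> complex" where
  "exp_sum \<phi> X \<omega> = (\<Sum>x\<in>X. \<phi> \<omega> x)"

definition res_part :: "int set \<Rightarrow> int \<Rightarrow> int \<Rightarrow> int set" where
  "res_part X m c = {x \<in> X. x mod m = c}"

definition tri :: "nat \<Rightarrow> nat" where
  "tri l = l * (l + 1) div 2"

lemma two_tri: "2 * tri l = l * (l + 1)"
  by (simp add: tri_def)

lemma real_tri: "real (tri l) = real l * (real l + 1) / 2"
proof -
  have "real (2 * tri l) = real (l * (l + 1))" by (simp only: two_tri)
  then show ?thesis by (simp add: algebra_simps)
qed

lemma tri_ge_1: "l \<ge> 1 \<Longrightarrow> tri l \<ge> 1"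
  using two_tri[of l] by (cases "tri l") auto

lemma tri_mono: "l \<le> k \<Longrightarrow> tri l \<le> tri k"
  unfolding tri_def by (intro div_le_mono mult_le_mono) auto

locale decoupling =
  fixes p K :: nat and \<Omega> :: "'w set"
  assumes prime_p: "prime p" and K_less_p: "K < p" and finite_\<Omega>: "finite \<Omega>"
begin

lemma p_gt_1: "p > 1" using prime_p prime_gt_1_nat by blast
lemma pp_pos [simp]: "0 < int p ^ n" using p_gt_1 by simp

text \<open>The square of the L^(2s) norm for the counting measure on \<open>\<Omega>\<close>. An
  l^2 decoupling inequality adds squares of norms over the classes, so \<open>sqfun\<close> is its
  right-hand side, and Minkowski's inequality is applied to |exp_sum|^2.\<close>

definition sqnorm :: "nat \<Rightarrow> ('w \<Rightarrow> int \<Rightarrow> complex) \<Rightarrow> int set \<Rightarrow> real" where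
  "sqnorm s \<phi> X = (\<Sum>\<omega>\<in>\<Omega>. norm (exp_sum \<phi> X \<omega>) ^ (2 * s)) powr (1 / real s)"

definition sqfun :: "nat \<Rightarrow> nat \<Rightarrow> ('w \<Rightarrow> int \<Rightarrow> complex) \<Rightarrow> int set \<Rightarrow> real" where
  "sqfun N s \<phi> X = (\<Sum>\<theta>\<in>{0..<int p ^ N}. sqnorm s \<phi> (res_part X (int p ^ N) \<theta>))"

text \<open>
  On a torus of polynomial phases, multiplying the coefficients by a rational polynomial phase is a
  translation of the parameter.  Only this invariance is used, so \<open>\<Omega>\<close> can be any finite set.
\<close>

definition shift :: "('w \<Rightarrow> int \<Rightarrow> complex) \<Rightarrow> (int \<Rightarrow> complex) \<Rightarrow> bool" where
  "shift \<phi> h \<longleftrightarrow> (\<exists>\<sigma> u. bij_betw \<sigma> \<Omega> \<Omega> \<and>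
     (\<forall>\<omega>\<in>\<Omega>. norm (u \<omega>) = 1 \<and> (\<forall>x. \<phi> (\<sigma> \<omega>) x = u \<omega> * \<phi> \<omega> x * h x)))"

text \<open>
  The polynomial \<open>Q\<close> is a unit modulo \<open>p\<close> at every integer.  The phases belonging to level \<open>l\<close> are the
  \<open>G\<close> with \<open>G' = K! Q r\<close>, \<open>degree r < l\<close>; this family is stable under the passage to lower degree, which
  the plain polynomials of degree \<open>l\<close> (the case \<open>Q = 1\<close>) are not.  The bound on \<open>degree Q\<close> keeps
  \<open>degree G \<le> K\<close>, so that the factor \<open>K!\<close>, a unit modulo \<open>p\<close>, makes \<open>G\<close> integral.
\<close>

definition weight :: "nat \<Rightarrow> int poly \<Rightarrow> bool" where
  "weight l Q \<longleftrightarrow> (\<exists>q Q'. Q = [:q:] + smult (int p) Q' \<and> \<not> int p dvd q) \<and> degree Q \<le> K - l"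

definition admissible :: "nat \<Rightarrow> nat \<Rightarrow> int poly \<Rightarrow> ('w \<Rightarrow> int \<Rightarrow> complex) \<Rightarrow> bool" where
  "admissible l N Q \<phi> \<longleftrightarrow> (\<forall>r G. degree r < l \<longrightarrow> pderiv G = smult (fact K) (Q * r) \<longrightarrow>
     shift \<phi> (\<lambda>x. expi (of_int (poly G x) / real p ^ (l * N))))"

text \<open>\<open>2 * tri l\<close> is l(l+1), the critical exponent of the moment curve in degree
  l. In the usual normalisation by norms instead of their squares, \<open>D\<close> is the square of
  the decoupling constant.\<close>

definition dec :: "nat \<Rightarrow> nat \<Rightarrow> real \<Rightarrow> bool" where
  "dec l N D \<longleftrightarrow> (\<forall>\<phi> Q X. finite X \<longrightarrow> weight l Q \<longrightarrow> admissible l N Q \<phi> \<longrightarrow>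
     sqnorm (tri l) \<phi> X \<le> D * sqfun N (tri l) \<phi> X)"

lemma weight_pcompose:
  assumes "weight l Q" shows "weight l (pcompose Q [:c, m:])"
proof -
  from assms obtain q Q' where Q: "Q = [:q:] + smult (int p) Q'" "\<not> int p dvd q" "degree Q \<le> K - l"
    by (auto simp: weight_def)
  have "pcompose Q [:c, m:] = [:q:] + smult (int p) (pcompose Q' [:c, m:])"
    by (simp add: Q(1) pcompose_add pcompose_smult pcompose_const)
  moreover have "degree (pcompose Q [:c, m:]) \<le> K - l"
    using Q(3) by (auto simp: degree_pcompose)
  ultimately show ?thesis using Q(2) unfolding weight_def by blast
qed

text \<open>A factor d + p x is congruent to d, a unit modulo p. The l - l' new linear factors use
  up exactly the increase of the permitted degree from K - l to K - l'.\<close>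

lemma weight_mult_power:
  assumes "weight l Q" "\<not> int p dvd d" "l' \<le> l" "l \<le> K"
  shows "weight l' (Q * [:d, int p:] ^ (l - l'))"
proof -
  have unit: "(\<exists>q Q'. Q * [:d, int p:] ^ n = [:q:] + smult (int p) Q' \<and> \<not> int p dvd q)" for n
  proof (induction n)
    case 0 then show ?case using assms(1) by (auto simp: weight_def)
  next
    case (Suc n)
    then obtain q Q' where q: "Q * [:d, int p:] ^ n = [:q:] + smult (int p) Q'" "\<not> int p dvd q" by blast
    have "Q * [:d, int p:] ^ Suc n = ([:q:] + smult (int p) Q') * ([:d:] + smult (int p) [:0, 1:])"
      by (simp add: q(1) [symmetric] algebra_simps)
    also have "\<dots> = [:q * d:] + smult (int p) ([:q:] * [:0, 1:] + Q' * [:d, int p:])"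
      by (subst poly_eq_poly_eq_iff [symmetric], rule ext) (simp add: algebra_simps)
    finally show ?case using q(2) assms(2) prime_p
      by (metis prime_dvd_mult_iff prime_int_nat_transfer nat_int of_nat_0_le_iff prime_nat_int_transfer)
  qed
  have "degree (Q * [:d, int p:] ^ (l - l')) \<le> degree Q + degree [:d, int p:] * (l - l')"
    by (rule order_trans[OF degree_mult_le add_left_mono[OF degree_power_le]])
  also have "\<dots> \<le> (K - l) + 1 * (l - l')"
    using assms(1) by (intro add_mono mult_mono) (auto simp: weight_def)
  also have "\<dots> = K - l'" using assms by simp
  finally show ?thesis using unit by (auto simp: weight_def)
qed

text \<open>If the phase is constant on \<open>Y\<close>, the translation multiplies
  \<open>exp_sum \<phi> Y\<close> by a unimodular number, so a factor depending on the modulus is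
  carried along unchanged. The constant \<open>v'\<close> arising from the substitution
  \<open>\<iota>\<close> goes into the unimodular multiplier.\<close>

lemma shift_restrict:
  assumes "shift \<phi> h" and v: "norm v = 1" "\<And>x. x \<in> Y \<Longrightarrow> h x = v"
    and v': "norm v' = 1" "\<And>y. h (\<iota> y) = v' * h' y"
  shows "shift (\<lambda>\<omega> y. of_real (F (norm (exp_sum \<phi> Y \<omega>))) * \<phi> \<omega> (\<iota> y)) h'"
proof -
  from assms(1) obtain \<sigma> u where \<sigma>: "bij_betw \<sigma> \<Omega> \<Omega>"
    and u: "\<And>\<omega>. \<omega> \<in> \<Omega> \<Longrightarrow> norm (u \<omega>) = 1" "\<And>\<omega> x. \<omega> \<in> \<Omega> \<Longrightarrow> \<phi> (\<sigma> \<omega>) x = u \<omega> * \<phi> \<omega> x * h x"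
    unfolding shift_def by blast
  have *: "norm (exp_sum \<phi> Y (\<sigma> \<omega>)) = norm (exp_sum \<phi> Y \<omega>)" if "\<omega> \<in> \<Omega>" for \<omega>
  proof -
    have "exp_sum \<phi> Y (\<sigma> \<omega>) = u \<omega> * exp_sum \<phi> Y \<omega> * v"
      using v(2) u(2)[OF that] by (simp add: exp_sum_def sum_distrib_left sum_distrib_right)
    then show ?thesis using u(1)[OF that] v by (simp add: norm_mult)
  qed
  show ?thesis unfolding shift_def
    using \<sigma> u v' by (intro exI[of _ \<sigma>] exI[of _ "\<lambda>\<omega>. u \<omega> * v'"]) (auto simp: * norm_mult)
qed

lemma shift_rescale:
  assumes "shift \<phi> h" "norm v' = 1" "\<And>y. h (\<iota> y) = v' * h' y"
  shows "shift (\<lambda>\<omega> y. \<phi> \<omega> (\<iota> y)) h'"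
  using shift_restrict[OF assms(1), of 1 "{}" v' \<iota> h' "\<lambda>_. 1"] assms(2,3) by simp

lemma pderiv_pcompose_linear:
  "pderiv (pcompose G [:c, m:]) = smult m (pcompose (pderiv G) [:c, m:])"
  by (simp add: pderiv_pcompose pderiv_pCons)

text \<open>A phase on the class has to be induced by a phase of the whole line. The chain rule
  contributes one factor p^a and the rescaled \<open>R\<close> another p^(a(l-1)); together they are
  p^(al), exactly the quotient of the denominators p^(lN) and p^(l(N-a)).\<close>

lemma admissible_rescale:
  assumes adm: "admissible l N Q \<phi>" and Q: "weight l Q" and a: "a \<le> N" and l: "1 \<le> l" "l \<le> K"
  shows "admissible l (N - a) (pcompose Q [:c, int p ^ a:]) (\<lambda>\<omega> y. \<phi> \<omega> (c + int p ^ a * y))"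
  unfolding admissible_def
proof (intro allI impI)
  fix r G' assume r: "degree r < l" and G': "pderiv G' = smult (fact K) (pcompose Q [:c, int p ^ a:] * r)"
  define m where "m = int p ^ a"
  obtain R where R: "degree R < l" "pcompose R [:c, m:] = smult (m ^ (l - 1)) r"
    using exists_poly_rescale[OF r] by blast
  have "degree (Q * R) \<le> degree Q + degree R" by (rule degree_mult_le)
  also have "\<dots> < K" using R(1) Q l by (auto simp: weight_def)
  finally obtain G where G: "pderiv G = smult (fact K) (Q * R)" using exists_antiderivative_fact by blast
  have m_pow: "m * (fact K * m ^ (l - 1)) = m ^ l * fact K" using l by (cases l) auto
  have "pderiv (pcompose G [:c, m:]) = smult (m * (fact K * m ^ (l - 1))) (pcompose Q [:c, m:] * r)"
    by (simp only: pderiv_pcompose_linear G pcompose_smult pcompose_mult R smult_smult mult_smult_right)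
  also have "\<dots> = pderiv (smult (m ^ l) G')"
    by (simp only: m_pow pderiv_smult G'[folded m_def] smult_smult)
  finally have "pderiv (pcompose G [:c, m:]) = pderiv (smult (m ^ l) G')" .
  then obtain b where b: "pcompose G [:c, m:] = smult (m ^ l) G' + [:b:]"
    using pderiv_eq_imp_eq_add_const by blast
  have "shift \<phi> (\<lambda>x. expi (of_int (poly G x) / real p ^ (l * N)))"
    using adm R(1) G unfolding admissible_def by blast
  then show "shift (\<lambda>\<omega> y. \<phi> \<omega> (c + int p ^ a * y)) (\<lambda>y. expi (of_int (poly G' y) / real p ^ (l * (N - a))))"
  proof (rule shift_rescale)
    fix y
    have "poly G (c + int p ^ a * y) = m ^ l * poly G' y + b"
      using arg_cong[OF b, of "\<lambda>q. poly q y"] by (simp add: poly_pcompose m_def mult.commute)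
    moreover have "real p ^ (l * N) = real_of_int m ^ l * real p ^ (l * (N - a))"
    proof -
      have "l * N = a * l + l * (N - a)" using a by (metis add_mult_distrib2 le_add_diff_inverse mult.commute)
      then show ?thesis by (simp add: m_def power_add power_mult)
    qed
    moreover have "m \<noteq> 0" using p_gt_1 by (simp add: m_def)
    ultimately have "of_int (poly G (c + int p ^ a * y)) / real p ^ (l * N)
       = of_int (poly G' y) / real p ^ (l * (N - a)) + of_int b / real p ^ (l * N)"
      by (simp add: add_divide_distrib)
    then show "expi (of_int (poly G (c + int p ^ a * y)) / real p ^ (l * N)) =
         expi (of_int b / real p ^ (l * N)) * expi (of_int (poly G' y) / real p ^ (l * (N - a)))"
      by (simp add: expi_add)
  qed simp
qed

end

lemma pcompose_power: "pcompose (q ^ n) r = pcompose q r ^ n"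
  for q r :: "'a :: comm_semiring_1 poly"
  by (induction n) (simp_all add: pcompose_mult pcompose_1)

section \<open>Rescaling of residue classes, and phases constant on a transversal class\<close>

context decoupling
begin

lemma p_pos [simp]: "0 < p"
  using p_gt_1 by simp

lemma sqnorm_nonneg [simp]: "0 \<le> sqnorm s \<phi> X"
  by (simp add: sqnorm_def)

lemma sqfun_nonneg [simp]: "0 \<le> sqfun N s \<phi> X"
  by (auto simp: sqfun_def intro: sum_nonneg)

lemma sqnorm_empty [simp]: "s \<ge> 1 \<Longrightarrow> sqnorm s \<phi> {} = 0"
  by (simp add: sqnorm_def exp_sum_def)

lemma sqnorm_power:
  "s \<ge> 1 \<Longrightarrow> sqnorm s \<phi> X ^ s = (\<Sum>\<omega>\<in>\<Omega>. norm (exp_sum \<phi> X \<omega>) ^ (2 * s))"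
  unfolding sqnorm_def by (rule powr_inverse_power) (auto intro: sum_nonneg)

lemma finite_res_part [simp]: "finite X \<Longrightarrow> finite (res_part X m c)"
  by (simp add: res_part_def)

lemma sqfun_partition:
  assumes "s \<ge> 1" "a \<le> N"
  shows "sqfun N s \<phi> X = (\<Sum>c\<in>{0..<int p ^ a}. sqfun N s \<phi> (res_part X (int p ^ a) c))"
proof -
  have "(\<Sum>c\<in>{0..<int p ^ a}. sqfun N s \<phi> (res_part X (int p ^ a) c)) =
     (\<Sum>\<theta>\<in>{0..<int p ^ N}. \<Sum>c\<in>{0..<int p ^ a}. sqnorm s \<phi> (res_part (res_part X (int p ^ a) c) (int p ^ N) \<theta>))"
    unfolding sqfun_def by (rule sum.swap)
  also have "\<dots> = (\<Sum>\<theta>\<in>{0..<int p ^ N}. \<Sum>c\<in>{0..<int p ^ a}.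
      if c = \<theta> mod int p ^ a then sqnorm s \<phi> (res_part X (int p ^ N) \<theta>) else 0)"
  proof (intro sum.cong refl)
    fix \<theta> c
    have dvd: "int p ^ a dvd int p ^ N" using assms by (simp add: le_imp_power_dvd)
    have "x mod int p ^ a = \<theta> mod int p ^ a" if "x mod int p ^ N = \<theta>" for x
      using that dvd by (metis mod_mod_cancel)
    then have "res_part (res_part X (int p ^ a) c) (int p ^ N) \<theta> =
       (if c = \<theta> mod int p ^ a then res_part X (int p ^ N) \<theta> else {})"
      by (auto simp: res_part_def)
    then show "sqnorm s \<phi> (res_part (res_part X (int p ^ a) c) (int p ^ N) \<theta>) =
      (if c = \<theta> mod int p ^ a then sqnorm s \<phi> (res_part X (int p ^ N) \<theta>) else 0)"
      using assms by simp
  qed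
  also have "\<dots> = (\<Sum>\<theta>\<in>{0..<int p ^ N}. sqnorm s \<phi> (res_part X (int p ^ N) \<theta>))"
    by (intro sum.cong refl) simp
  finally show ?thesis by (simp add: sqfun_def)
qed

lemma sqfun_res_part_le:
  assumes "s \<ge> 1" "a \<le> N"
  shows "sqfun N s \<phi> (res_part X (int p ^ a) c) \<le> sqfun N s \<phi> X"
proof (cases "c \<in> {0..<int p ^ a}")
  case True
  show ?thesis unfolding sqfun_partition[OF assms, of \<phi> X]
    by (rule member_le_sum[OF True, of "\<lambda>c. sqfun N s \<phi> (res_part X (int p ^ a) c)"]) auto
next
  case False
  then have "x mod int p ^ a \<noteq> c" for x
    using pos_mod_bound[OF pp_pos, of x a] pos_mod_sign[OF pp_pos, of x a] by auto
  then have empty: "res_part X (int p ^ a) c = {}" by (auto simp: res_part_def)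
  have "sqfun N s \<phi> {} = 0" using assms by (simp add: sqfun_def res_part_def)
  then show ?thesis by (simp only: empty sqfun_nonneg)
qed

lemma exp_sum_rescale:
  assumes "\<And>x. x \<in> X \<Longrightarrow> x mod m = c" "m > 0"
  shows "exp_sum (\<lambda>\<omega> y. \<phi> \<omega> (c + m * y)) {y. c + m * y \<in> X} \<omega> = exp_sum \<phi> X \<omega>"
  unfolding exp_sum_def
proof (rule sum.reindex_bij_witness[of _ "\<lambda>x. x div m" "\<lambda>y. c + m * y"])
  fix y assume "y \<in> {y. c + m * y \<in> X}"
  then have "c + m * y \<in> X" by simp
  from assms(1)[OF this] have "(c + m * y) mod m = c" .
  then have "m * ((c + m * y) div m) + c = c + m * y" by (metis mult_div_mod_eq)
  then show "(c + m * y) div m = y" using assms(2) by simp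
next
  fix x assume "x \<in> X"
  then have "c + m * (x div m) = x" using assms(1)[of x] by (metis add.commute mult_div_mod_eq)
  then show "c + m * (x div m) = x" "x div m \<in> {y. c + m * y \<in> X}" using \<open>x \<in> X\<close> by auto
qed auto

lemma finite_rescale:
  fixes m :: int
  assumes "finite X" "m > 0"
  shows "finite {y. c + m * y \<in> X}"
proof (rule finite_imageD)
  show "finite ((\<lambda>y. c + m * y) ` {y. c + m * y \<in> X})"
    by (rule finite_subset[OF _ assms(1)]) auto
  show "inj_on (\<lambda>y. c + m * y) {y. c + m * y \<in> X}" using assms(2) by (auto simp: inj_on_def)
qed

lemma sqnorm_rescale:
  assumes "\<And>x. x \<in> X \<Longrightarrow> x mod m = c" "m > 0"
  shows "sqnorm s (\<lambda>\<omega> y. \<phi> \<omega> (c + m * y)) {y. c + m * y \<in> X} = sqnorm s \<phi> X"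
  unfolding sqnorm_def by (simp add: exp_sum_rescale[OF assms])

text \<open>Only the \<theta> congruent to c modulo p^a have nonempty classes, and these are c + p^a
  \<eta> with \<eta> below p^(N-a).\<close>

lemma sqfun_rescale:
  assumes X: "\<And>x. x \<in> X \<Longrightarrow> x mod int p ^ a = c" and c: "c \<in> {0..<int p ^ a}"
    and "a \<le> N" "s \<ge> 1"
  shows "sqfun (N - a) s (\<lambda>\<omega> y. \<phi> \<omega> (c + int p ^ a * y)) {y. c + int p ^ a * y \<in> X} = sqfun N s \<phi> X"
proof -
  define m where "m = int p ^ a"
  define M where "M = int p ^ (N - a)"
  have mM: "int p ^ N = m * M" using assms by (simp add: m_def M_def flip: power_add)
  have pos: "m > 0" "M > 0" by (auto simp: m_def M_def)
  have mod_eq: "(c + m * y) mod (m * M) = c + m * (y mod M)" for y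
    using c pos by (simp add: zmod_zmult2_eq m_def [symmetric])
  have "sqfun N s \<phi> X = (\<Sum>\<theta>\<in>(\<lambda>\<eta>. c + m * \<eta>) ` {0..<M}. sqnorm s \<phi> (res_part X (m * M) \<theta>))"
    unfolding sqfun_def mM
  proof (rule sum.mono_neutral_right)
    have "c + m * \<eta> < m * M" if "\<eta> < M" for \<eta>
    proof -
      have "m * (\<eta> + 1) \<le> m * M" using that pos by (intro mult_left_mono) auto
      then show ?thesis using c by (simp add: m_def [symmetric] algebra_simps)
    qed
    then show "(\<lambda>\<eta>. c + m * \<eta>) ` {0..<M} \<subseteq> {0..<m * M}" using c pos by (auto simp: m_def [symmetric])
    show "\<forall>i\<in>{0..<m * M} - (\<lambda>\<eta>. c + m * \<eta>) ` {0..<M}. sqnorm s \<phi> (res_part X (m * M) i) = 0"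
    proof
      fix i assume i: "i \<in> {0..<m * M} - (\<lambda>\<eta>. c + m * \<eta>) ` {0..<M}"
      have "x mod (m * M) \<noteq> i" if "x \<in> X" for x
      proof -
        have "x = c + m * (x div m)" using X[OF that] by (metis add.commute mult_div_mod_eq m_def)
        then have "x mod (m * M) = c + m * ((x div m) mod M)" using mod_eq by metis
        then show ?thesis using i pos by auto
      qed
      then have "res_part X (m * M) i = {}" by (auto simp: res_part_def)
      then show "sqnorm s \<phi> (res_part X (m * M) i) = 0" using assms by simp
    qed
  qed auto
  also have "\<dots> = (\<Sum>\<eta>\<in>{0..<M}. sqnorm s \<phi> (res_part X (m * M) (c + m * \<eta>)))"
    using pos by (subst sum.reindex) (auto simp: inj_on_def)
  also have "\<dots> = (\<Sum>\<eta>\<in>{0..<M}. sqnorm s (\<lambda>\<omega> y. \<phi> \<omega> (c + m * y)) (res_part {y. c + m * y \<in> X} M \<eta>))"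
  proof (intro sum.cong refl)
    fix \<eta>
    have "res_part {y. c + m * y \<in> X} M \<eta> = {y. c + m * y \<in> res_part X (m * M) (c + m * \<eta>)}"
      using pos by (auto simp: res_part_def mod_eq)
    then show "sqnorm s \<phi> (res_part X (m * M) (c + m * \<eta>)) =
       sqnorm s (\<lambda>\<omega> y. \<phi> \<omega> (c + m * y)) (res_part {y. c + m * y \<in> X} M \<eta>)"
      using X pos by (subst sqnorm_rescale [symmetric]) (auto simp: res_part_def m_def)
  qed
  finally show ?thesis by (simp add: sqfun_def m_def M_def)
qed

text \<open>A class modulo p^a is an affine image of the whole line at the smaller scale N - a; this
  is what makes induction on scales possible.\<close>

lemma dec_residue_class:
  assumes D: "dec l (N - a) D" and "weight l Q" "admissible l N Q \<phi>" "a \<le> N" "1 \<le> l" "l \<le> K" "finite X"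
    and X: "\<And>x. x \<in> X \<Longrightarrow> x mod int p ^ a = c"
  shows "sqnorm (tri l) \<phi> X \<le> D * sqfun N (tri l) \<phi> X"
proof (cases "X = {}")
  case True
  then show ?thesis using tri_ge_1 assms by (simp add: sqfun_def res_part_def)
next
  case False
  then obtain x where "x \<in> X" by blast
  from X[OF this] have c: "c \<in> {0..<int p ^ a}" by auto
  have "sqnorm (tri l) (\<lambda>\<omega> y. \<phi> \<omega> (c + int p ^ a * y)) {y. c + int p ^ a * y \<in> X}
     \<le> D * sqfun (N - a) (tri l) (\<lambda>\<omega> y. \<phi> \<omega> (c + int p ^ a * y)) {y. c + int p ^ a * y \<in> X}"
    using D weight_pcompose[OF assms(2)] admissible_rescale[OF assms(3,2,4-6)] finite_rescale[OF \<open>finite X\<close>]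
    unfolding dec_def by (metis pp_pos)
  then show ?thesis
    using sqfun_rescale[OF X c] sqnorm_rescale[of X "int p ^ a" c, OF X] tri_ge_1 assms by simp
qed

text \<open>Taylor's formula without factorials: after moving c to 0, the coefficients of degrees 1
  to n vanish because the derivative is divisible by x^n, and every later monomial contains
  m^(n+1).\<close>

lemma dvd_poly_diff_power:
  fixes G H :: "int poly"
  assumes "pderiv G = [:- c, 1:] ^ n * H"
  shows "m ^ (n + 1) dvd poly G (c + m * t) - poly G c"
proof -
  define G1 where "G1 = pcompose G [:c, 1:]"
  have "pderiv G1 = monom 1 n * pcompose H [:c, 1:]"
    by (simp add: G1_def pderiv_pcompose_linear assms pcompose_mult pcompose_power pcompose_pCons monom_altdef)
  then have "coeff (pderiv G1) j = 0" if "j < n" for j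
    using that by (simp add: coeff_monom_mult)
  then have z: "coeff G1 j = 0" if "j \<noteq> 0" "j \<le> n" for j
    using that by (cases j) (auto simp: coeff_pderiv)
  have "poly G (c + m * t) - poly G c = poly G1 (m * t) - coeff G1 0"
    by (simp add: G1_def poly_pcompose poly_0_coeff_0 [symmetric] del: poly_0_coeff_0)
  also have "\<dots> = (\<Sum>j\<in>{..degree G1} - {0}. coeff G1 j * (m * t) ^ j)"
    by (simp add: poly_altdef sum_diff1)
  also have "m ^ (n + 1) dvd \<dots>"
  proof (rule dvd_sum)
    fix j assume j: "j \<in> {..degree G1} - {0}"
    show "m ^ (n + 1) dvd coeff G1 j * (m * t) ^ j"
    proof (cases "j \<le> n")
      case False
      then have "m ^ (n + 1) dvd m ^ j" by (intro le_imp_power_dvd) auto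
      then show ?thesis by (simp add: power_mult_distrib)
    qed (use z j in auto)
  qed
  finally show ?thesis .
qed

text \<open>
  The phases whose derivative vanishes to order \<open>l - l'\<close> at \<open>c\<close> are constant modulo 1 on \<open>Y\<close>, so the
  shifts they induce preserve \<open>|exp_sum \<phi> Y|\<close>, and with it any weight depending on it only.
\<close>

lemma admissible_transverse:
  assumes adm: "admissible l N Q \<phi>" and Q: "weight l Q" and l: "1 \<le> l'" "l' \<le> l" "l \<le> K"
    and N': "l' * (N' + 1) \<le> (l - l' + 1) * b" "l' * (N' + 1) \<le> l * N"
    and Y: "\<And>x. x \<in> Y \<Longrightarrow> x mod int p ^ b = c"
  shows "admissible l' N' (pcompose Q [:i, int p:] * [:i - c, int p:] ^ (l - l'))
     (\<lambda>\<omega> y. of_real (F (norm (exp_sum \<phi> Y \<omega>))) * \<phi> \<omega> (i + int p * y))"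
  unfolding admissible_def
proof (intro allI impI)
  fix r G' assume r: "degree r < l'"
    and G': "pderiv G' = smult (fact K) (pcompose Q [:i, int p:] * [:i - c, int p:] ^ (l - l') * r)"
  obtain R where R: "degree R < l'" "pcompose R [:i, int p:] = smult (int p ^ (l' - 1)) r"
    using exists_poly_rescale[OF r] by blast
  have deg: "degree ([:- c, 1:] ^ (l - l') * R) < l"
  proof -
    have "degree ([:- c, 1:] ^ (l - l') * R) \<le> degree [:- c, 1:] * (l - l') + degree R"
      by (rule order_trans[OF degree_mult_le add_right_mono[OF degree_power_le]])
    then show ?thesis using R(1) l by simp
  qed
  have "degree (Q * ([:- c, 1:] ^ (l - l') * R)) \<le> degree Q + degree ([:- c, 1:] ^ (l - l') * R)"
    by (rule degree_mult_le)
  also have "\<dots> < K" using deg Q l by (auto simp: weight_def)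
  finally obtain G where G: "pderiv G = smult (fact K) (Q * ([:- c, 1:] ^ (l - l') * R))"
    using exists_antiderivative_fact by blast
  have p_pow: "int p * (fact K * int p ^ (l' - 1)) = int p ^ l' * fact K" using l by (cases l') auto
  have lin: "pcompose [:- c, 1:] [:i, int p:] = [:i - c, int p:]" by (simp add: pcompose_pCons)
  have "pderiv (pcompose G [:i, int p:]) = smult (int p * (fact K * int p ^ (l' - 1)))
     (pcompose Q [:i, int p:] * [:i - c, int p:] ^ (l - l') * r)"
    by (simp only: pderiv_pcompose_linear G pcompose_smult pcompose_mult R smult_smult mult_smult_right
         pcompose_power lin mult.assoc)
  also have "\<dots> = pderiv (smult (int p ^ l') G')"
    by (simp only: p_pow pderiv_smult G' smult_smult)
  finally obtain \<beta> where \<beta>: "pcompose G [:i, int p:] = smult (int p ^ l') G' + [:\<beta>:]"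
    using pderiv_eq_imp_eq_add_const by blast
  \<comment> \<open>Multiplication by p^e stays in the family of phases of level l and lowers the
    denominator from p^(lN) to p^(l'(N'+1)).\<close>
  define e where "e = l * N - l' * (N' + 1)"
  have e: "l * N = e + l' * (N' + 1)" using N' by (simp add: e_def)
  have "degree (smult (int p ^ e) ([:- c, 1:] ^ (l - l') * R)) < l" using deg by (simp add: degree_smult_le)
  moreover have "pderiv (smult (int p ^ e) G) = smult (fact K) (Q * smult (int p ^ e) ([:- c, 1:] ^ (l - l') * R))"
    by (simp add: pderiv_smult G mult.commute)
  ultimately have "shift \<phi> (\<lambda>x. expi (of_int (poly (smult (int p ^ e) G) x) / real p ^ (l * N)))"
    using adm unfolding admissible_def by blast
  moreover have "of_int (poly (smult (int p ^ e) G) x) / real p ^ (l * N) = of_int (poly G x) / real p ^ (l' * (N' + 1))" for x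
    using p_gt_1 by (simp add: e power_add)
  ultimately have sh: "shift \<phi> (\<lambda>x. expi (of_int (poly G x) / real p ^ (l' * (N' + 1))))" by simp
  show "shift (\<lambda>\<omega> y. of_real (F (norm (exp_sum \<phi> Y \<omega>))) * \<phi> \<omega> (i + int p * y))
     (\<lambda>x. expi (of_int (poly G' x) / real p ^ (l' * N')))"
  proof (rule shift_restrict[OF sh])
    fix x assume "x \<in> Y"
    then have x: "x = c + int p ^ b * (x div int p ^ b)" using Y by (metis add.commute mult_div_mod_eq)
    \<comment> \<open>On \<open>Y\<close> the variable differs from c by a multiple of p^b, and G -
      G(c) vanishes at c to order l - l' + 1; so the phase is constant modulo 1 as soon as b(l - l'
      + 1) is at least l'(N' + 1).\<close>
    have "int p ^ (l' * (N' + 1)) dvd (int p ^ b) ^ (l - l' + 1)"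
      unfolding power_mult [symmetric] using N' by (intro le_imp_power_dvd) (simp add: mult.commute)
    also have "\<dots> dvd poly G x - poly G c"
      by (subst x, rule dvd_poly_diff_power[of _ _ _ "smult (fact K) (Q * R)"]) (simp add: G mult_ac)
    finally obtain d where "poly G x = poly G c + int p ^ (l' * (N' + 1)) * d"
      by (metis dvdE diff_eq_eq add.commute)
    then have "of_int (poly G x) / real p ^ (l' * (N' + 1)) = of_int (poly G c) / real p ^ (l' * (N' + 1)) + of_int d"
      using p_gt_1 by (simp add: add_divide_distrib)
    then show "expi (of_int (poly G x) / real p ^ (l' * (N' + 1))) = expi (of_int (poly G c) / real p ^ (l' * (N' + 1)))"
      by (simp only: expi_add expi_of_int mult_1_right)
  next
    fix y
    have "poly G (i + int p * y) = int p ^ l' * poly G' y + \<beta>"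
      using arg_cong[OF \<beta>, of "\<lambda>q. poly q y"] by (simp add: poly_pcompose mult.commute)
    then have "of_int (poly G (i + int p * y)) / real p ^ (l' * (N' + 1)) =
       of_int \<beta> / real p ^ (l' * (N' + 1)) + of_int (poly G' y) / real p ^ (l' * N')"
      using p_gt_1 by (simp add: add_divide_distrib power_add)
    then show "expi (of_int (poly G (i + int p * y)) / real p ^ (l' * (N' + 1))) =
       expi (of_int \<beta> / real p ^ (l' * (N' + 1))) * expi (of_int (poly G' y) / real p ^ (l' * N'))"
      by (simp only: expi_add)
  qed simp_all
qed

text \<open>One power of p is spent on writing x = i + p y, which is why scale N' yields classes
  modulo p^(N'+1). Transversality is what turns (i - c + p y)^(l-l') into a legitimate
  weight.\<close>

lemma dec_transverse:
  assumes D: "dec l' N' D" and adm: "admissible l N Q \<phi>" and Q: "weight l Q" and l: "1 \<le> l'" "l' \<le> l" "l \<le> K"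
    and N': "l' * (N' + 1) \<le> (l - l' + 1) * b" "l' * (N' + 1) \<le> l * N" "b \<ge> 1"
    and Y: "\<And>x. x \<in> Y \<Longrightarrow> x mod int p ^ b = c"
    and X: "finite X" "\<And>x. x \<in> X \<Longrightarrow> x mod int p = i" and ic: "\<not> int p dvd i - c"
  shows "sqnorm (tri l') (\<lambda>\<omega> x. of_real (F (norm (exp_sum \<phi> Y \<omega>))) * \<phi> \<omega> x) X
     \<le> D * sqfun (N' + 1) (tri l') (\<lambda>\<omega> x. of_real (F (norm (exp_sum \<phi> Y \<omega>))) * \<phi> \<omega> x) X"
proof (cases "X = {}")
  case True
  then show ?thesis using tri_ge_1 l by (simp add: sqfun_def res_part_def)
next
  case False
  then obtain x where "x \<in> X" by blast
  from X(2)[OF this] have i: "i \<in> {0..<int p ^ 1}" by auto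
  have X': "\<And>x. x \<in> X \<Longrightarrow> x mod int p ^ 1 = i" using X by simp
  have "weight l' (pcompose Q [:i, int p:] * [:i - c, int p:] ^ (l - l'))"
    using weight_mult_power[OF weight_pcompose[OF Q] ic] l by blast
  then have "sqnorm (tri l') (\<lambda>\<omega> y. of_real (F (norm (exp_sum \<phi> Y \<omega>))) * \<phi> \<omega> (i + int p ^ 1 * y)) {y. i + int p ^ 1 * y \<in> X}
    \<le> D * sqfun N' (tri l') (\<lambda>\<omega> y. of_real (F (norm (exp_sum \<phi> Y \<omega>))) * \<phi> \<omega> (i + int p ^ 1 * y)) {y. i + int p ^ 1 * y \<in> X}"
    using D admissible_transverse[OF adm Q l N'(1,2) Y, where F = F and i = i] finite_rescale[OF X(1), where m = "int p ^ 1" and c = i]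
    unfolding dec_def by simp
  then show ?thesis
    using sqfun_rescale[OF X' i, where N = "N' + 1" and s = "tri l'"
        and \<phi> = "\<lambda>\<omega> x. of_real (F (norm (exp_sum \<phi> Y \<omega>))) * \<phi> \<omega> x"]
      sqnorm_rescale[where X = X and m = "int p ^ 1" and c = i and s = "tri l'"
        and \<phi> = "\<lambda>\<omega> x. of_real (F (norm (exp_sum \<phi> Y \<omega>))) * \<phi> \<omega> x", OF X'] tri_ge_1 l
    by simp
qed

end

section \<open>Degree one, and mixed moments over transversal classes\<close>

lemma poly_diff_dvd: "x - y dvd poly G x - poly G y" for x y :: int
proof (induction G)
  case (pCons a G)
  have "poly (pCons a G) x - poly (pCons a G) y = (x - y) * poly G x + y * (poly G x - poly G y)"
    by (simp add: algebra_simps)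
  then show ?case using pCons.IH by simp
qed simp

lemma Holder_sum_power:
  fixes u v :: "'a \<Rightarrow> real"
  assumes "\<And>i. i \<in> I \<Longrightarrow> u i \<ge> 0" "\<And>i. i \<in> I \<Longrightarrow> v i \<ge> 0" "a \<ge> 1" "b \<ge> 1"
  shows "(\<Sum>i\<in>I. u i ^ a * v i ^ b) \<le>
    (\<Sum>i\<in>I. u i ^ (a + b)) powr (a / (a + b)) * (\<Sum>i\<in>I. v i ^ (a + b)) powr (b / (a + b))"
proof -
  have *: "(x ^ (a + b)) powr (c / (a + b)) = x ^ c" if "x \<ge> 0" "c \<ge> 1" for x :: real and c :: nat
    using that assms(3) by (cases "x = 0") (auto simp: powr_realpow [symmetric] powr_powr power_0_left)
  have t: "1 - real b / real (a + b) = real a / real (a + b)" using assms by (simp add: field_simps)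
  have "(\<Sum>i\<in>I. u i ^ a * v i ^ b) = (\<Sum>i\<in>I. (u i ^ (a + b)) powr (1 - b / (a + b)) * (v i ^ (a + b)) powr (b / (a + b)))"
    unfolding t using assms by (intro sum.cong refl) (simp add: * del: of_nat_add)
  also have "\<dots> \<le> (\<Sum>i\<in>I. u i ^ (a + b)) powr (1 - b / (a + b)) * (\<Sum>i\<in>I. v i ^ (a + b)) powr (b / (a + b))"
    using assms by (intro Holder_sum_weighted) auto
  finally show ?thesis unfolding t unfolding of_nat_add .
qed

text \<open>Apart from the degenerate case of a vanishing factor this is an equality. The value of
  \<open>t\<close> is forced by tri l - tri (l-1) = l and tri k - tri (k-l) - tri (l-1) =
  l(k-l+1).\<close>

lemma power_mult_le_powr_interpolation:
  fixes u v :: real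
  assumes uv: "u \<ge> 0" "v \<ge> 0" and l: "1 \<le> l" "l < k"
  defines "t \<equiv> 1 / real (k - l + 1)"
  shows "u ^ (2 * tri l) * v ^ (2 * (tri k - tri l)) \<le>
    (u ^ (2 * tri (l - 1)) * v ^ (2 * (tri k - tri (l - 1)))) powr (1 - t) *
    (v ^ (2 * tri (k - l)) * u ^ (2 * (tri k - tri (k - l)))) powr t"
proof (cases "u = 0 \<or> v = 0")
  case True
  have "tri l < tri k" using l real_tri[of l] real_tri[of k]
    by (smt (verit) mult_strict_mono of_nat_0_le_iff of_nat_less_iff divide_strict_right_mono)
  then have "u ^ (2 * tri l) * v ^ (2 * (tri k - tri l)) = 0" using True tri_ge_1[OF l(1)] by auto
  then show ?thesis by (simp only: mult_nonneg_nonneg powr_ge_zero)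
next
  case False
  then have pos: "u > 0" "v > 0" using uv by auto
  have tr: "tri (l - 1) \<le> tri k" "tri l \<le> tri k" "tri (k - l) \<le> tri k" using l by (auto intro: tri_mono)
  have t: "real k = real l - 1 + 1 / t" "t \<noteq> 0" using l by (auto simp: t_def of_nat_diff)
  have rl: "real (l - 1) = real l - 1" "real (k - l) = 1 / t - 1" using l by (auto simp: t_def of_nat_diff)
  have e1: "2 * real (tri (l - 1)) * (1 - t) + 2 * (real (tri k) - real (tri (k - l))) * t = 2 * real (tri l)"
    unfolding real_tri rl t(1) using t(2) by (simp add: field_simps)
  have e2: "2 * (real (tri k) - real (tri (l - 1))) * (1 - t) + 2 * real (tri (k - l)) * t = 2 * (real (tri k) - real (tri l))"
    unfolding real_tri rl t(1) using t(2) by (simp add: field_simps)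
  have "(u ^ (2 * tri (l - 1)) * v ^ (2 * (tri k - tri (l - 1)))) powr (1 - t) *
    (v ^ (2 * tri (k - l)) * u ^ (2 * (tri k - tri (k - l)))) powr t
    = u powr (2 * real (tri (l - 1)) * (1 - t) + 2 * (real (tri k) - real (tri (k - l))) * t)
      * v powr (2 * (real (tri k) - real (tri (l - 1))) * (1 - t) + 2 * real (tri (k - l)) * t)"
    using pos tr by (simp add: powr_realpow [symmetric] powr_mult powr_powr powr_add of_nat_diff mult_ac)
  also have "\<dots> = u ^ (2 * tri l) * v ^ (2 * (tri k - tri l))"
    unfolding e1 e2 using pos tr by (simp add: powr_realpow [symmetric] of_nat_diff)
  finally show ?thesis by simp
qed

lemma expi_eq_1_iff: "expi x = 1 \<longleftrightarrow> x \<in> \<int>"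
proof
  assume "expi x = 1"
  then obtain n :: int where "2 * pi * x = 2 * real_of_int n * pi"
    unfolding expi_def exp_eq_1 by (auto simp: Im_divide)
  then show "x \<in> \<int>" by auto
qed (auto elim: Ints_cases)

context decoupling
begin

lemma p_not_dvd_fact: "\<not> int p dvd fact K"
proof
  assume "int p dvd fact K"
  then have "int p dvd int (fact K)" by simp
  then show False using prime_p K_less_p by (simp only: int_dvd_int_iff prime_dvd_fact_iff)
qed

text \<open>Modulo p the antiderivative is linear with unit slope: \<open>j * coeff G j\<close> is
  K! times a coefficient of \<open>Q\<close>, and p divides neither K! nor any positive j up to K.
  Hence G(x) - G(y) is x - y times a number prime to p.\<close>

lemma weight_antiderivative_dvd:
  assumes Q: "weight 1 Q" and K: "1 \<le> K" and G: "pderiv G = smult (fact K) Q"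
    and dvd: "int p ^ N dvd poly G x - poly G y"
  shows "int p ^ N dvd x - y"
proof -
  from Q obtain q Q' where Q': "Q = [:q:] + smult (int p) Q'" "\<not> int p dvd q" and deg: "degree Q \<le> K - 1"
    by (auto simp: weight_def)
  define g0 g1 where "g0 = coeff G 0" and "g1 = coeff G 1"
  have cG: "int (Suc j) * coeff G (Suc j) = fact K * coeff Q j" for j
    using arg_cong[OF G, of "\<lambda>P. coeff P j"] by (simp add: coeff_pderiv)
  have prime: "prime (int p)" using prime_p by simp
  have g1: "\<not> int p dvd g1"
  proof
    assume "int p dvd g1"
    then have "int p dvd fact K * coeff Q 0" using cG[of 0] by (simp add: g1_def)
    then have "int p dvd coeff Q 0" using p_not_dvd_fact prime by (simp add: prime_dvd_mult_iff)
    then show False using Q' by (simp add: dvd_add_left_iff)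
  qed
  have higher: "int p dvd coeff G j" if "j \<ge> 2" for j
  proof -
    from that obtain i where j: "j = Suc i" "i \<ge> 1" by (cases j) auto
    show ?thesis
    proof (cases "j \<le> K")
      case True
      have "int p dvd coeff Q i" using j by (cases i) (auto simp: Q')
      then have "int p dvd int j * coeff G j" unfolding j cG by simp
      moreover have "\<not> int p dvd int j" using True K_less_p j by (auto dest: zdvd_imp_le)
      ultimately show ?thesis using prime by (simp add: prime_dvd_mult_iff)
    next
      case False
      then have "coeff Q i = 0" using deg j by (intro coeff_eq_0) auto
      then have "int j * coeff G j = 0" unfolding j cG by simp
      then show ?thesis using j by simp
    qed
  qed
  have "int p dvd coeff (G - [:g0, g1:]) j" for j
    using higher[of j] by (cases j; cases "j - 1") (auto simp: g0_def g1_def coeff_pCons split: nat.splits)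
  then have "[:int p:] dvd G - [:g0, g1:]" by (simp add: const_poly_dvd_iff)
  then obtain H where "G - [:g0, g1:] = smult (int p) H" by (auto simp: dvd_def)
  then have GH: "G = [:g0, g1:] + smult (int p) H" by (simp add: algebra_simps)
  obtain m where m: "poly H x - poly H y = (x - y) * m" using poly_diff_dvd by blast
  have "poly G x - poly G y = g1 * (x - y) + int p * (poly H x - poly H y)"
    by (simp add: GH algebra_simps)
  also have "\<dots> = (x - y) * (g1 + int p * m)" unfolding m by (simp add: algebra_simps)
  finally have "poly G x - poly G y = (x - y) * (g1 + int p * m)" .
  then have "int p ^ N dvd (x - y) * (g1 + int p * m)" using dvd by simp
  moreover have "coprime (int p ^ N) (g1 + int p * m)"
  proof -
    have "\<not> int p dvd g1 + int p * m" using g1 by (simp add: dvd_add_left_iff)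
    then show ?thesis using prime by (simp add: prime_imp_coprime)
  qed
  ultimately show ?thesis by (simp add: coprime_dvd_mult_left_iff)
qed

lemma exp_sum_partition:
  assumes "finite X" "m > 0"
  shows "exp_sum \<phi> X \<omega> = (\<Sum>c\<in>{0..<m}. exp_sum \<phi> (res_part X m c) \<omega>)"
proof -
  have "(\<Sum>c\<in>{0..<m}. exp_sum \<phi> (res_part X m c) \<omega>) = exp_sum \<phi> (\<Union>c\<in>{0..<m}. res_part X m c) \<omega>"
    unfolding exp_sum_def using assms by (intro sum.UNION_disjoint [symmetric]) (auto simp: res_part_def)
  also have "(\<Union>c\<in>{0..<m}. res_part X m c) = X" using assms by (auto simp: res_part_def)
  finally show ?thesis by simp
qed

text \<open>Orthogonality: invariance under the shift multiplies the inner product of the columns x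
  and y by e((G(x) - G(y))/p^N), so it is 0 unless x and y agree modulo p^N. As
  \<open>2 * tri 1\<close> is 2, the moment splits exactly over the classes.\<close>

lemma dec_1: assumes "1 \<le> K" shows "dec 1 N 1"
  unfolding dec_def
proof (intro allI impI)
  fix \<phi> :: "'w \<Rightarrow> int \<Rightarrow> complex" and Q and X :: "int set"
  assume X: "finite X" and Q: "weight 1 Q" and adm: "admissible 1 N Q \<phi>"
  define I where "I x y = (\<Sum>\<omega>\<in>\<Omega>. \<phi> \<omega> x * cnj (\<phi> \<omega> y))" for x y
  have "degree Q < K" using Q assms by (auto simp: weight_def)
  then obtain G where G: "pderiv G = smult (fact K) Q" using exists_antiderivative_fact by blast
  have sh: "shift \<phi> (\<lambda>x. expi (of_int (poly G x) / real p ^ N))"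
    using adm[unfolded admissible_def, rule_format, of 1 G] G by simp
  have orth: "I x y = 0" if "x mod int p ^ N \<noteq> y mod int p ^ N" for x y
  proof -
    define h where "h x = expi (of_int (poly G x) / real p ^ N)" for x
    from sh obtain \<sigma> u where \<sigma>: "bij_betw \<sigma> \<Omega> \<Omega>"
      and u: "\<And>\<omega>. \<omega> \<in> \<Omega> \<Longrightarrow> norm (u \<omega>) = 1" "\<And>\<omega> x. \<omega> \<in> \<Omega> \<Longrightarrow> \<phi> (\<sigma> \<omega>) x = u \<omega> * \<phi> \<omega> x * h x"
      unfolding shift_def h_def by blast
    have uu: "u \<omega> * cnj (u \<omega>) = 1" if "\<omega> \<in> \<Omega>" for \<omega> using u(1)[OF that] by (simp add: complex_norm_square [symmetric])
    have "I x y = (\<Sum>\<omega>\<in>\<Omega>. \<phi> (\<sigma> \<omega>) x * cnj (\<phi> (\<sigma> \<omega>) y))"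
      unfolding I_def by (rule sum.reindex_bij_betw[OF \<sigma>, symmetric])
    also have "\<dots> = (\<Sum>\<omega>\<in>\<Omega>. h x * cnj (h y) * (\<phi> \<omega> x * cnj (\<phi> \<omega> y)))"
    proof (intro sum.cong refl)
      fix \<omega> assume w: "\<omega> \<in> \<Omega>"
      have "\<phi> (\<sigma> \<omega>) x * cnj (\<phi> (\<sigma> \<omega>) y) = (u \<omega> * cnj (u \<omega>)) * (h x * cnj (h y) * (\<phi> \<omega> x * cnj (\<phi> \<omega> y)))"
        using u(2)[OF w] by (simp add: mult_ac)
      then show "\<phi> (\<sigma> \<omega>) x * cnj (\<phi> (\<sigma> \<omega>) y) = h x * cnj (h y) * (\<phi> \<omega> x * cnj (\<phi> \<omega> y))"
        using uu[OF w] by simp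
    qed
    also have "\<dots> = h x * cnj (h y) * I x y" by (simp add: I_def sum_distrib_left)
    finally have eq: "I x y = h x * cnj (h y) * I x y" .
    have "h x * cnj (h y) = expi (of_int (poly G x - poly G y) / real p ^ N)"
    proof -
      have "cnj (h y) = expi (- (of_int (poly G y) / real p ^ N))" by (simp add: h_def expi_def exp_cnj)
      then show ?thesis by (simp add: h_def diff_divide_distrib flip: expi_add)
    qed
    also have "\<dots> \<noteq> 1"
    proof
      assume "expi (of_int (poly G x - poly G y) / real p ^ N) = 1"
      then obtain n where "of_int (poly G x - poly G y) / real p ^ N = of_int n"
        by (auto simp: expi_eq_1_iff elim: Ints_cases)
      then have "real_of_int (poly G x - poly G y) = real_of_int (int p ^ N * n)"
        using p_gt_1 by (simp add: field_simps)
      then have "int p ^ N dvd poly G x - poly G y" by (metis dvd_triv_left of_int_eq_iff)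
      then have "int p ^ N dvd x - y" using weight_antiderivative_dvd[OF Q assms G] by blast
      then show False using that by (simp add: mod_eq_dvd_iff)
    qed
    finally show ?thesis using eq by auto
  qed
  have sq: "complex_of_real (\<Sum>\<omega>\<in>\<Omega>. norm (exp_sum \<phi> Z \<omega>) ^ 2) = (\<Sum>x\<in>Z. \<Sum>y\<in>Z. I x y)" for Z
  proof -
    have "complex_of_real (\<Sum>\<omega>\<in>\<Omega>. norm (exp_sum \<phi> Z \<omega>) ^ 2) = (\<Sum>\<omega>\<in>\<Omega>. exp_sum \<phi> Z \<omega> * cnj (exp_sum \<phi> Z \<omega>))"
      by (simp only: of_real_sum complex_norm_square)
    also have "\<dots> = (\<Sum>\<omega>\<in>\<Omega>. \<Sum>x\<in>Z. \<Sum>y\<in>Z. \<phi> \<omega> x * cnj (\<phi> \<omega> y))"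
      by (simp add: exp_sum_def sum_product)
    also have "\<dots> = (\<Sum>x\<in>Z. \<Sum>\<omega>\<in>\<Omega>. \<Sum>y\<in>Z. \<phi> \<omega> x * cnj (\<phi> \<omega> y))" by (rule sum.swap)
    also have "\<dots> = (\<Sum>x\<in>Z. \<Sum>y\<in>Z. I x y)" unfolding I_def by (intro sum.cong refl) (rule sum.swap)
    finally show ?thesis .
  qed
  have part: "sum g X = (\<Sum>\<theta>\<in>{0..<int p ^ N}. sum g (res_part X (int p ^ N) \<theta>))" for g :: "int \<Rightarrow> complex"
    using exp_sum_partition[OF X pp_pos, of "\<lambda>_. g" undefined N] by (simp add: exp_sum_def)
  have "(\<Sum>x\<in>X. \<Sum>y\<in>X. I x y) = (\<Sum>\<theta>\<in>{0..<int p ^ N}. \<Sum>x\<in>res_part X (int p ^ N) \<theta>. \<Sum>y\<in>X. I x y)"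
    by (rule part)
  also have "\<dots> = (\<Sum>\<theta>\<in>{0..<int p ^ N}. \<Sum>x\<in>res_part X (int p ^ N) \<theta>. \<Sum>y\<in>res_part X (int p ^ N) \<theta>. I x y)"
    by (intro sum.cong refl sum.mono_neutral_right) (auto simp: X res_part_def intro!: orth)
  finally have "complex_of_real (\<Sum>\<omega>\<in>\<Omega>. norm (exp_sum \<phi> X \<omega>) ^ 2) =
     complex_of_real (\<Sum>\<theta>\<in>{0..<int p ^ N}. \<Sum>\<omega>\<in>\<Omega>. norm (exp_sum \<phi> (res_part X (int p ^ N) \<theta>) \<omega>) ^ 2)"
    by (simp only: sq of_real_sum [of _ "{0..<int p ^ N}"])
  then have "(\<Sum>\<omega>\<in>\<Omega>. norm (exp_sum \<phi> X \<omega>) ^ 2) =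
     (\<Sum>\<theta>\<in>{0..<int p ^ N}. \<Sum>\<omega>\<in>\<Omega>. norm (exp_sum \<phi> (res_part X (int p ^ N) \<theta>) \<omega>) ^ 2)"
    by (simp only: of_real_eq_iff)
  then show "sqnorm (tri 1) \<phi> X \<le> 1 * sqfun N (tri 1) \<phi> X"
    by (simp add: sqnorm_def sqfun_def tri_def sum_nonneg)
qed

text \<open>Moments of total degree \<open>2 * tri k\<close> in which a class modulo p meets a
  transversal class modulo p^b. \<open>\<kappa>\<close> bounds the moment itself, so it scales like
  the \<open>tri k\<close>-th power of a decoupling constant.\<close>

definition bilinear :: "nat \<Rightarrow> nat \<Rightarrow> nat \<Rightarrow> nat \<Rightarrow> real \<Rightarrow> bool" where
  "bilinear k l b N \<kappa> \<longleftrightarrow> (\<forall>\<phi> Q X Y i c. weight k Q \<longrightarrow> admissible k N Q \<phi> \<longrightarrow> finite X \<longrightarrow> finite Y \<longrightarrow>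
     (\<forall>x\<in>X. x mod int p = i) \<longrightarrow> (\<forall>y\<in>Y. y mod int p ^ b = c) \<longrightarrow> \<not> int p dvd i - c \<longrightarrow>
     (\<Sum>\<omega>\<in>\<Omega>. norm (exp_sum \<phi> X \<omega>) ^ (2 * tri l) * norm (exp_sum \<phi> Y \<omega>) ^ (2 * (tri k - tri l)))
       \<le> \<kappa> * sqfun N (tri k) \<phi> X ^ tri l * sqfun N (tri k) \<phi> Y ^ (tri k - tri l))"

lemma bilinearD:
  assumes "bilinear k l b N \<kappa>" "weight k Q" "admissible k N Q \<phi>" "finite X" "finite Y"
    "\<And>x. x \<in> X \<Longrightarrow> x mod int p = i" "\<And>y. y \<in> Y \<Longrightarrow> y mod int p ^ b = c" "\<not> int p dvd i - c"
  shows "(\<Sum>\<omega>\<in>\<Omega>. norm (exp_sum \<phi> X \<omega>) ^ (2 * tri l) * norm (exp_sum \<phi> Y \<omega>) ^ (2 * (tri k - tri l)))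
       \<le> \<kappa> * sqfun N (tri k) \<phi> X ^ tri l * sqfun N (tri k) \<phi> Y ^ (tri k - tri l)"
  using assms(1)[unfolded bilinear_def, rule_format, OF assms(2-5), of i c] assms(6-8) by blast

text \<open>No factor of \<open>X\<close> is present, and \<open>Y\<close>, confined to a class
  modulo p^b, is a decoupling problem at scale N - b. All gain in the recursion originates
  here.\<close>

lemma bilinear_0:
  assumes "dec k (N - b) D" "b \<le> N" "1 \<le> k" "k \<le> K"
  shows "bilinear k 0 b N (D ^ tri k)"
  unfolding bilinear_def
proof (intro allI impI)
  fix \<phi> :: "'w \<Rightarrow> int \<Rightarrow> complex" and Q and X Y :: "int set" and i c
  assume A: "weight k Q" "admissible k N Q \<phi>" "finite Y" "\<forall>y\<in>Y. y mod int p ^ b = c"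
  have "sqnorm (tri k) \<phi> Y ^ tri k \<le> (D * sqfun N (tri k) \<phi> Y) ^ tri k"
    using A assms by (intro power_mono dec_residue_class[of k N b D Q]) auto
  then show "(\<Sum>\<omega>\<in>\<Omega>. norm (exp_sum \<phi> X \<omega>) ^ (2 * tri 0) * norm (exp_sum \<phi> Y \<omega>) ^ (2 * (tri k - tri 0)))
       \<le> D ^ tri k * sqfun N (tri k) \<phi> X ^ tri 0 * sqfun N (tri k) \<phi> Y ^ (tri k - tri 0)"
    using tri_ge_1[OF assms(3)] by (simp add: sqnorm_power tri_def[of 0] power_mult_distrib)
qed

lemma tri_less: "l < k \<Longrightarrow> tri l < tri k"
  using mult_strict_mono[of l k "l + 1" "k + 1"] two_tri[of l] two_tri[of k] by simp

text \<open>Hoelder's inequality with each factor decoupled at full scale: nothing is gained from b,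
  which is the estimate of slope 0.\<close>

lemma bilinear_trivial:
  assumes "dec k N D" "1 \<le> l" "l < k" "D \<ge> 0"
  shows "bilinear k l b N (D ^ tri k)"
  unfolding bilinear_def
proof (intro allI impI)
  fix \<phi> :: "'w \<Rightarrow> int \<Rightarrow> complex" and Q and X Y :: "int set" and i c
  assume A: "weight k Q" "admissible k N Q \<phi>" "finite X" "finite Y"
  have tl: "tri l \<ge> 1" "tri l < tri k" using assms tri_ge_1 tri_less by auto
  define m where "m = tri k - tri l"
  have m: "m \<ge> 1" "tri k = tri l + m" using tl by (auto simp: m_def)
  have root: "(\<Sum>\<omega>\<in>\<Omega>. (norm (exp_sum \<phi> Z \<omega>))\<^sup>2 ^ (tri l + m)) powr (real c / real (tri l + m)) = sqnorm (tri k) \<phi> Z ^ c"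
    if "c \<ge> 1" for Z c
  proof -
    have "sqnorm (tri k) \<phi> Z ^ c = ((\<Sum>\<omega>\<in>\<Omega>. norm (exp_sum \<phi> Z \<omega>) ^ (2 * tri k)) powr (1 / real (tri k))) powr real c"
      using that by (cases "sqnorm (tri k) \<phi> Z = 0") (auto simp: sqnorm_def powr_realpow)
    moreover have "norm (exp_sum \<phi> Z \<omega>) ^ (2 * tri k) = (norm (exp_sum \<phi> Z \<omega>))\<^sup>2 ^ (tri l + m)" for \<omega>
      by (simp only: m(2) power_mult)
    ultimately show ?thesis by (simp only: powr_powr m(2) times_divide_eq_left mult_1)
  qed
  have "(\<Sum>\<omega>\<in>\<Omega>. norm (exp_sum \<phi> X \<omega>) ^ (2 * tri l) * norm (exp_sum \<phi> Y \<omega>) ^ (2 * m))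
    \<le> sqnorm (tri k) \<phi> X ^ tri l * sqnorm (tri k) \<phi> Y ^ m"
    using Holder_sum_power[of \<Omega> "\<lambda>\<omega>. (norm (exp_sum \<phi> X \<omega>))\<^sup>2" "\<lambda>\<omega>. (norm (exp_sum \<phi> Y \<omega>))\<^sup>2" "tri l" m] tl m
      root[of "tri l" X] root[of m Y]
    by (simp add: power_mult)
  also have "\<dots> \<le> (D * sqfun N (tri k) \<phi> X) ^ tri l * (D * sqfun N (tri k) \<phi> Y) ^ m"
    using A assms(1,4) unfolding dec_def by (intro mult_mono power_mono zero_le_power mult_nonneg_nonneg) auto
  also have "\<dots> = D ^ tri k * sqfun N (tri k) \<phi> X ^ tri l * sqfun N (tri k) \<phi> Y ^ m"
    by (simp add: m(2) power_add power_mult_distrib mult_ac)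
  finally show "(\<Sum>\<omega>\<in>\<Omega>. norm (exp_sum \<phi> X \<omega>) ^ (2 * tri l) * norm (exp_sum \<phi> Y \<omega>) ^ (2 * (tri k - tri l)))
       \<le> D ^ tri k * sqfun N (tri k) \<phi> X ^ tri l * sqfun N (tri k) \<phi> Y ^ (tri k - tri l)"
    by (simp only: m_def)
qed

text \<open>Interpolation between the moment of index l - 1 and a moment in which \<open>X\<close>
  and \<open>Y\<close> exchange roles. In the latter \<open>X\<close> is the set confined to a fine
  class, modulo p^a, while \<open>Y\<close> is viewed modulo p.\<close>

lemma bilinear_step_Holder:
  assumes b1: "bilinear k (l - 1) b N \<kappa>1" and b2: "bilinear k (k - l) a N \<kappa>2"
    and l: "1 \<le> l" "l < k" and ab: "1 \<le> a" "1 \<le> b" and pos: "\<kappa>1 \<ge> 0" "\<kappa>2 \<ge> 0"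
    and A: "weight k Q" "admissible k N Q \<phi>" "finite X" "finite Y"
      "\<And>x. x \<in> X \<Longrightarrow> x mod int p = i" "\<And>y. y \<in> Y \<Longrightarrow> y mod int p ^ b = c" "\<not> int p dvd i - c"
      "\<And>x. x \<in> X \<Longrightarrow> x mod int p ^ a = \<theta>"
  defines "t \<equiv> 1 / real (k - l + 1)"
  shows "(\<Sum>\<omega>\<in>\<Omega>. norm (exp_sum \<phi> X \<omega>) ^ (2 * tri l) * norm (exp_sum \<phi> Y \<omega>) ^ (2 * (tri k - tri l)))
       \<le> (\<kappa>1 powr (1 - t) * \<kappa>2 powr t) * sqfun N (tri k) \<phi> X ^ tri l * sqfun N (tri k) \<phi> Y ^ (tri k - tri l)"
proof (cases "X = {}")
  case True
  have L: "(\<Sum>\<omega>\<in>\<Omega>. norm (exp_sum \<phi> X \<omega>) ^ (2 * tri l) * norm (exp_sum \<phi> Y \<omega>) ^ (2 * (tri k - tri l))) = 0"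
    using tri_ge_1[OF l(1)] True by (simp add: exp_sum_def power_0_left)
  show ?thesis unfolding L by (intro mult_nonneg_nonneg zero_le_power) auto
next
  case False
  then obtain x0 where x0: "x0 \<in> X" by blast
  define G where "G = sqfun N (tri k) \<phi>"
  have G0: "G Z \<ge> 0" for Z by (simp add: G_def)
  have t: "0 < t" "t < 1" using l by (auto simp: t_def)
  \<comment> \<open>Transversality survives the exchange: it concerns the classes modulo p only, and
    \<theta> reduces to i there because \<open>X\<close> is nonempty.\<close>
  have "\<not> int p dvd c mod int p - \<theta>"
  proof
    assume d: "int p dvd c mod int p - \<theta>"
    have "int p dvd int p ^ a" using ab by (simp add: dvd_power)
    then have "\<theta> mod int p = i" using A(5,8)[OF x0] by (metis mod_mod_cancel)
    moreover have "(c mod int p) mod int p = \<theta> mod int p" using d by (simp only: mod_eq_dvd_iff)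
    ultimately have "c mod int p = i mod int p" by auto
    then show False using A(7) by (metis mod_eq_dvd_iff)
  qed
  moreover have "y mod int p = c mod int p" if "y \<in> Y" for y
  proof -
    have "int p dvd int p ^ b" using ab by (simp add: dvd_power)
    then show ?thesis using A(6)[OF that] by (metis mod_mod_cancel)
  qed
  ultimately have B2: "(\<Sum>\<omega>\<in>\<Omega>. norm (exp_sum \<phi> Y \<omega>) ^ (2 * tri (k - l)) * norm (exp_sum \<phi> X \<omega>) ^ (2 * (tri k - tri (k - l))))
       \<le> \<kappa>2 * G Y ^ tri (k - l) * G X ^ (tri k - tri (k - l))"
    unfolding G_def using A by (intro bilinearD[OF b2]) auto
  have B1: "(\<Sum>\<omega>\<in>\<Omega>. norm (exp_sum \<phi> X \<omega>) ^ (2 * tri (l - 1)) * norm (exp_sum \<phi> Y \<omega>) ^ (2 * (tri k - tri (l - 1))))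
       \<le> \<kappa>1 * G X ^ tri (l - 1) * G Y ^ (tri k - tri (l - 1))"
    unfolding G_def using A by (intro bilinearD[OF b1]) auto
  let ?f = "\<lambda>\<omega>. norm (exp_sum \<phi> X \<omega>) ^ (2 * tri (l - 1)) * norm (exp_sum \<phi> Y \<omega>) ^ (2 * (tri k - tri (l - 1)))"
  let ?g = "\<lambda>\<omega>. norm (exp_sum \<phi> Y \<omega>) ^ (2 * tri (k - l)) * norm (exp_sum \<phi> X \<omega>) ^ (2 * (tri k - tri (k - l)))"
  have "(\<Sum>\<omega>\<in>\<Omega>. norm (exp_sum \<phi> X \<omega>) ^ (2 * tri l) * norm (exp_sum \<phi> Y \<omega>) ^ (2 * (tri k - tri l)))
     \<le> (\<Sum>\<omega>\<in>\<Omega>. ?f \<omega> powr (1 - t) * ?g \<omega> powr t)"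
    unfolding t_def by (intro sum_mono power_mult_le_powr_interpolation l) auto
  also have "\<dots> \<le> (\<Sum>\<omega>\<in>\<Omega>. ?f \<omega>) powr (1 - t) * (\<Sum>\<omega>\<in>\<Omega>. ?g \<omega>) powr t"
    using t by (intro Holder_sum_weighted) auto
  also have "\<dots> \<le> (\<kappa>1 * G X ^ tri (l - 1) * G Y ^ (tri k - tri (l - 1))) powr (1 - t) *
      (\<kappa>2 * G Y ^ tri (k - l) * G X ^ (tri k - tri (k - l))) powr t"
    using t B1 B2 by (intro mult_mono powr_mono2) (auto intro: sum_nonneg)
  also have "\<dots> = (\<kappa>1 powr (1 - t) * \<kappa>2 powr t) *
     ((G X ^ tri (l - 1) * G Y ^ (tri k - tri (l - 1))) powr (1 - t) *
      (G Y ^ tri (k - l) * G X ^ (tri k - tri (k - l))) powr t)"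
    using pos G0 by (simp add: powr_mult mult_ac)
  also have "(G X ^ tri (l - 1) * G Y ^ (tri k - tri (l - 1))) powr (1 - t) *
      (G Y ^ tri (k - l) * G X ^ (tri k - tri (k - l))) powr t = G X ^ tri l * G Y ^ (tri k - tri l)"
  proof (cases "G X = 0 \<or> G Y = 0")
    case True
    have z: "tri l \<ge> 1" "tri k - tri l \<ge> 1" "tri k - tri (l - 1) \<ge> 1" "tri k - tri (k - l) \<ge> 1"
    proof -
      have "l - 1 < k" "k - l < k" using l by auto
      then show "tri l \<ge> 1" "tri k - tri l \<ge> 1" "tri k - tri (l - 1) \<ge> 1" "tri k - tri (k - l) \<ge> 1"
        using tri_ge_1[OF l(1)] tri_less[OF l(2)] tri_less[of "l - 1" k] tri_less[of "k - l" k] by auto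
    qed
    then show ?thesis using True by (auto simp: power_0_left)
  next
    case False
    then have pos: "G X > 0" "G Y > 0" using G0[of X] G0[of Y] by auto
    have tr: "tri (l - 1) \<le> tri k" "tri l \<le> tri k" "tri (k - l) \<le> tri k" using l by (auto intro: tri_mono)
    have t': "real k = real l - 1 + 1 / t" "t \<noteq> 0" using l by (auto simp: t_def of_nat_diff)
    have rl: "real (l - 1) = real l - 1" "real (k - l) = 1 / t - 1" using l by (auto simp: t_def of_nat_diff)
    have e1: "real (tri (l - 1)) * (1 - t) + (real (tri k) - real (tri (k - l))) * t = real (tri l)"
      unfolding real_tri rl t'(1) using t'(2) by (simp add: field_simps)
    have e2: "(real (tri k) - real (tri (l - 1))) * (1 - t) + real (tri (k - l)) * t = real (tri k) - real (tri l)"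
      unfolding real_tri rl t'(1) using t'(2) by (simp add: field_simps)
    have "(G X ^ tri (l - 1) * G Y ^ (tri k - tri (l - 1))) powr (1 - t) *
      (G Y ^ tri (k - l) * G X ^ (tri k - tri (k - l))) powr t
      = G X powr (real (tri (l - 1)) * (1 - t) + (real (tri k) - real (tri (k - l))) * t)
        * G Y powr ((real (tri k) - real (tri (l - 1))) * (1 - t) + real (tri (k - l)) * t)"
      using pos tr by (simp add: powr_realpow [symmetric] powr_mult powr_powr powr_add of_nat_diff mult_ac)
    also have "\<dots> = G X ^ tri l * G Y ^ (tri k - tri l)"
      unfolding e1 e2 using pos tr by (simp add: powr_realpow [symmetric] of_nat_diff)
    finally show ?thesis .
  qed
  finally show ?thesis by (simp add: G_def mult.assoc)
qed

text \<open>With a weight built from \<open>Y\<close> the mixed moment becomes an L^(2 tri l) norm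
  over \<open>X\<close>, which degree l decouples into classes modulo p^a. Interpolation is applied
  on each class, and the quantities \<open>sqfun\<close> add up over the classes. The constraint on
  \<open>a\<close> is the one under which the phases in question are constant on
  \<open>Y\<close>.\<close>

lemma bilinear_step:
  assumes D: "dec l (a - 1) D" "D \<ge> 1" and a: "a = 1 \<or> l * a \<le> (k - l + 1) * b" "1 \<le> a" "a \<le> N" "1 \<le> b"
    and b1: "bilinear k (l - 1) b N \<kappa>1" and b2: "bilinear k (k - l) a N \<kappa>2"
    and l: "1 \<le> l" "l < k" "k \<le> K" and pos: "\<kappa>1 \<ge> 0" "\<kappa>2 \<ge> 0"
  shows "bilinear k l b N (D ^ tri l * (\<kappa>1 powr (1 - 1 / real (k - l + 1)) * \<kappa>2 powr (1 / real (k - l + 1))))"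
  unfolding bilinear_def
proof (intro allI impI)
  fix \<phi> :: "'w \<Rightarrow> int \<Rightarrow> complex" and Q and X Y :: "int set" and i c
  assume A: "weight k Q" "admissible k N Q \<phi>" "finite X" "finite Y"
      "\<forall>x\<in>X. x mod int p = i" "\<forall>y\<in>Y. y mod int p ^ b = c" "\<not> int p dvd i - c"
  define \<kappa> where "\<kappa> = \<kappa>1 powr (1 - 1 / real (k - l + 1)) * \<kappa>2 powr (1 / real (k - l + 1))"
  have "\<kappa> \<ge> 0" by (simp add: \<kappa>_def)
  define G where "G = sqfun N (tri k) \<phi>"
  have G0: "G Z \<ge> 0" for Z by (simp add: G_def)
  have tl: "tri l \<ge> 1" "tri k - tri l \<ge> 1" using tri_ge_1[OF l(1)] tri_less[OF l(2)] by auto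
  \<comment> \<open>Chosen so that the power \<open>2 * tri l\<close> of \<open>F\<close>, at the
    square of |exp_sum \<phi> Y|, is the power \<open>2 * (tri k - tri l)\<close> of |exp_sum \<phi>
    Y|.\<close>
  define e where "e = real (tri k - tri l) / real (tri l)"
  define F where "F v = v powr (e / 2)" for v :: real
  have F_pow: "F v ^ (2 * tri l) = v ^ (2 * (tri k - tri l) div 2)" if "v \<ge> 0" for v
    using that tl by (cases "v = 0") (auto simp: F_def e_def powr_realpow [symmetric] powr_powr power_0_left)
  define f where "f = (\<lambda>\<omega> x. of_real (F (norm (exp_sum \<phi> Y \<omega>) ^ 2)) * \<phi> \<omega> x)"
  have norm_f: "norm (exp_sum f Z \<omega>) ^ (2 * tri l) =
     norm (exp_sum \<phi> Z \<omega>) ^ (2 * tri l) * norm (exp_sum \<phi> Y \<omega>) ^ (2 * (tri k - tri l))" for Z \<omega>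
  proof -
    have "exp_sum f Z \<omega> = of_real (F (norm (exp_sum \<phi> Y \<omega>) ^ 2)) * exp_sum \<phi> Z \<omega>"
      by (simp add: exp_sum_def f_def sum_distrib_left)
    then have "norm (exp_sum f Z \<omega>) ^ (2 * tri l) =
      F (norm (exp_sum \<phi> Y \<omega>) ^ 2) ^ (2 * tri l) * norm (exp_sum \<phi> Z \<omega>) ^ (2 * tri l)"
      by (simp add: norm_mult power_mult_distrib F_def)
    then show ?thesis by (simp add: F_pow power_mult [symmetric])
  qed
  have "sqnorm (tri l) f X \<le> D * sqfun a (tri l) f X"
  proof (cases "l * a \<le> (k - l + 1) * b")
    case True
    have "l * a \<le> k * N" using l a by (intro mult_mono) auto
    then show ?thesis
      using dec_transverse[OF D(1) A(2,1), where F = "\<lambda>v. F (v ^ 2)" and Y = Y and X = X and b = b and c = c and i = i] A a l True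
      by (simp add: f_def)
  next
    \<comment> \<open>For a = 1 there is nothing to decouple, as \<open>X\<close> is already a
      single class modulo p. This covers small b, where (k-l+1) b < l and the constraint leaves no
      positive a.\<close>
    case False
    then have a1: "a = 1" using a by blast
    have "sqnorm (tri l) f X \<le> sqfun a (tri l) f X"
    proof (cases "X = {}")
      case False
      then obtain x where "x \<in> X" by blast
      then have i: "i \<in> {0..<int p ^ 1}" using A(5) by auto
      have "res_part X (int p ^ 1) i = X" using A(5) by (auto simp: res_part_def)
      then show ?thesis unfolding sqfun_def a1
        using member_le_sum[OF i, of "\<lambda>\<theta>. sqnorm (tri l) f (res_part X (int p ^ 1) \<theta>)"] by simp
    qed (use tl in simp)
    also have "\<dots> \<le> D * sqfun a (tri l) f X" using D(2) mult_right_mono[OF D(2) sqfun_nonneg] by simp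
    finally show ?thesis .
  qed
  also have "\<dots> \<le> D * (\<Sum>\<theta>\<in>{0..<int p ^ a}. \<kappa> powr (1 / tri l) * G (res_part X (int p ^ a) \<theta>) * G Y powr e)"
    unfolding sqfun_def
  proof (intro mult_left_mono sum_mono)
    fix \<theta>
    let ?Z = "res_part X (int p ^ a) \<theta>"
    have "(\<Sum>\<omega>\<in>\<Omega>. norm (exp_sum f ?Z \<omega>) ^ (2 * tri l)) \<le> \<kappa> * G ?Z ^ tri l * G Y ^ (tri k - tri l)"
      unfolding norm_f G_def \<kappa>_def
      by (rule bilinear_step_Holder[OF b1 b2 l(1,2) a(2,4) pos A(1,2), of _ _ i c \<theta>])
         (use A in \<open>auto simp: res_part_def\<close>)
    then have "sqnorm (tri l) f ?Z \<le> (\<kappa> * G ?Z ^ tri l * G Y ^ (tri k - tri l)) powr (1 / tri l)"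
      unfolding sqnorm_def by (intro powr_mono2) (auto intro: sum_nonneg)
    also have "\<dots> = \<kappa> powr (1 / tri l) * (G ?Z ^ tri l) powr (1 / tri l) * (G Y ^ (tri k - tri l)) powr (1 / tri l)"
      using \<open>\<kappa> \<ge> 0\<close> G0 by (simp add: powr_mult)
    also have "(G ?Z ^ tri l) powr (1 / tri l) = G ?Z"
      using tl G0[of ?Z] by (cases "G ?Z = 0") (auto simp: powr_realpow [symmetric] powr_powr power_0_left)
    also have "(G Y ^ (tri k - tri l)) powr (1 / tri l) = G Y powr e"
      using tl G0[of Y] by (cases "G Y = 0") (auto simp: powr_realpow [symmetric] powr_powr power_0_left e_def)
    finally show "sqnorm (tri l) f ?Z \<le> \<kappa> powr (1 / tri l) * G ?Z * G Y powr e" .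
  qed (use D in auto)
  also have "\<dots> = D * \<kappa> powr (1 / tri l) * G X * G Y powr e"
    using sqfun_partition[of "tri k" a N \<phi> X] tl a tri_ge_1[of k] l
    by (simp add: G_def sum_distrib_left sum_distrib_right mult_ac)
  finally have "sqnorm (tri l) f X ^ tri l \<le> (D * \<kappa> powr (1 / tri l) * G X * G Y powr e) ^ tri l"
    by (intro power_mono) auto
  also have "\<dots> = D ^ tri l * (\<kappa> powr (1 / tri l)) ^ tri l * G X ^ tri l * (G Y powr e) ^ tri l"
    by (simp add: power_mult_distrib)
  also have "(\<kappa> powr (1 / tri l)) ^ tri l = \<kappa>" using tl \<open>\<kappa> \<ge> 0\<close> by (intro powr_inverse_power) auto
  also have "(G Y powr e) ^ tri l = G Y ^ (tri k - tri l)"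
    using tl G0[of Y] by (cases "G Y = 0") (auto simp: powr_realpow [symmetric] powr_powr power_0_left e_def)
  finally show "(\<Sum>\<omega>\<in>\<Omega>. norm (exp_sum \<phi> X \<omega>) ^ (2 * tri l) * norm (exp_sum \<phi> Y \<omega>) ^ (2 * (tri k - tri l)))
       \<le> D ^ tri l * (\<kappa>1 powr (1 - 1 / real (k - l + 1)) * \<kappa>2 powr (1 / real (k - l + 1))) *
         sqfun N (tri k) \<phi> X ^ tri l * sqfun N (tri k) \<phi> Y ^ (tri k - tri l)"
    using tl by (simp only: sqnorm_power norm_f G_def \<kappa>_def)
qed

end

section \<open>From mixed moments back to decoupling\<close>

lemma tri_1 [simp]: "tri (Suc 0) = 1"
  by (simp add: tri_def)

context decoupling
begin

lemma dec_mono: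
  assumes "dec l N D" "D \<le> D'" shows "dec l N D'"
  unfolding dec_def
proof (intro allI impI)
  fix \<phi> :: "'w \<Rightarrow> int \<Rightarrow> complex" and Q and X :: "int set"
  assume "finite X" "weight l Q" "admissible l N Q \<phi>"
  then have "sqnorm (tri l) \<phi> X \<le> D * sqfun N (tri l) \<phi> X" using assms(1) unfolding dec_def by blast
  also have "\<dots> \<le> D' * sqfun N (tri l) \<phi> X" using assms(2) by (intro mult_right_mono) auto
  finally show "sqnorm (tri l) \<phi> X \<le> D' * sqfun N (tri l) \<phi> X" .
qed

lemma bilinear_mono:
  assumes "bilinear k l b N \<kappa>" "\<kappa> \<le> \<kappa>'" shows "bilinear k l b N \<kappa>'"
  unfolding bilinear_def
proof (intro allI impI)
  fix \<phi> :: "'w \<Rightarrow> int \<Rightarrow> complex" and Q and X Y :: "int set" and i c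
  assume A: "weight k Q" "admissible k N Q \<phi>" "finite X" "finite Y"
      "\<forall>x\<in>X. x mod int p = i" "\<forall>y\<in>Y. y mod int p ^ b = c" "\<not> int p dvd i - c"
  have "(\<Sum>\<omega>\<in>\<Omega>. norm (exp_sum \<phi> X \<omega>) ^ (2 * tri l) * norm (exp_sum \<phi> Y \<omega>) ^ (2 * (tri k - tri l)))
      \<le> \<kappa> * sqfun N (tri k) \<phi> X ^ tri l * sqfun N (tri k) \<phi> Y ^ (tri k - tri l)"
    using A by (intro bilinearD[OF assms(1)]) auto
  also have "\<dots> \<le> \<kappa>' * sqfun N (tri k) \<phi> X ^ tri l * sqfun N (tri k) \<phi> Y ^ (tri k - tri l)"
    using assms(2) by (intro mult_right_mono) auto
  finally show "(\<Sum>\<omega>\<in>\<Omega>. norm (exp_sum \<phi> X \<omega>) ^ (2 * tri l) * norm (exp_sum \<phi> Y \<omega>) ^ (2 * (tri k - tri l)))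
      \<le> \<kappa>' * sqfun N (tri k) \<phi> X ^ tri l * sqfun N (tri k) \<phi> Y ^ (tri k - tri l)" .
qed

text \<open>Cauchy-Schwarz over the p^N classes, then Minkowski: every degree has decoupling
  exponent 1, from which the improvement starts.\<close>

lemma dec_trivial:
  assumes "1 \<le> l" shows "dec l N (real p ^ N)"
  unfolding dec_def
proof (intro allI impI)
  fix \<phi> :: "'w \<Rightarrow> int \<Rightarrow> complex" and Q and X :: "int set"
  assume X: "finite X"
  define s where "s = tri l"
  have s: "s \<ge> 1" using assms tri_ge_1 by (simp add: s_def)
  define f where "f \<theta> \<omega> = norm (exp_sum \<phi> (res_part X (int p ^ N) \<theta>) \<omega>)" for \<theta> \<omega>
  have pw: "norm (exp_sum \<phi> X \<omega>) ^ 2 \<le> (\<Sum>\<theta>\<in>{0..<int p ^ N}. real p ^ N * f \<theta> \<omega> ^ 2)" for \<omega>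
  proof -
    have "norm (exp_sum \<phi> X \<omega>) \<le> (\<Sum>\<theta>\<in>{0..<int p ^ N}. f \<theta> \<omega>)"
      unfolding exp_sum_partition[OF X pp_pos, of \<phi> \<omega> N] f_def by (rule norm_sum)
    then have "norm (exp_sum \<phi> X \<omega>) ^ 2 \<le> (\<Sum>\<theta>\<in>{0..<int p ^ N}. f \<theta> \<omega>) ^ 2" by (intro power_mono) auto
    also have "\<dots> \<le> (\<Sum>\<theta>\<in>{0..<int p ^ N}. 1\<^sup>2) * (\<Sum>\<theta>\<in>{0..<int p ^ N}. f \<theta> \<omega> ^ 2)"
      using Cauchy_Schwarz_ineq_sum[of "\<lambda>_. 1" "\<lambda>\<theta>. f \<theta> \<omega>" "{0..<int p ^ N}"] by simp
    also have "\<dots> = (\<Sum>\<theta>\<in>{0..<int p ^ N}. real p ^ N * f \<theta> \<omega> ^ 2)"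
      by (simp add: sum_distrib_left nat_power_eq)
    finally show ?thesis .
  qed
  have "sqnorm s \<phi> X = (\<Sum>\<omega>\<in>\<Omega>. (norm (exp_sum \<phi> X \<omega>) ^ 2) ^ s) powr (1 / real s)"
    by (simp add: sqnorm_def power_mult)
  also have "\<dots> \<le> (\<Sum>\<omega>\<in>\<Omega>. (\<Sum>\<theta>\<in>{0..<int p ^ N}. real p ^ N * f \<theta> \<omega> ^ 2) ^ s) powr (1 / real s)"
    using pw by (intro powr_mono2 sum_mono power_mono) (auto intro: sum_nonneg)
  also have "\<dots> \<le> (\<Sum>\<theta>\<in>{0..<int p ^ N}. (\<Sum>\<omega>\<in>\<Omega>. (real p ^ N * f \<theta> \<omega> ^ 2) ^ s) powr (1 / real s))"
    using s finite_\<Omega> by (intro Minkowski_sum) (auto simp: f_def)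
  also have "\<dots> = (\<Sum>\<theta>\<in>{0..<int p ^ N}. real p ^ N * sqnorm s \<phi> (res_part X (int p ^ N) \<theta>))"
  proof (intro sum.cong refl)
    fix \<theta>
    have "(\<Sum>\<omega>\<in>\<Omega>. (real p ^ N * f \<theta> \<omega> ^ 2) ^ s) = (real p ^ N) ^ s * (\<Sum>\<omega>\<in>\<Omega>. f \<theta> \<omega> ^ (2 * s))"
      by (simp add: power_mult_distrib sum_distrib_left power_mult)
    then have "(\<Sum>\<omega>\<in>\<Omega>. (real p ^ N * f \<theta> \<omega> ^ 2) ^ s) powr (1 / real s) =
      ((real p ^ N) ^ s) powr (1 / real s) * (\<Sum>\<omega>\<in>\<Omega>. f \<theta> \<omega> ^ (2 * s)) powr (1 / real s)"
      by (simp add: powr_mult sum_nonneg f_def)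
    also have "((real p ^ N) ^ s) powr (1 / real s) = real p ^ N"
      using s by (simp add: powr_realpow [symmetric] powr_powr)
    finally show "(\<Sum>\<omega>\<in>\<Omega>. (real p ^ N * f \<theta> \<omega> ^ 2) ^ s) powr (1 / real s) = real p ^ N * sqnorm s \<phi> (res_part X (int p ^ N) \<theta>)"
      by (simp add: sqnorm_def f_def)
  qed
  finally show "sqnorm (tri l) \<phi> X \<le> real p ^ N * sqfun N (tri l) \<phi> X"
    by (simp add: s_def sqfun_def sum_distrib_left)
qed

lemma power_sum_le_card_power:
  fixes f :: "'a \<Rightarrow> real"
  assumes "finite A" "\<And>x. x \<in> A \<Longrightarrow> f x \<ge> 0" "r \<ge> 1"
  shows "sum f A ^ r \<le> real (card A) ^ r * (\<Sum>x\<in>A. f x ^ r)"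
proof (cases "A = {}")
  case False
  define M where "M = Max (f ` A)"
  have "M \<in> f ` A" unfolding M_def using assms(1) False by (intro Max_in) auto
  then obtain x where x: "x \<in> A" "M = f x" by blast
  have "sum f A \<le> real (card A) * M" using assms(1) by (intro sum_bounded_above) (auto simp: M_def)
  then have "sum f A ^ r \<le> (real (card A) * M) ^ r" using assms by (intro power_mono sum_nonneg) auto
  also have "\<dots> = real (card A) ^ r * f x ^ r" by (simp add: power_mult_distrib x)
  also have "\<dots> \<le> real (card A) ^ r * (\<Sum>x\<in>A. f x ^ r)"
    using x assms by (intro mult_left_mono member_le_sum) auto
  finally show ?thesis .
qed (use assms in \<open>auto simp: power_0_left\<close>)

text \<open>The class of j modulo p is cut into classes modulo p^b by brute force. After the root of
  order \<open>tri k\<close> the price is p^(2b), to be regained from the dependence of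
  \<open>\<kappa>\<close> on b.\<close>

lemma bilinear_class_sum:
  assumes bil: "bilinear k 1 b N \<kappa>" and \<kappa>: "\<kappa> \<ge> 0" and b: "1 \<le> b" "b \<le> N" and k: "2 \<le> k"
    and A: "weight k Q" "admissible k N Q \<phi>" "finite X" and ij: "i \<noteq> j"
  shows "(\<Sum>\<omega>\<in>\<Omega>. norm (exp_sum \<phi> (res_part X (int p) i) \<omega>) ^ 2 * norm (exp_sum \<phi> (res_part X (int p) j) \<omega>) ^ (2 * (tri k - 1)))
    \<le> (real p ^ b) ^ (2 * tri k) * \<kappa> * sqfun N (tri k) \<phi> X ^ tri k"
proof -
  define s where "s = tri k"
  have s: "s \<ge> 2" using two_tri[of k] mult_le_mono[OF k k] k by (simp add: s_def)
  define n where "n = int p ^ b"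
  have n: "n > 0" "real_of_int n \<ge> 1" using p_gt_1 by (auto simp: n_def)
  define G where "G = sqfun N s \<phi>"
  let ?X = "res_part X (int p) i" and ?Y = "res_part X (int p) j"
  have G: "0 \<le> G Z" for Z by (simp add: G_def)
  have GX: "G ?X \<le> G X" "G ?Y \<le> G X"
    using sqfun_res_part_le[of s 1 N \<phi> X] s b by (auto simp: G_def)
  have GY: "G (res_part ?Y n c) \<le> G X" for c
    using sqfun_res_part_le[of s b N \<phi> ?Y c] s b GX by (simp add: G_def n_def)
  have each: "(\<Sum>\<omega>\<in>\<Omega>. norm (exp_sum \<phi> ?X \<omega>) ^ 2 * norm (exp_sum \<phi> (res_part ?Y n c) \<omega>) ^ (2 * (s - 1))) \<le> \<kappa> * G X ^ s" for c
  proof (cases "res_part ?Y n c = {} \<or> ?X = {}")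
    case True
    have L: "(\<Sum>\<omega>\<in>\<Omega>. norm (exp_sum \<phi> ?X \<omega>) ^ 2 * norm (exp_sum \<phi> (res_part ?Y n c) \<omega>) ^ (2 * (s - 1))) = 0"
      using True s by (auto simp: exp_sum_def power_0_left)
    show ?thesis unfolding L using \<kappa> G by simp
  next
    case False
    then obtain y x where y: "y mod n = c" "y mod int p = j" "x mod int p = i" by (auto simp: res_part_def)
    have "\<not> int p dvd i - c"
    proof
      assume "int p dvd i - c"
      then have "i mod int p = c mod int p" by (simp add: mod_eq_dvd_iff)
      moreover have "c mod int p = y mod int p" unfolding y(1) [symmetric]
        using b by (intro mod_mod_cancel) (simp add: n_def dvd_power)
      moreover have "i mod int p = i" using y(3) by auto
      ultimately show False using y ij by simp
    qed
    then have "(\<Sum>\<omega>\<in>\<Omega>. norm (exp_sum \<phi> ?X \<omega>) ^ (2 * tri 1) * norm (exp_sum \<phi> (res_part ?Y n c) \<omega>) ^ (2 * (tri k - tri 1)))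
       \<le> \<kappa> * sqfun N (tri k) \<phi> ?X ^ tri 1 * sqfun N (tri k) \<phi> (res_part ?Y n c) ^ (tri k - tri 1)"
      using A by (intro bilinearD[OF bil]) (auto simp: res_part_def n_def)
    also have "\<dots> = \<kappa> * (G ?X * G (res_part ?Y n c) ^ (s - 1))" by (simp add: G_def s_def)
    also have "\<dots> \<le> \<kappa> * (G X * G X ^ (s - 1))"
      using \<kappa> G GX GY by (intro mult_left_mono mult_mono power_mono) auto
    also have "G X * G X ^ (s - 1) = G X ^ s" using s by (cases s) auto
    finally show ?thesis by (simp add: s_def)
  qed
  have "(\<Sum>\<omega>\<in>\<Omega>. norm (exp_sum \<phi> ?X \<omega>) ^ 2 * norm (exp_sum \<phi> ?Y \<omega>) ^ (2 * (s - 1)))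
     \<le> (\<Sum>\<omega>\<in>\<Omega>. norm (exp_sum \<phi> ?X \<omega>) ^ 2 * (real_of_int n ^ (2 * (s - 1)) *
           (\<Sum>c\<in>{0..<n}. norm (exp_sum \<phi> (res_part ?Y n c) \<omega>) ^ (2 * (s - 1)))))"
  proof (intro sum_mono mult_left_mono)
    fix \<omega>
    have "norm (exp_sum \<phi> ?Y \<omega>) \<le> (\<Sum>c\<in>{0..<n}. norm (exp_sum \<phi> (res_part ?Y n c) \<omega>))"
      using A n by (subst exp_sum_partition[of ?Y n]) (auto intro: norm_sum)
    then have "norm (exp_sum \<phi> ?Y \<omega>) ^ (2 * (s - 1)) \<le> (\<Sum>c\<in>{0..<n}. norm (exp_sum \<phi> (res_part ?Y n c) \<omega>)) ^ (2 * (s - 1))"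
      by (intro power_mono) auto
    also have "\<dots> \<le> real_of_int n ^ (2 * (s - 1)) * (\<Sum>c\<in>{0..<n}. norm (exp_sum \<phi> (res_part ?Y n c) \<omega>) ^ (2 * (s - 1)))"
      using power_sum_le_card_power[of "{0..<n}" "\<lambda>c. norm (exp_sum \<phi> (res_part ?Y n c) \<omega>)" "2 * (s - 1)"] s n by simp
    finally show "norm (exp_sum \<phi> ?Y \<omega>) ^ (2 * (s - 1)) \<le> \<dots>" .
  qed auto
  also have "\<dots> = real_of_int n ^ (2 * (s - 1)) * (\<Sum>c\<in>{0..<n}. \<Sum>\<omega>\<in>\<Omega>. norm (exp_sum \<phi> ?X \<omega>) ^ 2 * norm (exp_sum \<phi> (res_part ?Y n c) \<omega>) ^ (2 * (s - 1)))"
    by (subst sum.swap) (simp add: sum_distrib_left mult_ac)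
  also have "\<dots> \<le> real_of_int n ^ (2 * (s - 1)) * (\<Sum>c\<in>{0..<n}. \<kappa> * G X ^ s)"
    using n by (intro mult_left_mono sum_mono each) auto
  also have "\<dots> = real_of_int n ^ (2 * (s - 1) + 1) * (\<kappa> * G X ^ s)" using n by simp
  also have "\<dots> \<le> real_of_int n ^ (2 * s) * (\<kappa> * G X ^ s)"
    using n s \<kappa> G by (intro mult_right_mono power_increasing) auto
  finally show ?thesis by (simp add: s_def G_def n_def mult.assoc)
qed

text \<open>|exp_sum|^2 is at most a sum of products over pairs of classes modulo p. Equal pairs are
  rescaled to N - 1 and recombine without loss; distinct classes are transversal, and
  \<open>bilinear\<close> applies to them.\<close>

lemma dec_broad_narrow:
  assumes D: "dec k (N - 1) D" and bil: "bilinear k 1 b N \<kappa>" and \<kappa>: "\<kappa> \<ge> 0"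
    and b: "1 \<le> b" "b \<le> N" and k: "2 \<le> k" "k \<le> K"
  shows "dec k N (D + real p ^ 2 * ((real p ^ b) ^ (2 * tri k) * \<kappa>) powr (1 / real (tri k)))"
  unfolding dec_def
proof (intro allI impI)
  fix \<phi> :: "'w \<Rightarrow> int \<Rightarrow> complex" and Q and X :: "int set"
  assume A: "finite X" "weight k Q" "admissible k N Q \<phi>"
  define s where "s = tri k"
  have s: "s \<ge> 2" using two_tri[of k] mult_le_mono[OF k(1) k(1)] k by (simp add: s_def)
  define \<kappa>' where "\<kappa>' = (real p ^ b) ^ (2 * s) * \<kappa>"
  have \<kappa>': "\<kappa>' \<ge> 0" using \<kappa> by (simp add: \<kappa>'_def)
  define G where "G = sqfun N s \<phi> X"
  have G0: "G \<ge> 0" by (simp add: G_def)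
  define I where "I = {0..<int p}"
  define f where "f i \<omega> = norm (exp_sum \<phi> (res_part X (int p) i) \<omega>)" for i \<omega>
  have f0: "f i \<omega> \<ge> 0" for i \<omega> by (simp add: f_def)
  have pw: "norm (exp_sum \<phi> X \<omega>) ^ 2 \<le> (\<Sum>(i, j)\<in>I \<times> I. f i \<omega> * f j \<omega>)" for \<omega>
  proof -
    have "norm (exp_sum \<phi> X \<omega>) \<le> (\<Sum>i\<in>I. f i \<omega>)"
      unfolding exp_sum_partition[OF A(1), of "int p" \<phi> \<omega>, simplified] f_def I_def by (rule norm_sum)
    then have "norm (exp_sum \<phi> X \<omega>) ^ 2 \<le> (\<Sum>i\<in>I. f i \<omega>) ^ 2" by (intro power_mono) auto
    also have "\<dots> = (\<Sum>(i, j)\<in>I \<times> I. f i \<omega> * f j \<omega>)"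
      by (simp add: power2_eq_square sum_product sum.cartesian_product)
    finally show ?thesis .
  qed
  have trm: "(\<Sum>\<omega>\<in>\<Omega>. (f i \<omega> * f j \<omega>) ^ s) powr (1 / real s) \<le>
     (if i = j then sqnorm s \<phi> (res_part X (int p) i) else 0) + \<kappa>' powr (1 / real s) * G" for i j
  proof (cases "i = j")
    case True
    then have "(\<Sum>\<omega>\<in>\<Omega>. (f i \<omega> * f j \<omega>) ^ s) powr (1 / real s) = sqnorm s \<phi> (res_part X (int p) i)"
      by (simp add: sqnorm_def f_def power_mult power2_eq_square)
    then show ?thesis using True G0 by simp
  next
    case False
    have pair: "(\<Sum>\<omega>\<in>\<Omega>. f i \<omega> ^ 2 * f j \<omega> ^ (2 * (s - 1))) \<le> \<kappa>' * G ^ s" if "i \<noteq> j" for i j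
      unfolding f_def \<kappa>'_def G_def s_def by (rule bilinear_class_sum[OF bil \<kappa> b k(1) A(2,3,1) that])
    \<comment> \<open>The product is symmetric in i and j, whereas the mixed moment with l = 1 is
      not; Cauchy-Schwarz separates it into the two moments with exponents 2 and 2(s-1).\<close>
    have "(\<Sum>\<omega>\<in>\<Omega>. (f i \<omega> * f j \<omega>) ^ s) ^ 2 = (\<Sum>\<omega>\<in>\<Omega>. (f i \<omega> * f j \<omega> ^ (s - 1)) * (f j \<omega> * f i \<omega> ^ (s - 1))) ^ 2"
      using s by (cases s) (simp_all add: power_mult_distrib mult_ac)
    also have "\<dots> \<le> (\<Sum>\<omega>\<in>\<Omega>. (f i \<omega> * f j \<omega> ^ (s - 1))\<^sup>2) * (\<Sum>\<omega>\<in>\<Omega>. (f j \<omega> * f i \<omega> ^ (s - 1))\<^sup>2)"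
      by (rule Cauchy_Schwarz_ineq_sum)
    also have "\<dots> = (\<Sum>\<omega>\<in>\<Omega>. f i \<omega> ^ 2 * f j \<omega> ^ (2 * (s - 1))) * (\<Sum>\<omega>\<in>\<Omega>. f j \<omega> ^ 2 * f i \<omega> ^ (2 * (s - 1)))"
      by (simp add: power_mult_distrib power_mult [symmetric] mult.commute[of 2])
    also have "\<dots> \<le> (\<kappa>' * G ^ s) * (\<kappa>' * G ^ s)"
      using False \<kappa>' G0 by (intro mult_mono pair) (auto intro!: sum_nonneg simp: f0)
    finally have "(\<Sum>\<omega>\<in>\<Omega>. (f i \<omega> * f j \<omega>) ^ s) ^ 2 \<le> (\<kappa>' * G ^ s) ^ 2" by (simp add: power2_eq_square)
    then have "(\<Sum>\<omega>\<in>\<Omega>. (f i \<omega> * f j \<omega>) ^ s) \<le> \<kappa>' * G ^ s"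
      by (rule power2_le_imp_le) (use \<kappa>' G0 in simp)
    then have "(\<Sum>\<omega>\<in>\<Omega>. (f i \<omega> * f j \<omega>) ^ s) powr (1 / real s) \<le> (\<kappa>' * G ^ s) powr (1 / real s)"
      by (intro powr_mono2) (auto intro!: sum_nonneg simp: f0)
    also have "\<dots> = \<kappa>' powr (1 / real s) * (G ^ s) powr (1 / real s)" using \<kappa>' G0 by (simp add: powr_mult)
    also have "(G ^ s) powr (1 / real s) = G"
      using s G0 by (cases "G = 0") (auto simp: powr_realpow [symmetric] powr_powr power_0_left)
    finally show ?thesis using False by simp
  qed
  have "sqnorm s \<phi> X = (\<Sum>\<omega>\<in>\<Omega>. (norm (exp_sum \<phi> X \<omega>) ^ 2) ^ s) powr (1 / real s)"
    by (simp add: sqnorm_def power_mult)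
  also have "\<dots> \<le> (\<Sum>\<omega>\<in>\<Omega>. (\<Sum>t\<in>I \<times> I. case t of (i, j) \<Rightarrow> f i \<omega> * f j \<omega>) ^ s) powr (1 / real s)"
    using pw by (intro powr_mono2 sum_mono power_mono) (auto intro!: sum_nonneg)
  also have "\<dots> \<le> (\<Sum>t\<in>I \<times> I. (\<Sum>\<omega>\<in>\<Omega>. (case t of (i, j) \<Rightarrow> f i \<omega> * f j \<omega>) ^ s) powr (1 / real s))"
    using s finite_\<Omega> by (intro Minkowski_sum) (auto simp: f0 I_def)
  also have "\<dots> \<le> (\<Sum>(i, j)\<in>I \<times> I. (if i = j then sqnorm s \<phi> (res_part X (int p) i) else 0) + \<kappa>' powr (1 / real s) * G)"
    using trm by (intro sum_mono) auto
  also have "\<dots> = (\<Sum>i\<in>I. sqnorm s \<phi> (res_part X (int p) i)) + real p ^ 2 * \<kappa>' powr (1 / real s) * G"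
    by (simp add: sum.cartesian_product [symmetric] sum.distrib I_def power2_eq_square)
  also have "(\<Sum>i\<in>I. sqnorm s \<phi> (res_part X (int p) i)) \<le> (\<Sum>i\<in>I. D * sqfun N s \<phi> (res_part X (int p) i))"
  proof (rule sum_mono)
    fix i
    show "sqnorm s \<phi> (res_part X (int p) i) \<le> D * sqfun N s \<phi> (res_part X (int p) i)"
      unfolding s_def using A b k by (intro dec_residue_class[of k N 1 D Q \<phi> _ i] D) (auto simp: res_part_def)
  qed
  also have "(\<Sum>i\<in>I. D * sqfun N s \<phi> (res_part X (int p) i)) = D * G"
    using sqfun_partition[of s 1 N \<phi> X] s b by (simp add: G_def I_def sum_distrib_left)
  finally show "sqnorm (tri k) \<phi> X \<le> (D + real p ^ 2 * ((real p ^ b) ^ (2 * tri k) * \<kappa>) powr (1 / real (tri k))) * sqfun N (tri k) \<phi> X"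
    by (simp add: s_def G_def \<kappa>'_def algebra_simps)
qed

end

text \<open>
  The constants must not depend on \<open>\<Omega>\<close>, and a definition cannot quantify over its type; the type
  \<open>nat \<Rightarrow> nat\<close> is rich enough for the torus.
\<close>

locale uniform_decoupling =
  fixes p K :: nat
  assumes prime_p: "prime p" and K_less_p: "K < p"
begin

lemma p_gt_1: "p > 1" using prime_p prime_gt_1_nat by blast

lemma decoupling: "finite \<Omega> \<Longrightarrow> decoupling p K \<Omega>"
  using prime_p K_less_p by unfold_locales

definition udec :: "nat \<Rightarrow> nat \<Rightarrow> real \<Rightarrow> bool" where
  "udec l N D \<longleftrightarrow> (\<forall>\<Omega> :: (nat \<Rightarrow> nat) set. finite \<Omega> \<longrightarrow> decoupling.dec p K \<Omega> l N D)"

definition ubilinear :: "nat \<Rightarrow> nat \<Rightarrow> nat \<Rightarrow> nat \<Rightarrow> real \<Rightarrow> bool" where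
  "ubilinear k l b N \<kappa> \<longleftrightarrow> (\<forall>\<Omega> :: (nat \<Rightarrow> nat) set. finite \<Omega> \<longrightarrow> decoupling.bilinear p K \<Omega> k l b N \<kappa>)"

lemma udecI: "(\<And>\<Omega> :: (nat \<Rightarrow> nat) set. finite \<Omega> \<Longrightarrow> decoupling p K \<Omega> \<Longrightarrow> decoupling.dec p K \<Omega> l N D) \<Longrightarrow> udec l N D"
  unfolding udec_def by (simp add: decoupling)

lemma udecD: "udec l N D \<Longrightarrow> finite (\<Omega> :: (nat \<Rightarrow> nat) set) \<Longrightarrow> decoupling.dec p K \<Omega> l N D"
  unfolding udec_def by simp

lemma ubilinearI:
  "(\<And>\<Omega> :: (nat \<Rightarrow> nat) set. finite \<Omega> \<Longrightarrow> decoupling p K \<Omega> \<Longrightarrow> decoupling.bilinear p K \<Omega> k l b N \<kappa>) \<Longrightarrow> ubilinear k l b N \<kappa>"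
  unfolding ubilinear_def by (simp add: decoupling)

lemma ubilinearD: "ubilinear k l b N \<kappa> \<Longrightarrow> finite (\<Omega> :: (nat \<Rightarrow> nat) set) \<Longrightarrow> decoupling.bilinear p K \<Omega> k l b N \<kappa>"
  unfolding ubilinear_def by simp

lemma udec_mono: "udec l N D \<Longrightarrow> D \<le> D' \<Longrightarrow> udec l N D'"
  by (rule udecI) (rule decoupling.dec_mono, assumption, rule udecD)

lemma ubilinear_mono: "ubilinear k l b N \<kappa> \<Longrightarrow> \<kappa> \<le> \<kappa>' \<Longrightarrow> ubilinear k l b N \<kappa>'"
  by (rule ubilinearI) (rule decoupling.bilinear_mono, assumption, rule ubilinearD)

lemma udec_trivial: "1 \<le> l \<Longrightarrow> udec l N (real p ^ N)"
  by (rule udecI) (rule decoupling.dec_trivial)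

lemma udec_1: "1 \<le> K \<Longrightarrow> udec 1 N 1"
  by (rule udecI) (rule decoupling.dec_1)

lemma ubilinear_0: "udec k (N - b) D \<Longrightarrow> b \<le> N \<Longrightarrow> 1 \<le> k \<Longrightarrow> k \<le> K \<Longrightarrow> ubilinear k 0 b N (D ^ tri k)"
  by (rule ubilinearI) (rule decoupling.bilinear_0, assumption, rule udecD)

lemma ubilinear_trivial: "udec k N D \<Longrightarrow> 1 \<le> l \<Longrightarrow> l < k \<Longrightarrow> D \<ge> 0 \<Longrightarrow> ubilinear k l b N (D ^ tri k)"
  by (rule ubilinearI) (rule decoupling.bilinear_trivial, assumption, rule udecD)

lemma ubilinear_step:
  assumes "udec l (a - 1) D" "D \<ge> 1" "a = 1 \<or> l * a \<le> (k - l + 1) * b" "1 \<le> a" "a \<le> N" "1 \<le> b"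
    and "ubilinear k (l - 1) b N \<kappa>1" "ubilinear k (k - l) a N \<kappa>2"
    and "1 \<le> l" "l < k" "k \<le> K" "\<kappa>1 \<ge> 0" "\<kappa>2 \<ge> 0"
  shows "ubilinear k l b N (D ^ tri l * (\<kappa>1 powr (1 - 1 / real (k - l + 1)) * \<kappa>2 powr (1 / real (k - l + 1))))"
  by (rule ubilinearI, rule decoupling.bilinear_step[OF _ udecD[OF assms(1)] assms(2-6)
        ubilinearD[OF assms(7)] ubilinearD[OF assms(8)] assms(9-13)])

lemma udec_broad_narrow:
  assumes "udec k (N - 1) D" "ubilinear k 1 b N \<kappa>" "\<kappa> \<ge> 0" "1 \<le> b" "b \<le> N" "2 \<le> k" "k \<le> K"
  shows "udec k N (D + real p ^ 2 * ((real p ^ b) ^ (2 * tri k) * \<kappa>) powr (1 / real (tri k)))"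
  by (rule udecI, rule decoupling.dec_broad_narrow[OF _ udecD[OF assms(1)] ubilinearD[OF assms(2)] assms(3-7)])

end

text \<open>With a = nb/l the terms in x are in equilibrium, x l(k-l) being the eigenvector. The
  term 1/k records the gain of the case l = 0, where (1/k) k b = b; the first summand alone passes
  it on, turning (k-l+1) b/k into (k-l) b/k. Rounding \<open>a\<close> down costs at most x l
  k.\<close>

lemma transverse_gain_recursion:
  fixes k l b a n x :: real
  assumes l: "1 \<le> l" "l < k" and k: "1 \<le> k" and x: "x \<ge> 0"
    and n: "n = k - l + 1" and a: "a \<ge> n * b / l - 1"
  shows "(x * l + 1 / k) * (k - l) * b - x * l * k
    \<le> (1 - 1 / n) * ((x * (l - 1) + 1 / k) * (k - (l - 1)) * b) + (1 / n) * (x * (k - l) * l * a)"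
proof -
  have n1: "n > 1" using l n by simp
  have kl: "k - l = n - 1" "k - (l - 1) = n" using n by auto
  have "(1 / n) * (x * (n - 1) * l * a) \<ge> (1 / n) * (x * (n - 1) * l * (n * b / l - 1))"
    using n1 x l a by (intro mult_left_mono) auto
  moreover have "(1 / n) * (x * (n - 1) * l * (n * b / l - 1)) = x * (n - 1) * b - x * l * ((n - 1) / n)"
    using n1 l by (simp add: field_simps)
  moreover have "x * l * ((n - 1) / n) \<le> x * l * k"
  proof (intro mult_left_mono)
    have "(n - 1) / n \<le> 1" using n1 by simp
    then show "(n - 1) / n \<le> k" using k by linarith
  qed (use x l in auto)
  moreover have "(1 - 1 / n) * ((x * (l - 1) + 1 / k) * n * b) = (n - 1) * (x * (l - 1) + 1 / k) * b"
    using n1 by (simp add: field_simps)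
  moreover have "(x * l + 1 / k) * (n - 1) * b = (n - 1) * (x * (l - 1) + 1 / k) * b + x * (n - 1) * b"
    by (simp add: algebra_simps)
  ultimately show ?thesis unfolding kl by linarith
qed

section \<open>Improving the decoupling exponent\<close>

context uniform_decoupling
begin

definition dec_exponent :: "nat \<Rightarrow> real \<Rightarrow> bool" where
  "dec_exponent l \<epsilon> \<longleftrightarrow> (\<exists>C\<ge>1. \<forall>N. udec l N (C * real p powr (\<epsilon> * N)))"

lemma real_p_gt_1: "real p > 1" using p_gt_1 by simp

lemma dec_exponent_mono:
  assumes "dec_exponent l \<epsilon>" "\<epsilon> \<le> \<epsilon>'" shows "dec_exponent l \<epsilon>'"
proof -
  from assms(1) obtain C where C: "C \<ge> 1" "\<And>N. udec l N (C * real p powr (\<epsilon> * N))"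
    by (auto simp: dec_exponent_def)
  have "C * real p powr (\<epsilon> * N) \<le> C * real p powr (\<epsilon>' * N)" for N :: nat
    using C(1) assms(2) real_p_gt_1 by (intro mult_left_mono powr_mono mult_right_mono) auto
  then show ?thesis using C udec_mono unfolding dec_exponent_def by blast
qed

text \<open>
  The gain in the bilinear estimate with \<open>Y\<close> in a class modulo \<open>p\<^sup>b\<close> is measured by the slope \<open>n/k\<^sup>2\<close>.
  The shape \<open>l(k - l)\<close> is the eigenvector of the homogeneous recursion given by
  the transverse step, so one sweep over \<open>l\<close> adds \<open>1/k\<^sup>2\<close> to the slope.
\<close>

definition bilinear_slope :: "nat \<Rightarrow> real \<Rightarrow> nat \<Rightarrow> bool" where
  "bilinear_slope k \<eta> n \<longleftrightarrow> (\<forall>\<epsilon>>0. \<exists>C\<ge>1. \<forall>N b l. 1 \<le> l \<longrightarrow> l < k \<longrightarrow> 1 \<le> b \<longrightarrow> k ^ (n + 1) * b \<le> N \<longrightarrow>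
     ubilinear k l b N (C * real p powr (tri k * ((\<eta> + \<epsilon>) * N - \<eta> * (real n / real k ^ 2 * (real k - real l) * l * b)))))"

lemma bilinear_slope_0:
  assumes "dec_exponent k \<eta>"
  shows "bilinear_slope k \<eta> 0"
  unfolding bilinear_slope_def
proof (intro allI impI)
  fix \<epsilon> :: real assume "\<epsilon> > 0"
  from assms obtain C where C: "C \<ge> 1" "\<And>N. udec k N (C * real p powr (\<eta> * N))" by (auto simp: dec_exponent_def)
  have "ubilinear k l b N (C ^ tri k * real p powr (tri k * ((\<eta> + \<epsilon>) * N - \<eta> * (real 0 / real k ^ 2 * (real k - real l) * l * b))))"
    if "1 \<le> l" "l < k" for N b l
  proof -
    have "(C * real p powr (\<eta> * N)) ^ tri k = C ^ tri k * real p powr (tri k * (\<eta> * N))"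
      using real_p_gt_1 by (simp add: power_mult_distrib powr_powr powr_realpow [symmetric] mult_ac)
    also have "\<dots> \<le> C ^ tri k * real p powr (tri k * ((\<eta> + \<epsilon>) * N))"
      using C(1) real_p_gt_1 \<open>\<epsilon> > 0\<close> by (intro mult_left_mono powr_mono mult_right_mono) auto
    finally have "(C * real p powr (\<eta> * N)) ^ tri k \<le> C ^ tri k * real p powr (tri k * ((\<eta> + \<epsilon>) * N))" .
    moreover have "ubilinear k l b N ((C * real p powr (\<eta> * N)) ^ tri k)"
      using C(1) by (intro ubilinear_trivial[OF C(2) that]) auto
    ultimately show ?thesis using ubilinear_mono by simp
  qed
  then show "\<exists>C\<ge>1. \<forall>N b l. 1 \<le> l \<longrightarrow> l < k \<longrightarrow> 1 \<le> b \<longrightarrow> k ^ (0 + 1) * b \<le> N \<longrightarrow>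
     ubilinear k l b N (C * real p powr (tri k * ((\<eta> + \<epsilon>) * N - \<eta> * (real 0 / real k ^ 2 * (real k - real l) * l * b))))"
    using C(1) by (intro exI[of _ "C ^ tri k"]) auto
qed

lemma bilinear_slope_Suc:
  assumes IH: "\<And>l \<epsilon>. 1 \<le> l \<Longrightarrow> l < k \<Longrightarrow> \<epsilon> > 0 \<Longrightarrow> dec_exponent l \<epsilon>"
    and val: "dec_exponent k \<eta>" and \<eta>: "\<eta> \<ge> 0" and k: "2 \<le> k" "k \<le> K"
    and slope: "bilinear_slope k \<eta> n"
  shows "bilinear_slope k \<eta> (Suc n)"
proof -
  define x where "x = real n / real k ^ 2"
  have x0: "x \<ge> 0" by (simp add: x_def)
  \<comment> \<open>The sweep over l: moments with exchanged roles enter with the old slope x, and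
    the fresh gain from l = 0 travels through the term 1/k. Since l/k^2 is at most 1/k, the result
    dominates the required shape with slope (n+1)/k^2.\<close>
  have inner: "\<forall>\<epsilon>>0. \<exists>C\<ge>1. \<forall>N b. 1 \<le> b \<longrightarrow> k ^ (n + 2) * b \<le> N \<longrightarrow>
     ubilinear k l b N (C * real p powr (tri k * ((\<eta> + \<epsilon>) * N - \<eta> * ((x * l + 1 / k) * (real k - l) * b))))"
    if "l < k" for l
    using that
  proof (induction l)
    case 0
    from val obtain C where C: "C \<ge> 1" "\<And>N. udec k N (C * real p powr (\<eta> * N))" by (auto simp: dec_exponent_def)
    show ?case
    proof (intro allI impI exI[of _ "C ^ tri k"] conjI)
      fix \<epsilon> :: real and N b :: nat
      assume A: "\<epsilon> > 0" "1 \<le> b" "k ^ (n + 2) * b \<le> N"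
      have "1 * b \<le> k ^ (n + 2) * b" using k by (intro mult_right_mono) auto
      then have b: "b \<le> N" using order_trans[OF _ A(3)] by simp
      show "ubilinear k 0 b N (C ^ tri k * real p powr (tri k * ((\<eta> + \<epsilon>) * N - \<eta> * ((x * (0::nat) + 1 / k) * (real k - (0::nat)) * b))))"
      proof (rule ubilinear_mono[OF ubilinear_0[OF C(2) b]])
        have "(C * real p powr (\<eta> * real (N - b))) ^ tri k = C ^ tri k * real p powr (tri k * (\<eta> * real (N - b)))"
          using real_p_gt_1 by (simp add: power_mult_distrib powr_powr powr_realpow [symmetric] mult_ac)
        also have "\<dots> \<le> C ^ tri k * real p powr (tri k * ((\<eta> + \<epsilon>) * N - \<eta> * ((x * (0::nat) + 1 / k) * (real k - (0::nat)) * b)))"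
          using C(1) real_p_gt_1 A b k by (intro mult_left_mono powr_mono) (auto simp: of_nat_diff algebra_simps)
        finally show "(C * real p powr (\<eta> * real (N - b))) ^ tri k \<le> \<dots>" .
      qed (use k in auto)
    qed (use C in auto)
  next
    case (Suc l')
    define l where "l = Suc l'"
    have l: "1 \<le> l" "l < k" "l - 1 = l'" using Suc.prems by (auto simp: l_def)
    show ?case unfolding l_def [symmetric]
    proof (intro allI impI)
      fix \<epsilon> :: real assume \<epsilon>: "\<epsilon> > 0"
      define t where "t = 1 / real (k - l + 1)"
      have t: "0 < t" "t < 1" using l by (auto simp: t_def)
      obtain C1 where C1: "C1 \<ge> 1" "\<And>N b. 1 \<le> b \<Longrightarrow> k ^ (n + 2) * b \<le> N \<Longrightarrow>
         ubilinear k (l - 1) b N (C1 * real p powr (tri k * ((\<eta> + \<epsilon> / 2) * N - \<eta> * ((x * real (l - 1) + 1 / k) * (real k - real (l - 1)) * b))))"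
        using Suc.IH[rule_format, of "\<epsilon> / 2"] \<epsilon> Suc.prems unfolding l by auto
      obtain C2 where C2: "C2 \<ge> 1" "\<And>N b l. 1 \<le> l \<Longrightarrow> l < k \<Longrightarrow> 1 \<le> b \<Longrightarrow> k ^ (n + 1) * b \<le> N \<Longrightarrow>
         ubilinear k l b N (C2 * real p powr (tri k * ((\<eta> + \<epsilon> / 2) * N - \<eta> * (x * (real k - real l) * l * b))))"
        using slope[unfolded bilinear_slope_def, rule_format, of "\<epsilon> / 2"] \<epsilon> unfolding x_def by auto
      obtain C3 where C3: "C3 \<ge> 1" "\<And>N. udec l N (C3 * real p powr (\<epsilon> / 2 * N))"
        using IH[of l "\<epsilon> / 2"] l \<epsilon> by (auto simp: dec_exponent_def)
      \<comment> \<open>The last factor absorbs the rounding loss in \<open>a\<close>, which is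
        independent of b and N.\<close>
      define C where "C = C3 ^ tri l * (C1 powr (1 - t) * C2 powr t) * real p powr (tri k * (\<eta> * (x * l * k)))"
      have "C \<ge> 1" unfolding C_def
        using C1(1) C2(1) C3(1) t real_p_gt_1 \<eta> x0 by (intro mult_ge1_I one_le_power ge_one_powr_ge_zero | simp)+
      moreover have "ubilinear k l b N (C * real p powr (tri k * ((\<eta> + \<epsilon>) * N - \<eta> * ((x * l + 1 / k) * (real k - l) * b))))"
        if b: "1 \<le> b" "k ^ (n + 2) * b \<le> N" for N b
      proof -
        \<comment> \<open>The largest value permitted by the transverse step, but at least 1. It can
          be as large as k b, so each sweep calls the previous estimate with b multiplied by up to
          k; this is the origin of the requirement k^(n+1) b \<le> N.\<close>
        define a where "a = max 1 ((k - l + 1) * b div l)"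
        have "(k - l + 1) * b div l \<le> (k - l + 1) * b" by simp
        also have "\<dots> \<le> k * b" using l by (intro mult_right_mono) auto
        finally have "a \<le> k * b" using b(1) k by (simp add: a_def)
        then have "k ^ (n + 1) * a \<le> k ^ (n + 1) * (k * b)" by (rule mult_left_mono) simp
        also have "k ^ (n + 1) * (k * b) = k ^ (n + 2) * b" by simp
        also note b(2)
        finally have a_N: "k ^ (n + 1) * a \<le> N" .
        have "1 * a \<le> k ^ (n + 1) * a" using k by (intro mult_right_mono) auto
        also note a_N
        finally have "a \<le> N" by simp
        then have a: "1 \<le> a" "a \<le> N" by (auto simp: a_def)
        have a_cond: "a = 1 \<or> l * a \<le> (k - l + 1) * b"
          by (auto simp: a_def max_def)
        have a_real: "real a \<ge> (real k - real l + 1) * real b / real l - 1"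
        proof -
          have "real (m div l) \<ge> real m / real l - 1" for m
          proof -
            have "m \<le> m div l * l + l" using l by (metis add_left_mono div_mult_mod_eq less_imp_le mod_less_divisor One_nat_def Suc_le_lessD)
            then have "real m \<le> real (m div l) * real l + real l" by (metis of_nat_add of_nat_le_iff of_nat_mult)
            then show ?thesis using l by (simp add: field_simps)
          qed
          from this[of "(k - l + 1) * b"] have "real ((k - l + 1) * b) / real l - real ((k - l + 1) * b div l) \<le> 1"
            by linarith
          moreover have "real ((k - l + 1) * b) = (real k - real l + 1) * real b"
            unfolding of_nat_mult using l by (simp add: of_nat_diff)
          moreover have "real ((k - l + 1) * b div l) \<le> real a" unfolding a_def of_nat_le_iff by (rule max.cobounded2)
          moreover have "u - 1 \<le> real a" if "u - v \<le> 1" "v \<le> real a" for u v using that by linarith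
          ultimately show ?thesis by metis
        qed
        define E1 where "E1 = (\<eta> + \<epsilon> / 2) * N - \<eta> * ((x * real (l - 1) + 1 / k) * (real k - real (l - 1)) * b)"
        define E2 where "E2 = (\<eta> + \<epsilon> / 2) * N - \<eta> * (x * (real k - l) * l * a)"
        have b1: "ubilinear k (l - 1) b N (C1 * real p powr (tri k * E1))"
          unfolding E1_def using C1(2)[OF b] .
        have b2: "ubilinear k (k - l) a N (C2 * real p powr (tri k * E2))"
          using C2(2)[of "k - l" a N] l a a_N by (simp add: E2_def of_nat_diff mult_ac)
        have D: "udec l (a - 1) (C3 * real p powr (\<epsilon> / 2 * N))"
          using C3 real_p_gt_1 a \<epsilon> by (intro udec_mono[OF C3(2)[of "a - 1"]] mult_left_mono powr_mono) auto
        have D1: "C3 * real p powr (\<epsilon> / 2 * N) \<ge> 1"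
          using C3(1) real_p_gt_1 \<epsilon> by (intro mult_ge1_I ge_one_powr_ge_zero) auto
        have "ubilinear k l b N ((C3 * real p powr (\<epsilon> / 2 * N)) ^ tri l *
           ((C1 * real p powr (tri k * E1)) powr (1 - t) * (C2 * real p powr (tri k * E2)) powr t))"
          unfolding t_def using C1(1) C2(1) l k b(1) by (intro ubilinear_step[OF D D1 a_cond a b(1) b1 b2]) auto
        also have "(C3 * real p powr (\<epsilon> / 2 * N)) ^ tri l *
           ((C1 * real p powr (tri k * E1)) powr (1 - t) * (C2 * real p powr (tri k * E2)) powr t)
           = C3 ^ tri l * (C1 powr (1 - t) * C2 powr t) * real p powr (tri l * (\<epsilon> / 2 * N) + tri k * ((1 - t) * E1 + t * E2))"
        proof -
          have e: "tri l * (\<epsilon> / 2 * N) + tri k * ((1 - t) * E1 + t * E2) = \<epsilon> / 2 * N * tri l + (tri k * E1 * (1 - t) + tri k * E2 * t)"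
            by (simp add: algebra_simps)
          have pw: "(real p powr u) ^ m = real p powr (u * m)" for u m
            using real_p_gt_1 by (simp add: powr_realpow [symmetric] powr_powr)
          show ?thesis
            unfolding e powr_add power_mult_distrib pw using C1(1) C2(1) by (simp add: powr_mult powr_powr)
        qed
        finally have bil': "ubilinear k l b N (C3 ^ tri l * (C1 powr (1 - t) * C2 powr t) * real p powr (tri l * (\<epsilon> / 2 * N) + tri k * ((1 - t) * E1 + t * E2)))" .
        have "C3 ^ tri l * (C1 powr (1 - t) * C2 powr t) * real p powr (tri l * (\<epsilon> / 2 * N) + tri k * ((1 - t) * E1 + t * E2))
          \<le> C3 ^ tri l * (C1 powr (1 - t) * C2 powr t) * real p powr
            (tri k * (\<eta> * (x * l * k)) + tri k * ((\<eta> + \<epsilon>) * N - \<eta> * ((x * l + 1 / k) * (real k - l) * b)))"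
        proof (intro mult_left_mono powr_mono)
          have "tri l * (\<epsilon> / 2 * N) \<le> tri k * (\<epsilon> / 2 * N)"
            using \<epsilon> tri_mono[of l k] l by (intro mult_right_mono) auto
          moreover have "(1 - t) * E1 + t * E2 \<le> (\<eta> + \<epsilon> / 2) * N - \<eta> * ((x * l + 1 / k) * (real k - l) * b - x * l * k)"
          proof -
            have "real (k - l + 1) = real k - real l + 1" using l by (simp add: of_nat_diff)
            then have "(x * l + 1 / k) * (real k - l) * b - x * l * k
                \<le> (1 - t) * ((x * (real l - 1) + 1 / k) * (real k - (real l - 1)) * b) + t * (x * (real k - l) * l * a)"
              unfolding t_def using l k x0 a_real by (intro transverse_gain_recursion) (auto simp: add.commute[of 1])
            then have "\<eta> * ((x * l + 1 / k) * (real k - l) * b - x * l * k)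
                \<le> \<eta> * ((1 - t) * ((x * (real l - 1) + 1 / k) * (real k - (real l - 1)) * b) + t * (x * (real k - l) * l * a))"
              using \<eta> by (rule mult_left_mono)
            moreover have "(1 - t) * (M - \<eta> * V) + t * (M - \<eta> * W) = M - \<eta> * ((1 - t) * V + t * W)" for M V W
              by (simp add: algebra_simps)
            moreover have "real (l - 1) = real l - 1" using l by (simp add: of_nat_diff)
            ultimately show ?thesis unfolding E1_def E2_def by simp
          qed
          then have "tri k * ((1 - t) * E1 + t * E2) \<le> tri k * ((\<eta> + \<epsilon> / 2) * N - \<eta> * ((x * l + 1 / k) * (real k - l) * b - x * l * k))"
            by (rule mult_left_mono) simp
          ultimately show "tri l * (\<epsilon> / 2 * N) + tri k * ((1 - t) * E1 + t * E2)
            \<le> tri k * (\<eta> * (x * l * k)) + tri k * ((\<eta> + \<epsilon>) * N - \<eta> * ((x * l + 1 / k) * (real k - l) * b))"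
            by (simp add: algebra_simps)
        qed (use real_p_gt_1 C3 in auto)
        also have "\<dots> = C * real p powr (tri k * ((\<eta> + \<epsilon>) * N - \<eta> * ((x * l + 1 / k) * (real k - l) * b)))"
          by (simp only: powr_add C_def mult.assoc)
        finally show ?thesis by (rule ubilinear_mono[OF bil'])
      qed
      ultimately show "\<exists>C\<ge>1. \<forall>N b. 1 \<le> b \<longrightarrow> k ^ (n + 2) * b \<le> N \<longrightarrow>
         ubilinear k l b N (C * real p powr (tri k * ((\<eta> + \<epsilon>) * N - \<eta> * ((x * l + 1 / k) * (real k - l) * b))))"
        by blast
    qed
  qed
  show ?thesis unfolding bilinear_slope_def
  proof (intro allI impI)
    fix \<epsilon> :: real assume \<epsilon>: "\<epsilon> > 0"
    have "\<forall>l\<in>{1..<k}. \<exists>C\<ge>1. \<forall>N b. 1 \<le> b \<longrightarrow> k ^ (n + 2) * b \<le> N \<longrightarrow>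
     ubilinear k l b N (C * real p powr (tri k * ((\<eta> + \<epsilon>) * N - \<eta> * ((x * l + 1 / k) * (real k - l) * b))))"
      using inner \<epsilon> by auto
    then obtain f where f: "\<And>l. l \<in> {1..<k} \<Longrightarrow> f l \<ge> 1" "\<And>l N b. l \<in> {1..<k} \<Longrightarrow> 1 \<le> b \<Longrightarrow> k ^ (n + 2) * b \<le> N \<Longrightarrow>
     ubilinear k l b N (f l * real p powr (tri k * ((\<eta> + \<epsilon>) * N - \<eta> * ((x * l + 1 / k) * (real k - l) * b))))"
      by metis
    define C where "C = 1 + (\<Sum>l\<in>{1..<k}. f l)"
    have fC: "f l \<le> C" if "l \<in> {1..<k}" for l
      using member_le_sum[OF that, of f] f(1) by (force simp: C_def)
    have "0 \<le> (\<Sum>l\<in>{1..<k}. f l)" by (intro sum_nonneg order_trans[OF zero_le_one f(1)])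
    then have "C \<ge> 1" by (simp add: C_def)
    moreover have "ubilinear k l b N (C * real p powr (tri k * ((\<eta> + \<epsilon>) * N - \<eta> * (real (Suc n) / real k ^ 2 * (real k - real l) * l * b))))"
      if l: "1 \<le> l" "l < k" and b: "1 \<le> b" "k ^ (Suc n + 1) * b \<le> N" for N b l
    proof (rule ubilinear_mono[OF f(2)])
      have "real (Suc n) / real k ^ 2 * l \<le> x * l + 1 / k"
      proof -
        have "real (Suc n) / real k ^ 2 * l = x * l + l / real k ^ 2"
          using k by (simp add: x_def field_simps)
        moreover have "l / real k ^ 2 \<le> 1 / k" using l by (simp add: field_simps power2_eq_square)
        ultimately show ?thesis by simp
      qed
      then have "real (Suc n) / real k ^ 2 * l * (real k - l) * b \<le> (x * l + 1 / k) * (real k - l) * b"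
        using l by (intro mult_right_mono) auto
      then have "\<eta> * (real (Suc n) / real k ^ 2 * (real k - l) * l * b) \<le> \<eta> * ((x * l + 1 / k) * (real k - l) * b)"
        using \<eta> by (intro mult_left_mono) (auto simp: mult_ac)
      then show "f l * real p powr (tri k * ((\<eta> + \<epsilon>) * N - \<eta> * ((x * l + 1 / k) * (real k - l) * b)))
         \<le> C * real p powr (tri k * ((\<eta> + \<epsilon>) * N - \<eta> * (real (Suc n) / real k ^ 2 * (real k - real l) * l * b)))"
        using fC[of l] f(1)[of l] l real_p_gt_1 \<open>C \<ge> 1\<close>
        by (intro mult_mono powr_mono mult_left_mono) (auto simp: of_nat_diff)
    qed (use l b in auto)
    ultimately show "\<exists>C\<ge>1. \<forall>N b l. 1 \<le> l \<longrightarrow> l < k \<longrightarrow> 1 \<le> b \<longrightarrow> k ^ (Suc n + 1) * b \<le> N \<longrightarrow>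
       ubilinear k l b N (C * real p powr (tri k * ((\<eta> + \<epsilon>) * N - \<eta> * (real (Suc n) / real k ^ 2 * (real k - real l) * l * b))))"
      by blast
  qed
qed

lemma bilinear_slope_all:
  assumes "\<And>l \<epsilon>. 1 \<le> l \<Longrightarrow> l < k \<Longrightarrow> \<epsilon> > 0 \<Longrightarrow> dec_exponent l \<epsilon>"
    and "dec_exponent k \<eta>" "\<eta> \<ge> 0" "2 \<le> k" "k \<le> K"
  shows "bilinear_slope k \<eta> n"
proof (induction n)
  case 0
  show ?case by (rule bilinear_slope_0[OF assms(2)])
next
  case (Suc n)
  show ?case by (rule bilinear_slope_Suc[OF assms(1) assms(2-5) Suc.IH])
qed

text \<open>
  Broad-narrow with \<open>b = N div m\<close> loses \<open>p\<^bsup>2b\<^esup>\<close>, which a slope of at least 3 more than recovers.  The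
  admissible decrement of \<open>\<eta>\<close> is bounded below as long as \<open>\<eta>\<close> stays away from 0.
\<close>

lemma dec_exponent_improve:
  assumes IH: "\<And>l \<epsilon>. 1 \<le> l \<Longrightarrow> l < k \<Longrightarrow> \<epsilon> > 0 \<Longrightarrow> dec_exponent l \<epsilon>"
    and val: "dec_exponent k \<eta>" and \<eta>: "\<eta> \<ge> 0" and k: "2 \<le> k" "k \<le> K"
    and n: "\<eta> * (real n / real k ^ 2 * (real k - 1)) \<ge> 3"
    and m: "m = k ^ (n + 1)" and \<delta>: "\<delta> > 0" "\<delta> \<ge> \<eta> - 1 / (2 * real m)"
  shows "dec_exponent k \<delta>"
proof -
  define s where "s = tri k"
  have s: "s \<ge> 1" using tri_ge_1 k by (simp add: s_def)
  have m1: "m \<ge> 1" unfolding m using k by (intro one_le_power) auto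
  from val obtain C0 where C0: "C0 \<ge> 1" "\<And>N. udec k N (C0 * real p powr (\<eta> * N))" by (auto simp: dec_exponent_def)
  have m_pos: "1 / (2 * real m) > 0" using m1 by simp
  have "bilinear_slope k \<eta> n" by (rule bilinear_slope_all[OF IH val \<eta> k])
  from this[unfolded bilinear_slope_def, rule_format, OF m_pos]
  obtain C where C: "C \<ge> 1" "\<And>N b l. 1 \<le> l \<Longrightarrow> l < k \<Longrightarrow> 1 \<le> b \<Longrightarrow> m * b \<le> N \<Longrightarrow>
     ubilinear k l b N (C * real p powr (s * ((\<eta> + 1 / (2 * real m)) * N - \<eta> * (real n / real k ^ 2 * (real k - real l) * l * b))))"
    unfolding m [symmetric] s_def [symmetric] by blast
  \<comment> \<open>p^2 counts the pairs of classes; the last factor p pays for rounding N/m down to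
    b.\<close>
  define C' where "C' = real p ^ 2 * C powr (1 / real s) * real p"
  have C'0: "C' \<ge> 0" by (simp add: C'_def)
  have step: "udec k N (D + C' * real p powr (\<delta> * N))" if N: "N \<ge> m" and D: "udec k (N - 1) D" for N D
  proof -
    define b where "b = N div m"
    have b: "1 \<le> b" "m * b \<le> N" using N m1 by (auto simp: b_def div_greater_zero_iff Suc_le_eq)
    then have "b \<le> N" using m1 by (metis mult_le_mono1 nat_mult_1 order_trans)
    define E where "E = (\<eta> + 1 / (2 * real m)) * N - \<eta> * (real n / real k ^ 2 * (real k - 1) * b)"
    have bil: "ubilinear k 1 b N (C * real p powr (s * E))"
      using C(2)[of 1 b N] b k by (simp add: E_def)
    have N_le: "real N \<le> real m * (b + 1)"
    proof -
      have "N < m * (b + 1)" using m1 by (simp add: b_def dividend_less_times_div)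
      then have "real N \<le> real (m * (b + 1))" by (simp only: of_nat_le_iff less_imp_le)
      then show ?thesis by (simp add: algebra_simps)
    qed
    have "3 * real b \<le> \<eta> * (real n / real k ^ 2 * (real k - 1)) * b"
      using n by (intro mult_right_mono) auto
    then have "2 * real b + E \<le> (\<eta> + 1 / (2 * real m)) * N - b" by (simp add: E_def mult_ac)
    also have "\<dots> \<le> (\<eta> + 1 / (2 * real m)) * N - (N / m - 1)"
    proof -
      have "N / m \<le> real b + 1" using N_le m1 by (simp add: divide_le_eq ac_simps)
      then show ?thesis by simp
    qed
    also have "\<dots> = (\<eta> - 1 / (2 * real m)) * N + 1" using m1 by (simp add: field_simps)
    also have "\<dots> \<le> \<delta> * N + 1" using \<delta> by (intro add_right_mono mult_right_mono) auto
    finally have E_le: "2 * real b + E \<le> \<delta> * N + 1" .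
    have "((real p ^ b) ^ (2 * s) * (C * real p powr (s * E))) powr (1 / real s)
      = C powr (1 / real s) * real p powr (2 * real b + E)"
    proof -
      have "(real p ^ b) ^ (2 * s) = real p powr (2 * real b * s)"
        using real_p_gt_1 by (simp add: powr_realpow [symmetric] powr_powr mult_ac)
      then have eq: "(real p ^ b) ^ (2 * s) * (C * real p powr (s * E)) = C * real p powr (s * (2 * real b + E))"
        by (simp add: powr_add distrib_left mult_ac)
      show ?thesis unfolding eq using C(1) s by (simp add: powr_mult powr_powr)
    qed
    also have "\<dots> \<le> C powr (1 / real s) * real p powr (\<delta> * N + 1)"
      using E_le real_p_gt_1 by (intro mult_left_mono powr_mono) auto
    finally have "D + real p ^ 2 * ((real p ^ b) ^ (2 * s) * (C * real p powr (s * E))) powr (1 / real s)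
       \<le> D + real p ^ 2 * (C powr (1 / real s) * real p powr (\<delta> * N + 1))"
      by (intro add_left_mono mult_left_mono) auto
    also have "\<dots> = D + C' * real p powr (\<delta> * N)"
      using real_p_gt_1 by (simp add: C'_def powr_add mult_ac)
    finally have le: "D + real p ^ 2 * ((real p ^ b) ^ (2 * s) * (C * real p powr (s * E))) powr (1 / real s) \<le> D + C' * real p powr (\<delta> * N)" .
    have "udec k N (D + real p ^ 2 * ((real p ^ b) ^ (2 * tri k) * (C * real p powr (s * E))) powr (1 / real (tri k)))"
      using C(1) by (intro udec_broad_narrow[OF D bil _ b(1) \<open>b \<le> N\<close> k]) auto
    from udec_mono[OF this[folded s_def] le] show ?thesis .
  qed
  \<comment> \<open>The recursion D(N) = D(N-1) + C' p^(\<delta>N) is a geometric sum: with q = 1 -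
    p^(-\<delta>), any constant at least C'/q reproduces itself.\<close>
  define q where "q = 1 - real p powr (- \<delta>)"
  have q: "0 < q" "q < 1" using real_p_gt_1 \<delta> by (auto simp: q_def powr_minus less_1_mult one_less_inverse_iff inverse_less_1_iff)
  define C'' where "C'' = C0 * real p powr (\<eta> * m) + C' / q"
  have C''_ge: "C'' \<ge> C0 * real p powr (\<eta> * m)" using C'0 q by (simp add: C''_def)
  have "C0 * real p powr (\<eta> * m) \<ge> 1" using C0(1) \<eta> real_p_gt_1 by (intro mult_ge1_I ge_one_powr_ge_zero) auto
  then have C''1: "C'' \<ge> 1" using C''_ge by simp
  have small: "udec k N (C'' * real p powr (\<delta> * N))" if "N \<le> m" for N
  proof (rule udec_mono[OF C0(2)])
    have "C0 * real p powr (\<eta> * N) \<le> C0 * real p powr (\<eta> * m)"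
      using that C0(1) \<eta> real_p_gt_1 by (intro mult_left_mono powr_mono) auto
    also have "\<dots> \<le> C'' * 1" using C''_ge by simp
    also have "\<dots> \<le> C'' * real p powr (\<delta> * N)"
      using C''1 \<delta> real_p_gt_1 by (intro mult_left_mono ge_one_powr_ge_zero) auto
    finally show "C0 * real p powr (\<eta> * N) \<le> C'' * real p powr (\<delta> * N)" .
  qed
  have "udec k N (C'' * real p powr (\<delta> * N))" for N
  proof (induction N)
    case 0 then show ?case using small[of 0] by simp
  next
    case (Suc N)
    show ?case
    proof (cases "Suc N \<le> m")
      case False
      then have "udec k (Suc N) (C'' * real p powr (\<delta> * N) + C' * real p powr (\<delta> * Suc N))"
        using Suc.IH by (intro step) auto
      moreover have "C'' * real p powr (\<delta> * N) + C' * real p powr (\<delta> * Suc N) \<le> C'' * real p powr (\<delta> * Suc N)"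
      proof -
        have "C' \<le> C'' * q" using C0(1) q by (simp add: C''_def distrib_right)
        then have 1: "C' * real p powr (\<delta> * Suc N) \<le> C'' * q * real p powr (\<delta> * Suc N)" by (intro mult_right_mono) auto
        have 2: "real p powr (\<delta> * N) = (1 - q) * real p powr (\<delta> * Suc N)"
          by (simp add: q_def algebra_simps flip: powr_add)
        have "C'' * real p powr (\<delta> * N) + C' * real p powr (\<delta> * Suc N)
          \<le> C'' * ((1 - q) * real p powr (\<delta> * Suc N)) + C'' * q * real p powr (\<delta> * Suc N)"
          unfolding 2 using 1 by (rule add_left_mono)
        also have "\<dots> = C'' * real p powr (\<delta> * Suc N)" by (simp add: algebra_simps)
        finally show ?thesis .
      qed
      ultimately show ?thesis by (rule udec_mono)
    qed (use small[of "Suc N"] in simp)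
  qed
  then show ?thesis using C''1 by (auto simp: dec_exponent_def)
qed

text \<open>The infimum of the valid positive exponents cannot be positive. It determines n, and
  with n the decrement 1/(2m), so an exponent less than 1/(4m) above the infimum would be improved
  to one below it.\<close>

theorem dec_exponent_all:
  assumes "1 \<le> k" "k \<le> K" "\<epsilon> > 0"
  shows "dec_exponent k \<epsilon>"
  using assms
proof (induction k arbitrary: \<epsilon> rule: less_induct)
  case (less k)
  have IH: "dec_exponent l \<epsilon>" if "1 \<le> l" "l < k" "\<epsilon> > 0" for l \<epsilon>
    using that less by auto
  show ?case
  proof (cases "k = 1")
    case True
    have "dec_exponent 1 0" using udec_1 less.prems p_gt_1 by (auto simp: dec_exponent_def intro!: exI[of _ 1])
    then show ?thesis using True less.prems dec_exponent_mono[of 1 0 \<epsilon>] by simp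
  next
    case False
    then have k: "2 \<le> k" "k \<le> K" using less.prems by auto
    define V where "V = {\<eta>. \<eta> > 0 \<and> dec_exponent k \<eta>}"
    have "dec_exponent k 1" unfolding dec_exponent_def
      using udec_trivial[of k] less.prems real_p_gt_1 by (intro exI[of _ 1]) (auto simp: powr_realpow)
    then have "1 \<in> V" by (simp add: V_def)
    then have V: "V \<noteq> {}" "bdd_below V"
      by blast (intro bdd_belowI[of _ 0], simp add: V_def)
    define \<eta>0 where "\<eta>0 = Inf V"
    have "\<eta>0 \<ge> 0" unfolding \<eta>0_def using V by (intro cInf_greatest) (auto simp: V_def)
    have "\<eta>0 = 0"
    proof (rule ccontr)
      assume "\<eta>0 \<noteq> 0"
      then have \<eta>0: "\<eta>0 > 0" using \<open>\<eta>0 \<ge> 0\<close> by simp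
      obtain n :: nat where n: "real n \<ge> 3 * real k ^ 2 / (\<eta>0 * (real k - 1))" using real_arch_simple by blast
      define m where "m = k ^ (n + 1)"
      have m: "m \<ge> 1" unfolding m_def using k by (intro one_le_power) auto
      then obtain \<eta> where \<eta>: "\<eta> \<in> V" "\<eta> < \<eta>0 + 1 / (4 * real m)"
        using cInf_lessD[OF V(1), of "\<eta>0 + 1 / (4 * real m)"] by (auto simp: \<eta>0_def)
      have "\<eta>0 \<le> \<eta>" unfolding \<eta>0_def using V \<eta> by (intro cInf_lower)
      \<comment> \<open>The maximum keeps \<delta> positive; both candidates lie below the
        infimum.\<close>
      define \<delta> where "\<delta> = max (\<eta> - 1 / (2 * real m)) (\<eta>0 / 2)"
      define w where "w = 1 / (4 * real m)"
      have "w > 0" "1 / (2 * real m) = 2 * w" using m by (auto simp: w_def)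
      then have \<delta>: "\<delta> > 0" "\<delta> < \<eta>0" using \<eta>(2) \<eta>0 by (auto simp: \<delta>_def w_def [symmetric])
      have "\<eta> * (real n / real k ^ 2 * (real k - 1)) \<ge> 3"
      proof -
        have "3 = \<eta>0 * ((3 * real k ^ 2 / (\<eta>0 * (real k - 1))) / real k ^ 2 * (real k - 1))"
          using \<eta>0 k by (simp add: field_simps)
        also have "\<dots> \<le> \<eta> * (real n / real k ^ 2 * (real k - 1))"
          using \<eta>0 k n \<open>\<eta>0 \<le> \<eta>\<close> by (intro mult_mono divide_right_mono mult_right_mono) auto
        finally show ?thesis .
      qed
      then have "dec_exponent k \<delta>"
        using IH \<eta> k \<delta> by (intro dec_exponent_improve[of k \<eta> n m \<delta>]) (auto simp: V_def m_def \<delta>_def)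
      then have "\<delta> \<in> V" using \<delta> by (simp add: V_def)
      then have "\<eta>0 \<le> \<delta>" unfolding \<eta>0_def using V by (intro cInf_lower)
      then show False using \<delta> by simp
    qed
    then obtain \<eta> where "\<eta> \<in> V" "\<eta> < \<epsilon>"
      using cInf_lessD[OF V(1), of \<epsilon>] less.prems by (auto simp: \<eta>0_def)
    then show ?thesis using dec_exponent_mono[of k \<eta> \<epsilon>] by (auto simp: V_def)
  qed
qed

end

section \<open>Mean values of Weyl sums\<close>

lemma expi_minus: "expi (- x) = cnj (expi x)"
  by (simp add: expi_def exp_cnj)

lemma expi_of_nat [simp]: "expi (real n) = 1"
  using expi_of_int[of "int n"] by simp

lemma expi_power: "expi x ^ n = expi (real n * x)"
  by (induction n) (simp_all add: expi_add [symmetric] algebra_simps)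

lemma sum_expi_roots_of_unity:
  fixes d :: int
  assumes "M > 0"
  shows "(\<Sum>t<M. expi (real t * of_int d / real M)) = (if int M dvd d then of_nat M else 0)"
proof -
  define z where "z = expi (of_int d / real M)"
  have zt: "expi (real t * of_int d / real M) = z ^ t" for t by (simp add: z_def expi_power)
  have z1: "z = 1 \<longleftrightarrow> int M dvd d"
  proof
    assume "z = 1"
    then obtain n where "of_int d / real M = of_int n" unfolding z_def expi_eq_1_iff by (auto elim: Ints_cases)
    then have "real_of_int d = real_of_int (int M * n)" using assms by (simp add: field_simps)
    then show "int M dvd d" by (metis dvd_triv_left of_int_eq_iff)
  next
    assume "int M dvd d"
    then obtain n where "d = int M * n" by blast
    then show "z = 1" using assms by (simp add: z_def)
  qed
  have zM: "z ^ M = 1" using assms by (simp add: z_def expi_power)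
  show ?thesis unfolding zt using z1 zM by (cases "z = 1") (auto simp: sum_gp_strict)
qed

lemma Parseval_discrete:
  fixes a :: "nat \<Rightarrow> complex"
  assumes "d < M"
  shows "(\<Sum>t<M. norm (\<Sum>v\<le>d. a v * expi (real t * real v / real M)) ^ 2) = real M * (\<Sum>v\<le>d. norm (a v) ^ 2)"
proof -
  have M: "M > 0" using assms by simp
  have "complex_of_real (\<Sum>t<M. norm (\<Sum>v\<le>d. a v * expi (real t * real v / real M)) ^ 2)
     = (\<Sum>t<M. \<Sum>v\<le>d. \<Sum>w\<le>d. a v * cnj (a w) * expi (real t * of_int (int v - int w) / real M))"
    unfolding of_real_sum complex_norm_square cnj_sum sum_product
  proof (intro sum.cong refl)
    fix t v w
    have "expi (real t * of_int (int v - int w) / real M) = expi (real t * real v / real M) * cnj (expi (real t * real w / real M))"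
      by (simp add: expi_minus [symmetric] expi_add [symmetric] right_diff_distrib diff_divide_distrib)
    then show "a v * expi (real t * real v / real M) * cnj (a w * expi (real t * real w / real M))
       = a v * cnj (a w) * expi (real t * of_int (int v - int w) / real M)"
      by (simp add: mult_ac)
  qed
  also have "\<dots> = (\<Sum>v\<le>d. \<Sum>t<M. \<Sum>w\<le>d. a v * cnj (a w) * expi (real t * of_int (int v - int w) / real M))"
    by (rule sum.swap)
  also have "\<dots> = (\<Sum>v\<le>d. \<Sum>w\<le>d. \<Sum>t<M. a v * cnj (a w) * expi (real t * of_int (int v - int w) / real M))"
    by (intro sum.cong refl sum.swap)
  also have "\<dots> = (\<Sum>v\<le>d. \<Sum>w\<le>d. if w = v then a v * cnj (a v) * of_nat M else 0)"
  proof (intro sum.cong refl)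
    fix v w assume vw: "v \<in> {..d}" "w \<in> {..d}"
    have "int M dvd int v - int w \<longleftrightarrow> w = v"
    proof
      assume "int M dvd int v - int w"
      moreover have "\<bar>int v - int w\<bar> < int M" using vw assms by auto
      ultimately have "int v - int w = 0" by (meson dvd_imp_le_int not_le abs_of_nat zdvd_not_zless zero_less_abs_iff dvd_abs_iff)
      then show "w = v" by simp
    qed simp
    then show "(\<Sum>t<M. a v * cnj (a w) * expi (real t * of_int (int v - int w) / real M))
      = (if w = v then a v * cnj (a v) * of_nat M else 0)"
      using sum_expi_roots_of_unity[OF M, of "int v - int w"] by (simp flip: sum_distrib_left)
  qed
  also have "\<dots> = complex_of_real (real M * (\<Sum>v\<le>d. norm (a v) ^ 2))"
    unfolding sum_distrib_left of_real_sum of_real_mult complex_norm_square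
    by (intro sum.cong refl) (simp add: mult.commute)
  finally show ?thesis by (simp only: of_real_eq_iff)
qed

text \<open>
  The \<open>s\<close>-th power is a polynomial with few coefficients, hence by Cauchy-Schwarz its value at one
  point is controlled by its mean square.  This inserts the lower-degree coordinates into a Weyl sum.
\<close>

lemma norm_sum_power_le_average:
  fixes c :: "'a \<Rightarrow> complex" and h :: "'a \<Rightarrow> nat"
  assumes X: "finite X" and h: "\<And>x. x \<in> X \<Longrightarrow> h x \<le> H" and M: "s * H < M"
  shows "norm (\<Sum>x\<in>X. c x) ^ (2 * s) \<le>
    real (s * H + 1) / real M * (\<Sum>t<M. norm (\<Sum>x\<in>X. c x * expi (real t * real (h x) / real M)) ^ (2 * s))"
proof -
  define F where "F = (\<Sum>x\<in>X. monom (c x) (h x))"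
  define d where "d = s * H"
  have "degree F \<le> H" unfolding F_def
    using h by (intro degree_sum_le X) (auto intro: order_trans[OF degree_monom_le])
  then have "degree (F ^ s) \<le> d"
    unfolding d_def by (intro order_trans[OF degree_power_le]) (simp add: mult.commute)
  then have ev: "poly (F ^ s) z = (\<Sum>v\<le>d. coeff (F ^ s) v * z ^ v)" for z
    unfolding poly_altdef by (intro sum.mono_neutral_left) (auto simp: coeff_eq_0)
  have Fz: "poly F z = (\<Sum>x\<in>X. c x * z ^ h x)" for z
    by (simp add: F_def poly_sum poly_monom)
  define a where "a v = coeff (F ^ s) v" for v
  have "norm (\<Sum>x\<in>X. c x) ^ (2 * s) = norm (poly (F ^ s) 1) ^ 2"
    by (simp add: Fz norm_power power_mult mult.commute[of 2])
  also have "\<dots> = norm (\<Sum>v\<le>d. a v) ^ 2" by (simp only: ev a_def) simp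
  also have "\<dots> \<le> (\<Sum>v\<le>d. norm (a v)) ^ 2" by (intro power_mono norm_sum) auto
  also have "\<dots> \<le> (\<Sum>v\<le>d. 1\<^sup>2) * (\<Sum>v\<le>d. norm (a v) ^ 2)"
    using Cauchy_Schwarz_ineq_sum[of "\<lambda>_. 1" "\<lambda>v. norm (a v)" "{..d}"] by simp
  also have "\<dots> = real (d + 1) / real M * (real M * (\<Sum>v\<le>d. norm (a v) ^ 2))" using M by simp
  also have "real M * (\<Sum>v\<le>d. norm (a v) ^ 2) = (\<Sum>t<M. norm (\<Sum>v\<le>d. a v * expi (real t * real v / real M)) ^ 2)"
    using M by (subst Parseval_discrete) (auto simp: d_def)
  also have "\<dots> = (\<Sum>t<M. norm (\<Sum>x\<in>X. c x * expi (real t * real (h x) / real M)) ^ (2 * s))"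
  proof (intro sum.cong refl)
    fix t
    have e: "expi (real t / real M) ^ v = expi (real t * real v / real M)" for v
      by (simp add: expi_power mult.commute)
    have "(\<Sum>v\<le>d. a v * expi (real t * real v / real M)) = (\<Sum>x\<in>X. c x * expi (real t * real (h x) / real M)) ^ s"
      using ev[of "expi (real t / real M)"] by (simp add: Fz e a_def)
    then show "norm (\<Sum>v\<le>d. a v * expi (real t * real v / real M)) ^ 2 = norm (\<Sum>x\<in>X. c x * expi (real t * real (h x) / real M)) ^ (2 * s)"
      by (simp add: norm_power power_mult mult.commute[of 2])
  qed
  finally show ?thesis by (simp add: d_def)
qed

section \<open>From the torus of all degrees to the Weyl sum of degree k\<close>

lemma sum_PiE_insert:
  assumes "j \<notin> J"
  shows "sum g (PiE (insert j J) (\<lambda>_. T)) = (\<Sum>t\<in>T. \<Sum>\<omega>\<in>PiE J (\<lambda>_. T). g (fun_upd \<omega> j t))"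
proof -
  have "sum g (PiE (insert j J) (\<lambda>_. T)) = sum g ((\<lambda>(t, \<omega>). fun_upd \<omega> j t) ` (T \<times> PiE J (\<lambda>_. T)))"
    by (simp only: PiE_insert_eq)
  also have "\<dots> = (\<Sum>(t, \<omega>)\<in>T \<times> PiE J (\<lambda>_. T). g (fun_upd \<omega> j t))"
    by (subst sum.reindex[OF inj_combinator[OF assms]]) (simp add: case_prod_unfold)
  finally show ?thesis by (simp add: sum.cartesian_product)
qed

text \<open>One coordinate at a time, the phases already inserted being absorbed into the
  coefficients. The factor of coordinate j compares the s P^j + 1 frequencies of the
  \<open>s\<close>-th power with the M sampling points.\<close>

lemma norm_sum_power_le_torus_average:
  fixes c :: "int \<Rightarrow> complex"
  assumes "finite J" and X: "finite X" "\<And>x. x \<in> X \<Longrightarrow> 0 \<le> x \<and> x \<le> int P" and M: "\<And>j. j \<in> J \<Longrightarrow> s * P ^ j < M"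
  shows "norm (\<Sum>x\<in>X. c x) ^ (2 * s) \<le> (\<Prod>j\<in>J. real (s * P ^ j + 1) / real M) *
     (\<Sum>\<omega>\<in>PiE J (\<lambda>_. {..<M}). norm (\<Sum>x\<in>X. c x * expi ((\<Sum>j\<in>J. real (\<omega> j) * of_int x ^ j) / real M)) ^ (2 * s))"
  using assms(1) M
proof (induction J rule: finite_induct)
  case empty
  then show ?case by simp
next
  case (insert j J)
  let ?W = "\<lambda>J \<omega> x. expi ((\<Sum>j\<in>J. real (\<omega> j) * of_int x ^ j) / real M)"
  have "norm (\<Sum>x\<in>X. c x) ^ (2 * s) \<le> (\<Prod>j\<in>J. real (s * P ^ j + 1) / real M) *
     (\<Sum>\<omega>\<in>PiE J (\<lambda>_. {..<M}). norm (\<Sum>x\<in>X. c x * ?W J \<omega> x) ^ (2 * s))"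
    using insert by auto
  also have "\<dots> \<le> (\<Prod>j\<in>J. real (s * P ^ j + 1) / real M) *
     (\<Sum>\<omega>\<in>PiE J (\<lambda>_. {..<M}). real (s * P ^ j + 1) / real M *
        (\<Sum>t<M. norm (\<Sum>x\<in>X. c x * ?W J \<omega> x * expi (real t * real (nat x ^ j) / real M)) ^ (2 * s)))"
    using X insert.prems
    by (intro mult_left_mono sum_mono norm_sum_power_le_average prod_nonneg) (auto intro!: power_mono simp: nat_le_iff)
  also have "\<dots> = (\<Prod>j\<in>insert j J. real (s * P ^ j + 1) / real M) *
     (\<Sum>t<M. \<Sum>\<omega>\<in>PiE J (\<lambda>_. {..<M}). norm (\<Sum>x\<in>X. c x * ?W J \<omega> x * expi (real t * real (nat x ^ j) / real M)) ^ (2 * s))"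
    using insert by (subst sum.swap) (simp add: sum_distrib_left mult_ac)
  also have "(\<Sum>t<M. \<Sum>\<omega>\<in>PiE J (\<lambda>_. {..<M}). norm (\<Sum>x\<in>X. c x * ?W J \<omega> x * expi (real t * real (nat x ^ j) / real M)) ^ (2 * s))
    = (\<Sum>\<omega>\<in>PiE (insert j J) (\<lambda>_. {..<M}). norm (\<Sum>x\<in>X. c x * ?W (insert j J) \<omega> x) ^ (2 * s))"
    unfolding sum_PiE_insert[OF insert.hyps(2)]
  proof (intro sum.cong refl arg_cong[where f = "\<lambda>z. norm z ^ (2 * s)"])
    fix t \<omega> x assume x: "x \<in> X"
    have "(\<Sum>i\<in>J. real ((fun_upd \<omega> j t) i) * of_int x ^ i) = (\<Sum>i\<in>J. real (\<omega> i) * of_int x ^ i)"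
      using insert.hyps by (intro sum.cong) auto
    then have "?W (insert j J) (fun_upd \<omega> j t) x = ?W J \<omega> x * expi (real t * real (nat x ^ j) / real M)"
      using insert.hyps X(2)[OF x] by (simp add: add_divide_distrib expi_add)
    then show "c x * ?W J \<omega> x * expi (real t * real (nat x ^ j) / real M) = c x * ?W (insert j J) (fun_upd \<omega> j t) x"
      by (simp add: mult.assoc)
  qed
  finally show ?case .
qed

definition weyl_sum :: "nat \<Rightarrow> nat \<Rightarrow> real \<Rightarrow> complex" where
  "weyl_sum k P \<alpha> = (\<Sum>x=1..P. expi (\<alpha> * real x ^ k))"

lemma expi_cong_mod:
  assumes "M > 0" "int M dvd a - b"
  shows "expi (of_int a / real M) = expi (of_int b / real M)"
proof -
  from assms(2) obtain q where "a - b = int M * q" by blast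
  then have "a = b + int M * q" by simp
  then have "of_int a / real M = of_int b / real M + of_int q" using assms(1) by (simp add: add_divide_distrib)
  then show ?thesis by (simp only: expi_add expi_of_int mult_1_right)
qed

text \<open>Multiplication by e(G(x)/M) translates \<open>\<omega> j\<close> by the coefficient of
  degree j of G modulo M; the constant term goes into the unimodular multiplier. As K is k here, the
  top level carries the trivial weight 1.\<close>

lemma torus_admissible:
  fixes N :: nat and c :: "int \<Rightarrow> complex"
  assumes p: "prime p" "k < p" and k: "1 \<le> k"
  defines "M \<equiv> p ^ (k * N)"
  defines "\<Omega> \<equiv> PiE {1..k} (\<lambda>_. {..<M})"
  shows "decoupling p k \<Omega>"
    and "decoupling.weight p k k 1"
    and "decoupling.admissible p k \<Omega> k N 1 (\<lambda>\<omega> x. c x * expi ((\<Sum>j\<in>{1..k}. real (\<omega> j) * of_int x ^ j) / real M))"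
proof -
  show D: "decoupling p k \<Omega>" using p by unfold_locales (auto simp: \<Omega>_def intro!: finite_PiE)
  interpret D: decoupling p k \<Omega> by (rule D)
  have "\<not> int p dvd 1" using D.p_gt_1 by simp
  moreover have "1 = [:1:] + smult (int p) 0" by (simp add: one_pCons)
  ultimately show "D.weight k 1" unfolding D.weight_def by (metis degree_1 le0)
  have M: "M > 0" by (simp add: M_def)
  show "D.admissible k N 1 (\<lambda>\<omega> x. c x * expi ((\<Sum>j\<in>{1..k}. real (\<omega> j) * of_int x ^ j) / real M))"
    unfolding D.admissible_def D.shift_def
  proof (intro allI impI)
    fix r G :: "int poly" assume r: "degree r < k" and G: "pderiv G = smult (fact k) (1 * r)"
    have "degree G - 1 = degree (smult (fact k) r)" using G degree_pderiv[of G] by simp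
    also have "\<dots> \<le> degree r" by (rule degree_smult_le)
    finally have degG: "degree G \<le> k" using r by simp
    define \<sigma> where "\<sigma> \<omega> = (\<lambda>j\<in>{1..k}. nat ((int (\<omega> j) + coeff G j) mod int M))" for \<omega> :: "nat \<Rightarrow> nat"
    have \<sigma>_eq: "int (\<sigma> \<omega> j) = (int (\<omega> j) + coeff G j) mod int M" if "j \<in> {1..k}" for \<omega> j
      using that M by (simp add: \<sigma>_def)
    have "\<sigma> ` \<Omega> \<subseteq> \<Omega>"
      using M by (auto simp: \<sigma>_def \<Omega>_def nat_less_iff)
    moreover have "inj_on \<sigma> \<Omega>"
    proof (rule inj_onI)
      fix \<omega> \<omega>' assume w: "\<omega> \<in> \<Omega>" "\<omega>' \<in> \<Omega>" and eq: "\<sigma> \<omega> = \<sigma> \<omega>'"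
      show "\<omega> = \<omega>'"
      proof (rule PiE_ext[OF w[unfolded \<Omega>_def]])
        fix j assume j: "j \<in> {1..k}"
        have "(int (\<omega> j) + coeff G j) mod int M = (int (\<omega>' j) + coeff G j) mod int M"
          using \<sigma>_eq[OF j] eq by metis
        then have "int (\<omega> j) mod int M = int (\<omega>' j) mod int M" by (simp add: mod_eq_dvd_iff)
        moreover have "\<omega> j < M" "\<omega>' j < M" using w j by (auto simp: \<Omega>_def)
        ultimately show "\<omega> j = \<omega>' j" by simp
      qed
    qed
    ultimately have "bij_betw \<sigma> \<Omega> \<Omega>"
      using D.finite_\<Omega> by (simp add: bij_betw_def endo_inj_surj)
    moreover have "c x * expi ((\<Sum>j\<in>{1..k}. real (\<sigma> \<omega> j) * of_int x ^ j) / real M) =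
       expi (- (of_int (coeff G 0) / real M)) * (c x * expi ((\<Sum>j\<in>{1..k}. real (\<omega> j) * of_int x ^ j) / real M)) *
        expi (of_int (poly G x) / real p ^ (k * N))" for \<omega> x
    proof -
      have "poly G x = (\<Sum>j\<le>k. coeff G j * x ^ j)"
        unfolding poly_altdef using degG by (intro sum.mono_neutral_left) (auto simp: coeff_eq_0)
      also have "{..k} = insert 0 {1..k}" by auto
      finally have Gx: "poly G x = coeff G 0 + (\<Sum>j\<in>{1..k}. coeff G j * x ^ j)" by simp
      define A where "A = (\<Sum>j\<in>{1..k}. int (\<sigma> \<omega> j) * x ^ j)"
      define B where "B = (\<Sum>j\<in>{1..k}. int (\<omega> j) * x ^ j)"
      have "A - (B + (poly G x - coeff G 0)) = (\<Sum>j\<in>{1..k}. (int (\<sigma> \<omega> j) - (int (\<omega> j) + coeff G j)) * x ^ j)"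
        by (simp add: A_def B_def Gx sum.distrib sum_subtractf algebra_simps)
      also have "int M dvd \<dots>"
        by (intro dvd_sum dvd_mult2) (simp add: \<sigma>_eq mod_eq_dvd_iff [symmetric])
      finally have "expi (of_int A / real M) = expi (of_int (B + (poly G x - coeff G 0)) / real M)"
        by (rule expi_cong_mod[OF M])
      also have "\<dots> = expi (- (of_int (coeff G 0) / real M)) * expi (of_int B / real M) * expi (of_int (poly G x) / real M)"
        by (simp add: expi_add [symmetric] add_divide_distrib diff_divide_distrib algebra_simps)
      finally have "expi (of_int A / real M) = expi (- (of_int (coeff G 0) / real M)) * expi (of_int B / real M) * expi (of_int (poly G x) / real p ^ (k * N))"
        by (simp add: M_def)
      moreover have "(\<Sum>j\<in>{1..k}. real (\<sigma> \<omega> j) * of_int x ^ j) = of_int A" "(\<Sum>j\<in>{1..k}. real (\<omega> j) * of_int x ^ j) = of_int B"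
        by (simp_all add: A_def B_def)
      ultimately show ?thesis by (simp add: mult_ac)
    qed
    ultimately show "\<exists>\<sigma> u. bij_betw \<sigma> \<Omega> \<Omega> \<and> (\<forall>\<omega>\<in>\<Omega>. norm (u \<omega>) = 1 \<and>
       (\<forall>x. c x * expi ((\<Sum>j\<in>{1..k}. real (\<sigma> \<omega> j) * of_int x ^ j) / real M) =
        u \<omega> * (c x * expi ((\<Sum>j\<in>{1..k}. real (\<omega> j) * of_int x ^ j) / real M)) * expi (of_int (poly G x) / real p ^ (k * N))))"
      by (intro exI[of _ \<sigma>] exI[of _ "\<lambda>_. expi (- (of_int (coeff G 0) / real M))"]) auto
  qed
qed

text \<open>P < p^N makes the classes modulo p^N singletons, on which the sums are unimodular. The
  decoupled side is therefore explicit: P times the 1/s-th power of the number M^k of torus points.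
  The coefficients \<open>c\<close> leave room for a fixed \<alpha>.\<close>

lemma torus_mean_value:
  assumes p: "prime p" "k < p" and k: "1 \<le> k" and P: "P < p ^ N"
    and c: "\<And>x. norm (c x) = 1"
  defines "M \<equiv> p ^ (k * N)"
  defines "\<Omega> \<equiv> PiE {1..k} (\<lambda>_. {..<M})"
  assumes dec: "decoupling.dec p k \<Omega> k N D" and D: "D \<ge> 0"
  shows "(\<Sum>\<omega>\<in>\<Omega>. norm (\<Sum>x\<in>{1..int P}. c x * expi ((\<Sum>j\<in>{1..k}. real (\<omega> j) * of_int x ^ j) / real M)) ^ (2 * tri k))
    \<le> (D * real P) ^ tri k * real M ^ k"
proof -
  interpret D: decoupling p k \<Omega> unfolding \<Omega>_def M_def by (rule torus_admissible(1)[OF p k])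
  define \<phi> where "\<phi> = (\<lambda>\<omega> x. c x * expi ((\<Sum>j\<in>{1..k}. real (\<omega> j) * of_int x ^ j) / real M))"
  define s where "s = tri k"
  define X where "X = {1..int P}"
  have s: "s \<ge> 1" using tri_ge_1 k by (simp add: s_def)
  have norm_\<phi>: "norm (\<phi> \<omega> x) = 1" for \<omega> x by (simp add: \<phi>_def norm_mult c)
  have adm: "D.admissible k N 1 \<phi>" and wt: "D.weight k 1"
    unfolding \<phi>_def \<Omega>_def M_def by (rule torus_admissible[OF p k])+
  have P': "int P < int p ^ N" using P by (metis of_nat_less_iff of_nat_power)
  have modX: "x mod int p ^ N = x" if "x \<in> X" for x
    using that order_le_less_trans[OF _ P'] by (intro mod_pos_pos_trivial) (simp_all add: X_def)
  have subX: "X \<subseteq> {0..<int p ^ N}"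
    using order_le_less_trans[OF _ P'] by (auto simp: X_def)
  have "D.sqfun N s \<phi> X = (\<Sum>\<theta>\<in>X. D.sqnorm s \<phi> (res_part X (int p ^ N) \<theta>))"
    unfolding D.sqfun_def
  proof (rule sum.mono_neutral_right)
    show "\<forall>i\<in>{0..<int p ^ N} - X. D.sqnorm s \<phi> (res_part X (int p ^ N) i) = 0"
    proof
      fix i assume "i \<in> {0..<int p ^ N} - X"
      then have "res_part X (int p ^ N) i = {}" using modX by (auto simp: res_part_def)
      then show "D.sqnorm s \<phi> (res_part X (int p ^ N) i) = 0" using s by simp
    qed
  qed (use subX in auto)
  also have "\<dots> = (\<Sum>\<theta>\<in>X. (real M ^ k) powr (1 / real s))"
  proof (intro sum.cong refl)
    fix \<theta> assume "\<theta> \<in> X"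
    then have "res_part X (int p ^ N) \<theta> = {\<theta>}" using modX by (auto simp: res_part_def)
    moreover have "card \<Omega> = M ^ k" by (simp add: \<Omega>_def card_PiE)
    ultimately show "D.sqnorm s \<phi> (res_part X (int p ^ N) \<theta>) = (real M ^ k) powr (1 / real s)"
      by (simp add: D.sqnorm_def exp_sum_def norm_\<phi>)
  qed
  also have "\<dots> = real P * (real M ^ k) powr (1 / real s)" by (simp add: X_def)
  finally have G: "D.sqfun N s \<phi> X = real P * (real M ^ k) powr (1 / real s)" .
  have "D.sqnorm s \<phi> X \<le> D * D.sqfun N s \<phi> X"
    using dec adm wt unfolding D.dec_def s_def X_def by blast
  then have "D.sqnorm s \<phi> X ^ s \<le> (D * real P * (real M ^ k) powr (1 / real s)) ^ s"
    unfolding G by (intro power_mono) (auto simp: mult.assoc)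
  also have "\<dots> = (D * real P) ^ s * ((real M ^ k) powr (1 / real s)) ^ s" by (simp only: power_mult_distrib)
  also have "((real M ^ k) powr (1 / real s)) ^ s = real M ^ k" using s by (intro powr_inverse_power) auto
  finally show ?thesis using D.sqnorm_power[OF s, of \<phi> X] by (simp add: exp_sum_def \<phi>_def s_def X_def)
qed

text \<open>The coordinates below k are inserted by averaging, coordinate k is t, and e(\<alpha>
  x^k) is a coefficient. The exponent tri k - k of P is 1 + ... + (k-1), and
  \<open>tri k < p\<close> gives enough sampling points, s P^j < M, for j < k.\<close>

lemma weyl_sum_discrete_mean_value:
  assumes p: "prime p" "k < p" "tri k < p" and k: "1 \<le> k" and P: "1 \<le> P" "P < p ^ N"
  defines "M \<equiv> p ^ (k * N)"
  assumes dec: "decoupling.dec p k (PiE {1..k} (\<lambda>_. {..<M})) k N D" and D: "D \<ge> 0"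
  shows "(\<Sum>t<M. norm (weyl_sum k P (\<alpha> + real t / real M)) ^ (2 * tri k))
     \<le> real M * ((2 * tri k) ^ k * real P ^ (tri k - k) * (D * real P) ^ tri k)"
proof -
  define s where "s = tri k"
  have s: "s \<ge> 1" using tri_ge_1 k by (simp add: s_def)
  have p1: "p > 1" using p prime_gt_1_nat by blast
  have N: "N \<ge> 1" using P by (cases N) auto
  have M0: "M > 0" using p1 by (simp add: M_def)
  define c where "c x = expi (\<alpha> * of_int x ^ k)" for x :: int
  define X where "X = {1..int P}"
  define J where "J = {1..<k}"
  have Jk: "insert k J = {1..k}" "k \<notin> J" using k by (auto simp: J_def)
  have M: "s * P ^ j < M" if "j \<in> J" for j
  proof -
    have "s * P ^ j \<le> s * P ^ (k - 1)" using that P by (intro mult_left_mono power_increasing) (auto simp: J_def)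
    also have "\<dots> \<le> s * (p ^ N) ^ (k - 1)" using P by (intro mult_left_mono power_mono) auto
    also have "\<dots> < p * (p ^ N) ^ (k - 1)" using p p1 by (intro mult_strict_right_mono) (auto simp: s_def)
    also have "\<dots> \<le> p ^ N * (p ^ N) ^ (k - 1)" using N p1 by (intro mult_right_mono) (auto intro: self_le_power)
    also have "\<dots> = M" using k by (cases k) (simp_all add: M_def power_mult [symmetric] power_add [symmetric] algebra_simps)
    finally show ?thesis .
  qed
  let ?W = "\<lambda>J \<omega> x. expi ((\<Sum>j\<in>J. real (\<omega> j) * of_int x ^ j) / real M)"
  have ws: "weyl_sum k P (\<alpha> + real t / real M) = (\<Sum>x\<in>X. c x * expi (real t * of_int x ^ k / real M))" for t
    unfolding weyl_sum_def X_def c_def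
    by (rule sum.reindex_bij_witness[of _ nat int])
       (auto simp: expi_add [symmetric] algebra_simps)
  have "(\<Sum>t<M. norm (weyl_sum k P (\<alpha> + real t / real M)) ^ (2 * s))
    \<le> (\<Sum>t<M. (\<Prod>j\<in>J. real (s * P ^ j + 1) / real M) *
     (\<Sum>\<omega>\<in>PiE J (\<lambda>_. {..<M}). norm (\<Sum>x\<in>X. c x * expi (real t * of_int x ^ k / real M) * ?W J \<omega> x) ^ (2 * s)))"
    unfolding ws by (intro sum_mono norm_sum_power_le_torus_average M) (auto simp: J_def X_def)
  also have "\<dots> = (\<Prod>j\<in>J. real (s * P ^ j + 1) / real M) *
     (\<Sum>\<omega>\<in>PiE (insert k J) (\<lambda>_. {..<M}). norm (\<Sum>x\<in>X. c x * ?W (insert k J) \<omega> x) ^ (2 * s))"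
    unfolding sum_PiE_insert[OF Jk(2)] sum_distrib_left [symmetric]
  proof (rule arg_cong[where f = "\<lambda>z. _ * z"], intro refl sum.cong arg_cong[where f = "\<lambda>z. norm z ^ (2 * s)"])
    fix t \<omega> x
    have "(\<Sum>i\<in>J. real ((fun_upd \<omega> k t) i) * of_int x ^ i) = (\<Sum>i\<in>J. real (\<omega> i) * of_int x ^ i)"
      using Jk by (intro sum.cong) auto
    moreover have "finite J" by (simp add: J_def)
    ultimately have "?W (insert k J) (fun_upd \<omega> k t) x = ?W J \<omega> x * expi (real t * of_int x ^ k / real M)"
      using Jk(2) by (simp add: add_divide_distrib expi_add)
    then show "c x * expi (real t * of_int x ^ k / real M) * ?W J \<omega> x = c x * ?W (insert k J) (fun_upd \<omega> k t) x"
      by (simp add: mult_ac)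
  qed
  also have "\<dots> \<le> (\<Prod>j\<in>J. real (s * P ^ j + 1) / real M) * ((D * real P) ^ s * real M ^ k)"
    unfolding Jk(1) s_def X_def M_def
    by (intro mult_left_mono torus_mean_value p k P dec[unfolded M_def] D prod_nonneg) (auto simp: c_def)
  also have "(\<Prod>j\<in>J. real (s * P ^ j + 1) / real M) \<le> (\<Prod>j\<in>J. (2 * real s) * real P ^ j / real M)"
  proof (intro prod_mono conjI divide_right_mono)
    fix j
    have "1 * 1 \<le> real s * real P ^ j" using s P by (intro mult_mono) auto
    then show "real (s * P ^ j + 1) \<le> 2 * real s * real P ^ j" by simp
  qed auto
  also have "(\<Prod>j\<in>J. (2 * real s) * real P ^ j / real M) = (2 * real s) ^ (k - 1) * real P ^ (\<Sum>j\<in>J. j) / real M ^ (k - 1)"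
    by (simp add: prod_dividef prod.distrib power_sum J_def)
  also have "(\<Sum>j\<in>J. j) = s - k"
  proof -
    have "(\<Sum>j\<in>{1..k}. j) = s" using Sum_Icc_nat[of 1 k] by (simp add: s_def tri_def)
    moreover have "(\<Sum>j\<in>{1..k}. j) = k + (\<Sum>j\<in>J. j)" unfolding Jk(1) [symmetric] using Jk(2) by (subst sum.insert) (auto simp: J_def)
    ultimately show ?thesis by simp
  qed
  also have "(2 * real s) ^ (k - 1) * real P ^ (s - k) / real M ^ (k - 1) * ((D * real P) ^ s * real M ^ k)
     = real M * ((2 * real s) ^ (k - 1) * real P ^ (s - k) * (D * real P) ^ s)"
    using k M0 by (cases k) auto
  also have "\<dots> \<le> real M * ((2 * real s) ^ k * real P ^ (s - k) * (D * real P) ^ s)"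
    using s D by (intro mult_left_mono mult_right_mono power_increasing) auto
  finally show ?thesis using D by (simp add: s_def mult_right_mono)
qed

section \<open>Passage to the integral over a period\<close>

lemma continuous_on_expi [continuous_intros]:
  "continuous_on A f \<Longrightarrow> continuous_on A (\<lambda>x. expi (f x))"
  unfolding expi_def by (intro continuous_intros)

lemma continuous_on_weyl_sum [continuous_intros]:
  "continuous_on A f \<Longrightarrow> continuous_on A (\<lambda>x. weyl_sum k P (f x))"
  unfolding weyl_sum_def by (intro continuous_intros)

text \<open>The translates by t/M tile a period, so a bound for the discrete moments that is uniform
  in the base point bounds the integral.\<close>

lemma integral_unit_interval_partition:
  fixes g :: "real \<Rightarrow> real"
  assumes g: "continuous_on UNIV g" and M: "M > 0"
  shows "integral {c..c + 1} g = integral {c..c + 1 / real M} (\<lambda>\<alpha>. \<Sum>t<M. g (\<alpha> + real t / real M))"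
proof -
  have int: "g integrable_on {a..b}" for a b
    using g by (intro integrable_continuous_interval continuous_on_subset[OF g]) auto
  have partial: "integral {c..c + real m / real M} g = (\<Sum>t<m. integral {c + real t / real M..c + real (Suc t) / real M} g)" for m
  proof (induction m)
    case (Suc m)
    have "integral {c..c + real m / real M} g + integral {c + real m / real M..c + real (Suc m) / real M} g = integral {c..c + real (Suc m) / real M} g"
      by (intro Henstock_Kurzweil_Integration.integral_combine int) (auto intro: divide_right_mono)
    then show ?case using Suc.IH by simp
  qed simp
  have "integral {c..c + 1} g = (\<Sum>t<M. integral {c + real t / real M..c + real (Suc t) / real M} g)"
    using partial[of M] M by simp
  also have "\<dots> = (\<Sum>t<M. integral {c..c + 1 / real M} (\<lambda>\<alpha>. g (\<alpha> + real t / real M)))"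
  proof (intro sum.cong refl)
    fix t
    show "integral {c + real t / real M..c + real (Suc t) / real M} g = integral {c..c + 1 / real M} (\<lambda>\<alpha>. g (\<alpha> + real t / real M))"
      using integral_shift_real_ivl[of "c + real t / real M" "real t / real M" "c + real (Suc t) / real M" g]
      by (simp add: add_divide_distrib)
  qed
  also have "\<dots> = integral {c..c + 1 / real M} (\<lambda>\<alpha>. \<Sum>t<M. g (\<alpha> + real t / real M))"
    by (intro integral_sum [symmetric] integrable_continuous_interval continuous_on_compose2[OF g] continuous_intros) auto
  finally show ?thesis .
qed

text \<open>For s = tri k the powers of P add up to (s - k) + s = k^2. The constant \<open>D\<close>
  enters to the power s, so \<epsilon> is divided by s, and P is within the factor p of p^N.\<close>

theorem weyl_sum_mean_value:
  assumes k: "1 \<le> k" and \<epsilon>: "\<epsilon> > 0"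
  shows "\<exists>C\<ge>1. \<forall>P\<ge>1. \<forall>u. integral {u..u + 1} (\<lambda>\<alpha>. norm (weyl_sum k P \<alpha>) ^ (2 * tri k)) \<le> C * real P powr (real k ^ 2 + \<epsilon>)"
proof -
  define s where "s = tri k"
  have s: "s \<ge> 1" using tri_ge_1 k by (simp add: s_def)
  obtain p where p: "prime p" "p > max k s" using bigger_prime by blast
  interpret U: uniform_decoupling p k using p by unfold_locales auto
  define \<delta> where "\<delta> = \<epsilon> / real s"
  have \<delta>: "\<delta> > 0" using \<epsilon> s by (simp add: \<delta>_def)
  obtain C where C: "C \<ge> 1" "\<And>N. U.udec k N (C * real p powr (\<delta> * N))"
    using U.dec_exponent_all[OF k order_refl \<delta>] by (auto simp: U.dec_exponent_def)
  define C' where "C' = (2 * real s) ^ k * (C * real p powr \<delta>) ^ s"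
  have "1 \<le> (2 * real s) ^ k" using s by (intro one_le_power) auto
  moreover have "1 \<le> (C * real p powr \<delta>) ^ s"
    using C(1) \<delta> U.real_p_gt_1 by (intro one_le_power mult_ge1_I ge_one_powr_ge_zero) auto
  ultimately have "C' \<ge> 1" unfolding C'_def by (rule mult_ge1_I)
  moreover have "integral {u..u + 1} (\<lambda>\<alpha>. norm (weyl_sum k P \<alpha>) ^ (2 * tri k)) \<le> C' * real P powr (real k ^ 2 + \<epsilon>)"
    if P: "P \<ge> 1" for P u
  proof -
    obtain n where n: "p ^ n \<le> P" "P < p ^ (n + 1)" using ex_power_ivl1[of p P] U.p_gt_1 P by auto
    define N where "N = n + 1"
    define M where "M = p ^ (k * N)"
    define D where "D = C * real p powr (\<delta> * N)"
    have M0: "M > 0" using U.p_gt_1 by (simp add: M_def)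
    have D0: "D \<ge> 0" using C(1) by (simp add: D_def)
    have D_le: "D \<le> C * real p powr \<delta> * real P powr \<delta>"
    proof -
      have "real p powr (\<delta> * N) = (real (p ^ n) * real p) powr \<delta>"
        using U.p_gt_1 by (simp add: N_def powr_realpow [symmetric] powr_powr powr_add powr_mult algebra_simps)
      also have "real (p ^ n) \<le> real P" using n(1) by (simp only: of_nat_le_iff)
      then have "(real (p ^ n) * real p) powr \<delta> \<le> (real P * real p) powr \<delta>"
        using \<delta> by (intro powr_mono2 mult_right_mono) auto
      also have "\<dots> = real p powr \<delta> * real P powr \<delta>" by (simp add: powr_mult)
      finally show ?thesis using C(1) by (simp add: D_def mult.assoc)
    qed
    define B where "B = (2 * s) ^ k * real P ^ (s - k) * (D * real P) ^ s"
    have "(\<Sum>t<M. norm (weyl_sum k P (\<alpha> + real t / real M)) ^ (2 * s)) \<le> real M * B" for \<alpha>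
      unfolding B_def s_def M_def
      using p P n(2) C(2)[of N] k D0
      by (intro weyl_sum_discrete_mean_value U.udecD) (auto simp: s_def N_def D_def intro!: finite_PiE)
    then have "integral {u..u + 1 / real M} (\<lambda>\<alpha>. \<Sum>t<M. norm (weyl_sum k P (\<alpha> + real t / real M)) ^ (2 * s))
        \<le> integral {u..u + 1 / real M} (\<lambda>\<alpha>. real M * B)"
      by (intro integral_le integrable_continuous_interval continuous_intros)
    also have "\<dots> = B" using M0 by simp
    finally have "integral {u..u + 1} (\<lambda>\<alpha>. norm (weyl_sum k P \<alpha>) ^ (2 * s)) \<le> B"
      using integral_unit_interval_partition[of "\<lambda>\<alpha>. norm (weyl_sum k P \<alpha>) ^ (2 * s)" M u] M0
      by (simp add: continuous_intros)
    also have "B \<le> (2 * s) ^ k * real P ^ (s - k) * (C * real p powr \<delta> * real P powr \<delta> * real P) ^ s"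
      unfolding B_def using D_le D0 by (intro mult_left_mono power_mono mult_right_mono) auto
    also have "\<dots> = C' * (real P ^ (s - k) * (real P powr \<delta>) ^ s * real P ^ s)"
      by (simp add: C'_def power_mult_distrib)
    also have "real P ^ (s - k) * (real P powr \<delta>) ^ s * real P ^ s = real P powr (real (s - k) + \<delta> * s + s)"
      using P by (simp add: powr_add powr_realpow [symmetric] powr_powr)
    also have "real (s - k) + \<delta> * s + s = real k ^ 2 + \<epsilon>"
    proof -
      have "2 * k \<le> k * (k + 1)" by simp
      then have "k \<le> s" unfolding two_tri [symmetric] by (simp add: s_def)
      then have "real (s - k) = real s - real k" by (simp add: of_nat_diff)
      moreover have "\<delta> * s = \<epsilon>" using s by (simp add: \<delta>_def)
      ultimately show ?thesis by (simp add: s_def real_tri power2_eq_square field_simps)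
    qed
    finally show ?thesis by (simp add: s_def)
  qed
  ultimately show ?thesis by blast
qed

section \<open>Weyl's inequality\<close>

lemma sin_ge_linear:
  assumes "0 \<le> x" "x \<le> pi / 2"
  shows "sin x \<ge> 2 * x / pi"
proof -
  have conc: "concave_on {0..pi / 2} sin"
  proof (rule f''_le0_imp_concave[where f' = cos and f'' = "\<lambda>x. - sin x"])
    fix x :: real assume "x \<in> {0..pi / 2}"
    then show "- sin x \<le> 0" using sin_ge_zero[of x] by auto
  qed (auto intro!: derivative_eq_intros)
  define t where "t = 2 * x / pi"
  have t: "0 \<le> t" "t \<le> 1" using assms by (auto simp: t_def field_simps)
  have "sin ((1 - t) *\<^sub>R 0 + t *\<^sub>R (pi / 2)) \<ge> (1 - t) * sin 0 + t * sin (pi / 2)"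
    using conc t by (intro concave_onD) auto
  then show ?thesis by (simp add: t_def)
qed

lemma norm_expi_minus_1_eq: "norm (expi x - 1) = 2 * \<bar>sin (pi * x)\<bar>"
proof -
  have "expi x = exp (\<i> * of_real (2 * pi * x))" by (simp add: expi_def mult_ac)
  then show ?thesis using dist_exp_i_1[of "2 * pi * x"] by simp
qed

lemma norm_expi_minus_1:
  assumes "\<bar>x\<bar> \<le> 1 / 2"
  shows "norm (expi x - 1) \<ge> 4 * \<bar>x\<bar>"
proof -
  have "sin (pi * \<bar>x\<bar>) \<ge> 0" using assms by (intro sin_ge_zero) (auto simp: field_simps)
  then have sin_abs: "\<bar>sin (pi * x)\<bar> = sin (pi * \<bar>x\<bar>)" by (cases "x \<ge> 0") auto
  have "norm (expi x - 1) = 2 * \<bar>sin (pi * x)\<bar>" by (rule norm_expi_minus_1_eq)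
  also note sin_abs
  also have "2 * sin (pi * \<bar>x\<bar>) \<ge> 2 * (2 * (pi * \<bar>x\<bar>) / pi)"
    using assms by (intro mult_left_mono sin_ge_linear) (auto simp: field_simps)
  finally show ?thesis by simp
qed

lemma norm_expi_diff_le: "norm (expi x - expi y) \<le> 2 * pi * \<bar>x - y\<bar>"
proof -
  have "expi x - expi y = expi y * (expi (x - y) - 1)"
    by (simp add: right_diff_distrib flip: expi_add)
  then have "norm (expi x - expi y) = norm (expi (x - y) - 1)" by (simp add: norm_mult)
  also have "\<dots> = 2 * \<bar>sin (pi * (x - y))\<bar>" by (rule norm_expi_minus_1_eq)
  also have "\<dots> \<le> 2 * \<bar>pi * (x - y)\<bar>" by (intro mult_left_mono abs_sin_x_le_abs_x) auto
  finally show ?thesis by (simp add: abs_mult)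
qed

text \<open>Multiplied by e(\<alpha>) - 1 the geometric sum telescopes to a difference of two
  unimodular numbers; in product form, integral \<alpha> is no exception.\<close>

lemma geometric_sum_large_imp_near_int:
  assumes "norm (\<Sum>x\<in>{a..<a + int L}. expi (\<beta> + \<alpha> * of_int x)) \<ge> T" "T > 0"
  shows "\<exists>b::int. \<bar>\<alpha> - of_int b\<bar> \<le> 1 / (2 * T)"
proof -
  define S where "S = (\<Sum>x\<in>{a..<a + int L}. expi (\<beta> + \<alpha> * of_int x))"
  define b where "b = round \<alpha>"
  have b: "\<bar>\<alpha> - of_int b\<bar> \<le> 1 / 2" using of_int_round_abs_le[of \<alpha>] by (simp add: b_def abs_minus_commute)
  have tele: "(\<Sum>x\<in>{a..<a + int n}. g (x + 1) - g x) = g (a + int n) - g a" for g :: "int \<Rightarrow> complex" and n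
  proof (induction n)
    case (Suc n)
    have "{a..<a + int (Suc n)} = insert (a + int n) {a..<a + int n}" by auto
    then show ?case using Suc by (simp add: algebra_simps)
  qed simp
  have "S * (expi \<alpha> - 1) = (\<Sum>x\<in>{a..<a + int L}. expi (\<beta> + \<alpha> * of_int (x + 1)) - expi (\<beta> + \<alpha> * of_int x))"
    unfolding S_def sum_distrib_right
    by (intro sum.cong refl) (simp add: algebra_simps expi_add)
  also have "\<dots> = expi (\<beta> + \<alpha> * of_int (a + int L)) - expi (\<beta> + \<alpha> * of_int a)" by (rule tele)
  also have "norm \<dots> \<le> 2" by (rule order_trans[OF norm_triangle_ineq4]) simp
  finally have 1: "norm S * norm (expi \<alpha> - 1) \<le> 2" by (simp add: norm_mult)
  have "expi \<alpha> = expi (\<alpha> - of_int b)" using expi_add[of "\<alpha> - of_int b" "of_int b"] by simp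
  then have "norm (expi \<alpha> - 1) \<ge> 4 * \<bar>\<alpha> - of_int b\<bar>" using norm_expi_minus_1[OF b] by simp
  then have "T * (4 * \<bar>\<alpha> - of_int b\<bar>) \<le> norm S * norm (expi \<alpha> - 1)"
    using assms by (intro mult_mono) (auto simp: S_def)
  then have "T * (4 * \<bar>\<alpha> - of_int b\<bar>) \<le> 2" using 1 by linarith
  then show ?thesis using assms(2) by (intro exI[of _ b]) (simp add: field_simps)
qed

section \<open>Recurrence modulo one and Weyl differencing\<close>

lemma pigeonhole_fiber:
  assumes "finite A" "finite B" "B \<noteq> {}" "f ` A \<subseteq> B"
  shows "\<exists>y\<in>B. card A \<le> card B * card {x \<in> A. f x = y}"
proof (rule ccontr)
  assume "\<not> ?thesis"
  then have less: "card B * card {x \<in> A. f x = y} < card A" if "y \<in> B" for y using that by auto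
  have "card A = (\<Sum>y\<in>B. card {x \<in> A. f x = y})"
    using sum.group[OF assms(1,2,4), of "\<lambda>_. 1::nat"] by simp
  then have "card B * card A = (\<Sum>y\<in>B. card B * card {x \<in> A. f x = y})" by (simp add: sum_distrib_left)
  also have "\<dots> < (\<Sum>y\<in>B. card A)" using assms less by (intro sum_strict_mono) auto
  finally show False by simp
qed

lemma card_int_set_le_diff:
  fixes A :: "int set"
  assumes "finite A" "A \<noteq> {}" "d \<ge> 1" "\<And>x y. x \<in> A \<Longrightarrow> y \<in> A \<Longrightarrow> d dvd x - y"
  shows "\<exists>x\<in>A. \<exists>y\<in>A. d * (int (card A) - 1) \<le> y - x"
proof -
  define m M where "m = Min A" and "M = Max A"
  have mM: "m \<in> A" "M \<in> A" using assms by (auto simp: m_def M_def)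
  have bounds: "m \<le> x" "x \<le> M" if "x \<in> A" for x using that assms by (auto simp: m_def M_def)
  define f where "f x = (x - m) div d" for x
  have fx: "d * f x = x - m" if "x \<in> A" for x using assms(4)[OF that mM(1)] by (simp add: f_def)
  have "inj_on f A"
  proof (rule inj_onI)
    fix x y assume "x \<in> A" "y \<in> A" "f x = f y"
    then have "x - m = y - m" by (metis fx)
    then show "x = y" by simp
  qed
  moreover have "f ` A \<subseteq> {0..f M}"
  proof (rule image_subsetI)
    fix x assume "x \<in> A"
    then have x: "0 \<le> x - m" "x - m \<le> M - m" using bounds by auto
    have "f x \<le> f M" unfolding f_def using x(2) assms(3) by (intro zdiv_mono1) auto
    then show "f x \<in> {0..f M}" using x(1) assms(3) by (simp add: f_def pos_imp_zdiv_nonneg_iff)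
  qed
  ultimately have "card A \<le> card {0..f M}" using card_inj_on_le[of f A "{0..f M}"] by simp
  moreover have "0 \<le> f M" using bounds[OF mM(2)] bounds(1)[OF mM(2)] assms(3) by (simp add: f_def pos_imp_zdiv_nonneg_iff)
  ultimately have "int (card A) - 1 \<le> f M" by simp
  then have "d * (int (card A) - 1) \<le> d * f M" using assms(3) by (intro mult_left_mono) auto
  then show ?thesis using fx[OF mM(2)] mM by auto
qed

text \<open>
  Two elements of \<open>H\<close> at distance \<open>d \<lless> F\<close> give \<open>\<parallel>d\<theta>\<parallel> \<le> 2\<epsilon>\<close>.  Two elements of \<open>H\<close> in the same class modulo
  \<open>d\<close> at distance \<open>md\<close>, with \<open>m\<close> as large as possible, then give \<open>m\<parallel>d\<theta>\<parallel> = \<parallel>md\<theta>\<parallel> \<le> 2\<epsilon>\<close>, because \<open>m\<parallel>d\<theta>\<parallel>\<close> is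
  too small to wrap around.
\<close>

lemma near_int_recurrence:
  fixes \<theta> \<epsilon> E F :: real and P :: nat and H :: "int set"
  assumes H: "finite H" "H \<subseteq> {- int P<..<int P}" "real (card H) \<ge> real P / F"
    and near: "\<And>h. h \<in> H \<Longrightarrow> \<exists>b::int. \<bar>\<theta> * of_int h - of_int b\<bar> \<le> \<epsilon>"
    and EF: "E \<ge> 1" "F \<ge> 1" and \<epsilon>: "0 \<le> \<epsilon>" "\<epsilon> \<le> E / real P" and P: "real P \<ge> 1360 * E * F ^ 2"
  shows "\<exists>d::nat. 1 \<le> d \<and> real d \<le> 20 * F \<and> (\<exists>b::int. \<bar>real d * \<theta> - of_int b\<bar> \<le> 2720 * E * F ^ 2 * \<epsilon> / real P)"
proof -
  have F2: "F ^ 2 \<ge> F" "F ^ 2 \<ge> 1" using EF by (auto simp: power2_eq_square intro: mult_ge1_I order_trans[OF _ mult_right_mono[of 1 F F]])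
  have EF2: "E * F ^ 2 \<ge> E * F" "E * F \<ge> E" "E * F \<ge> F" using EF F2 by (auto intro: mult_left_mono simp: mult_le_cancel_left1 mult_le_cancel_right1)
  then have P_large: "real P \<ge> 1360 * (E * F)" "real P \<ge> 1360 * E" "real P \<ge> 1360 * F" "real P \<ge> 1360"
    using P EF unfolding mult.assoc by linarith+
  \<comment> \<open>Window length: a multiplier m below P/(8E) satisfies m * 2\<epsilon> \<le> 1/4.
    The range of \<open>H\<close> meets at most 34 E windows, so one of them contains r = P/(34 E F)
    elements.\<close>
  define w where "w = nat \<lfloor>real P / (8 * E)\<rfloor>"
  have w_le: "real w \<le> real P / (8 * E)" using EF by (simp add: w_def)
  have "real P / (8 * E) \<ge> 170" using P_large EF by (simp add: field_simps)
  then have w_ge: "real w \<ge> real P / (16 * E)" "w \<ge> 1"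
  proof -
    have "real w > real P / (8 * E) - 1" using EF by (simp add: w_def)
    moreover have "real P / (8 * E) = 2 * (real P / (16 * E))" by simp
    ultimately show "real w \<ge> real P / (16 * E)" using \<open>real P / (8 * E) \<ge> 170\<close> by linarith
    then have "real w > 0" using \<open>real P / (8 * E) \<ge> 170\<close> \<open>real P / (8 * E) = 2 * (real P / (16 * E))\<close> by linarith
    then show "w \<ge> 1" by simp
  qed
  define I where "I = {- (int P div int w) - 1..int P div int w}"
  have card_I: "real (card I) \<le> 34 * E"
  proof -
    have "int P div int w \<ge> 0" using w_ge by (simp add: pos_imp_zdiv_nonneg_iff)
    then have "real (card I) = 2 * of_int (int P div int w) + 2" by (simp add: I_def)
    also have "of_int (int P div int w) \<le> real P / real w"
      using real_of_int_div4[of "int P" "int w"] by simp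
    also have "real P / real w \<le> 16 * E" using w_ge EF by (simp add: field_simps)
    finally show ?thesis using EF by simp
  qed
  have "(\<lambda>h. h div int w) ` H \<subseteq> I"
  proof (rule image_subsetI)
    fix h assume "h \<in> H"
    then have "- int P \<le> h" "h \<le> int P" using H by auto
    then have "(- int P) div int w \<le> h div int w" "h div int w \<le> int P div int w"
      using w_ge(2) by (intro zdiv_mono1; simp)+
    moreover have "(- int P) div int w \<ge> - (int P div int w) - 1" using w_ge by (simp add: zdiv_zminus1_eq_if)
    ultimately show "h div int w \<in> I" by (simp add: I_def)
  qed
  moreover have "int P div int w \<ge> 0" using w_ge by (simp add: pos_imp_zdiv_nonneg_iff)
  then have "finite I" "I \<noteq> {}" by (auto simp: I_def)
  ultimately obtain y where y: "card H \<le> card I * card {h \<in> H. h div int w = y}"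
    using pigeonhole_fiber[OF H(1)] by blast
  define W where "W = {h \<in> H. h div int w = y}"
  have finW: "finite W" using H by (simp add: W_def)
  have Wdiff: "\<bar>h - h'\<bar> < int w" if "h \<in> W" "h' \<in> W" for h h'
  proof -
    have "h div int w = y" "h' div int w = y" using that by (auto simp: W_def)
    then have "h = int w * y + h mod int w" "h' = int w * y + h' mod int w"
      by (metis mult_div_mod_eq)+
    moreover have "0 \<le> h mod int w" "h mod int w < int w" "0 \<le> h' mod int w" "h' mod int w < int w" using w_ge by auto
    ultimately show ?thesis by linarith
  qed
  define r where "r = real P / (34 * E * F)"
  have r_ge: "r \<ge> 40 * F"
  proof -
    have "40 * F * (34 * E * F) = 1360 * E * F ^ 2" by (simp add: power2_eq_square)
    also note P
    finally have "40 * F * (34 * E * F) \<le> real P" .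
    then show ?thesis unfolding r_def using EF by (subst pos_le_divide_eq) auto
  qed
  have cardW: "real (card W) \<ge> r"
  proof -
    have "real (card H) \<le> real (card I * card W)" using y unfolding W_def of_nat_le_iff .
    with H(3) have "real P / F \<le> real (card I * card W)" by linarith
    also have "\<dots> \<le> 34 * E * real (card W)" using card_I by (simp add: mult_right_mono)
    finally show ?thesis using EF by (simp add: r_def field_simps)
  qed
  have "W \<noteq> {}" using cardW r_ge EF by auto
  then obtain h0 where h0: "h0 \<in> W" by blast
  have near_diff: "\<exists>b::int. \<bar>\<theta> * of_int (h - h') - of_int b\<bar> \<le> 2 * \<epsilon>" if "h \<in> W" "h' \<in> W" for h h'
  proof -
    obtain b b' where "\<bar>\<theta> * of_int h - of_int b\<bar> \<le> \<epsilon>" "\<bar>\<theta> * of_int h' - of_int b'\<bar> \<le> \<epsilon>"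
      using near[of h] near[of h'] \<open>h \<in> W\<close> \<open>h' \<in> W\<close> by (auto simp: W_def)
    then have "\<bar>\<theta> * of_int (h - h') - of_int (b - b')\<bar> \<le> 2 * \<epsilon>" by (simp add: algebra_simps)
    then show ?thesis by blast
  qed
  \<comment> \<open>Cells of length at least 18 F, covering distances up to P/(8E) on both sides of
    \<open>h0\<close>, number at most (34/72) r + 2, fewer than the elements of \<open>W\<close>. So
    two of these share a cell, at a distance d < g.\<close>
  define g where "g = nat \<lceil>18 * F\<rceil>"
  have "\<lceil>18 * F\<rceil> \<ge> 0" using EF by (simp add: order_trans[of _ 0])
  then have "real g = of_int \<lceil>18 * F\<rceil>" by (simp add: g_def)
  then have g: "real g \<ge> 18 * F" "real g \<le> 20 * F" using EF by linarith+
  then have "real g \<ge> 1" using EF by linarith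
  then have g1: "g \<ge> 1" by simp
  have "\<not> inj_on (\<lambda>h. (h - h0) div int g) W"
  proof
    assume inj: "inj_on (\<lambda>h. (h - h0) div int g) W"
    have "(\<lambda>h. (h - h0) div int g) ` W \<subseteq> {- (int w div int g) - 1..int w div int g}"
    proof (rule image_subsetI)
      fix h assume "h \<in> W"
      then have "- int w \<le> h - h0" "h - h0 \<le> int w" using Wdiff[OF _ h0] by fastforce+
      then have "(- int w) div int g \<le> (h - h0) div int g" "(h - h0) div int g \<le> int w div int g"
        using g1 by (intro zdiv_mono1; simp)+
      moreover have "(- int w) div int g \<ge> - (int w div int g) - 1" using g1 by (simp add: zdiv_zminus1_eq_if)
      ultimately show "(h - h0) div int g \<in> {- (int w div int g) - 1..int w div int g}" by simp
    qed
    then have "card W \<le> card {- (int w div int g) - 1..int w div int g}"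
      using inj by (intro card_inj_on_le) auto
    moreover have "int w div int g \<ge> 0" using g1 by (simp add: pos_imp_zdiv_nonneg_iff)
    ultimately have "real (card W) \<le> 2 * of_int (int w div int g) + 2" by simp
    also have "of_int (int w div int g) \<le> real w / real g"
      using real_of_int_div4[of "int w" "int g"] by simp
    also have "real w / real g \<le> (real P / (8 * E)) / (18 * F)"
      using w_le g EF by (intro frac_le) auto
    also have "\<dots> = r * (34 / 144)" using EF by (simp add: r_def field_simps)
    finally have "real (card W) \<le> r * (34 / 72) + 2" by simp
    then show False using cardW r_ge EF by linarith
  qed
  then obtain h1 h2 where h12: "h1 \<in> W" "h2 \<in> W" "h1 \<noteq> h2" "(h1 - h0) div int g = (h2 - h0) div int g"
    by (auto simp: inj_on_def)
  define d where "d = nat \<bar>h1 - h2\<bar>"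
  have d: "1 \<le> d" "d < g"
  proof -
    show "1 \<le> d" using h12 by (simp add: d_def)
    have "h1 - h0 = int g * ((h1 - h0) div int g) + (h1 - h0) mod int g" "h2 - h0 = int g * ((h1 - h0) div int g) + (h2 - h0) mod int g"
      unfolding h12(4) by (metis mult_div_mod_eq h12(4)) (metis mult_div_mod_eq)
    moreover have "0 \<le> (h1 - h0) mod int g" "(h1 - h0) mod int g < int g" "0 \<le> (h2 - h0) mod int g" "(h2 - h0) mod int g < int g" using g1 by auto
    ultimately have "\<bar>h1 - h2\<bar> < int g" by linarith
    then show "d < g" by (simp add: d_def)
  qed
  have d_le: "real d \<le> 20 * F" using d g by linarith
  obtain b where b: "\<bar>real d * \<theta> - of_int b\<bar> \<le> 2 * \<epsilon>"
  proof (cases "h1 \<ge> h2")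
    case True
    then have "of_int (h1 - h2) = real d" by (simp add: d_def)
    then show ?thesis using that near_diff[OF h12(1,2)] by (metis mult.commute)
  next
    case False
    then have "of_int (h2 - h1) = real d" by (simp add: d_def)
    then show ?thesis using that near_diff[OF h12(2,1)] by (metis mult.commute)
  qed
  define \<kappa> where "\<kappa> = real d * \<theta> - of_int b"
  have "(\<lambda>h. h mod int d) ` W \<subseteq> {0..<int d}" using d by auto
  then obtain z where z: "card W \<le> card {0..<int d} * card {h \<in> W. h mod int d = z}"
    using pigeonhole_fiber[OF finW, of "{0..<int d}" "\<lambda>h. h mod int d"] d by auto
  define Z where "Z = {h \<in> W. h mod int d = z}"
  have cardZ: "real (card Z) \<ge> r / (20 * F)"
  proof -
    have "r \<le> real (card W)" by (rule cardW)
    also have "\<dots> \<le> real (d * card Z)" using z by (simp add: Z_def del: of_nat_mult)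
    also have "\<dots> \<le> 20 * F * real (card Z)" using d_le by (simp add: mult_right_mono)
    finally show ?thesis using EF by (simp add: field_simps)
  qed
  have r10: "r / (20 * F) \<ge> 2" using r_ge EF by (simp add: field_simps)
  then have "Z \<noteq> {}" using cardZ by auto
  have dvdZ: "int d dvd x - y" if "x \<in> Z" "y \<in> Z" for x y
    using that by (simp add: Z_def mod_eq_dvd_iff [symmetric])
  have "finite Z" "int d \<ge> 1" using finW d by (auto simp: Z_def)
  from card_int_set_le_diff[OF this(1) \<open>Z \<noteq> {}\<close> this(2) dvdZ]
  obtain x y where xy: "x \<in> Z" "y \<in> Z" "int d * (int (card Z) - 1) \<le> y - x" by blast
  define m where "m = (y - x) div int d"
  have md: "y - x = m * int d"
    using dvdZ[OF xy(2,1)] by (simp add: m_def)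
  have m_ge: "of_int m \<ge> r / (40 * F)"
  proof -
    have "int d * (int (card Z) - 1) \<le> int d * m" using xy(3) md by (simp add: mult.commute)
    then have "int (card Z) - 1 \<le> m" using d by simp
    then have "real_of_int (int (card Z) - 1) \<le> of_int m" by (simp only: of_int_le_iff)
    then have "real (card Z) - 1 \<le> of_int m" by simp
    moreover have "r / (20 * F) = 2 * (r / (40 * F))" by simp
    ultimately show ?thesis using cardZ r10 by linarith
  qed
  have rF: "r / (40 * F) > 0" using r_ge EF by auto
  then have m_pos: "of_int m > (0::real)" using m_ge by linarith
  have m_le: "of_int m \<le> real P / (8 * E)"
  proof -
    have "m * 1 \<le> m * int d" using d m_pos by (intro mult_left_mono) auto
    also have "\<dots> < int w" using Wdiff[of y x] xy md by (auto simp: Z_def)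
    finally have "real_of_int m \<le> real w" by linarith
    then show ?thesis using w_le by linarith
  qed
  obtain b' where b': "\<bar>\<theta> * of_int (y - x) - of_int b'\<bar> \<le> 2 * \<epsilon>"
    using near_diff[of y x] xy by (auto simp: Z_def)
  have eq: "\<theta> * of_int (y - x) - of_int b' = of_int m * \<kappa> + of_int (m * b - b')"
    by (simp add: md \<kappa>_def algebra_simps)
  have "\<bar>of_int m * \<kappa>\<bar> \<le> (real P / (8 * E)) * (2 * (E / real P))"
    unfolding abs_mult using m_le m_pos b \<epsilon> by (intro mult_mono) (auto simp: \<kappa>_def)
  also have "\<dots> = 1 / 4" using EF P_large by (simp add: field_simps)
  finally have m\<kappa>: "\<bar>of_int m * \<kappa>\<bar> \<le> 1 / 4" .
  have "2 * \<epsilon> \<le> 2 * (E / real P)" using \<epsilon> by simp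
  also have "\<dots> \<le> 1 / 4" using EF P_large by (simp add: field_simps)
  finally have "\<bar>real_of_int (m * b - b')\<bar> \<le> 1 / 2" using b' m\<kappa> unfolding eq by linarith
  then have "m * b - b' = 0" by linarith
  then have "of_int m * \<bar>\<kappa>\<bar> \<le> 2 * \<epsilon>" using b' m_pos unfolding eq by (simp add: abs_mult)
  then have "\<bar>\<kappa>\<bar> \<le> 2 * \<epsilon> / of_int m" using m_pos by (simp add: field_simps)
  also have "\<dots> \<le> 2 * \<epsilon> / (r / (40 * F))" using m_ge rF \<epsilon> by (intro frac_le) auto
  also have "\<dots> = 2720 * E * F ^ 2 * \<epsilon> / real P" using EF by (simp add: r_def power2_eq_square field_simps)
  finally show ?thesis using d(1) d_le by (auto simp: \<kappa>_def)
qed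

text \<open>The range of x for a given difference is again an interval, so a differenced sum is of
  the same kind as the original one and the induction on the degree can continue.\<close>

lemma norm_sq_sum_differencing:
  fixes f :: "int \<Rightarrow> complex" and a :: int
  assumes "L \<le> P"
  defines "J h \<equiv> {max a (a - h)..<min (a + int L) (a + int L - h)}"
  shows "norm (\<Sum>x\<in>{a..<a + int L}. f x) ^ 2 \<le> (\<Sum>h\<in>{- int P<..<int P}. norm (\<Sum>x\<in>J h. f (x + h) * cnj (f x)))"
proof -
  define I where "I = {a..<a + int L}"
  define H where "H = {- int P<..<int P}"
  have J: "{x \<in> I. x + h \<in> I} = J h" for h by (auto simp: I_def J_def)
  have "(\<Sum>y\<in>I. f y * cnj (f x)) = (\<Sum>h\<in>{h \<in> H. x + h \<in> I}. f (x + h) * cnj (f x))" if "x \<in> I" for x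
    using that assms(1)
    by (intro sum.reindex_bij_witness[of _ "\<lambda>h. x + h" "\<lambda>y. y - x"]) (auto simp: I_def H_def)
  then have "(\<Sum>x\<in>I. \<Sum>y\<in>I. f y * cnj (f x)) = (\<Sum>x\<in>I. \<Sum>h\<in>{h \<in> H. x + h \<in> I}. f (x + h) * cnj (f x))"
    by simp
  also have "\<dots> = (\<Sum>h\<in>H. \<Sum>x\<in>{x \<in> I. x + h \<in> I}. f (x + h) * cnj (f x))"
    by (rule sum.swap_restrict) (auto simp: I_def H_def)
  finally have eq: "(\<Sum>x\<in>I. \<Sum>y\<in>I. f y * cnj (f x)) = (\<Sum>h\<in>H. \<Sum>x\<in>J h. f (x + h) * cnj (f x))"
    by (simp only: J)
  have "complex_of_real (norm (\<Sum>x\<in>I. f x) ^ 2) = (\<Sum>x\<in>I. \<Sum>y\<in>I. f y * cnj (f x))"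
    unfolding complex_norm_square cnj_sum sum_product by (rule sum.swap)
  then have "norm (\<Sum>x\<in>I. f x) ^ 2 = norm (\<Sum>h\<in>H. \<Sum>x\<in>J h. f (x + h) * cnj (f x))"
    unfolding eq [symmetric] by (metis norm_of_real abs_of_nonneg zero_le_power2)
  also have "\<dots> \<le> (\<Sum>h\<in>H. norm (\<Sum>x\<in>J h. f (x + h) * cnj (f x)))" by (rule norm_sum)
  finally show ?thesis by (simp add: I_def H_def)
qed

lemma degree_le_1_eq:
  assumes "degree p \<le> 1" shows "p = [:coeff p 0, coeff p 1:]"
proof (rule poly_eqI)
  fix n
  consider "n = 0" | "n = 1" | m where "n = Suc (Suc m)" by (cases n; cases "n - 1") auto
  then show "coeff p n = coeff [:coeff p 0, coeff p 1:] n"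
    using assms by cases (auto intro: coeff_eq_0)
qed

lemma coeff_difference_poly:
  fixes \<psi> :: "real poly" and h :: real
  assumes "degree \<psi> \<le> Suc k"
  defines "\<psi>' \<equiv> pcompose \<psi> [:h, 1:] - \<psi>"
  shows "degree \<psi>' \<le> k" "coeff \<psi>' k = real (Suc k) * coeff \<psi> (Suc k) * h"
proof -
  have "degree (pcompose \<psi> [:h, 1:] - \<psi>) \<le> k \<and>
    coeff (pcompose \<psi> [:h, 1:] - \<psi>) k = real (Suc k) * coeff \<psi> (Suc k) * h"
    using assms(1)
  proof (induction k arbitrary: \<psi>)
    case 0
    then obtain a b where \<psi>: "\<psi> = [:a, b:]" using degree_le_1_eq[of \<psi>] by auto
    then show ?case by (simp add: pcompose_pCons)
  next
    case (Suc k)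
    obtain c \<rho> where \<psi>: "\<psi> = pCons c \<rho>" by (cases \<psi>)
    have deg: "degree \<rho> \<le> Suc k" using Suc.prems by (cases "\<rho> = 0") (auto simp: \<psi>)
    define \<rho>' where "\<rho>' = pcompose \<rho> [:h, 1:]"
    have IH: "degree (\<rho>' - \<rho>) \<le> k" "coeff (\<rho>' - \<rho>) k = real (Suc k) * coeff \<rho> (Suc k) * h"
      using Suc.IH[OF deg] by (auto simp: \<rho>'_def)
    have eq: "pcompose \<psi> [:h, 1:] - \<psi> = smult h \<rho>' + pCons 0 (\<rho>' - \<rho>)"
      unfolding \<psi> \<rho>'_def
      by (subst poly_eq_poly_eq_iff [symmetric], rule ext) (simp add: poly_pcompose algebra_simps)
    have "degree \<rho>' \<le> Suc k" using deg by (simp add: \<rho>'_def degree_pcompose)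
    then have "degree (smult h \<rho>' + pCons 0 (\<rho>' - \<rho>)) \<le> Suc k"
      using IH(1) by (intro degree_add_le order_trans[OF degree_smult_le] order_trans[OF degree_pCons_le]) auto
    moreover have "coeff (\<rho>' - \<rho>) (Suc k) = 0" using IH(1) by (intro coeff_eq_0) auto
    then have "coeff (smult h \<rho>' + pCons 0 (\<rho>' - \<rho>)) (Suc k) = real (Suc (Suc k)) * coeff \<psi> (Suc (Suc k)) * h"
      using IH(2) by (simp add: \<psi> algebra_simps)
    ultimately show ?case by (simp only: eq simp_thms)
  qed
  then show "degree \<psi>' \<le> k" "coeff \<psi>' k = real (Suc k) * coeff \<psi> (Suc k) * h"
    by (auto simp: \<psi>'_def)
qed

text \<open>The h with small \<open>g h\<close> account for at most half of the lower bound for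
  \<open>S ^ 2\<close>, and each of the others contributes at most P.\<close>

lemma many_large_differences:
  fixes g :: "int \<Rightarrow> real" and S :: real
  assumes "S \<ge> real P / D" "S ^ 2 \<le> (\<Sum>h\<in>{- int P<..<int P}. g h)" "\<And>h. g h \<le> real P" "P \<ge> 1" "D \<ge> 1"
  shows "real (card {h \<in> {- int P<..<int P}. g h \<ge> real P / (4 * D ^ 2)}) \<ge> real P / (2 * D ^ 2)"
proof -
  define A where "A = {- int P<..<int P}"
  define T where "T = real P / (4 * D ^ 2)"
  define H where "H = {h \<in> A. g h \<ge> T}"
  have [simp]: "finite A" by (simp add: A_def)
  then have [simp]: "finite H" by (simp add: H_def)
  have cardA: "real (card A) \<le> 2 * real P" by (simp add: A_def)
  have "T \<ge> 0" by (simp add: T_def)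
  have "real P ^ 2 / D ^ 2 = (real P / D) ^ 2" by (simp add: power_divide)
  also have "\<dots> \<le> S ^ 2" using assms by (intro power_mono) auto
  also have "\<dots> \<le> (\<Sum>h\<in>A. g h)" using assms by (simp add: A_def)
  also have "\<dots> \<le> (\<Sum>h\<in>A. (if h \<in> H then real P else 0) + T)"
    using assms(3) \<open>T \<ge> 0\<close> by (intro sum_mono) (auto simp: H_def add_increasing2)
  also have "\<dots> = real (card H) * real P + real (card A) * T"
    by (simp add: sum.distrib sum.If_cases H_def Int_def)
  also have "\<dots> \<le> real (card H) * real P + 2 * real P * T"
    using cardA \<open>T \<ge> 0\<close> by (intro add_left_mono mult_right_mono)
  finally have "real P * (real P / D ^ 2) \<le> real P * (real (card H) + 2 * T)"
    by (simp add: power2_eq_square algebra_simps)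
  then have "real P / D ^ 2 \<le> real (card H) + 2 * T" by (rule mult_left_le_imp_le) (use assms(4) in simp)
  moreover have "2 * T = real P / (2 * D ^ 2)" "real P / D ^ 2 = 2 * (real P / (2 * D ^ 2))" by (simp_all add: T_def)
  ultimately have "real (card H) \<ge> real P / (2 * D ^ 2)" by linarith
  then show ?thesis by (simp only: H_def A_def T_def)
qed

text \<open>The inverse form, polynomial in D with unspecified constants, involves neither a divisor
  bound nor a factor P^\<epsilon>. Differencing yields approximations to (k+1)\<alpha>h for many h;
  the pigeonhole principle makes the denominator common, and recurrence in h gains the missing
  factor 1/P.\<close>

theorem weyl_inequality:
  assumes "1 \<le> k"
  shows "\<exists>C\<ge>1. \<exists>c::nat. \<forall>\<psi> a L P D. degree \<psi> \<le> k \<longrightarrow> L \<le> P \<longrightarrow> 1 \<le> P \<longrightarrow> 1 \<le> D \<longrightarrow>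
    norm (\<Sum>x\<in>{a..<a + int L}. expi (poly \<psi> (of_int x))) \<ge> real P / D \<longrightarrow>
    (\<exists>q::nat. 1 \<le> q \<and> real q \<le> C * D ^ c \<and> (\<exists>b::int. \<bar>real q * coeff \<psi> k - of_int b\<bar> \<le> C * D ^ c / real P ^ k))"
  using assms
proof (induction k rule: nat_induct_at_least)
  case base
  show ?case
  proof (intro exI[of _ "1::real"] exI[of _ "1::nat"] conjI allI impI)
    fix \<psi> :: "real poly" and a :: int and L P :: nat and D :: real
    assume A: "degree \<psi> \<le> 1" "1 \<le> P" "1 \<le> D"
      "norm (\<Sum>x\<in>{a..<a + int L}. expi (poly \<psi> (of_int x))) \<ge> real P / D"
    obtain \<beta> \<alpha> where \<psi>: "\<psi> = [:\<beta>, \<alpha>:]" using degree_le_1_eq[OF A(1)] by blast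
    have poly_\<psi>: "poly \<psi> x = \<beta> + \<alpha> * x" for x by (simp add: \<psi> mult.commute)
    have "\<exists>b::int. \<bar>\<alpha> - of_int b\<bar> \<le> 1 / (2 * (real P / D))"
      by (rule geometric_sum_large_imp_near_int[OF A(4)[unfolded poly_\<psi>]]) (use A in simp)
    then obtain b :: int where "\<bar>\<alpha> - of_int b\<bar> \<le> 1 / (2 * (real P / D))" by blast
    also have "\<dots> \<le> D / real P" using A by (simp add: field_simps)
    finally show "\<exists>b::int. \<bar>real 1 * coeff \<psi> 1 - of_int b\<bar> \<le> 1 * D ^ 1 / real P ^ 1" by (auto simp: \<psi>)
  qed auto
next
  case (Suc k)
  from Suc.IH obtain C c where C: "C \<ge> 1" and IH0: "\<forall>\<psi> a L P D. degree \<psi> \<le> k \<longrightarrow> L \<le> P \<longrightarrow> 1 \<le> P \<longrightarrow> 1 \<le> D \<longrightarrow>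
    norm (\<Sum>x\<in>{a..<a + int L}. expi (poly \<psi> (of_int x))) \<ge> real P / D \<longrightarrow>
    (\<exists>q::nat. 1 \<le> q \<and> real q \<le> C * D ^ c \<and> (\<exists>b::int. \<bar>real q * coeff \<psi> k - of_int b\<bar> \<le> C * D ^ c / real P ^ k))"
    by (elim exE conjE)
  note IH = IH0[rule_format]
  define A where "A = 2 * C * 4 ^ c"
  define m where "m = 2 * c + 2"
  define B where "B = 2720 * (real k + 1) * A ^ 4"
  have A1: "A \<ge> 1" using C one_le_power[of "4::real" c] unfolding A_def by (intro mult_ge1_I) auto
  then have A4: "1 \<le> A ^ 4" "A ^ 2 \<le> A ^ 4" "A ^ 3 \<le> A ^ 4" by (simp_all add: power_increasing)
  have B1: "B \<ge> 1" using A4 by (auto simp: B_def intro!: mult_ge1_I)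
  show ?case
  proof (rule exI[of _ "B ^ Suc k"], rule conjI[OF one_le_power[OF B1]], rule exI[of _ "4 * m * Suc k"], intro allI impI)
    fix \<psi> :: "real poly" and a :: int and L P :: nat and D :: real
    assume deg: "degree \<psi> \<le> Suc k" and LP: "L \<le> P" and P: "1 \<le> P" and D: "1 \<le> D"
      and large: "norm (\<Sum>x\<in>{a..<a + int L}. expi (poly \<psi> (of_int x))) \<ge> real P / D"
    define \<alpha> where "\<alpha> = coeff \<psi> (Suc k)"
    define E where "E = C * (4 * D ^ 2) ^ c"
    define F where "F = 2 * D ^ 2 * E"
    have Dm: "1 \<le> D ^ j" for j using D by (rule one_le_power)
    have E1: "E \<ge> 1" using C D by (auto simp: E_def intro!: mult_ge1_I one_le_power)
    have F1: "F \<ge> 1" using E1 D by (auto simp: F_def intro!: mult_ge1_I one_le_power)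
    have "D ^ m = (D ^ 2) ^ c * D ^ 2" by (simp add: m_def power_add power_mult power2_eq_square)
    then have F_eq: "F = A * D ^ m" by (simp add: F_def E_def A_def power_mult_distrib mult_ac)
    have "1 \<le> 2 * D ^ 2" using Dm[of 2] by linarith
    then have "E * 1 \<le> E * (2 * D ^ 2)" using E1 by (intro mult_left_mono) auto
    then have E_F: "E \<le> F" by (simp add: F_def mult_ac)
    define R where "R = B * D ^ (4 * m)"
    have R1: "R \<ge> 1" unfolding R_def by (rule mult_ge1_I[OF B1 Dm])
    have R_Suc: "R ^ Suc k = B ^ Suc k * D ^ (4 * m * Suc k)" by (simp only: R_def power_mult_distrib power_mult)
    have R_le: "R \<le> R ^ Suc k" using R1 by (intro self_le_power) auto
    have FR: "2720 * (real k + 1) * F ^ 4 = R"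
      by (simp add: F_eq R_def B_def power_mult_distrib power_mult [symmetric] mult.commute[of m])
    have F_pows: "1 \<le> F ^ 4" "F ^ 2 \<le> F ^ 4" "F ^ 3 \<le> F ^ 4"
      using F1 by (simp_all add: power_increasing)
    show "\<exists>q::nat. 1 \<le> q \<and> real q \<le> B ^ Suc k * D ^ (4 * m * Suc k) \<and>
      (\<exists>b::int. \<bar>real q * coeff \<psi> (Suc k) - of_int b\<bar> \<le> B ^ Suc k * D ^ (4 * m * Suc k) / real P ^ Suc k)"
      unfolding R_Suc [symmetric] \<alpha>_def [symmetric]
    proof (cases "real P \<ge> 1360 * E * F ^ 2")
      \<comment> \<open>Here P is at most R and the claim is trivial, the permitted error
        R^(k+1)/P^(k+1) being at least 1. This case is the reason for the exponent
        \<open>Suc k\<close> on R.\<close>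
      case False
      have "1360 * E * F ^ 2 \<le> 1360 * (F * F ^ 2)" using E_F F1 by (simp add: mult_right_mono)
      also have "F * F ^ 2 = F ^ 3" by (simp add: power2_eq_square power3_eq_cube)
      also have "1360 * F ^ 3 \<le> (2720 * (real k + 1)) * F ^ 4" using F_pows F1 by (intro mult_mono) auto
      finally have "real P \<le> R" using False FR by linarith
      then have "real P ^ Suc k \<le> R ^ Suc k" by (intro power_mono) auto
      then have "1 \<le> R ^ Suc k / real P ^ Suc k" using P by (simp add: le_divide_eq del: power_Suc)
      moreover have "\<bar>real 1 * \<alpha> - of_int (round \<alpha>)\<bar> \<le> 1 / 2" using of_int_round_abs_le[of \<alpha>] by (simp add: abs_minus_commute)
      ultimately have "\<bar>real 1 * \<alpha> - of_int (round \<alpha>)\<bar> \<le> R ^ Suc k / real P ^ Suc k" by linarith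
      moreover have "real 1 \<le> R ^ Suc k" unfolding of_nat_1 by (rule one_le_power[OF R1])
      ultimately show "\<exists>q::nat. 1 \<le> q \<and> real q \<le> R ^ Suc k \<and> (\<exists>b::int. \<bar>real q * \<alpha> - of_int b\<bar> \<le> R ^ Suc k / real P ^ Suc k)"
        by (intro exI[of _ "1::nat"] conjI exI[of _ "round \<alpha>"] order_refl)
    next
      case True
      define J where "J h = {max a (a - h)..<min (a + int L) (a + int L - h)}" for h
      define \<psi>' where "\<psi>' h = pcompose \<psi> [:of_int h, 1:] - \<psi>" for h :: int
      define g where "g h = norm (\<Sum>x\<in>J h. expi (poly (\<psi>' h) (of_int x)))" for h
      \<comment> \<open>Truncated subtraction makes the length 0 when |h| exceeds L, in agreement
        with the empty interval \<open>J h\<close>.\<close>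
      have J_eq: "J h = {max a (a - h)..<max a (a - h) + int (L - nat \<bar>h\<bar>)}" for h
        by (cases "h \<ge> 0"; cases "nat \<bar>h\<bar> \<le> L") (auto simp: J_def of_nat_diff)
      have g_le: "g h \<le> real P" for h
      proof -
        have "g h \<le> (\<Sum>x\<in>J h. norm (expi (poly (\<psi>' h) (of_int x))))" unfolding g_def by (rule norm_sum)
        also have "\<dots> \<le> real P" using LP by (simp add: J_eq)
        finally show ?thesis .
      qed
      have "norm (\<Sum>x\<in>{a..<a + int L}. expi (poly \<psi> (of_int x))) ^ 2 \<le> (\<Sum>h\<in>{- int P<..<int P}. g h)"
      proof -
        have "expi (poly \<psi> (of_int (x + h))) * cnj (expi (poly \<psi> (of_int x))) = expi (poly (\<psi>' h) (of_int x))" for x h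
          by (simp add: \<psi>'_def poly_pcompose expi_minus [symmetric] expi_add [symmetric] add.commute)
        then show ?thesis
          using norm_sq_sum_differencing[OF LP, of "\<lambda>x. expi (poly \<psi> (of_int x))" a] by (simp add: g_def J_def)
      qed
      from many_large_differences[OF large this g_le P D]
      have cardH: "real (card {h \<in> {- int P<..<int P}. g h \<ge> real P / (4 * D ^ 2)}) \<ge> real P / (2 * D ^ 2)" .
      define H where "H = {h \<in> {- int P<..<int P}. g h \<ge> real P / (4 * D ^ 2)}"
      have "\<exists>q::nat. 1 \<le> q \<and> real q \<le> E \<and> (\<exists>b::int. \<bar>real q * (real (Suc k) * \<alpha> * of_int h) - of_int b\<bar> \<le> E / real P ^ k)"
        if "h \<in> H" for h
      proof -
        have D4: "1 \<le> 4 * D ^ 2" using Dm[of 2] by linarith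
        have "L - nat \<bar>h\<bar> \<le> P" using LP by simp
        moreover have "norm (\<Sum>x\<in>{max a (a - h)..<max a (a - h) + int (L - nat \<bar>h\<bar>)}. expi (poly (\<psi>' h) (of_int x))) \<ge> real P / (4 * D ^ 2)"
          using that by (simp add: H_def g_def J_eq)
        ultimately show ?thesis
          using IH[of "\<psi>' h" "L - nat \<bar>h\<bar>" P "4 * D ^ 2" "max a (a - h)"] coeff_difference_poly[OF deg, of "of_int h"] P D4
          by (simp add: \<psi>'_def \<alpha>_def E_def)
      qed
      then obtain q where q: "\<And>h. h \<in> H \<Longrightarrow> 1 \<le> q h \<and> real (q h) \<le> E \<and>
          (\<exists>b::int. \<bar>real (q h) * (real (Suc k) * \<alpha> * of_int h) - of_int b\<bar> \<le> E / real P ^ k)"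
        by metis
      define QS where "QS = {1..nat \<lfloor>E\<rfloor>}"
      have QS: "finite QS" "QS \<noteq> {}" "real (card QS) \<le> E" using E1 by (auto simp: QS_def le_nat_floor)
      have "q ` H \<subseteq> QS" using q by (auto simp: QS_def le_nat_floor)
      moreover have finH: "finite H" by (rule finite_subset[of _ "{- int P<..<int P}"]) (auto simp: H_def)
      ultimately obtain q0 where q0: "q0 \<in> QS" "card H \<le> card QS * card {h \<in> H. q h = q0}"
        using pigeonhole_fiber[of H QS q] QS by meson
      define H' where "H' = {h \<in> H. q h = q0}"
      have "real P / F \<le> real (card H')"
      proof -
        have "real P / (2 * D ^ 2) \<le> real (card H)" using cardH by (simp add: H_def)
        also have "\<dots> \<le> real (card QS * card H')" using q0(2) unfolding H'_def of_nat_le_iff .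
        also have "\<dots> \<le> E * real (card H')" using QS(3) by (simp add: mult_right_mono)
        finally show ?thesis using E1 D by (simp add: F_def field_simps)
      qed
      moreover have "finite H'" using finH by (simp add: H'_def)
      moreover have "H' \<subseteq> {- int P<..<int P}" by (auto simp: H'_def H_def)
      moreover have "\<exists>b::int. \<bar>(real q0 * real (Suc k) * \<alpha>) * of_int h - of_int b\<bar> \<le> E / real P ^ k" if "h \<in> H'" for h
        using q[of h] that by (auto simp: H'_def mult_ac)
      moreover have "E / real P ^ k \<le> E / real P"
        using P E1 Suc.hyps self_le_power[of "real P" k] by (intro divide_left_mono) auto
      ultimately obtain d where d: "1 \<le> d" "real d \<le> 20 * F"
         "\<exists>b::int. \<bar>real d * (real q0 * real (Suc k) * \<alpha>) - of_int b\<bar> \<le> 2720 * E * F ^ 2 * (E / real P ^ k) / real P"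
        using near_int_recurrence[of H' P F "real q0 * real (Suc k) * \<alpha>" "E / real P ^ k" E] E1 F1 True by auto
      have q0_E: "1 \<le> q0" "real q0 \<le> E" using q0(1) E1 by (auto simp: QS_def) linarith
      show "\<exists>q::nat. 1 \<le> q \<and> real q \<le> R ^ Suc k \<and> (\<exists>b::int. \<bar>real q * \<alpha> - of_int b\<bar> \<le> R ^ Suc k / real P ^ Suc k)"
      proof (intro exI[of _ "d * q0 * Suc k"] conjI)
        have "0 < d * q0 * Suc k" using d q0_E by simp
        then show "1 \<le> d * q0 * Suc k" by linarith
        have "real (d * q0 * Suc k) \<le> (20 * F) * F * (real k + 1)"
          unfolding of_nat_mult using d q0_E E_F F1 by (intro mult_mono) auto
        also have "\<dots> = 20 * (real k + 1) * F ^ 2" by (simp add: power2_eq_square)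
        also have "\<dots> \<le> 2720 * (real k + 1) * F ^ 4" using F_pows by (intro mult_mono) auto
        also have "\<dots> \<le> R ^ Suc k" using FR R_le by simp
        finally show "real (d * q0 * Suc k) \<le> R ^ Suc k" .
        obtain b :: int where b: "\<bar>real d * (real q0 * real (Suc k) * \<alpha>) - of_int b\<bar> \<le> 2720 * E * F ^ 2 * (E / real P ^ k) / real P"
          using d(3) by (elim exE)
        have "2720 * E * F ^ 2 * (E / real P ^ k) / real P = (2720 * (E * E) * F ^ 2) / real P ^ Suc k" by (simp add: mult_ac)
        also have "\<dots> \<le> (2720 * (F * F) * F ^ 2) / real P ^ Suc k"
          using E_F E1 F1 by (intro divide_right_mono mult_right_mono mult_left_mono mult_mono[of E F E F]) auto
        also have "2720 * (F * F) * F ^ 2 = 2720 * 1 * F ^ 4" by (simp add: power2_eq_square power4_eq_xxxx)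
        also have "2720 * 1 * F ^ 4 / real P ^ Suc k \<le> 2720 * (real k + 1) * F ^ 4 / real P ^ Suc k"
          using F_pows by (intro divide_right_mono mult_right_mono mult_left_mono) auto
        also have "\<dots> \<le> R ^ Suc k / real P ^ Suc k" using FR R_le by (intro divide_right_mono) auto
        finally have "\<bar>real (d * q0 * Suc k) * \<alpha> - of_int b\<bar> \<le> R ^ Suc k / real P ^ Suc k"
          using b by (simp only: of_nat_mult mult.assoc)
        then show "\<exists>b::int. \<bar>real (d * q0 * Suc k) * \<alpha> - of_int b\<bar> \<le> R ^ Suc k / real P ^ Suc k" by blast
      qed
    qed
  qed
qed

section \<open>Major arcs\<close>

definition gauss_avg :: "nat \<Rightarrow> nat \<Rightarrow> nat \<Rightarrow> complex" where
  "gauss_avg k q a = inverse (of_nat q) * (\<Sum>r=1..q. expi (real (a * r ^ k) / real q))"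

lemma norm_gauss_avg: "norm (gauss_avg k q a) = norm (\<Sum>r=1..q. expi (real (a * r ^ k) / real q)) / real q"
  unfolding gauss_avg_def norm_mult norm_inverse norm_of_nat by (simp only: divide_inverse mult.commute)

text \<open>Weyl's inequality for the complete sum, with P = q and leading coefficient a/q. For a
  denominator q' either q divides q', or q'a/q is at distance at least 1/q from the integers, and
  then q^(k-1) \<le> C D^c. As k \<ge> 2, D is at least a power of q in both cases.\<close>

lemma gauss_avg_bound:
  assumes k: "2 \<le> k"
  shows "\<exists>C\<ge>1. \<exists>\<delta>>0. \<forall>q\<ge>1. \<forall>a. coprime a q \<longrightarrow> norm (gauss_avg k q a) \<le> C * real q powr (- \<delta>)"
proof -
  have "1 \<le> k" using k by simp
  from weyl_inequality[OF this] obtain C c where C: "C \<ge> 1"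
    and W0: "\<forall>\<psi> a L P D. degree \<psi> \<le> k \<longrightarrow> L \<le> P \<longrightarrow> 1 \<le> P \<longrightarrow> 1 \<le> D \<longrightarrow>
    norm (\<Sum>x\<in>{a..<a + int L}. expi (poly \<psi> (of_int x))) \<ge> real P / D \<longrightarrow>
    (\<exists>q::nat. 1 \<le> q \<and> real q \<le> C * D ^ c \<and> (\<exists>b::int. \<bar>real q * coeff \<psi> k - of_int b\<bar> \<le> C * D ^ c / real P ^ k))"
    by (elim exE conjE)
  note W = W0[rule_format]
  \<comment> \<open>The successor keeps 1/c' a positive exponent when c = 0.\<close>
  define c' where "c' = Suc c"
  define \<delta> where "\<delta> = 1 / real c'"
  have "norm (gauss_avg k q a) \<le> C * real q powr (- \<delta>)" if q: "q \<ge> 1" and cop: "coprime a q" for q a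
  proof (cases "gauss_avg k q a = 0")
    case True
    then show ?thesis using C by simp
  next
    case False
    define S where "S = (\<Sum>r=1..q. expi (real (a * r ^ k) / real q))"
    have g: "norm (gauss_avg k q a) = norm S / real q"
      by (simp only: norm_gauss_avg S_def)
    have S0: "norm S > 0" using False q by (auto simp: gauss_avg_def S_def)
    have "norm S \<le> (\<Sum>r=1..q. norm (expi (real (a * r ^ k) / real q)))" unfolding S_def by (rule norm_sum)
    then have S_le: "norm S \<le> real q" by simp
    define D where "D = real q / norm S"
    have D1: "D \<ge> 1" using S0 S_le by (simp add: D_def)
    define \<psi> where "\<psi> = monom (real a / real q) k"
    have "S = (\<Sum>x\<in>{1..<1 + int q}. expi (poly \<psi> (of_int x)))"
      unfolding S_def
      by (rule sum.reindex_bij_witness[of _ nat int]) (auto simp: \<psi>_def poly_monom)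
    then have "norm (\<Sum>x\<in>{1..<1 + int q}. expi (poly \<psi> (of_int x))) \<ge> real q / D"
      using S0 q by (simp add: D_def)
    from W[OF _ order_refl q D1 this] obtain q' b where q': "1 \<le> q'" "real q' \<le> C * D ^ c"
      and b: "\<bar>real q' * coeff \<psi> k - of_int b\<bar> \<le> C * D ^ c / real q ^ k"
      by (auto simp: \<psi>_def degree_monom_le)
    have q_le: "real q \<le> C * D ^ c"
    proof (cases "q dvd q' * a")
      case True
      then have "q dvd q'" using cop by (simp add: coprime_dvd_mult_left_iff coprime_commute)
      then have "q \<le> q'" using q' by (intro dvd_imp_le) auto
      then show ?thesis using q' by linarith
    next
      case False
      have "int (q' * a) - b * int q \<noteq> 0"
      proof
        assume "int (q' * a) - b * int q = 0"
        then have "int q dvd int (q' * a)" by simp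
        then show False using False by (simp only: int_dvd_int_iff)
      qed
      then have "1 \<le> \<bar>real_of_int (int (q' * a) - b * int q)\<bar>" by linarith
      also have "real_of_int (int (q' * a) - b * int q) = real q * (real q' * coeff \<psi> k - of_int b)"
        using q by (simp add: \<psi>_def field_simps)
      also have "\<bar>\<dots>\<bar> \<le> real q * (C * D ^ c / real q ^ k)"
        unfolding abs_mult abs_of_nat using b by (rule mult_left_mono) simp
      also have "\<dots> = C * D ^ c / real q ^ (k - 1)" using q k by (cases k) auto
      finally have "real q ^ (k - 1) \<le> C * D ^ c" using q by (simp add: le_divide_eq)
      moreover have "real q ^ 1 \<le> real q ^ (k - 1)" using q k by (intro power_increasing) auto
      ultimately show ?thesis unfolding power_one_right by (rule order_trans [rotated])
    qed
    also have "C * D ^ c \<le> C * D ^ c'" using C D1 by (intro mult_left_mono power_increasing) (auto simp: c'_def)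
    also have "\<dots> \<le> C ^ c' * D ^ c'" using C D1 self_le_power[of C c'] by (intro mult_right_mono) (auto simp: c'_def)
    finally have "real q \<le> (C * D) ^ c'" by (simp add: power_mult_distrib)
    then have "real q powr \<delta> \<le> ((C * D) ^ c') powr \<delta>" by (intro powr_mono2) (auto simp: \<delta>_def)
    also have "\<dots> = C * D"
    proof -
      have CD: "C * D > 0" using C D1 by (intro mult_pos_pos) linarith+
      then have "((C * D) ^ c') powr \<delta> = (C * D) powr (real c' * \<delta>)" by (simp only: powr_realpow [symmetric] powr_powr)
      then show ?thesis using CD by (simp add: \<delta>_def c'_def)
    qed
    finally have "real q powr \<delta> * norm (gauss_avg k q a) \<le> C * (D * norm (gauss_avg k q a))"
      by (simp add: mult.assoc [symmetric] mult_right_mono)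
    also have "D * norm (gauss_avg k q a) = 1" using S0 q by (simp add: D_def g)
    finally show ?thesis using q by (simp add: powr_minus field_simps)
  qed
  then show ?thesis using C by (intro exI[of _ C] conjI exI[of _ \<delta>]) (auto simp: \<delta>_def c'_def)
qed

lemma norm_gauss_avg_le_1: "q \<ge> 1 \<Longrightarrow> norm (gauss_avg k q a) \<le> 1"
proof -
  assume q: "q \<ge> 1"
  have "norm (\<Sum>r=1..q. expi (real (a * r ^ k) / real q)) \<le> (\<Sum>r=1..q. norm (expi (real (a * r ^ k) / real q)))"
    by (rule norm_sum)
  then show ?thesis unfolding norm_gauss_avg using q by (simp add: divide_le_eq)
qed

text \<open>
  The weights are the Taylor coefficients of \<open>\<Gamma>(1 + 1/k) (1 - z)\<^bsup>-1/k\<^esup>\<close> rather than the usual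
  \<open>m\<^bsup>1/k - 1\<^esup>/k\<close>, so that the coefficients of the \<open>s\<close>-th power are again explicit.
\<close>

definition wt :: "nat \<Rightarrow> nat \<Rightarrow> real" where
  "wt k m = Gamma (1 + 1 / real k) * (pochhammer (1 / real k) m / fact m)"

lemma wt_pos: "1 \<le> k \<Longrightarrow> 0 < wt k m"
  unfolding wt_def by (intro mult_pos_pos divide_pos_pos Gamma_real_pos pochhammer_pos) (auto intro: add_pos_nonneg)

lemma wt_decreasing: "1 \<le> k \<Longrightarrow> wt k (Suc m) \<le> wt k m"
proof -
  assume k: "1 \<le> k"
  have "wt k (Suc m) = wt k m * ((1 / real k + real m) / (real m + 1))"
    by (simp add: wt_def pochhammer_Suc field_simps)
  also have "\<dots> \<le> wt k m * 1"
    using k wt_pos[OF k, of m] by (intro mult_left_mono) (auto simp: divide_le_eq_1)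
  finally show ?thesis by simp
qed

lemma wt_antimono: "1 \<le> k \<Longrightarrow> m \<le> n \<Longrightarrow> wt k n \<le> wt k m"
  by (rule lift_Suc_antimono_le[of "wt k"]) (auto intro: wt_decreasing)

lemma nonpos_Ints_of_pos: "0 < x \<Longrightarrow> (x :: real) \<notin> \<int>\<^sub>\<le>\<^sub>0"
  by (auto elim!: nonpos_Ints_cases)

text \<open>Log-convexity of Gamma between x and x + 1, together with the functional
  equation.\<close>

lemma Gamma_shift_le:
  fixes x a :: real
  assumes "x > 0" "0 \<le> a" "a \<le> 1"
  shows "Gamma (x + a) \<le> x powr a * Gamma x"
proof -
  have "ln (Gamma ((1 - a) *\<^sub>R x + a *\<^sub>R (x + 1))) \<le> (1 - a) * ln (Gamma x) + a * ln (Gamma (x + 1))"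
    using convex_onD[OF log_convex_Gamma_real, of a x "x + 1"] assms by (simp add: o_def)
  moreover have "(1 - a) *\<^sub>R x + a *\<^sub>R (x + 1) = x + a" by (simp add: algebra_simps)
  moreover have "Gamma (x + 1) = x * Gamma x" using assms by (intro Gamma_plus1) (rule nonpos_Ints_of_pos)
  moreover have G: "Gamma x \<noteq> 0" using Gamma_real_pos[OF assms(1)] by linarith
  then have "ln (x * Gamma x) = ln x + ln (Gamma x)" using assms by (simp add: ln_mult)
  ultimately have "ln (Gamma (x + a)) \<le> a * ln x + ln (Gamma x)" by (simp add: algebra_simps)
  also have "\<dots> = ln (x powr a * Gamma x)" using assms G by (simp add: ln_mult ln_powr)
  finally show ?thesis using assms by (subst (asm) ln_le_cancel_iff) (auto intro!: Gamma_real_pos mult_pos_pos)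
qed

text \<open>Partial summation multiplies the generating function by 1/(1 - z), which changes its
  exponent from -1/k to -1 - 1/k.\<close>

lemma sum_wt: "(\<Sum>m\<le>t. wt k m) = Gamma (1 + 1 / real k) * (pochhammer (1 + 1 / real k) t / fact t)"
proof (induction t)
  case (Suc t)
  define b where "b = 1 / real k"
  define A where "A = pochhammer (1 + b) t / fact t"
  have "pochhammer b (Suc t) / fact (Suc t) = A * (b / (1 + real t))"
    by (simp add: A_def pochhammer_rec ac_simps)
  moreover have "pochhammer (1 + b) (Suc t) / fact (Suc t) = A * ((1 + b + real t) / (1 + real t))"
    by (simp add: A_def pochhammer_Suc)
  moreover have "A * ((1 + b + real t) / (1 + real t)) = A + A * (b / (1 + real t))"
    by (simp add: divide_simps) (simp add: algebra_simps)
  moreover have "(\<Sum>m\<le>Suc t. wt k m) = Gamma (1 + b) * A + Gamma (1 + b) * (pochhammer b (Suc t) / fact (Suc t))"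
    by (simp only: sum.atMost_Suc Suc b_def A_def) (simp only: wt_def)
  ultimately show ?case by (simp only: b_def [symmetric] distrib_left)
qed (simp add: wt_def)

text \<open>This is what the factor Gamma(1 + 1/k) in \<open>wt\<close> achieves: the weights up to
  t add up to t^(1/k) with an error of at most 1, just like the number of k-th powers up to
  t.\<close>

lemma sum_wt_bounds:
  assumes k: "1 \<le> k"
  shows "real t powr (1 / real k) \<le> (\<Sum>m\<le>t. wt k m)" "(\<Sum>m\<le>t. wt k m) \<le> real (t + 1) powr (1 / real k)"
proof -
  define a where "a = 1 / real k"
  have a: "0 < a" "a \<le> 1" using k by (auto simp: a_def)
  have nonint: "1 + a \<notin> \<int>\<^sub>\<le>\<^sub>0" using a by (intro nonpos_Ints_of_pos) simp
  have G: "Gamma (1 + a) \<noteq> 0" using Gamma_real_pos[of "1 + a"] a by linarith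
  have fact: "Gamma (real t + 1) = fact t" using Gamma_fact[of t, where 'a = real] by (simp only: add.commute)
  have sum: "(\<Sum>m\<le>t. wt k m) = Gamma (real t + 1 + a) / fact t"
    using G by (simp add: sum_wt a_def [symmetric] pochhammer_Gamma[OF nonint] add_ac)
  have "Gamma (real t + 1 + a) \<le> real (t + 1) powr a * fact t"
    using Gamma_shift_le[of "real t + 1" a] a by (simp only: fact of_nat_add of_nat_1)
  then show "(\<Sum>m\<le>t. wt k m) \<le> real (t + 1) powr (1 / real k)"
    by (simp add: sum a_def [symmetric] divide_le_eq)
  show "real t powr (1 / real k) \<le> (\<Sum>m\<le>t. wt k m)"
  proof (cases "t = 0")
    case False
    have pos: "real t + a > 0" using a by simp
    have "Gamma ((real t + a) + (1 - a)) \<le> (real t + a) powr (1 - a) * Gamma (real t + a)"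
      using a pos by (intro Gamma_shift_le) auto
    then have "fact t \<le> (real t + a) powr (1 - a) * Gamma (real t + a)" by (simp add: fact)
    then have "(real t + a) powr a * fact t \<le> (real t + a) powr a * ((real t + a) powr (1 - a) * Gamma (real t + a))"
      by (intro mult_left_mono) auto
    also have "\<dots> = (real t + a) * Gamma (real t + a)" using pos by (simp flip: mult.assoc powr_add)
    also have "\<dots> = Gamma (real t + 1 + a)"
      using Gamma_plus1[of "real t + a"] pos by (simp add: add_ac nonpos_Ints_of_pos)
    finally have "(real t + a) powr a \<le> Gamma (real t + 1 + a) / fact t" by (simp add: le_divide_eq)
    moreover have "real t powr a \<le> (real t + a) powr a" using a by (intro powr_mono2) auto
    ultimately show ?thesis by (simp add: sum a_def [symmetric])
  qed (auto intro!: sum_nonneg less_imp_le wt_pos k)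
qed

text \<open>Takes the place of the usual integral of e(\<beta> x^k) over x. It is a trigonometric
  polynomial with the period of the Weyl sum, so the Fourier coefficients of its powers can be
  computed exactly.\<close>

definition sing_sum :: "nat \<Rightarrow> nat \<Rightarrow> real \<Rightarrow> complex" where
  "sing_sum k n \<beta> = (\<Sum>m\<le>n. of_real (wt k m) * expi (\<beta> * real m))"

lemma continuous_on_sing_sum [continuous_intros]:
  "continuous_on A f \<Longrightarrow> continuous_on A (\<lambda>x. sing_sum k n (f x))"
  unfolding sing_sum_def by (intro continuous_intros)

lemma norm_sing_sum_le: "1 \<le> k \<Longrightarrow> norm (sing_sum k n \<beta>) \<le> real (n + 1) powr (1 / real k)"
proof -
  assume k: "1 \<le> k"
  have "norm (sing_sum k n \<beta>) \<le> (\<Sum>m\<le>n. norm (of_real (wt k m) * expi (\<beta> * real m)))"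
    unfolding sing_sum_def by (rule norm_sum)
  also have "\<dots> = (\<Sum>m\<le>n. wt k m)" using wt_pos[OF k] by (simp add: norm_mult less_imp_le abs_of_pos)
  also have "\<dots> \<le> real (n + 1) powr (1 / real k)" by (rule sum_wt_bounds(2)[OF k])
  finally show ?thesis .
qed

lemma Abel_sum_bound:
  fixes w :: "nat \<Rightarrow> real" and z :: "nat \<Rightarrow> complex"
  assumes dec: "\<And>m. w (Suc m) \<le> w m" and nonneg: "\<And>m. 0 \<le> w m"
    and B: "\<And>N. norm (\<Sum>m<N. z m) \<le> B"
  shows "norm (\<Sum>m<N. of_real (w m) * z m) \<le> w 0 * B"
proof (cases N)
  case (Suc N')
  define Z where "Z N = (\<Sum>m<N. z m)" for N
  have B0: "0 \<le> B" using B[of 0] by simp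
  have eq: "(\<Sum>m<Suc N. of_real (w m) * z m) = of_real (w N) * Z (Suc N) + (\<Sum>m<N. of_real (w m - w (Suc m)) * Z (Suc m))" for N
    by (induction N) (auto simp: Z_def algebra_simps)
  have "norm (\<Sum>m<Suc N'. of_real (w m) * z m) \<le> norm (of_real (w N') * Z (Suc N')) + norm (\<Sum>m<N'. of_real (w m - w (Suc m)) * Z (Suc m))"
    unfolding eq by (rule norm_triangle_ineq)
  also have "\<dots> \<le> w N' * B + (\<Sum>m<N'. (w m - w (Suc m)) * B)"
    using dec nonneg B by (intro add_mono order_trans[OF norm_sum] sum_mono)
       (auto simp: norm_mult Z_def simp del: sum.lessThan_Suc simp flip: of_real_diff intro!: mult_left_mono)
  also have "(\<Sum>m<N'. (w m - w (Suc m)) * B) = (w 0 - w N') * B"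
    by (simp only: sum_distrib_right [symmetric] sum_lessThan_telescope')
  also have "w N' * B + (w 0 - w N') * B = w 0 * B" by (simp add: algebra_simps)
  finally show ?thesis by (simp only: Suc)
qed (use nonneg[of 0] order_trans[OF norm_ge_zero B[of 0]] in simp)

text \<open>The sum is cut at M, about 1/|\<beta>|. Below M the trivial bound M^(1/k) has the right
  order. Above M, Abel summation against geometric sums leaves wt k M / |\<beta>|, and monotonicity
  compares M wt k M with the sum of the weights below M.\<close>

lemma norm_sing_sum_decay:
  assumes k: "1 \<le> k" and \<beta>: "\<beta> \<noteq> 0" "\<bar>\<beta>\<bar> \<le> 1 / 2"
  shows "norm (sing_sum k n \<beta>) \<le> 3 * \<bar>\<beta>\<bar> powr (- (1 / real k))"
proof -
  define a where "a = 1 / real k"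
  have a: "0 < a" "a \<le> 1" using k by (auto simp: a_def)
  define M where "M = nat \<lceil>1 / \<bar>\<beta>\<bar>\<rceil>"
  have inv: "1 / \<bar>\<beta>\<bar> \<ge> 2" using \<beta> by (simp add: field_simps)
  have "real M = of_int \<lceil>1 / \<bar>\<beta>\<bar>\<rceil>" using inv by (simp add: M_def)
  then have M: "1 / \<bar>\<beta>\<bar> \<le> real M" "real M \<le> 2 * (1 / \<bar>\<beta>\<bar>)" using inv by linarith+
  then have M1: "M \<ge> 1" using inv by (cases M) auto
  have Ma: "real M powr a \<le> 2 * \<bar>\<beta>\<bar> powr (- a)"
  proof -
    have "real M powr a \<le> (2 * (1 / \<bar>\<beta>\<bar>)) powr a" using M a by (intro powr_mono2) auto
    also have "\<dots> = 2 powr a * \<bar>\<beta>\<bar> powr (- a)" by (simp only: powr_mult powr_divide powr_one_eq_one powr_minus_divide)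
    also have "\<dots> \<le> 2 powr 1 * \<bar>\<beta>\<bar> powr (- a)" using a by (intro mult_right_mono powr_mono) auto
    finally show ?thesis by simp
  qed
  show ?thesis
  proof (cases "n < M")
    case True
    have "norm (sing_sum k n \<beta>) \<le> real (n + 1) powr a" unfolding a_def by (rule norm_sing_sum_le[OF k])
    also have "\<dots> \<le> real M powr a" using True a by (intro powr_mono2) auto
    also have "\<dots> \<le> 3 * \<bar>\<beta>\<bar> powr (- a)" using Ma powr_ge_zero[of "\<bar>\<beta>\<bar>" "- a"] by linarith
    finally show ?thesis by (simp add: a_def)
  next
    case False
    define N where "N = Suc n - M"
    have "sing_sum k n \<beta> = (\<Sum>m<M + N. of_real (wt k m) * expi (\<beta> * real m))"
      unfolding sing_sum_def using False by (intro sum.cong) (auto simp: N_def)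
    also have "\<dots> = (\<Sum>m<M. of_real (wt k m) * expi (\<beta> * real m)) + (\<Sum>m<N. of_real (wt k (M + m)) * expi (\<beta> * real (M + m)))"
      by (induction N) (simp_all add: add.assoc)
    finally have split: "sing_sum k n \<beta> = (\<Sum>m<M. of_real (wt k m) * expi (\<beta> * real m)) +
       (\<Sum>m<N. of_real (wt k (M + m)) * expi (\<beta> * real (M + m)))" .
    have sum_M: "(\<Sum>m<M. wt k m) \<le> real M powr a"
      using sum_wt_bounds(2)[OF k, of "M - 1"] M1 by (simp add: a_def lessThan_Suc_atMost [symmetric])
    have "norm (\<Sum>m<M. of_real (wt k m) * expi (\<beta> * real m)) \<le> (\<Sum>m<M. norm (of_real (wt k m) * expi (\<beta> * real m)))"
      by (rule norm_sum)
    also have "\<dots> = (\<Sum>m<M. wt k m)" using wt_pos[OF k] by (simp add: norm_mult less_imp_le abs_of_pos)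
    finally have first: "norm (\<Sum>m<M. of_real (wt k m) * expi (\<beta> * real m)) \<le> 2 * \<bar>\<beta>\<bar> powr (- a)"
      using sum_M Ma by linarith
    have geo: "norm (\<Sum>m<N. expi (\<beta> * real (M + m))) \<le> 1 / (2 * \<bar>\<beta>\<bar>)" for N
    proof -
      have "(\<Sum>m<N. expi (\<beta> * real (M + m))) * (expi \<beta> - 1) = expi (\<beta> * real (M + N)) - expi (\<beta> * real M)"
        by (induction N) (auto simp: algebra_simps expi_add)
      then have "norm (\<Sum>m<N. expi (\<beta> * real (M + m))) * norm (expi \<beta> - 1) = norm (expi (\<beta> * real (M + N)) - expi (\<beta> * real M))"
        by (metis norm_mult)
      also have "\<dots> \<le> 2" by (rule order_trans[OF norm_triangle_ineq4]) simp
      finally have "norm (\<Sum>m<N. expi (\<beta> * real (M + m))) * norm (expi \<beta> - 1) \<le> 2" .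
      moreover have "norm (\<Sum>m<N. expi (\<beta> * real (M + m))) * (4 * \<bar>\<beta>\<bar>) \<le> norm (\<Sum>m<N. expi (\<beta> * real (M + m))) * norm (expi \<beta> - 1)"
        by (intro mult_left_mono norm_expi_minus_1 \<beta>) auto
      ultimately have "norm (\<Sum>m<N. expi (\<beta> * real (M + m))) * (4 * \<bar>\<beta>\<bar>) \<le> 2" by linarith
      then show ?thesis using \<beta> by (simp add: field_simps)
    qed
    have "norm (\<Sum>m<N. of_real (wt k (M + m)) * expi (\<beta> * real (M + m))) \<le> wt k (M + 0) * (1 / (2 * \<bar>\<beta>\<bar>))"
      using wt_decreasing[OF k] wt_pos[OF k] geo
      by (intro Abel_sum_bound[where w = "\<lambda>m. wt k (M + m)"]) (auto intro: less_imp_le)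
    also have "\<dots> \<le> \<bar>\<beta>\<bar> powr (- a)"
    proof -
      have "real M * wt k M = (\<Sum>m<M. wt k M)" by simp
      also have "\<dots> \<le> (\<Sum>m<M. wt k m)" by (intro sum_mono wt_antimono k) auto
      finally have "real M * wt k M \<le> 2 * \<bar>\<beta>\<bar> powr (- a)" using sum_M Ma by linarith
      moreover have "1 / \<bar>\<beta>\<bar> * wt k M \<le> real M * wt k M" using M wt_pos[OF k, of M] by (intro mult_right_mono) auto
      ultimately show ?thesis by simp
    qed
    finally have second: "norm (\<Sum>m<N. of_real (wt k (M + m)) * expi (\<beta> * real (M + m))) \<le> \<bar>\<beta>\<bar> powr (- a)" .
    show ?thesis unfolding split using norm_triangle_mono[OF first second] by (simp add: a_def)
  qed
qed

lemma Abel_expi_bound: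
  fixes c :: "nat \<Rightarrow> complex"
  assumes B: "\<And>M. M \<le> n \<Longrightarrow> norm (\<Sum>m\<le>M. c m) \<le> B"
  shows "norm (\<Sum>m\<le>n. c m * expi (\<beta> * real m)) \<le> B * (1 + 2 * pi * real n * \<bar>\<beta>\<bar>)"
proof -
  define Z where "Z M = (\<Sum>m\<le>M. c m)" for M
  have eq: "(\<Sum>m\<le>M. c m * expi (\<beta> * real m)) =
      Z M * expi (\<beta> * real M) - (\<Sum>m<M. Z m * (expi (\<beta> * real (Suc m)) - expi (\<beta> * real m)))" for M
    by (induction M) (auto simp: Z_def algebra_simps)
  have "norm (\<Sum>m\<le>n. c m * expi (\<beta> * real m)) \<le>
      norm (Z n * expi (\<beta> * real n)) + norm (\<Sum>m<n. Z m * (expi (\<beta> * real (Suc m)) - expi (\<beta> * real m)))"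
    unfolding eq by (rule norm_triangle_ineq4)
  also have "norm (Z n * expi (\<beta> * real n)) \<le> B" using B[of n] by (simp add: norm_mult Z_def)
  also have "norm (\<Sum>m<n. Z m * (expi (\<beta> * real (Suc m)) - expi (\<beta> * real m))) \<le>
      (\<Sum>m<n. B * (2 * pi * \<bar>\<beta>\<bar>))"
  proof (intro order_trans[OF norm_sum] sum_mono)
    fix m assume "m \<in> {..<n}"
    then have "norm (Z m) \<le> B" using B[of m] by (simp add: Z_def)
    moreover have "0 \<le> B" using order_trans[OF norm_ge_zero B[of 0]] by simp
    moreover have "norm (expi (\<beta> * real (Suc m)) - expi (\<beta> * real m)) \<le> 2 * pi * \<bar>\<beta> * real (Suc m) - \<beta> * real m\<bar>"
      by (rule norm_expi_diff_le)
    moreover have "\<beta> * real (Suc m) - \<beta> * real m = \<beta>" by (simp add: algebra_simps)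
    ultimately show "norm (Z m * (expi (\<beta> * real (Suc m)) - expi (\<beta> * real m))) \<le> B * (2 * pi * \<bar>\<beta>\<bar>)"
      unfolding norm_mult by (intro mult_mono) auto
  qed
  finally show ?thesis by (simp add: algebra_simps)
qed

text \<open>Complete periods cancel; the incomplete one and the matching multiple of the mean are
  each at most q.\<close>

lemma norm_periodic_sum_diff_le:
  fixes g :: "nat \<Rightarrow> complex"
  assumes q: "1 \<le> q" and per: "\<And>x. g (x + q) = g x" and g: "\<And>x. norm (g x) \<le> 1"
  shows "norm ((\<Sum>x=1..y. g x) - of_nat y * (inverse (of_nat q) * (\<Sum>r=1..q. g r))) \<le> 2 * real q"
proof -
  define S where "S = (\<Sum>r=1..q. g r)"
  have S_norm: "norm S \<le> real q"
    unfolding S_def using sum_norm_le[of "{1..q}" g "\<lambda>_. 1"] g by auto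
  have per': "g (x + t * q) = g x" for x t
    by (induction t) (use per[of "x + _ * q"] in \<open>auto simp: add.assoc [symmetric] add.commute[of q]\<close>)
  have sum_add: "(\<Sum>x=1..t * q + m. g x) = (\<Sum>x=1..t * q. g x) + (\<Sum>x=1..m. g x)" for t m
    by (induction m) (use per'[of "Suc _" t] in \<open>auto simp: add.commute[of "t * q"]\<close>)
  have blocks: "(\<Sum>x=1..t * q. g x) = of_nat t * S" for t
  proof (induction t)
    case (Suc t)
    then show ?case using sum_add[of t q] by (simp add: S_def algebra_simps)
  qed simp
  define m where "m = y mod q"
  have y: "y = (y div q) * q + m" by (simp add: m_def)
  have m: "m \<le> q" using q by (simp add: m_def less_imp_le)
  have "(\<Sum>x=1..y. g x) = of_nat (y div q) * S + (\<Sum>x=1..m. g x)"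
    by (subst y) (simp only: sum_add blocks)
  moreover have "of_nat y * (inverse (of_nat q) * S) = of_nat (y div q) * S + of_nat m * (inverse (of_nat q) * S)"
  proof -
    have "of_nat y = (of_nat (y div q) * of_nat q + of_nat m :: complex)"
      by (subst (1) y) (simp only: of_nat_add of_nat_mult)
    then show ?thesis using q by (simp add: field_simps)
  qed
  ultimately have "norm ((\<Sum>x=1..y. g x) - of_nat y * (inverse (of_nat q) * S)) =
      norm ((\<Sum>x=1..m. g x) - of_nat m * (inverse (of_nat q) * S))" by (simp add: algebra_simps)
  also have "\<dots> \<le> norm (\<Sum>x=1..m. g x) + norm (of_nat m * (inverse (of_nat q) * S))"
    by (rule norm_triangle_ineq4)
  also have "norm (\<Sum>x=1..m. g x) \<le> real m"
    using sum_norm_le[of "{1..m}" g "\<lambda>_. 1"] g by auto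
  also have "norm (of_nat m * (inverse (of_nat q) * S)) \<le> real m * (inverse (real q) * real q)"
    unfolding norm_mult norm_inverse norm_of_nat using S_norm by (intro mult_left_mono) auto
  finally show ?thesis using m q by (simp add: S_def)
qed

lemma nat_root_bracket:
  fixes m P :: nat
  assumes k: "1 \<le> k" and m: "m < (P + 1) ^ k"
  obtains y where "y \<le> P" "y ^ k \<le> m" "m < (y + 1) ^ k"
proof -
  define y where "y = (LEAST y. m < (y + 1) ^ k)"
  have "m < (y + 1) ^ k" unfolding y_def using m by (rule LeastI)
  moreover have "y \<le> P" unfolding y_def using m by (rule Least_le)
  moreover have "y ^ k \<le> m"
  proof (cases y)
    case 0
    then show ?thesis using k by (simp add: power_0_left)
  next
    case (Suc y')
    then have "\<not> m < (y' + 1) ^ k" using not_less_Least[of y' "\<lambda>y. m < (y + 1) ^ k"] by (simp add: y_def)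
    then show ?thesis using Suc by simp
  qed
  ultimately show ?thesis using that by blast
qed

lemma sum_group_le:
  fixes f :: "'a \<Rightarrow> nat" and g :: "'a \<Rightarrow> 'b::comm_monoid_add"
  assumes "finite X"
  shows "(\<Sum>m\<le>M. \<Sum>x\<in>{x. x \<in> X \<and> f x = m}. g x) = (\<Sum>x\<in>{x \<in> X. f x \<le> M}. g x)"
proof -
  define Y where "Y = {x \<in> X. f x \<le> M}"
  have "(\<Sum>x\<in>Y. g x) = (\<Sum>m\<le>M. \<Sum>x\<in>{x. x \<in> Y \<and> f x = m}. g x)"
    using assms by (intro sum.group[symmetric]) (auto simp: Y_def)
  also have "\<dots> = (\<Sum>m\<le>M. \<Sum>x\<in>{x. x \<in> X \<and> f x = m}. g x)"
  proof (intro sum.cong refl)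
    fix m assume "m \<in> {..M}"
    then show "{x. x \<in> Y \<and> f x = m} = {x. x \<in> X \<and> f x = m}" by (auto simp: Y_def)
  qed
  finally show ?thesis unfolding Y_def by (rule sym)
qed

text \<open>At \<beta> = 0 the comparison is between counting functions: cut at m \<le> M, the Weyl
  sum has mean \<open>gauss_avg\<close> per term up to 2q, and the weights add up to the number y of
  k-th powers up to 1. Abel summation then restores \<beta> at the cost of the factor 1 + 2 pi
  n|\<beta>|.\<close>

lemma weyl_sum_major_arc:
  assumes k: "1 \<le> k" and q: "1 \<le> q" and P: "P ^ k \<le> n" "n < (P + 1) ^ k"
  shows "norm (weyl_sum k P (real a / real q + \<beta>) - gauss_avg k q a * sing_sum k n \<beta>)
         \<le> 3 * real q * (1 + 2 * pi * real n * \<bar>\<beta>\<bar>)"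
proof -
  define g where "g x = expi (real (a * x ^ k) / real q)" for x
  define A where "A m = {x. x \<in> {1..P} \<and> x ^ k = m}" for m
  define c where "c m = (\<Sum>x\<in>A m. g x) - gauss_avg k q a * of_real (wt k m)" for m
  have img: "(\<lambda>x. x ^ k) ` {1..P} \<subseteq> {..n}" using P(1) power_mono[of _ P k] by (fastforce intro: order_trans)
  have "weyl_sum k P (real a / real q + \<beta>) = (\<Sum>x=1..P. g x * expi (\<beta> * real (x ^ k)))"
    unfolding weyl_sum_def g_def expi_add [symmetric] by (intro sum.cong refl arg_cong[of _ _ expi]) (simp add: field_simps)
  also have "\<dots> = (\<Sum>m\<le>n. \<Sum>x\<in>A m. g x * expi (\<beta> * real (x ^ k)))"
    unfolding A_def by (rule sum.group[symmetric]) (use img in auto)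
  also have "\<dots> = (\<Sum>m\<le>n. (\<Sum>x\<in>A m. g x) * expi (\<beta> * real m))"
    unfolding sum_distrib_right by (intro sum.cong refl) (auto simp: A_def)
  finally have "weyl_sum k P (real a / real q + \<beta>) - gauss_avg k q a * sing_sum k n \<beta> = (\<Sum>m\<le>n. c m * expi (\<beta> * real m))"
    by (simp only: c_def sing_sum_def sum_distrib_left sum_subtractf [symmetric] left_diff_distrib mult.assoc)
  also have "norm \<dots> \<le> 3 * real q * (1 + 2 * pi * real n * \<bar>\<beta>\<bar>)"
  proof (rule Abel_expi_bound)
    fix M assume M: "M \<le> n"
    then have "M < (P + 1) ^ k" using P(2) by simp
    then obtain y where y: "y \<le> P" "y ^ k \<le> M" "M < (y + 1) ^ k" by (rule nat_root_bracket[OF k])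
    have iff: "x ^ k \<le> M \<longleftrightarrow> x \<le> y" for x
    proof
      assume "x ^ k \<le> M"
      then have "x ^ k < (y + 1) ^ k" using y by simp
      then have "x < y + 1" by (rule power_less_imp_less_base) simp
      then show "x \<le> y" by simp
    next
      assume "x \<le> y"
      then have "x ^ k \<le> y ^ k" by (rule power_mono) simp
      then show "x ^ k \<le> M" using y(2) by (rule order_trans)
    qed
    have sub: "{x \<in> {1..P}. x ^ k \<le> M} = {1..y}" unfolding iff using y(1) by auto
    have part: "(\<Sum>m\<le>M. \<Sum>x\<in>A m. g x) = (\<Sum>x=1..y. g x)"
      unfolding A_def sum_group_le[OF finite_atLeastAtMost] sub ..
    have "(\<Sum>m\<le>M. c m) = ((\<Sum>x=1..y. g x) - of_nat y * gauss_avg k q a) - gauss_avg k q a * of_real ((\<Sum>m\<le>M. wt k m) - real y)"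
    proof -
      have "(\<Sum>m\<le>M. c m) = (\<Sum>m\<le>M. \<Sum>x\<in>A m. g x) - gauss_avg k q a * of_real (\<Sum>m\<le>M. wt k m)"
        unfolding c_def by (simp only: sum_subtractf sum_distrib_left of_real_sum)
      then show ?thesis unfolding part of_real_diff of_real_of_nat_eq by (simp only: right_diff_distrib mult.commute diff_diff_eq2 diff_add_cancel)
    qed
    also have "norm \<dots> \<le> norm ((\<Sum>x=1..y. g x) - of_nat y * gauss_avg k q a) + norm (gauss_avg k q a * of_real ((\<Sum>m\<le>M. wt k m) - real y))"
      by (rule norm_triangle_ineq4)
    also have "norm ((\<Sum>x=1..y. g x) - of_nat y * gauss_avg k q a) \<le> 2 * real q"
      unfolding gauss_avg_def g_def
    proof (rule norm_periodic_sum_diff_le[OF q])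
      fix x
      have "int q dvd int (a * (x + q) ^ k) - int (a * x ^ k)"
      proof -
        have "(int x + int q) ^ k - int x ^ k = (int x + int q - int x) * (\<Sum>i<k. int x ^ (k - Suc i) * (int x + int q) ^ i)"
          by (rule power_diff_sumr2)
        then have "int (a * (x + q) ^ k) - int (a * x ^ k) = int q * (int a * (\<Sum>i<k. int x ^ (k - Suc i) * (int x + int q) ^ i))"
          by (simp add: right_diff_distrib [symmetric])
        then show ?thesis by (rule dvdI)
      qed
      then have "expi (of_int (int (a * (x + q) ^ k)) / real q) = expi (of_int (int (a * x ^ k)) / real q)"
        using q by (intro expi_cong_mod) auto
      then show "expi (real (a * (x + q) ^ k) / real q) = expi (real (a * x ^ k) / real q)"
        by (simp only: of_int_of_nat_eq)
    qed simp
    also have "norm (gauss_avg k q a * of_real ((\<Sum>m\<le>M. wt k m) - real y)) \<le> 1 * 1"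
    proof -
      have root: "real (x ^ k) powr (1 / real k) = real x" for x
        using k by (cases "x = 0") (auto simp: powr_realpow [symmetric] powr_powr)
      have "real y \<le> real M powr (1 / real k)"
        unfolding root[of y, symmetric] using y by (intro powr_mono2) auto
      moreover have "real (M + 1) powr (1 / real k) \<le> real ((y + 1) ^ k) powr (1 / real k)"
        using y by (intro powr_mono2 of_nat_mono) auto
      ultimately have "\<bar>(\<Sum>m\<le>M. wt k m) - real y\<bar> \<le> 1"
        using sum_wt_bounds[OF k, of M] unfolding root by simp
      then show ?thesis
        unfolding norm_mult norm_of_real using norm_gauss_avg_le_1[OF q] by (intro mult_mono) auto
    qed
    finally show "norm (\<Sum>m\<le>M. c m) \<le> 3 * real q" using q by simp
  qed
  finally show ?thesis .
qed

section \<open>Representation counts and the singular integral as Fourier coefficients\<close>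

lemma rep_count_0: "rep_count 0 k n = (if n = 0 then 1 else 0)"
proof -
  have "{xs :: nat list. length xs = 0 \<and> (\<forall>x\<in>set xs. 0 < x) \<and> (\<Sum>x\<leftarrow>xs. x ^ k) = n} = (if n = 0 then {[]} else {})"
    by auto
  then show ?thesis unfolding rep_count_def by simp
qed

lemma rep_count_Suc:
  assumes k: "1 \<le> k" and P: "n < (P + 1) ^ k"
  shows "rep_count (Suc s) k n = (\<Sum>x=1..P. if x ^ k \<le> n then rep_count s k (n - x ^ k) else 0)"
proof -
  define R where "R s n = {xs :: nat list. length xs = s \<and> (\<forall>x\<in>set xs. 0 < x) \<and> (\<Sum>x\<leftarrow>xs. x ^ k) = n}" for s n
  have fin: "finite (R s n)" for s n
  proof (rule finite_subset)
    show "R s n \<subseteq> {xs. set xs \<subseteq> {..n} \<and> length xs = s}"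
    proof
      fix xs assume xs: "xs \<in> R s n"
      have "x \<le> n" if "x \<in> set xs" for x
      proof -
        have "x \<le> x ^ k" using k by (cases "x = 0") (auto intro: self_le_power)
        also have "\<dots> \<le> (\<Sum>x\<leftarrow>xs. x ^ k)" using that by (intro member_le_sum_list) auto
        finally show ?thesis using xs by (simp add: R_def)
      qed
      then show "xs \<in> {xs. set xs \<subseteq> {..n} \<and> length xs = s}" using xs by (auto simp: R_def)
    qed
  qed (rule finite_lists_length_eq, simp)
  define I where "I = {x \<in> {1..P}. x ^ k \<le> n}"
  have "R (Suc s) n = (\<Union>x\<in>I. (#) x ` R s (n - x ^ k))"
  proof (intro equalityI subsetI)
    fix xs assume "xs \<in> R (Suc s) n"
    then obtain x ys where xs: "xs = x # ys" and x: "0 < x" "x ^ k + (\<Sum>x\<leftarrow>ys. x ^ k) = n"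
      and ys: "length ys = s" "\<forall>x\<in>set ys. 0 < x"
      by (cases xs) (auto simp: R_def)
    have "x ^ k < (P + 1) ^ k" using x(2) P by simp
    then have "x < P + 1" by (rule power_less_imp_less_base) simp
    then have "x \<in> I" using x by (auto simp: I_def)
    moreover have "ys \<in> R s (n - x ^ k)" using x ys by (auto simp: R_def)
    ultimately show "xs \<in> (\<Union>x\<in>I. (#) x ` R s (n - x ^ k))" using xs by blast
  qed (auto simp: R_def I_def)
  then have "rep_count (Suc s) k n = card (\<Union>x\<in>I. (#) x ` R s (n - x ^ k))" by (simp add: rep_count_def R_def)
  also have "\<dots> = (\<Sum>x\<in>I. card ((#) x ` R s (n - x ^ k)))"
    by (intro card_UN_disjoint) (auto simp: I_def fin)
  also have "\<dots> = (\<Sum>x\<in>I. rep_count s k (n - x ^ k))"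
    by (intro sum.cong refl) (auto simp: card_image rep_count_def R_def)
  also have "\<dots> = (\<Sum>x=1..P. if x ^ k \<le> n then rep_count s k (n - x ^ k) else 0)"
    unfolding I_def by (rule sum.inter_filter) simp
  finally show ?thesis .
qed

lemma coeff_power_sum_eq_rep_count:
  assumes k: "1 \<le> k" and P: "n < (P + 1) ^ k"
  shows "coeff ((\<Sum>x=1..P. monom (1::complex) (x ^ k)) ^ s) n = of_nat (rep_count s k n)"
  using P
proof (induction s arbitrary: n)
  case (Suc s)
  have "coeff ((\<Sum>x=1..P. monom (1::complex) (x ^ k)) ^ Suc s) n =
      (\<Sum>x=1..P. coeff (monom 1 (x ^ k) * (\<Sum>x=1..P. monom (1::complex) (x ^ k)) ^ s) n)"
    by (simp only: power_Suc sum_distrib_right coeff_sum)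
  also have "\<dots> = (\<Sum>x=1..P. of_nat (if x ^ k \<le> n then rep_count s k (n - x ^ k) else 0))"
  proof (intro sum.cong refl)
    fix x
    have "n - x ^ k < (P + 1) ^ k" using Suc.prems by (rule order.strict_trans1[OF diff_le_self])
    then show "coeff (monom 1 (x ^ k) * (\<Sum>x=1..P. monom (1::complex) (x ^ k)) ^ s) n =
        of_nat (if x ^ k \<le> n then rep_count s k (n - x ^ k) else 0)"
      by (simp only: coeff_monom_mult Suc.IH) (simp add: not_le)
  qed
  finally show ?case by (simp only: rep_count_Suc[OF k Suc.prems] of_nat_sum)
qed (simp add: rep_count_0)

text \<open>The \<open>s\<close>-th power of (1 - z)^(-1/k) is (1 - z)^(-s/k). Truncation at N
  leaves the coefficients up to N intact, and the Cauchy product is Vandermonde's identity for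
  \<open>pochhammer\<close>.\<close>

lemma coeff_power_sum_wt:
  assumes N: "n \<le> N"
  shows "coeff ((\<Sum>m\<le>N. monom (complex_of_real (wt k m)) m) ^ s) n =
    of_real (Gamma (1 + 1 / real k) ^ s * (pochhammer (real s / real k) n / fact n))"
  using N
proof (induction s arbitrary: n)
  case 0
  then show ?case by (cases n) (auto simp: pochhammer_0_left)
next
  case (Suc s)
  define a where "a = 1 / real k"
  define G where "G = Gamma (1 + a)"
  define F where "F = (\<Sum>m\<le>N. monom (complex_of_real (wt k m)) m)"
  have F: "coeff F i = of_real (wt k i)" if "i \<le> N" for i
    using that by (simp add: F_def coeff_sum)
  have "coeff (F ^ Suc s) n = (\<Sum>i\<le>n. of_real (wt k i) * of_real (G ^ s * (pochhammer (real s / real k) (n - i) / fact (n - i))))"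
    unfolding power_Suc coeff_mult
  proof (intro sum.cong refl)
    fix i assume "i \<in> {..n}"
    then have "i \<le> N" "n - i \<le> N" using Suc.prems by auto
    then show "coeff F i * coeff (F ^ s) (n - i) = of_real (wt k i) * of_real (G ^ s * (pochhammer (real s / real k) (n - i) / fact (n - i)))"
      using Suc.IH[of "n - i"] F[of i] by (simp only: F_def G_def a_def)
  qed
  also have "\<dots> = of_real (\<Sum>i\<le>n. wt k i * (G ^ s * (pochhammer (real s / real k) (n - i) / fact (n - i))))"
    by (simp only: of_real_sum of_real_mult)
  also have "(\<Sum>i\<le>n. wt k i * (G ^ s * (pochhammer (real s / real k) (n - i) / fact (n - i)))) =
      G ^ Suc s * ((\<Sum>i\<le>n. of_nat (n choose i) * pochhammer a i * pochhammer (real s / real k) (n - i)) / fact n)"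
    unfolding sum_divide_distrib sum_distrib_left
    by (intro sum.cong refl) (auto simp: wt_def G_def a_def binomial_fact)
  also have "(\<Sum>i\<le>n. of_nat (n choose i) * pochhammer a i * pochhammer (real s / real k) (n - i)) = pochhammer (real (Suc s) / real k) n"
    unfolding pochhammer_binomial_sum [symmetric] a_def by (simp add: add_divide_distrib)
  finally show ?case by (simp only: F_def G_def a_def)
qed

lemma integral_expi_int:
  "((\<lambda>\<alpha>. expi (of_int j * \<alpha>)) has_integral (if j = 0 then 1 else 0)) {u..u + 1}"
proof (cases "j = 0")
  case True
  then show ?thesis using has_integral_const_real[of "1::complex" u "u + 1"] by (simp add: expi_def)
next
  case False
  define w where "w = 2 * of_real pi * \<i> * complex_of_int j"
  have w: "w \<noteq> 0" using False by (simp add: w_def)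
  have e: "expi (of_int j * \<alpha>) = exp (w * of_real \<alpha>)" for \<alpha> by (simp add: expi_def w_def mult_ac)
  have "((\<lambda>\<alpha>. exp (w * of_real \<alpha>)) has_integral (exp (w * of_real (u + 1)) / w - exp (w * of_real u) / w)) {u..u + 1}"
  proof (rule fundamental_theorem_of_calculus)
    fix x
    have "((\<lambda>z. exp (w * z) / w) has_field_derivative exp (w * of_real x)) (at (of_real x))"
      using w by (auto intro!: derivative_eq_intros)
    then show "((\<lambda>\<alpha>. exp (w * of_real \<alpha>) / w) has_vector_derivative exp (w * of_real x)) (at x within {u..u + 1})"
      by (rule has_vector_derivative_real_field)
  qed simp
  moreover have "exp (w * of_real (u + 1)) = exp (w * of_real u)"
    using expi_of_int[of j] unfolding e[symmetric] distrib_left mult_1_right expi_add by simp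
  ultimately show ?thesis using False by (simp add: e)
qed

lemma integral_poly_expi:
  "((\<lambda>\<alpha>. poly F (expi \<alpha>) * expi (- (real n * \<alpha>))) has_integral coeff F n) {u..u + 1}"
proof -
  have "((\<lambda>\<alpha>. \<Sum>i\<le>degree F. coeff F i * expi (of_int (int i - int n) * \<alpha>)) has_integral
      (\<Sum>i\<le>degree F. coeff F i * (if int i - int n = 0 then 1 else 0))) {u..u + 1}"
    by (intro has_integral_sum has_integral_mult_right integral_expi_int) auto
  moreover have "(\<Sum>i\<le>degree F. coeff F i * (if int i - int n = 0 then 1 else 0)) = coeff F n"
    by (cases "n \<le> degree F") (auto simp: coeff_eq_0 of_nat_eq_iff if_distrib cong: if_cong)
  moreover have "coeff F i * expi (of_int (int i - int n) * \<alpha>) = coeff F i * expi \<alpha> ^ i * expi (- (real n * \<alpha>))" for i \<alpha>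
    unfolding expi_power mult.assoc expi_add [symmetric] by (simp add: algebra_simps)
  ultimately show ?thesis by (simp only: poly_altdef sum_distrib_right)
qed

lemma integral_weyl_sum_power:
  assumes k: "1 \<le> k" and P: "n < (P + 1) ^ k"
  shows "((\<lambda>\<alpha>. weyl_sum k P \<alpha> ^ s * expi (- (real n * \<alpha>))) has_integral of_nat (rep_count s k n)) {u..u + 1}"
proof -
  have "weyl_sum k P \<alpha> = poly (\<Sum>x=1..P. monom 1 (x ^ k)) (expi \<alpha>)" for \<alpha>
    by (simp add: weyl_sum_def poly_sum poly_monom expi_power mult.commute)
  then show ?thesis
    using integral_poly_expi[of "(\<Sum>x=1..P. monom 1 (x ^ k)) ^ s" n u]
    by (simp only: poly_power coeff_power_sum_eq_rep_count[OF k P])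
qed

lemma integral_sing_sum_power:
  "((\<lambda>\<beta>. sing_sum k n \<beta> ^ s * expi (- (real n * \<beta>))) has_integral
     of_real (Gamma (1 + 1 / real k) ^ s * (pochhammer (real s / real k) n / fact n))) {u..u + 1}"
proof -
  have "sing_sum k n \<beta> = poly (\<Sum>m\<le>n. monom (complex_of_real (wt k m)) m) (expi \<beta>)" for \<beta>
    by (simp add: sing_sum_def poly_sum poly_monom expi_power mult.commute)
  then show ?thesis
    using integral_poly_expi[of "(\<Sum>m\<le>n. monom (complex_of_real (wt k m)) m) ^ s" n u]
    by (simp only: poly_power coeff_power_sum_wt[OF order_refl])
qed

text \<open>The limit formula for 1/Gamma: \<open>rGamma_series\<close> has one more Pochhammer
  factor z + n, and n^z in place of n^(z-1); the quotient n/(z + n), which tends to 1, corrects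
  both.\<close>

lemma pochhammer_div_fact_asymp:
  fixes z :: real
  assumes z: "z > 0"
  shows "(\<lambda>n. pochhammer z n / fact n / real n powr (z - 1)) \<longlonglongrightarrow> 1 / Gamma z"
proof -
  have "(\<lambda>n. rGamma_series z n * (real n / (z + real n))) \<longlonglongrightarrow> rGamma z * 1"
  proof (intro tendsto_mult rGamma_series_LIMSEQ)
    have "(\<lambda>n. 1 - z / (z + real n)) \<longlonglongrightarrow> 1 - 0"
      by (intro tendsto_diff tendsto_const tendsto_divide_0[OF tendsto_const] filterlim_at_top_imp_at_infinity
          filterlim_tendsto_add_at_top[OF tendsto_const] filterlim_real_sequentially)
    moreover have "1 - z / (z + real n) = real n / (z + real n)" for n using z by (simp add: field_simps)
    ultimately show "(\<lambda>n. real n / (z + real n)) \<longlonglongrightarrow> 1" by simp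
  qed
  moreover have "\<forall>\<^sub>F n in sequentially. rGamma_series z n * (real n / (z + real n)) = pochhammer z n / fact n / real n powr (z - 1)"
    using eventually_gt_at_top[of 0]
  proof eventually_elim
    case (elim n)
    have "exp (z * ln (real n)) = real n powr (z - 1) * real n"
      using elim powr_add[of "real n" "z - 1" 1] by (simp add: powr_def)
    moreover have "pochhammer z (n + 1) = pochhammer z n * (z + real n)" by (simp add: pochhammer_Suc)
    ultimately have "rGamma_series z n = (pochhammer z n * (z + real n)) / (fact n * (real n powr (z - 1) * real n))"
      unfolding rGamma_series_def by simp
    moreover have "z + real n \<noteq> 0" "real n \<noteq> 0" "real n powr (z - 1) \<noteq> 0" using elim z by auto
    ultimately show ?case by simp
  qed
  ultimately show ?thesis by (simp add: Gamma_def divide_inverse tendsto_cong)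
qed

section \<open>The singular series\<close>

text \<open>Numerators run from 1 to q, so the fractions lie in (0, 1] and the arc at 0 is
  represented by the one at 1/1.\<close>

definition farey :: "nat \<Rightarrow> (nat \<times> nat) set" where
  "farey Q = (SIGMA q:{1..Q}. {a \<in> {1..q}. coprime a q})"

lemma finite_farey [simp]: "finite (farey Q)"
  by (simp add: farey_def)

lemma farey_separation:
  assumes "(q, a) \<in> farey Q" "(q', a') \<in> farey Q" "(q, a) \<noteq> (q', a')"
  shows "1 / real Q ^ 2 \<le> \<bar>real a / real q - real a' / real q'\<bar>"
proof -
  have q: "1 \<le> q" "q \<le> Q" "1 \<le> q'" "q' \<le> Q" and cop: "coprime a q" "coprime a' q'"
    using assms by (auto simp: farey_def)
  have "a * q' \<noteq> a' * q"
  proof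
    assume eq: "a * q' = a' * q"
    then have "q dvd q'" using cop by (metis coprime_commute coprime_dvd_mult_right_iff dvd_triv_right)
    moreover have "q' dvd q" using cop eq by (metis coprime_commute coprime_dvd_mult_right_iff dvd_triv_right)
    ultimately have "q = q'" by (rule dvd_antisym)
    then show False using eq q assms(3) by simp
  qed
  then have "int (a * q') - int (a' * q) \<noteq> 0" by linarith
  then have "1 \<le> \<bar>real_of_int (int (a * q') - int (a' * q))\<bar>" by linarith
  also have "real_of_int (int (a * q') - int (a' * q)) = (real a / real q - real a' / real q') * (real q * real q')"
    using q by (simp add: field_simps)
  also have "\<bar>\<dots>\<bar> = \<bar>real a / real q - real a' / real q'\<bar> * (real q * real q')" by (simp add: abs_mult)
  also have "\<dots> \<le> \<bar>real a / real q - real a' / real q'\<bar> * (real Q * real Q)"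
    using q by (intro mult_left_mono mult_mono) auto
  finally show ?thesis using q by (simp add: divide_le_eq power2_eq_square)
qed

definition farey_arc :: "real \<Rightarrow> nat \<times> nat \<Rightarrow> real set" where
  "farey_arc \<delta> = (\<lambda>(q, a). {real a / real q - \<delta>..real a / real q + \<delta>})"

text \<open>The period is moved by 2\<delta> so that no arc wraps around: every centre is at least
  1/Q, which is at least 3\<delta>, and at most 1.\<close>

lemma arc_subset:
  assumes \<delta>: "0 \<le> \<delta>" "3 * \<delta> * real Q ^ 2 < 1" and i: "i \<in> farey Q"
  shows "farey_arc \<delta> i \<subseteq> {2 * \<delta>..1 + 2 * \<delta>}"
proof -
  obtain q a where qa: "i = (q, a)" "1 \<le> q" "q \<le> Q" "1 \<le> a" "a \<le> q" using i by (auto simp: farey_def)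
  have Q: "1 \<le> real Q" using qa by simp
  have "3 * \<delta> * real Q \<le> 3 * \<delta> * real Q ^ 2"
    using Q \<delta>(1) self_le_power[of "real Q" 2] by (intro mult_left_mono) auto
  then have "3 * \<delta> * real Q < 1" using \<delta> by linarith
  then have "3 * \<delta> \<le> 1 / real Q" using Q by (simp add: le_divide_eq)
  also have "1 / real Q \<le> real a / real q" using qa by (intro frac_le) auto
  finally have "3 * \<delta> \<le> real a / real q" .
  moreover have "real a / real q \<le> 1" using qa by simp
  ultimately show ?thesis using \<delta>(1) by (auto simp: farey_arc_def qa)
qed

text \<open>Distinct centres are at least 1/Q^2 > 3\<delta> apart, so the arcs are disjoint and at
  most one summand survives.\<close>

lemma sum_arc_indicator:
  fixes g :: "real \<Rightarrow> 'b::comm_monoid_add"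
  assumes \<delta>: "0 \<le> \<delta>" "3 * \<delta> * real Q ^ 2 < 1"
  shows "(\<Sum>i\<in>farey Q. if x \<in> farey_arc \<delta> i then g x else 0) = (if \<exists>i\<in>farey Q. x \<in> farey_arc \<delta> i then g x else 0)"
proof (cases "\<exists>i\<in>farey Q. x \<in> farey_arc \<delta> i")
  case True
  then obtain q a where i: "(q, a) \<in> farey Q" "x \<in> farey_arc \<delta> (q, a)" by auto
  have uniq: "(q', a') = (q, a)" if "(q', a') \<in> farey Q" "x \<in> farey_arc \<delta> (q', a')" for q' a'
  proof (rule ccontr)
    assume "(q', a') \<noteq> (q, a)"
    then have "1 / real Q ^ 2 \<le> \<bar>real a' / real q' - real a / real q\<bar>" by (rule farey_separation[OF that(1) i(1)])
    also have "\<dots> \<le> 2 * \<delta>" using i(2) that(2) by (auto simp: farey_arc_def)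
    finally have "1 / real Q ^ 2 \<le> 3 * \<delta>" using \<delta>(1) by linarith
    moreover have "real Q ^ 2 > 0" using i(1) by (auto simp: farey_def)
    ultimately show False using \<delta>(2) by (simp add: divide_le_eq)
  qed
  have "(\<Sum>i\<in>farey Q. if x \<in> farey_arc \<delta> i then g x else 0) = (\<Sum>i\<in>farey Q. if i = (q, a) then g x else 0)"
    using uniq i(2) by (intro sum.cong refl) auto
  then show ?thesis using True i(1) by simp
qed (auto intro: sum.neutral)

lemma arcs_has_integral:
  fixes g :: "real \<Rightarrow> 'b::euclidean_space"
  assumes g: "continuous_on UNIV g" and \<delta>: "0 \<le> \<delta>" "3 * \<delta> * real Q ^ 2 < 1"
  shows "((\<lambda>x. if \<exists>i\<in>farey Q. x \<in> farey_arc \<delta> i then g x else 0) has_integral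
     (\<Sum>(q, a)\<in>farey Q. integral {-\<delta>..\<delta>} (\<lambda>\<beta>. g (real a / real q + \<beta>)))) {2 * \<delta>..1 + 2 * \<delta>}"
  unfolding sum_arc_indicator[OF \<delta>, symmetric]
proof (rule has_integral_sum)
  fix i assume i: "i \<in> farey Q"
  obtain q a where qa: "i = (q, a)" by (cases i)
  have "g integrable_on farey_arc \<delta> i"
    unfolding qa farey_arc_def prod.case by (intro integrable_continuous_interval continuous_on_subset[OF g]) auto
  then have "(g has_integral integral (farey_arc \<delta> i) g) (farey_arc \<delta> i)" by (rule integrable_integral)
  moreover have "integral (farey_arc \<delta> i) g = integral {-\<delta>..\<delta>} (\<lambda>\<beta>. g (real a / real q + \<beta>))"
    using integral_shift_real_ivl[of "real a / real q - \<delta>" "real a / real q" "real a / real q + \<delta>" g]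
    by (simp add: qa farey_arc_def add.commute)
  ultimately show "((\<lambda>x. if x \<in> farey_arc \<delta> i then g x else 0) has_integral
     (case i of (q, a) \<Rightarrow> integral {-\<delta>..\<delta>} (\<lambda>\<beta>. g (real a / real q + \<beta>)))) {2 * \<delta>..1 + 2 * \<delta>}"
    unfolding has_integral_restrict[OF arc_subset[OF \<delta> i]] by (simp add: qa)
qed simp

text \<open>\<open>g\<close> minus its restriction to the arcs is dominated by \<open>G\<close>
  everywhere, trivially so on the arcs. This avoids treating the minor arcs as a domain of
  integration.\<close>

lemma arcs_integral_diff_bound:
  fixes g :: "real \<Rightarrow> 'b::euclidean_space"
  assumes g: "continuous_on UNIV g" and G: "continuous_on UNIV G" and \<delta>: "0 \<le> \<delta>" "3 * \<delta> * real Q ^ 2 < 1"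
    and G0: "\<And>x. 0 \<le> G x"
    and le: "\<And>x. x \<in> {2 * \<delta>..1 + 2 * \<delta>} \<Longrightarrow> \<forall>i\<in>farey Q. x \<notin> farey_arc \<delta> i \<Longrightarrow> norm (g x) \<le> G x"
  shows "norm (integral {2 * \<delta>..1 + 2 * \<delta>} g - (\<Sum>(q, a)\<in>farey Q. integral {-\<delta>..\<delta>} (\<lambda>\<beta>. g (real a / real q + \<beta>))))
    \<le> integral {2 * \<delta>..1 + 2 * \<delta>} G"
proof -
  define h where "h x = (if \<exists>i\<in>farey Q. x \<in> farey_arc \<delta> i then g x else 0)" for x
  have gi: "g integrable_on {2 * \<delta>..1 + 2 * \<delta>}"
    by (intro integrable_continuous_interval continuous_on_subset[OF g]) auto
  have Gi: "G integrable_on {2 * \<delta>..1 + 2 * \<delta>}"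
    by (intro integrable_continuous_interval continuous_on_subset[OF G]) auto
  have hi: "(h has_integral (\<Sum>(q, a)\<in>farey Q. integral {-\<delta>..\<delta>} (\<lambda>\<beta>. g (real a / real q + \<beta>)))) {2 * \<delta>..1 + 2 * \<delta>}"
    unfolding h_def by (rule arcs_has_integral[OF g \<delta>])
  have "integral {2 * \<delta>..1 + 2 * \<delta>} g - (\<Sum>(q, a)\<in>farey Q. integral {-\<delta>..\<delta>} (\<lambda>\<beta>. g (real a / real q + \<beta>))) =
      integral {2 * \<delta>..1 + 2 * \<delta>} (\<lambda>x. g x - h x)"
    using has_integral_diff[OF integrable_integral[OF gi] hi] by (rule integral_unique[symmetric])
  also have "norm \<dots> \<le> integral {2 * \<delta>..1 + 2 * \<delta>} G"
    using gi has_integral_integrable[OF hi] Gi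
  proof (intro integral_norm_bound_integral integrable_diff)
    fix x assume "x \<in> {2 * \<delta>..1 + 2 * \<delta>}"
    then show "norm (g x - h x) \<le> G x" using le[of x] G0[of x] by (auto simp: h_def)
  qed
  finally show ?thesis .
qed

lemma arcs_integral_le:
  fixes G :: "real \<Rightarrow> real"
  assumes G: "continuous_on UNIV G" and \<delta>: "0 \<le> \<delta>" "3 * \<delta> * real Q ^ 2 < 1" and G0: "\<And>x. 0 \<le> G x"
  shows "(\<Sum>(q, a)\<in>farey Q. integral {-\<delta>..\<delta>} (\<lambda>\<beta>. G (real a / real q + \<beta>))) \<le> integral {2 * \<delta>..1 + 2 * \<delta>} G"
proof (rule has_integral_le)
  show "((\<lambda>x. if \<exists>i\<in>farey Q. x \<in> farey_arc \<delta> i then G x else 0) has_integral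
     (\<Sum>(q, a)\<in>farey Q. integral {-\<delta>..\<delta>} (\<lambda>\<beta>. G (real a / real q + \<beta>)))) {2 * \<delta>..1 + 2 * \<delta>}"
    by (rule arcs_has_integral[OF G \<delta>])
  show "(G has_integral integral {2 * \<delta>..1 + 2 * \<delta>} G) {2 * \<delta>..1 + 2 * \<delta>}"
    by (intro integrable_integral integrable_continuous_interval continuous_on_subset[OF G]) auto
qed (use G0 in auto)

text \<open>All phases stay within the angle pi/4 < pi/3, so every term keeps at least half of its
  weight in the real part.\<close>

lemma norm_sing_sum_ge:
  assumes k: "1 \<le> k" and \<beta>: "\<bar>\<beta>\<bar> * real n \<le> 1 / 8"
  shows "real n powr (1 / real k) / 2 \<le> norm (sing_sum k n \<beta>)"
proof -
  have cos: "1 / 2 \<le> Re (expi (\<beta> * real m))" if "m \<le> n" for m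
  proof -
    have "\<bar>\<beta>\<bar> * real m \<le> \<bar>\<beta>\<bar> * real n" using that by (intro mult_left_mono) auto
    then have "2 * (pi * (\<bar>\<beta>\<bar> * real m)) \<le> 2 * (pi * (1 / 8))" using \<beta> by (intro mult_left_mono) auto
    then have "\<bar>2 * pi * (\<beta> * real m)\<bar> \<le> pi / 3" using pi_gt_zero by (simp add: abs_mult)
    then have "cos (pi / 3) \<le> cos \<bar>2 * pi * (\<beta> * real m)\<bar>" by (intro cos_monotone_0_pi_le) auto
    then show ?thesis by (simp add: expi_def Re_exp cos_60)
  qed
  have "real n powr (1 / real k) / 2 \<le> (\<Sum>m\<le>n. wt k m) / 2" using sum_wt_bounds(1)[OF k, of n] by simp
  also have "\<dots> = (\<Sum>m\<le>n. wt k m * (1 / 2))" by (simp add: sum_distrib_right)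
  also have "\<dots> \<le> (\<Sum>m\<le>n. wt k m * Re (expi (\<beta> * real m)))"
    using cos wt_pos[OF k] by (intro sum_mono mult_left_mono) (auto intro: less_imp_le)
  also have "\<dots> = Re (sing_sum k n \<beta>)" by (simp add: sing_sum_def)
  also have "\<dots> \<le> norm (sing_sum k n \<beta>)" by (rule complex_Re_le_cmod)
  finally show ?thesis .
qed

lemma add_power_le:
  fixes x y :: real
  assumes "0 \<le> x" "0 \<le> y"
  shows "(x + y) ^ m \<le> 2 ^ m * (x ^ m + y ^ m)"
proof -
  have "(x + y) ^ m \<le> (2 * max x y) ^ m" using assms by (intro power_mono) auto
  also have "\<dots> = 2 ^ m * max x y ^ m" by (simp add: power_mult_distrib)
  also have "max x y ^ m \<le> x ^ m + y ^ m" using assms by (auto simp: max_def)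
  finally show ?thesis by simp
qed

text \<open>
  Near \<open>a/q\<close> the Weyl sum of length \<open>P = Q\<^sup>2\<close> is \<open>gauss_avg k q a\<close> times a factor of size at least
  \<open>P/2\<close>, so the moment is a lower bound for the integral in the mean value theorem.
\<close>

lemma gauss_avg_moment:
  assumes k: "1 \<le> k" and \<epsilon>: "\<epsilon> > 0"
  shows "\<exists>C\<ge>1. \<forall>Q\<ge>1. (\<Sum>(q, a)\<in>farey Q. norm (gauss_avg k q a) ^ (2 * tri k)) \<le> C * real Q powr \<epsilon>"
proof -
  define m where "m = 2 * tri k"
  have m: "m = k ^ 2 + k" by (simp add: m_def two_tri power2_eq_square)
  obtain C0 where C0: "C0 \<ge> 1" and mv: "\<And>P u. P \<ge> 1 \<Longrightarrow>
      integral {u..u + 1} (\<lambda>\<alpha>. norm (weyl_sum k P \<alpha>) ^ m) \<le> C0 * real P powr (real k ^ 2 + \<epsilon> / 2)"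
    using weyl_sum_mean_value[OF k, of "\<epsilon> / 2"] \<epsilon> unfolding m_def by auto
  define C where "C = 4 * 4 ^ m * (C0 + 6 ^ m)"
  have "(\<Sum>(q, a)\<in>farey Q. norm (gauss_avg k q a) ^ m) \<le> C * real Q powr \<epsilon>" if Q: "Q \<ge> 1" for Q
  proof -
    \<comment> \<open>Long enough to make the error 6Q of the approximation harmless: (6Q)^m \<le>
      6^m P^(k^2), because m = k^2 + k is at most 2k^2.\<close>
    define P where "P = Q ^ 2"
    define n where "n = P ^ k"
    define \<delta> where "\<delta> = 1 / (8 * real n)"
    have P: "1 \<le> P" using Q by (simp add: P_def)
    have n: "1 \<le> n" using P by (simp add: n_def)
    have "real Q ^ 2 = real P" by (simp add: P_def)
    also have "\<dots> \<le> real n" unfolding n_def of_nat_power using P k by (intro self_le_power) auto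
    finally have Qn: "real Q ^ 2 \<le> real n" .
    have "1 \<le> real n" using n by simp
    then have "3 * real Q ^ 2 < 8 * real n" using Qn by linarith
    then have \<delta>: "0 \<le> \<delta>" "3 * \<delta> * real Q ^ 2 < 1" using n by (auto simp: \<delta>_def divide_less_eq)
    define G where "G \<alpha> = 2 ^ m * (norm (weyl_sum k P \<alpha>) ^ m + (6 * real Q) ^ m)" for \<alpha>
    have G: "continuous_on UNIV G" unfolding G_def by (intro continuous_intros)
    have root: "real n powr (1 / real k) = real P" using k P by (simp add: n_def powr_realpow [symmetric] powr_powr)
    have arc: "(norm (gauss_avg k q a) * (real P / 2)) ^ m * (2 * \<delta>) \<le> integral {-\<delta>..\<delta>} (\<lambda>\<beta>. G (real a / real q + \<beta>))"
      if "(q, a) \<in> farey Q" for q a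
    proof -
      have q: "1 \<le> q" "q \<le> Q" using that by (auto simp: farey_def)
      have "(norm (gauss_avg k q a) * (real P / 2)) ^ m \<le> G (real a / real q + \<beta>)" if "\<beta> \<in> {-\<delta>..\<delta>}" for \<beta>
      proof -
        have "\<bar>\<beta>\<bar> * real n \<le> \<delta> * real n" using that by (intro mult_right_mono) auto
        then have \<beta>: "\<bar>\<beta>\<bar> * real n \<le> 1 / 8" using n by (simp add: \<delta>_def)
        have "norm (gauss_avg k q a) * (real P / 2) \<le> norm (gauss_avg k q a * sing_sum k n \<beta>)"
          unfolding norm_mult using norm_sing_sum_ge[OF k \<beta>] by (intro mult_left_mono) (auto simp: root)
        also have "\<dots> \<le> norm (weyl_sum k P (real a / real q + \<beta>)) + norm (weyl_sum k P (real a / real q + \<beta>) - gauss_avg k q a * sing_sum k n \<beta>)"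
          by (subst norm_minus_commute) (rule norm_triangle_sub)
        also have "norm (weyl_sum k P (real a / real q + \<beta>) - gauss_avg k q a * sing_sum k n \<beta>) \<le> 3 * real q * (1 + 2 * pi * real n * \<bar>\<beta>\<bar>)"
          using k by (intro weyl_sum_major_arc k q) (auto simp: n_def power_strict_mono)
        also have "\<dots> \<le> 3 * real Q * 2"
        proof (intro mult_mono)
          have "2 * pi * (\<bar>\<beta>\<bar> * real n) \<le> 2 * 4 * (1 / 8)" using \<beta> pi_less_4 by (intro mult_mono) auto
          then show "1 + 2 * pi * real n * \<bar>\<beta>\<bar> \<le> 2" by (simp add: mult_ac)
        qed (use q in auto)
        finally have "(norm (gauss_avg k q a) * (real P / 2)) ^ m \<le> (norm (weyl_sum k P (real a / real q + \<beta>)) + 6 * real Q) ^ m"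
          by (intro power_mono) auto
        also have "\<dots> \<le> G (real a / real q + \<beta>)" unfolding G_def by (rule add_power_le) auto
        finally show ?thesis .
      qed
      moreover have "((\<lambda>\<beta>. (norm (gauss_avg k q a) * (real P / 2)) ^ m) has_integral
          (norm (gauss_avg k q a) * (real P / 2)) ^ m * (2 * \<delta>)) {-\<delta>..\<delta>}"
        using has_integral_const_real[of "(norm (gauss_avg k q a) * (real P / 2)) ^ m" "-\<delta>" \<delta>] \<delta>(1) by (simp add: mult.commute)
      moreover have "(\<lambda>\<beta>. G (real a / real q + \<beta>)) integrable_on {-\<delta>..\<delta>}"
        by (intro integrable_continuous_interval continuous_on_compose2[OF G] continuous_intros) auto
      ultimately show ?thesis by (intro has_integral_le[OF _ integrable_integral]) auto
    qed
    define T where "T = (\<Sum>(q, a)\<in>farey Q. norm (gauss_avg k q a) ^ m)"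
    have "T * ((real P / 2) ^ m * (2 * \<delta>)) = (\<Sum>(q, a)\<in>farey Q. (norm (gauss_avg k q a) * (real P / 2)) ^ m * (2 * \<delta>))"
      unfolding T_def sum_distrib_right by (intro sum.cong refl) (simp only: case_prod_unfold power_mult_distrib mult.assoc)
    also have "\<dots> \<le> (\<Sum>(q, a)\<in>farey Q. integral {-\<delta>..\<delta>} (\<lambda>\<beta>. G (real a / real q + \<beta>)))"
      using arc by (intro sum_mono) auto
    also have "\<dots> \<le> integral {2 * \<delta>..1 + 2 * \<delta>} G" by (rule arcs_integral_le[OF G \<delta>]) (simp add: G_def)
    also have "\<dots> = 2 ^ m * (integral {2 * \<delta>..1 + 2 * \<delta>} (\<lambda>\<alpha>. norm (weyl_sum k P \<alpha>) ^ m) + (6 * real Q) ^ m)"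
    proof -
      have "((\<lambda>\<alpha>. norm (weyl_sum k P \<alpha>) ^ m) has_integral integral {2 * \<delta>..1 + 2 * \<delta>} (\<lambda>\<alpha>. norm (weyl_sum k P \<alpha>) ^ m)) {2 * \<delta>..1 + 2 * \<delta>}"
        by (intro integrable_integral integrable_continuous_interval continuous_intros)
      moreover have "((\<lambda>\<alpha>. (6 * real Q) ^ m) has_integral (6 * real Q) ^ m) {2 * \<delta>..1 + 2 * \<delta>}"
        using has_integral_const_real[of "(6 * real Q) ^ m" "2 * \<delta>" "1 + 2 * \<delta>"] by simp
      ultimately show ?thesis
        unfolding G_def by (intro integral_unique has_integral_mult_right has_integral_add)
    qed
    also have "\<dots> \<le> 2 ^ m * (C0 * real P powr (real k ^ 2 + \<epsilon> / 2) + 6 ^ m * real P powr (real k ^ 2 + \<epsilon> / 2))"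
    proof (intro mult_left_mono add_mono)
      show "integral {2 * \<delta>..1 + 2 * \<delta>} (\<lambda>\<alpha>. norm (weyl_sum k P \<alpha>) ^ m) \<le> C0 * real P powr (real k ^ 2 + \<epsilon> / 2)"
        using mv[OF P, of "2 * \<delta>"] by (simp only: add.commute)
      have "real Q ^ m \<le> real Q ^ (2 * k ^ 2)"
        using Q k by (intro power_increasing) (auto simp: m power2_eq_square)
      also have "\<dots> = real P ^ (k ^ 2)" by (simp add: P_def power_mult)
      also have "\<dots> = real P powr (real k ^ 2)" using P by (simp flip: powr_realpow)
      also have "\<dots> \<le> real P powr (real k ^ 2 + \<epsilon> / 2)" using P \<epsilon> by (intro powr_mono) auto
      finally show "(6 * real Q) ^ m \<le> 6 ^ m * real P powr (real k ^ 2 + \<epsilon> / 2)" by (simp add: power_mult_distrib)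
    qed auto
    also have "\<dots> = 2 ^ m * (C0 + 6 ^ m) * (real P powr (real k ^ 2) * real Q powr \<epsilon>)"
    proof -
      have "real P powr (\<epsilon> / 2) = real Q powr \<epsilon>" 
      proof -
        have "real P = real Q powr 2" using Q by (simp add: P_def)
        then show ?thesis by (simp only: powr_powr) simp
      qed
      then show ?thesis by (simp add: powr_add algebra_simps)
    qed
    \<comment> \<open>An arc has length 1/(4n), and P^m = P^(k^2) n for n = P^k: the length removes
      exactly the excess of m over k^2.\<close>
    also have "(real P / 2) ^ m * (2 * \<delta>) = real P powr (real k ^ 2) / (4 * 2 ^ m)"
    proof -
      have "real P ^ m = real P powr (real k ^ 2) * real n"
      proof -
        have "real P ^ k ^ 2 = real P powr real (k ^ 2)" using P by (intro powr_realpow[symmetric]) simp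
        then show ?thesis by (simp add: m n_def power_add)
      qed
      then show ?thesis using n by (simp add: \<delta>_def power_divide)
    qed
    finally have "T * (real P powr (real k ^ 2) / (4 * 2 ^ m)) \<le> 2 ^ m * (C0 + 6 ^ m) * (real P powr (real k ^ 2) * real Q powr \<epsilon>)" .
    then have "real P powr (real k ^ 2) * T \<le> real P powr (real k ^ 2) * (C * real Q powr \<epsilon>)"
    proof -
      assume "T * (real P powr (real k ^ 2) / (4 * 2 ^ m)) \<le> 2 ^ m * (C0 + 6 ^ m) * (real P powr (real k ^ 2) * real Q powr \<epsilon>)"
      then have "T * real P powr (real k ^ 2) \<le> 2 ^ m * (C0 + 6 ^ m) * (real P powr (real k ^ 2) * real Q powr \<epsilon>) * (4 * 2 ^ m)"
        unfolding times_divide_eq_right by (subst (asm) pos_divide_le_eq) simp_all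
      also have "\<dots> = real P powr (real k ^ 2) * (4 * (2 ^ m * 2 ^ m) * (C0 + 6 ^ m) * real Q powr \<epsilon>)" by (simp only: ac_simps)
      also have "2 ^ m * 2 ^ m = (4 :: real) ^ m" by (simp flip: power_mult_distrib)
      finally show ?thesis by (simp only: C_def mult.commute)
    qed
    then show ?thesis using P by (simp add: T_def)
  qed
  moreover have "C \<ge> 1"
  proof -
    have "1 * 1 * 1 \<le> C" unfolding C_def using C0 by (intro mult_mono) (auto intro: add_increasing2)
    then show ?thesis by simp
  qed
  ultimately show ?thesis unfolding m_def by blast
qed

text \<open>Dyadic blocks: the block at 2^J is at most a constant times 2^(-J\<delta>/2), half of
  the saving \<delta> being spent on the growth of the partial sums.\<close>

lemma summable_powr_times:
  fixes c :: "nat \<Rightarrow> real"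
  assumes c: "\<And>q. 0 \<le> c q" and \<delta>: "\<delta> > 0" and C: "0 \<le> C"
    and bound: "\<And>N. 1 \<le> N \<Longrightarrow> (\<Sum>q=1..N. c q) \<le> C * real N powr (\<delta> / 2)"
  shows "summable (\<lambda>q. real (Suc q) powr (- \<delta>) * c (Suc q))"
proof -
  define f where "f q = real q powr (- \<delta>) * c q" for q
  define r where "r = 2 powr (- (\<delta> / 2))"
  have r: "0 < r" "r < 1" using \<delta> by (auto simp: r_def powr_less_one)
  have block: "(\<Sum>q\<in>{2 ^ J..<2 ^ Suc J}. f q) \<le> C * 2 powr (\<delta> / 2) * r ^ J" for J
  proof -
    have "(\<Sum>q\<in>{2 ^ J..<2 ^ Suc J}. f q) \<le> (\<Sum>q\<in>{2 ^ J..<2 ^ Suc J}. real (2 ^ J) powr (- \<delta>) * c q)"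
      unfolding f_def
    proof (intro sum_mono mult_right_mono c)
      fix q :: nat assume "q \<in> {2 ^ J..<2 ^ Suc J}"
      then have "real (2 ^ J) \<le> real q" by (simp only: of_nat_le_iff atLeastLessThan_iff)
      then show "real q powr (- \<delta>) \<le> real (2 ^ J) powr (- \<delta>)" using \<delta> by (intro powr_mono2') auto
    qed
    also have "\<dots> = real (2 ^ J) powr (- \<delta>) * (\<Sum>q\<in>{2 ^ J..<2 ^ Suc J}. c q)" by (simp only: sum_distrib_left)
    also have "(\<Sum>q\<in>{2 ^ J..<2 ^ Suc J}. c q) \<le> (\<Sum>q=1..2 ^ Suc J. c q)"
      using c by (intro sum_mono2) (auto intro: order_trans[OF one_le_power])
    also have "\<dots> \<le> C * real (2 ^ Suc J) powr (\<delta> / 2)" by (rule bound) simp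
    also have "real (2 ^ J) powr (- \<delta>) * (C * real (2 ^ Suc J) powr (\<delta> / 2)) = C * 2 powr (\<delta> / 2) * r ^ J"
    proof -
      have "real (2 ^ J) powr (- \<delta>) = 2 powr (- (real J * \<delta>))" by (simp add: powr_realpow [symmetric] powr_powr)
      moreover have "real (2 ^ Suc J) powr (\<delta> / 2) = 2 powr (\<delta> / 2 + real J * \<delta> / 2)"
        by (simp add: powr_realpow [symmetric] powr_powr powr_mult powr_add)
      moreover have "r ^ J = 2 powr (- (real J * \<delta> / 2))" by (simp add: r_def powr_power mult.commute[of \<delta>])
      moreover have "2 powr (- (real J * \<delta>)) * 2 powr (real J * \<delta> / 2) = 2 powr (- (real J * \<delta> / 2))"
        unfolding powr_add [symmetric] by (rule arg_cong[of _ _ "\<lambda>x. 2 powr x"]) (simp add: field_simps)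
      ultimately show ?thesis by (simp add: powr_add)
    qed
    finally show ?thesis by simp
  qed
  have partial: "(\<Sum>q\<in>{1..<2 ^ J}. f q) \<le> C * 2 powr (\<delta> / 2) * (\<Sum>j<J. r ^ j)" for J
  proof (induction J)
    case (Suc J)
    have "(\<Sum>q\<in>{1..<2 ^ Suc J}. f q) = (\<Sum>q\<in>{1..<2 ^ J}. f q) + (\<Sum>q\<in>{2 ^ J..<2 ^ Suc J}. f q)"
      by (rule sum.atLeastLessThan_concat[symmetric]) auto
    then show ?case using Suc block[of J] by (simp add: distrib_left del: power_Suc)
  qed simp
  show ?thesis
  proof (rule summableI_nonneg_bounded)
    fix N
    have "(\<Sum>q<N. real (Suc q) powr (- \<delta>) * c (Suc q)) = (\<Sum>q=1..N. f q)"
      unfolding f_def by (rule sum.reindex_bij_witness[of _ "\<lambda>q. q - 1" Suc]) auto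
    also have "\<dots> \<le> (\<Sum>q\<in>{1..<2 ^ N}. f q)"
      using le_less_trans[OF _ less_exp[of N]] c by (intro sum_mono2) (auto simp: f_def)
    also have "\<dots> \<le> C * 2 powr (\<delta> / 2) * (\<Sum>j<N. r ^ j)" by (rule partial)
    also have "\<dots> \<le> C * 2 powr (\<delta> / 2) * (1 / (1 - r))"
    proof (intro mult_left_mono)
      have "(\<Sum>j<N. r ^ j) \<le> (\<Sum>j. r ^ j)" using r by (intro sum_le_suminf summable_geometric) auto
      then show "(\<Sum>j<N. r ^ j) \<le> 1 / (1 - r)" using r suminf_geometric[of r] by simp
    qed (use C in auto)
    finally show "(\<Sum>q<N. real (Suc q) powr (- \<delta>) * c (Suc q)) \<le> C * 2 powr (\<delta> / 2) * (1 / (1 - r))" .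
  qed (use c in auto)
qed

definition gauss_moment :: "nat \<Rightarrow> nat \<Rightarrow> nat \<Rightarrow> real" where
  "gauss_moment s k q = (\<Sum>a\<in>{a \<in> {1..q}. coprime a q}. norm (gauss_avg k q a) ^ s)"

lemma gauss_moment_nonneg: "0 \<le> gauss_moment s k q"
  unfolding gauss_moment_def by (intro sum_nonneg) auto

lemma sum_gauss_moment: "(\<Sum>q=1..Q. gauss_moment s k q) = (\<Sum>(q, a)\<in>farey Q. norm (gauss_avg k q a) ^ s)"
  unfolding gauss_moment_def farey_def by (rule sum.Sigma) auto

text \<open>Of the more than k(k+1) factors, one is bounded by a multiple of q^(-\<delta>), and
  k(k+1) others form the moment, whose sum up to Q grows at most like Q^(\<delta>/2).\<close>

theorem summable_gauss_moment:
  assumes k: "2 \<le> k" and s: "2 * tri k < s"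
  shows "summable (\<lambda>q. gauss_moment s k (Suc q))"
proof -
  obtain K \<delta> where K: "K \<ge> 1" and \<delta>: "\<delta> > 0"
    and g: "\<And>q a. q \<ge> 1 \<Longrightarrow> coprime a q \<Longrightarrow> norm (gauss_avg k q a) \<le> K * real q powr (- \<delta>)"
    using gauss_avg_bound[OF k] by metis
  have k1: "1 \<le> k" using k by simp
  obtain C where C: "C \<ge> 1" and mom: "\<And>Q. Q \<ge> 1 \<Longrightarrow>
      (\<Sum>(q, a)\<in>farey Q. norm (gauss_avg k q a) ^ (2 * tri k)) \<le> C * real Q powr (\<delta> / 2)"
    using gauss_avg_moment[OF k1, of "\<delta> / 2"] \<delta> by (auto simp only: half_gt_zero_iff)
  have "summable (\<lambda>q. real (Suc q) powr (- \<delta>) * gauss_moment (2 * tri k) k (Suc q))"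
    by (rule summable_powr_times[OF gauss_moment_nonneg \<delta>, of C]) (use C mom in \<open>auto simp only: sum_gauss_moment\<close>)
  then have "summable (\<lambda>q. K * (real (Suc q) powr (- \<delta>) * gauss_moment (2 * tri k) k (Suc q)))" by (rule summable_mult)
  then show ?thesis
  proof (rule summable_comparison_test'[where N = 0])
    fix q
    have "gauss_moment s k (Suc q) \<le> (\<Sum>a\<in>{a \<in> {1..Suc q}. coprime a (Suc q)}. K * real (Suc q) powr (- \<delta>) * norm (gauss_avg k (Suc q) a) ^ (2 * tri k))"
      unfolding gauss_moment_def
    proof (intro sum_mono)
      fix a assume "a \<in> {a \<in> {1..Suc q}. coprime a (Suc q)}"
      then have "norm (gauss_avg k (Suc q) a) \<le> K * real (Suc q) powr (- \<delta>)" by (intro g) auto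
      moreover have "norm (gauss_avg k (Suc q) a) ^ s \<le> norm (gauss_avg k (Suc q) a) ^ Suc (2 * tri k)"
        using s by (intro power_decreasing norm_gauss_avg_le_1) auto
      ultimately show "norm (gauss_avg k (Suc q) a) ^ s \<le> K * real (Suc q) powr (- \<delta>) * norm (gauss_avg k (Suc q) a) ^ (2 * tri k)"
        by (elim order_trans) (auto intro: mult_right_mono)
    qed
    then show "norm (gauss_moment s k (Suc q)) \<le> K * (real (Suc q) powr (- \<delta>) * gauss_moment (2 * tri k) k (Suc q))"
      using gauss_moment_nonneg[of s k "Suc q"] by (simp only: real_norm_def abs_of_nonneg gauss_moment_def sum_distrib_left mult.assoc)
  qed
qed

section \<open>The asymptotic formula\<close>

lemma norm_integral_le_powr:
  fixes h :: "real \<Rightarrow> complex"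
  assumes h: "continuous_on UNIV h" and \<eta>: "0 < \<eta>" "\<eta> \<le> 1 / 2" and t: "1 < t" and K: "0 \<le> K"
    and le: "\<And>\<beta>. 0 < \<beta> \<Longrightarrow> \<beta> \<le> 1 / 2 \<Longrightarrow> norm (h \<beta>) \<le> K * \<beta> powr (- t)"
  shows "norm (integral {\<eta>..1 / 2} h) \<le> K / (t - 1) * \<eta> powr (1 - t)"
proof -
  have ftc: "((\<lambda>\<beta>. \<beta> powr (- t)) has_integral ((1 / 2) powr (1 - t) / (1 - t) - \<eta> powr (1 - t) / (1 - t))) {\<eta>..1 / 2}"
  proof (rule fundamental_theorem_of_calculus[OF \<eta>(2)])
    fix x assume "x \<in> {\<eta>..1 / 2}"
    then have x: "0 < x" using \<eta> by auto
    have "((\<lambda>\<beta>. \<beta> powr (1 - t) / (1 - t)) has_field_derivative ((1 - t) * x powr (1 - t - 1)) / (1 - t)) (at x)"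
      by (intro DERIV_cdivide has_real_derivative_powr x)
    moreover have "((1 - t) * x powr (1 - t - 1)) / (1 - t) = x powr (- t)" using t by simp
    ultimately show "((\<lambda>\<beta>. \<beta> powr (1 - t) / (1 - t)) has_vector_derivative x powr (- t)) (at x within {\<eta>..1 / 2})"
      by (simp only: has_real_derivative_iff_has_vector_derivative has_vector_derivative_at_within)
  qed
  have "norm (integral {\<eta>..1 / 2} h) \<le> integral {\<eta>..1 / 2} (\<lambda>\<beta>. K * \<beta> powr (- t))"
  proof (rule integral_norm_bound_integral)
    show "h integrable_on {\<eta>..1 / 2}" by (intro integrable_continuous_interval continuous_on_subset[OF h]) auto
    show "(\<lambda>\<beta>. K * \<beta> powr (- t)) integrable_on {\<eta>..1 / 2}"
      using has_integral_mult_right[OF ftc, of K] by (rule has_integral_integrable)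
  qed (use le \<eta> in auto)
  also have "\<dots> = K * ((1 / 2) powr (1 - t) / (1 - t) - \<eta> powr (1 - t) / (1 - t))"
    using has_integral_mult_right[OF ftc, of K] by (rule integral_unique)
  also have "\<dots> \<le> K * (\<eta> powr (1 - t) / (t - 1))"
  proof (rule mult_left_mono[OF _ K])
    have "(1 / 2) powr (1 - t) / (1 - t) \<le> 0" using t by (intro divide_nonneg_neg) auto
    moreover have "\<eta> powr (1 - t) / (t - 1) = - (\<eta> powr (1 - t) / (1 - t))"
      by (simp only: minus_divide_right minus_diff_eq)
    ultimately show "(1 / 2) powr (1 - t) / (1 - t) - \<eta> powr (1 - t) / (1 - t) \<le> \<eta> powr (1 - t) / (t - 1)" by linarith
  qed
  finally show ?thesis by simp
qed

text \<open>The complete singular integral: the coefficient of index n in the \<open>s\<close>-th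
  power of \<open>sing_sum\<close>, in closed form. The quotient of Gamma values in the theorem
  appears only in its asymptotics.\<close>

definition sing_int :: "nat \<Rightarrow> nat \<Rightarrow> nat \<Rightarrow> real" where
  "sing_int s k n = Gamma (1 + 1 / real k) ^ s * (pochhammer (real s / real k) n / fact n)"

text \<open>Outside the central interval the integrand is at most (3 |\<beta>|^(-1/k))^s, and s > k
  turns the tail into a negative power of \<eta>.\<close>

lemma sing_int_truncation:
  assumes k: "1 \<le> k" and s: "k < s" and \<eta>: "0 < \<eta>" "\<eta> \<le> 1 / 2"
  shows "norm (of_real (sing_int s k n) - integral {-\<eta>..\<eta>} (\<lambda>\<beta>. sing_sum k n \<beta> ^ s * expi (- (real n * \<beta>))))
    \<le> 2 * (3 ^ s / (real s / real k - 1)) * \<eta> powr (1 - real s / real k)"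
proof -
  define t where "t = real s / real k"
  define h where "h \<beta> = sing_sum k n \<beta> ^ s * expi (- (real n * \<beta>))" for \<beta>
  have t: "1 < t" using k s by (simp add: t_def)
  have h: "continuous_on UNIV h" unfolding h_def by (intro continuous_intros)
  have hi: "h integrable_on {a..b}" for a b by (intro integrable_continuous_interval continuous_on_subset[OF h]) auto
  have le: "norm (h \<beta>) \<le> 3 ^ s * \<bar>\<beta>\<bar> powr (- t)" if "\<beta> \<noteq> 0" "\<bar>\<beta>\<bar> \<le> 1 / 2" for \<beta>
  proof -
    have "norm (h \<beta>) = norm (sing_sum k n \<beta>) ^ s" by (simp add: h_def norm_mult norm_power)
    also have "\<dots> \<le> (3 * \<bar>\<beta>\<bar> powr (- (1 / real k))) ^ s" using norm_sing_sum_decay[OF k that] by (intro power_mono) auto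
    also have "\<dots> = 3 ^ s * \<bar>\<beta>\<bar> powr (- t)" using that(1) by (simp add: power_mult_distrib powr_power t_def)
    finally show ?thesis .
  qed
  have "of_real (sing_int s k n) = integral {-(1/2)..1/2} h"
    using integral_sing_sum_power[of k n s "-(1/2)"] unfolding h_def sing_int_def by (simp add: integral_unique)
  also have "\<dots> = integral {-(1/2)..-\<eta>} h + integral {-\<eta>..1/2} h"
    using \<eta> by (intro Henstock_Kurzweil_Integration.integral_combine[symmetric] hi) auto
  also have "integral {-\<eta>..1/2} h = integral {-\<eta>..\<eta>} h + integral {\<eta>..1/2} h"
    using \<eta> by (intro Henstock_Kurzweil_Integration.integral_combine[symmetric] hi) auto
  also have "integral {-(1/2)..-\<eta>} h = integral {\<eta>..1/2} (\<lambda>\<beta>. h (- \<beta>))"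
    using Henstock_Kurzweil_Integration.integral_reflect_real[where a = \<eta> and b = "1/2" and f = "\<lambda>\<beta>. h (- \<beta>)"] by simp
  finally have "norm (of_real (sing_int s k n) - integral {-\<eta>..\<eta>} h) = norm (integral {\<eta>..1/2} (\<lambda>\<beta>. h (- \<beta>)) + integral {\<eta>..1/2} h)"
    by (simp add: algebra_simps)
  also have "\<dots> \<le> norm (integral {\<eta>..1/2} (\<lambda>\<beta>. h (- \<beta>))) + norm (integral {\<eta>..1/2} h)" by (rule norm_triangle_ineq)
  also have "\<dots> \<le> 3 ^ s / (t - 1) * \<eta> powr (1 - t) + 3 ^ s / (t - 1) * \<eta> powr (1 - t)"
  proof (intro add_mono norm_integral_le_powr h \<eta> t)
    show "continuous_on UNIV (\<lambda>\<beta>. h (- \<beta>))" by (intro continuous_on_compose2[OF h] continuous_intros) auto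
    show "norm (h (- \<beta>)) \<le> 3 ^ s * \<beta> powr (- t)" if "0 < \<beta>" "\<beta> \<le> 1 / 2" for \<beta> using le[of "- \<beta>"] that by simp
    show "norm (h \<beta>) \<le> 3 ^ s * \<beta> powr (- t)" if "0 < \<beta>" "\<beta> \<le> 1 / 2" for \<beta> using le[of \<beta>] that by simp
  qed auto
  finally show ?thesis unfolding h_def t_def by simp
qed

lemma norm_power_diff_le:
  fixes x y :: "'a::real_normed_field"
  assumes "norm x \<le> B" "norm y \<le> B"
  shows "norm (x ^ s - y ^ s) \<le> real s * B ^ (s - 1) * norm (x - y)"
proof -
  have B: "0 \<le> B" using assms(1) norm_ge_zero[of x] by linarith
  have "norm (x ^ s - y ^ s) = norm (x - y) * norm (\<Sum>i<s. y ^ (s - Suc i) * x ^ i)"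
    by (simp only: power_diff_sumr2[of x s y] norm_mult)
  also have "\<dots> \<le> norm (x - y) * (\<Sum>i<s. B ^ (s - 1))"
  proof (intro mult_left_mono norm_ge_zero order_trans[OF norm_sum] sum_mono)
    fix i assume i: "i \<in> {..<s}"
    have "norm (y ^ (s - Suc i) * x ^ i) \<le> B ^ (s - Suc i) * B ^ i"
      unfolding norm_mult norm_power using assms B by (intro mult_mono power_mono) auto
    also have "\<dots> = B ^ (s - 1)" using i by (simp flip: power_add)
    finally show "norm (y ^ (s - Suc i) * x ^ i) \<le> B ^ (s - 1)" .
  qed
  finally show ?thesis by (simp add: mult.commute)
qed

text \<open>By contraposition: if the bound fails, Weyl's inequality with D = (Q/C)^c supplies q
  \<le> Q and b with |q\<alpha> - b| \<le> Q/P^k = \<eta>, and b/q in lowest terms is a Farey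
  fraction whose arc contains \<alpha>.\<close>

lemma minor_arc_bound:
  assumes k: "1 \<le> k"
  shows "\<exists>C\<ge>1. \<exists>c>0. \<forall>P Q \<alpha> \<eta>. 1 \<le> P \<longrightarrow> C \<le> real Q \<longrightarrow> \<eta> = real Q / real P ^ k \<longrightarrow> 3 * \<eta> * real Q ^ 2 < 1 \<longrightarrow>
    \<alpha> \<in> {2 * \<eta>..1 + 2 * \<eta>} \<longrightarrow> (\<forall>i\<in>farey Q. \<alpha> \<notin> farey_arc \<eta> i) \<longrightarrow>
    norm (weyl_sum k P \<alpha>) \<le> real P / (real Q / C) powr c"
proof -
  from weyl_inequality[OF k] obtain C c0 where C: "C \<ge> 1"
    and W0: "\<forall>\<psi> a L P D. degree \<psi> \<le> k \<longrightarrow> L \<le> P \<longrightarrow> 1 \<le> P \<longrightarrow> 1 \<le> D \<longrightarrow>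
    norm (\<Sum>x\<in>{a..<a + int L}. expi (poly \<psi> (of_int x))) \<ge> real P / D \<longrightarrow>
    (\<exists>q::nat. 1 \<le> q \<and> real q \<le> C * D ^ c0 \<and> (\<exists>b::int. \<bar>real q * coeff \<psi> k - of_int b\<bar> \<le> C * D ^ c0 / real P ^ k))"
    by (elim exE conjE)
  note W = W0[rule_format]
  define c where "c = 1 / real (Suc c0)"
  have c: "0 < c" by (simp add: c_def)
  have "norm (weyl_sum k P \<alpha>) \<le> real P / (real Q / C) powr c"
    if P: "1 \<le> P" and Q: "C \<le> real Q" and \<eta>_def: "\<eta> = real Q / real P ^ k" and \<eta>Q: "3 * \<eta> * real Q ^ 2 < 1"
      and \<alpha>: "\<alpha> \<in> {2 * \<eta>..1 + 2 * \<eta>}" and off: "\<forall>i\<in>farey Q. \<alpha> \<notin> farey_arc \<eta> i" for P Q \<alpha> \<eta>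
  proof (rule ccontr)
    assume neg: "\<not> norm (weyl_sum k P \<alpha>) \<le> real P / (real Q / C) powr c"
    define D where "D = (real Q / C) powr c"
    have QC: "1 \<le> real Q / C" using Q C by (simp add: le_divide_eq)
    have D1: "1 \<le> D" using QC c by (simp add: D_def ge_one_powr_ge_zero)
    have Q1: "1 \<le> real Q" using Q C by linarith
    have P0: "0 < real P" using P by simp
    have \<eta>: "0 < \<eta>" using Q1 P0 by (simp add: \<eta>_def)
    have "3 * \<eta> * real Q \<le> 3 * \<eta> * real Q ^ 2" using \<eta> Q1 self_le_power[of "real Q" 2] by (intro mult_left_mono) auto
    then have \<eta>Q: "3 * \<eta> * real Q < 1" using \<eta>Q by linarith
    define \<psi> where "\<psi> = monom \<alpha> k"
    have "weyl_sum k P \<alpha> = (\<Sum>x\<in>{1..<1 + int P}. expi (poly \<psi> (of_int x)))"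
      unfolding weyl_sum_def
      by (rule sum.reindex_bij_witness[of _ nat int]) (auto simp: \<psi>_def poly_monom)
    then have "norm (\<Sum>x\<in>{1..<1 + int P}. expi (poly \<psi> (of_int x))) \<ge> real P / D"
      using neg by (simp add: D_def)
    from W[OF _ order_refl P D1 this] obtain q b where q: "1 \<le> q" "real q \<le> C * D ^ c0"
      and b: "\<bar>real q * coeff \<psi> k - of_int b\<bar> \<le> C * D ^ c0 / real P ^ k"
      by (auto simp: \<psi>_def degree_monom_le)
    have "C * D ^ c0 \<le> C * D ^ Suc c0" using C D1 by (intro mult_left_mono power_increasing) auto
    also have "D ^ Suc c0 = real Q / C"
    proof -
      have "D ^ Suc c0 = (real Q / C) powr (real (Suc c0) * c)" unfolding D_def by (rule powr_power) (use Q1 C in auto)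
      also have "real (Suc c0) * c = 1" by (simp add: c_def)
      finally show ?thesis using Q1 C by simp
    qed
    also have "C * (real Q / C) = real Q" using C by simp
    finally have CD: "C * D ^ c0 \<le> real Q" .
    have qQ: "q \<le> Q" using q(2) CD by linarith
    have "C * D ^ c0 / real P ^ k \<le> \<eta>" unfolding \<eta>_def using CD by (intro divide_right_mono) auto
    then have close: "\<bar>real q * \<alpha> - of_int b\<bar> \<le> \<eta>" using b by (simp add: \<psi>_def)
    \<comment> \<open>Starting the period at 2\<eta> rather than at \<eta> is what excludes b = 0
      here.\<close>
    have b_pos: "0 < b"
    proof -
      have "1 * (2 * \<eta>) \<le> real q * \<alpha>" using \<alpha> q \<eta> by (intro mult_mono) auto
      then have "0 < real_of_int b" using close \<eta> by linarith
      then show ?thesis by simp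
    qed
    have b_le: "b \<le> int q"
    proof -
      have "real q * \<alpha> \<le> real q * (1 + 2 * \<eta>)" using \<alpha> by (intro mult_left_mono) auto
      then have "real_of_int b \<le> real q + (2 * real q + 1) * \<eta>" using close by (simp add: algebra_simps)
      also have "(2 * real q + 1) * \<eta> \<le> (3 * real Q) * \<eta>" using qQ Q1 \<eta> by (intro mult_right_mono) auto
      finally have "real_of_int b < real_of_int (int q + 1)" using \<eta>Q by (simp add: mult_ac)
      then show ?thesis by (simp only: of_int_less_iff)
    qed
    define g where "g = gcd (nat b) q"
    define q' where "q' = q div g"
    define b' where "b' = nat b div g"
    have g: "0 < g" using q by (simp add: g_def)
    have qg: "q = q' * g" "nat b = b' * g" by (simp_all add: q'_def b'_def g_def)
    have q'_pos: "0 < q'" "0 < b'" using qg q b_pos by (auto intro!: gr0I)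
    have "nat b \<le> q" using b_le by simp
    then have "b' \<le> q'" unfolding qg using g by (simp only: mult_le_cancel2)
    moreover have "coprime b' q'" unfolding b'_def q'_def g_def using q by (intro div_gcd_coprime) auto
    moreover have "q' \<le> Q" unfolding q'_def by (rule order_trans[OF div_le_dividend qQ])
    ultimately have "(q', b') \<in> farey Q" using q'_pos by (auto simp: farey_def)
    moreover have "\<alpha> \<in> farey_arc \<eta> (q', b')"
    proof -
      have "real b' / real q' = real (b' * g) / real (q' * g)" using g by simp
      also have "\<dots> = of_int b / real q" using b_pos qg by (metis of_nat_nat order_less_imp_le of_int_of_nat_eq)
      finally have eq: "real b' / real q' = of_int b / real q" .
      have "\<bar>\<alpha> - of_int b / real q\<bar> * 1 \<le> \<bar>\<alpha> - of_int b / real q\<bar> * real q" using q by (intro mult_left_mono) auto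
      also have "\<dots> = \<bar>(\<alpha> - of_int b / real q) * real q\<bar>" by (simp only: abs_mult abs_of_nat)
      also have "(\<alpha> - of_int b / real q) * real q = real q * \<alpha> - of_int b" using q by (simp add: field_simps)
      finally have "\<bar>\<alpha> - real b' / real q'\<bar> \<le> \<eta>" using close unfolding eq mult_1_right by (rule order_trans)
      then show ?thesis by (auto simp: farey_arc_def abs_le_iff)
    qed
    ultimately show False using off by blast
  qed
  then show ?thesis using C c by (intro exI[of _ C] conjI exI[of _ c]) blast+
qed

text \<open>At least one of the s factors is bounded pointwise, the remaining k(k+1) by the mean
  value theorem. The majorant \<open>G\<close> is a constant times the k(k+1)-th power of the Weyl
  sum and thus lives on the whole period.\<close>

lemma minor_arc_integral:
  assumes k: "1 \<le> k" and s: "2 * tri k < s"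
  shows "\<exists>K\<ge>0. \<exists>\<kappa>>0. \<exists>Q0. \<forall>P Q \<eta>. Q0 \<le> Q \<longrightarrow> Q ^ 10 \<le> P \<longrightarrow> P < (Q + 1) ^ 10 \<longrightarrow>
     \<eta> = real Q / real P ^ k \<longrightarrow> 3 * \<eta> * real Q ^ 2 < 1 \<longrightarrow>
     (\<exists>G. continuous_on UNIV G \<and> (\<forall>x. 0 \<le> G x) \<and>
       (\<forall>\<alpha>\<in>{2 * \<eta>..1 + 2 * \<eta>}. (\<forall>i\<in>farey Q. \<alpha> \<notin> farey_arc \<eta> i) \<longrightarrow> norm (weyl_sum k P \<alpha>) ^ s \<le> G \<alpha>) \<and>
       integral {2 * \<eta>..1 + 2 * \<eta>} G \<le> K * real P ^ (s - k) * real Q powr (- \<kappa>))"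
proof -
  define m where "m = 2 * tri k"
  have m: "m = k ^ 2 + k" by (simp add: m_def two_tri power2_eq_square)
  have m_s: "m < s" using s by (simp add: m_def)
  obtain C c where C: "C \<ge> 1" and c: "c > 0"
    and minor: "\<And>P Q \<alpha> \<eta>. 1 \<le> P \<Longrightarrow> C \<le> real Q \<Longrightarrow> \<eta> = real Q / real P ^ k \<Longrightarrow> 3 * \<eta> * real Q ^ 2 < 1 \<Longrightarrow>
      \<alpha> \<in> {2 * \<eta>..1 + 2 * \<eta>} \<Longrightarrow> \<forall>i\<in>farey Q. \<alpha> \<notin> farey_arc \<eta> i \<Longrightarrow>
      norm (weyl_sum k P \<alpha>) \<le> real P / (real Q / C) powr c"
    using minor_arc_bound[OF k] by blast
  \<comment> \<open>As P is below (2Q)^10, the loss P^\<epsilon> is at most a constant times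
    Q^(c/2), half of the pointwise saving Q^c.\<close>
  define \<epsilon> where "\<epsilon> = c / 20"
  have \<epsilon>: "\<epsilon> > 0" using c by (simp add: \<epsilon>_def)
  obtain C0 where C0: "C0 \<ge> 1" and mv: "\<And>P u. P \<ge> 1 \<Longrightarrow>
      integral {u..u + 1} (\<lambda>\<alpha>. norm (weyl_sum k P \<alpha>) ^ m) \<le> C0 * real P powr (real k ^ 2 + \<epsilon>)"
    using weyl_sum_mean_value[OF k \<epsilon>] unfolding m_def by auto
  define K where "K = C powr c * (C0 * 1024 powr \<epsilon>)"
  define \<kappa> where "\<kappa> = c / 2"
  have "\<exists>G. continuous_on UNIV G \<and> (\<forall>x. 0 \<le> G x) \<and>
       (\<forall>\<alpha>\<in>{2 * \<eta>..1 + 2 * \<eta>}. (\<forall>i\<in>farey Q. \<alpha> \<notin> farey_arc \<eta> i) \<longrightarrow> norm (weyl_sum k P \<alpha>) ^ s \<le> G \<alpha>) \<and>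
       integral {2 * \<eta>..1 + 2 * \<eta>} G \<le> K * real P ^ (s - k) * real Q powr (- \<kappa>)"
    if Q: "nat \<lceil>C\<rceil> \<le> Q" and QP: "Q ^ 10 \<le> P" "P < (Q + 1) ^ 10" and \<eta>: "\<eta> = real Q / real P ^ k" "3 * \<eta> * real Q ^ 2 < 1" for P Q \<eta>
  proof -
    have CQ: "C \<le> real Q" using Q by linarith
    have Q1: "1 \<le> Q" using CQ C by (cases Q) auto
    have P1: "1 \<le> P" using QP(1) Q1 one_le_power[of Q 10] by linarith
    define D where "D = (real Q / C) powr c"
    have D1: "1 \<le> D" using CQ C c by (simp add: D_def ge_one_powr_ge_zero le_divide_eq)
    define A where "A = (real P / D) ^ (s - m)"
    have A: "0 \<le> A" using D1 by (simp add: A_def)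
    define G where "G \<alpha> = A * norm (weyl_sum k P \<alpha>) ^ m" for \<alpha>
    have "norm (weyl_sum k P \<alpha>) ^ s \<le> G \<alpha>"
      if "\<alpha> \<in> {2 * \<eta>..1 + 2 * \<eta>}" "\<forall>i\<in>farey Q. \<alpha> \<notin> farey_arc \<eta> i" for \<alpha>
    proof -
      have "norm (weyl_sum k P \<alpha>) ^ (s - m) \<le> A"
        unfolding A_def D_def by (intro power_mono minor[OF P1 CQ \<eta> that]) auto
      then have "norm (weyl_sum k P \<alpha>) ^ (s - m) * norm (weyl_sum k P \<alpha>) ^ m \<le> A * norm (weyl_sum k P \<alpha>) ^ m"
        by (rule mult_right_mono) auto
      then show ?thesis using m_s by (simp add: G_def flip: power_add)
    qed
    moreover have "integral {2 * \<eta>..1 + 2 * \<eta>} G \<le> K * real P ^ (s - k) * real Q powr (- \<kappa>)"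
    proof -
      have "integral {2 * \<eta>..1 + 2 * \<eta>} G = A * integral {2 * \<eta>..2 * \<eta> + 1} (\<lambda>\<alpha>. norm (weyl_sum k P \<alpha>) ^ m)"
        unfolding G_def by (simp add: add.commute)
      also have "\<dots> \<le> A * (C0 * real P powr (real k ^ 2 + \<epsilon>))"
        using A mv[OF P1] by (intro mult_left_mono) auto
      also have "\<dots> \<le> real P ^ (s - m) * (1 / D) * (C0 * real P powr (real k ^ 2 + \<epsilon>))"
      proof (rule mult_right_mono)
        have "(1 / D) ^ (s - m) \<le> (1 / D) ^ 1" using D1 m_s by (intro power_decreasing) auto
        then show "A \<le> real P ^ (s - m) * (1 / D)" unfolding A_def power_divide using D1
          by (simp add: power_one_over divide_inverse power_inverse mult_left_mono)
      qed (use C0 in auto)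
      also have "real P ^ (s - m) * (1 / D) * (C0 * real P powr (real k ^ 2 + \<epsilon>)) = real P ^ (s - k) * (C0 * real P powr \<epsilon> / D)"
      proof -
        have "real P ^ (s - k) = real P ^ (s - m) * real P ^ (k ^ 2)"
          using m_s m by (simp flip: power_add)
        moreover have "real P powr (real k ^ 2) = real P ^ (k ^ 2)" using P1 powr_realpow[of "real P" "k ^ 2"] by simp
        ultimately show ?thesis by (simp add: powr_add)
      qed
      also have "\<dots> \<le> real P ^ (s - k) * (K * real Q powr (- \<kappa>))"
      proof (intro mult_left_mono)
        have "P \<le> (2 * Q) ^ 10" using QP(2) power_mono[of "Q + 1" "2 * Q" 10] Q1 by linarith
        then have "real P \<le> real ((2 * Q) ^ 10)" by (simp only: of_nat_le_iff)
        also have "\<dots> = 1024 * real Q powr 10" using Q1 by (simp add: power_mult_distrib)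
        finally have "real P powr \<epsilon> \<le> (1024 * real Q powr 10) powr \<epsilon>" using \<epsilon> by (intro powr_mono2) auto
        also have "\<dots> = 1024 powr \<epsilon> * real Q powr (c / 2)" 
          unfolding powr_mult powr_powr \<epsilon>_def by (simp only: times_divide_eq_right) simp
        finally have "C0 * real P powr \<epsilon> / D \<le> C0 * (1024 powr \<epsilon> * real Q powr (c / 2)) / D"
          using C0 D1 by (intro divide_right_mono mult_left_mono) auto
        also have "\<dots> = K * (real Q powr (c / 2) * real Q powr (- c))"
          using C Q1 by (simp add: D_def K_def powr_divide powr_minus_divide)
        also have "real Q powr (c / 2) * real Q powr (- c) = real Q powr (- \<kappa>)"
          unfolding powr_add [symmetric] \<kappa>_def by simp
        finally show "C0 * real P powr \<epsilon> / D \<le> K * real Q powr (- \<kappa>)" .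
      qed auto
      finally show ?thesis by (simp only: mult_ac)
    qed
    ultimately show ?thesis using A by (intro exI[of _ G]) (auto simp: G_def intro!: continuous_intros)
  qed
  moreover have "0 \<le> K" using C0 by (simp add: K_def)
  moreover have "0 < \<kappa>" using c by (simp add: \<kappa>_def)
  ultimately show ?thesis by (intro exI[of _ K] conjI exI[of _ \<kappa>] exI[of _ "nat \<lceil>C\<rceil>"]) blast+
qed

lemma card_farey_le: "card (farey Q) \<le> Q ^ 2"
proof -
  have "farey Q \<subseteq> {1..Q} \<times> {1..Q}" by (auto simp: farey_def)
  then have "card (farey Q) \<le> card ({1..Q} \<times> {1..Q})" by (rule card_mono[rotated]) auto
  then show ?thesis by (simp add: card_cartesian_product power2_eq_square)
qed

lemma norm_weyl_sum_le: "norm (weyl_sum k P \<alpha>) \<le> real P"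
proof -
  have "norm (weyl_sum k P \<alpha>) \<le> (\<Sum>x=1..P. 1)"
    unfolding weyl_sum_def by (intro order_trans[OF norm_sum] sum_mono) simp
  then show ?thesis by simp
qed

text \<open>The difference of \<open>s\<close>-th powers costs s (2P)^(s-1) times the approximation
  error, which is of order Q^2 on the arc; the arc has length 2Q/P^k. Relative to P^(s-k) the error
  of one arc is of order Q^3/P.\<close>

lemma major_arc_integral:
  assumes k: "1 \<le> k" and q: "1 \<le> q" "q \<le> Q" and P: "P ^ k \<le> n" "n < (P + 1) ^ k" "1 \<le> P" and \<eta>: "\<eta> = real Q / real P ^ k"
  shows "norm (integral {-\<eta>..\<eta>} (\<lambda>\<beta>. weyl_sum k P (real a / real q + \<beta>) ^ s * expi (- (real n * (real a / real q + \<beta>)))) -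
     gauss_avg k q a ^ s * expi (- (real n * real a / real q)) * integral {-\<eta>..\<eta>} (\<lambda>\<beta>. sing_sum k n \<beta> ^ s * expi (- (real n * \<beta>))))
     \<le> 54 * real s * 2 ^ k * 2 ^ s * real Q ^ 3 * real P ^ s / (real P ^ k * real P)"
proof -
  define f where "f \<beta> = weyl_sum k P (real a / real q + \<beta>)" for \<beta>
  define v where "v \<beta> = gauss_avg k q a * sing_sum k n \<beta>" for \<beta>
  define e where "e \<beta> = expi (- (real n * (real a / real q + \<beta>)))" for \<beta>
  define K where "K = real s * (2 * real P) ^ (s - 1) * (27 * 2 ^ k * real Q ^ 2)"
  have \<eta>0: "0 \<le> \<eta>" by (simp add: \<eta>)
  have Q1: "1 \<le> real Q" using q by simp
  have cont: "continuous_on {-\<eta>..\<eta>} f" "continuous_on {-\<eta>..\<eta>} v" "continuous_on {-\<eta>..\<eta>} e"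
    unfolding f_def v_def e_def by (intro continuous_intros)+
  have eq: "gauss_avg k q a ^ s * expi (- (real n * real a / real q)) * integral {-\<eta>..\<eta>} (\<lambda>\<beta>. sing_sum k n \<beta> ^ s * expi (- (real n * \<beta>))) =
     integral {-\<eta>..\<eta>} (\<lambda>\<beta>. v \<beta> ^ s * e \<beta>)"
  proof -
    have "v \<beta> ^ s * e \<beta> = gauss_avg k q a ^ s * expi (- (real n * real a / real q)) * (sing_sum k n \<beta> ^ s * expi (- (real n * \<beta>)))" for \<beta>
    proof -
      have "e \<beta> = expi (- (real n * real a / real q)) * expi (- (real n * \<beta>))"
        unfolding e_def expi_add [symmetric] by (rule arg_cong[of _ _ expi]) (simp add: algebra_simps)
      then show ?thesis by (simp add: v_def power_mult_distrib)
    qed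
    then show ?thesis by (simp only: integral_mult_right)
  qed
  have n_le: "real n * \<eta> \<le> 2 ^ k * real Q"
  proof -
    have "n \<le> (2 * P) ^ k" using P(2,3) power_mono[of "P + 1" "2 * P" k] by linarith
    then have "real n \<le> real ((2 * P) ^ k)" by (simp only: of_nat_le_iff)
    then have "real n * \<eta> \<le> (2 ^ k * real P ^ k) * \<eta>" using \<eta>0 by (intro mult_right_mono) (auto simp: power_mult_distrib)
    then show ?thesis using P(3) by (simp add: \<eta>)
  qed
  have bound: "norm (f \<beta> ^ s * e \<beta> - v \<beta> ^ s * e \<beta>) \<le> K" if \<beta>: "\<beta> \<in> {-\<eta>..\<eta>}" for \<beta>
  proof -
    have "norm (f \<beta>) \<le> 2 * real P" using norm_weyl_sum_le[of k P "real a / real q + \<beta>"] by (simp add: f_def)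
    moreover have "norm (v \<beta>) \<le> 2 * real P"
    proof -
      have "real (n + 1) powr (1 / real k) \<le> real ((P + 1) ^ k) powr (1 / real k)"
        using P by (intro powr_mono2 of_nat_mono) auto
      also have "\<dots> = real (P + 1)" using k by (simp only: of_nat_power powr_realpow [symmetric] powr_powr of_nat_0_less_iff) (simp add: powr_powr)
      finally have "norm (sing_sum k n \<beta>) \<le> 2 * real P" using norm_sing_sum_le[OF k, of n \<beta>] P(3) by simp
      then have "norm (gauss_avg k q a) * norm (sing_sum k n \<beta>) \<le> 1 * (2 * real P)"
        using norm_gauss_avg_le_1[OF q(1)] by (intro mult_mono) auto
      then show ?thesis by (simp add: v_def norm_mult)
    qed
    ultimately have "norm (f \<beta> ^ s - v \<beta> ^ s) \<le> real s * (2 * real P) ^ (s - 1) * norm (f \<beta> - v \<beta>)"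
      by (rule norm_power_diff_le)
    also have "\<dots> \<le> K"
      unfolding K_def
    proof (intro mult_left_mono)
      have "norm (f \<beta> - v \<beta>) \<le> 3 * real q * (1 + 2 * pi * real n * \<bar>\<beta>\<bar>)"
        unfolding f_def v_def by (rule weyl_sum_major_arc[OF k q(1) P(1,2)])
      also have "\<dots> \<le> 3 * real Q * (9 * (2 ^ k * real Q))"
      proof (intro mult_mono)
        have "real n * \<bar>\<beta>\<bar> \<le> real n * \<eta>" using \<beta> by (intro mult_left_mono) auto
        then have "(2 * pi) * (real n * \<bar>\<beta>\<bar>) \<le> 8 * (2 ^ k * real Q)" 
          using n_le pi_less_4 by (intro mult_mono[of "2 * pi" 8 "real n * \<bar>\<beta>\<bar>" "2 ^ k * real Q"]) auto
        moreover have "1 * 1 \<le> 2 ^ k * real Q" using Q1 by (intro mult_mono) auto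
        ultimately show "1 + 2 * pi * real n * \<bar>\<beta>\<bar> \<le> 9 * (2 ^ k * real Q)" by (simp only: mult.assoc)
      qed (use q in auto)
      finally show "norm (f \<beta> - v \<beta>) \<le> 27 * 2 ^ k * real Q ^ 2" by (simp add: power2_eq_square mult_ac)
    qed auto
    finally show ?thesis unfolding left_diff_distrib [symmetric] norm_mult by (simp add: e_def)
  qed
  have "norm (integral {-\<eta>..\<eta>} (\<lambda>\<beta>. f \<beta> ^ s * e \<beta>) - integral {-\<eta>..\<eta>} (\<lambda>\<beta>. v \<beta> ^ s * e \<beta>)) =
      norm (integral {-\<eta>..\<eta>} (\<lambda>\<beta>. f \<beta> ^ s * e \<beta> - v \<beta> ^ s * e \<beta>))"
    by (intro arg_cong[of _ _ norm] Henstock_Kurzweil_Integration.integral_diff[symmetric] integrable_continuous_interval continuous_intros cont)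
  also have "\<dots> \<le> K * (\<eta> - - \<eta>)"
    by (rule integral_bound) (use \<eta>0 bound in \<open>auto intro!: continuous_intros cont\<close>)
  also have "\<dots> = 54 * real s * 2 ^ k * real Q ^ 3 * (2 * real P) ^ (s - 1) / real P ^ k"
    by (simp add: K_def \<eta> power2_eq_square power3_eq_cube)
  also have "\<dots> \<le> 54 * real s * 2 ^ k * real Q ^ 3 * (2 ^ s * real P ^ s / real P) / real P ^ k"
  proof (cases s)
    case (Suc s')
    then show ?thesis using P(3) by (intro divide_right_mono mult_left_mono) (auto simp: power_mult_distrib)
  qed simp
  also have "\<dots> = 54 * real s * 2 ^ k * 2 ^ s * real Q ^ 3 * real P ^ s / (real P ^ k * real P)" by (simp add: mult_ac)
  finally show ?thesis unfolding eq f_def e_def .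
qed

lemma singular_term_eq: "singular_term s k n q =
    (\<Sum>a\<in>{a \<in> {1..q}. coprime a q}. gauss_avg k q a ^ s * expi (- (real n * real a / real q)))"
  by (simp only: singular_term_def gauss_avg_def)

lemma norm_singular_term_le: "norm (singular_term s k n q) \<le> gauss_moment s k q"
  unfolding singular_term_eq gauss_moment_def
  by (intro order_trans[OF norm_sum] sum_mono) (simp add: norm_mult norm_power)

text \<open>Three errors: the minor arcs; the approximation on at most Q^2 major arcs, of relative
  size Q^5/P \<le> Q^(-5), which is where the exponent 10 comes from; and the completion of the
  truncated integral to \<open>sing_int\<close>, multiplied by an absolutely bounded partial
  series.\<close>

lemma circle_estimate:
  assumes k: "2 \<le> k" and s: "2 * tri k < s"
  shows "\<exists>C\<ge>0. \<exists>\<kappa>>0. \<exists>Q0\<ge>1. \<forall>n P Q. Q0 \<le> Q \<longrightarrow> P ^ k \<le> n \<longrightarrow> n < (P + 1) ^ k \<longrightarrow> Q ^ 10 \<le> P \<longrightarrow> P < (Q + 1) ^ 10 \<longrightarrow>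
    norm (of_nat (rep_count s k n) - of_real (sing_int s k n) * (\<Sum>q=1..Q. singular_term s k n q))
      \<le> C * real P ^ (s - k) * real Q powr (- \<kappa>)"
proof -
  have k1: "1 \<le> k" using k by simp
  have ks: "k < s"
  proof -
    have "k \<le> 2 * tri k" by (simp add: two_tri)
    then show ?thesis using s by simp
  qed
  define t where "t = real s / real k"
  have t: "1 < t" using ks k by (simp add: t_def)
  obtain K \<kappa>0 Q1 where K: "K \<ge> 0" and \<kappa>0: "\<kappa>0 > 0" and minor: "\<And>P Q \<eta>. Q1 \<le> Q \<Longrightarrow> Q ^ 10 \<le> P \<Longrightarrow> P < (Q + 1) ^ 10 \<Longrightarrow>
     \<eta> = real Q / real P ^ k \<Longrightarrow> 3 * \<eta> * real Q ^ 2 < 1 \<Longrightarrow>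
     \<exists>G. continuous_on UNIV G \<and> (\<forall>x. 0 \<le> G x) \<and>
       (\<forall>\<alpha>\<in>{2 * \<eta>..1 + 2 * \<eta>}. (\<forall>i\<in>farey Q. \<alpha> \<notin> farey_arc \<eta> i) \<longrightarrow> norm (weyl_sum k P \<alpha>) ^ s \<le> G \<alpha>) \<and>
       integral {2 * \<eta>..1 + 2 * \<eta>} G \<le> K * real P ^ (s - k) * real Q powr (- \<kappa>0)"
    using minor_arc_integral[OF k1 s] by blast
  define c1 where "c1 = 54 * real s * 2 ^ k * 2 ^ s"
  define c2 where "c2 = 2 * (3 ^ s / (t - 1))"
  define B where "B = (\<Sum>q. gauss_moment s k (Suc q))"
  define \<kappa> where "\<kappa> = min \<kappa>0 (min 5 (t - 1))"
  have c1: "0 \<le> c1" by (simp add: c1_def)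
  have c2: "0 \<le> c2" using t by (simp add: c2_def)
  have summ: "summable (\<lambda>q. gauss_moment s k (Suc q))" by (rule summable_gauss_moment[OF k s])
  have B: "0 \<le> B" unfolding B_def using summ gauss_moment_nonneg by (intro suminf_nonneg)
  have "norm (of_nat (rep_count s k n) - of_real (sing_int s k n) * (\<Sum>q=1..Q. singular_term s k n q))
      \<le> (K + c1 + B * c2) * real P ^ (s - k) * real Q powr (- \<kappa>)"
    if Q: "max Q1 2 \<le> Q" and nP: "P ^ k \<le> n" "n < (P + 1) ^ k" and PQ: "Q ^ 10 \<le> P" "P < (Q + 1) ^ 10" for n P Q
  proof -
    have Q2: "2 \<le> Q" and Q1: "Q1 \<le> Q" using Q by auto
    have P1: "1 \<le> P" using PQ(1) Q2 one_le_power[of Q 10] by linarith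
    define \<eta> where "\<eta> = real Q / real P ^ k"
    have \<eta>0: "0 < \<eta>" using P1 Q2 by (simp add: \<eta>_def)
    have \<eta>Q: "3 * \<eta> * real Q ^ 2 < 1"
    proof -
      have "3 * Q ^ 3 < Q ^ 7 * Q ^ 3" using power_mono[OF Q2, of 7] Q2 by (intro mult_strict_right_mono) auto
      also have "\<dots> = Q ^ 10" by (simp flip: power_add)
      also have "\<dots> \<le> P ^ k" using PQ(1) P1 k self_le_power[of P k] by linarith
      finally have "real (3 * Q ^ 3) < real (P ^ k)" by (simp only: of_nat_less_iff)
      then show ?thesis using P1 by (simp add: \<eta>_def divide_less_eq power2_eq_square power3_eq_cube)
    qed
    have \<eta>_half: "\<eta> \<le> 1 / 2"
    proof -
      have "3 * \<eta> * 1 \<le> 3 * \<eta> * real Q ^ 2" using \<eta>0 Q2 by (intro mult_left_mono) auto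
      then show ?thesis using \<eta>Q by linarith
    qed
    define g where "g \<alpha> = weyl_sum k P \<alpha> ^ s * expi (- (real n * \<alpha>))" for \<alpha>
    have g: "continuous_on UNIV g" unfolding g_def by (intro continuous_intros)
    define S where "S = (\<lambda>(q, a). gauss_avg k q a ^ s * expi (- (real n * real a / real q)))"
    define T where "T = (\<lambda>(q, a). integral {-\<eta>..\<eta>} (\<lambda>\<beta>. g (real a / real q + \<beta>)))"
    define W where "W = integral {-\<eta>..\<eta>} (\<lambda>\<beta>. sing_sum k n \<beta> ^ s * expi (- (real n * \<beta>)))"
    define J where "J = complex_of_real (sing_int s k n)"
    have R: "of_nat (rep_count s k n) = integral {2 * \<eta>..1 + 2 * \<eta>} g"
      using integral_unique[OF integral_weyl_sum_power[OF k1 nP(2), of s "2 * \<eta>"]] unfolding g_def by (simp only: add.commute)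
    have S_sum: "(\<Sum>q=1..Q. singular_term s k n q) = (\<Sum>i\<in>farey Q. S i)"
      unfolding singular_term_eq farey_def S_def by (rule sum.Sigma) auto
    obtain G where G: "continuous_on UNIV G" "\<forall>x. 0 \<le> G x"
       "\<forall>\<alpha>\<in>{2 * \<eta>..1 + 2 * \<eta>}. (\<forall>i\<in>farey Q. \<alpha> \<notin> farey_arc \<eta> i) \<longrightarrow> norm (weyl_sum k P \<alpha>) ^ s \<le> G \<alpha>"
       "integral {2 * \<eta>..1 + 2 * \<eta>} G \<le> K * real P ^ (s - k) * real Q powr (- \<kappa>0)"
      using minor[OF Q1 PQ \<eta>_def \<eta>Q] by blast
    have "norm (integral {2 * \<eta>..1 + 2 * \<eta>} g - (\<Sum>(q, a)\<in>farey Q. integral {-\<eta>..\<eta>} (\<lambda>\<beta>. g (real a / real q + \<beta>)))) \<le> integral {2 * \<eta>..1 + 2 * \<eta>} G"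
    proof (rule arcs_integral_diff_bound[OF g G(1) _ \<eta>Q])
      fix x assume "x \<in> {2 * \<eta>..1 + 2 * \<eta>}" "\<forall>i\<in>farey Q. x \<notin> farey_arc \<eta> i"
      then show "norm (g x) \<le> G x" using G(3) by (simp add: g_def norm_mult norm_power)
    qed (use \<eta>0 G(2) in auto)
    then have e1: "norm (integral {2 * \<eta>..1 + 2 * \<eta>} g - (\<Sum>i\<in>farey Q. T i)) \<le> K * real P ^ (s - k) * real Q powr (- \<kappa>0)"
      using G(4) unfolding T_def by linarith
    have "norm (\<Sum>i\<in>farey Q. T i - S i * W) \<le> (\<Sum>i\<in>farey Q. c1 * real Q ^ 3 * real P ^ s / (real P ^ k * real P))"
    proof (intro order_trans[OF norm_sum] sum_mono)
      fix i assume "i \<in> farey Q"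
      then obtain q a where i: "i = (q, a)" "1 \<le> q" "q \<le> Q" by (auto simp: farey_def)
      show "norm (T i - S i * W) \<le> c1 * real Q ^ 3 * real P ^ s / (real P ^ k * real P)"
        using major_arc_integral[OF k1 i(2,3) nP P1 \<eta>_def, of a s]
        by (simp only: i(1) T_def S_def W_def g_def c1_def prod.case)
    qed
    also have "\<dots> = real (card (farey Q)) * (c1 * real Q ^ 3 * real P ^ s / (real P ^ k * real P))" by simp
    also have "\<dots> \<le> real Q ^ 2 * (c1 * real Q ^ 3 * real P ^ s / (real P ^ k * real P))"
      using card_farey_le[of Q] c1 by (intro mult_right_mono) (auto simp flip: of_nat_power)
    also have "\<dots> = c1 * real P ^ (s - k) * (real Q ^ 5 / real P)"
    proof -
      have "real P ^ s = real P ^ (s - k) * real P ^ k" using ks by (simp flip: power_add)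
      moreover have "real Q ^ 2 * real Q ^ 3 = real Q ^ 5" by (simp flip: power_add)
      ultimately show ?thesis using P1 by (simp add: field_simps)
    qed
    also have "\<dots> \<le> c1 * real P ^ (s - k) * real Q powr (- 5)"
    proof (rule mult_left_mono)
      have "real (Q ^ 10) \<le> real P" using PQ(1) by (simp only: of_nat_le_iff)
      then have "real Q ^ 5 / real P \<le> real Q ^ 5 / real Q ^ 10" using Q2 P1 by (intro divide_left_mono) auto
      also have "real Q ^ 10 = real Q ^ 5 * real Q ^ 5" by (simp flip: power_add)
      also have "real Q ^ 5 / (real Q ^ 5 * real Q ^ 5) = 1 / real Q ^ 5"
        unfolding divide_divide_eq_left [symmetric] using Q2 by simp
      also have "\<dots> = real Q powr (- 5)" using Q2 by (simp add: powr_minus_divide)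
      finally show "real Q ^ 5 / real P \<le> real Q powr (- 5)" .
    qed (use c1 in auto)
    finally have e2: "norm ((\<Sum>i\<in>farey Q. T i) - (\<Sum>i\<in>farey Q. S i) * W) \<le> c1 * real P ^ (s - k) * real Q powr (- 5)"
      by (simp only: sum_subtractf sum_distrib_right)
    have "norm (\<Sum>i\<in>farey Q. S i) \<le> (\<Sum>q=1..Q. gauss_moment s k q)"
      unfolding S_sum [symmetric] by (intro order_trans[OF norm_sum] sum_mono norm_singular_term_le)
    also have "\<dots> = (\<Sum>q<Q. gauss_moment s k (Suc q))"
      by (rule sum.reindex_bij_witness[of _ Suc "\<lambda>q. q - 1"]) auto
    also have "\<dots> \<le> B" unfolding B_def by (intro sum_le_suminf summ) (auto simp: gauss_moment_nonneg)
    finally have S_le: "norm (\<Sum>i\<in>farey Q. S i) \<le> B" .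
    have "norm (J - W) \<le> c2 * \<eta> powr (1 - t)"
      unfolding J_def W_def c2_def t_def by (rule sing_int_truncation[OF k1 ks \<eta>0 \<eta>_half])
    also have "\<eta> powr (1 - t) = real P ^ (s - k) * real Q powr (- (t - 1))"
    proof -
      have "\<eta> powr (1 - t) = real Q powr (1 - t) / (real P ^ k) powr (1 - t)" by (simp only: \<eta>_def powr_divide)
      also have "(real P ^ k) powr (1 - t) = real P powr (real k * (1 - t))" using P1 by (simp flip: powr_realpow add: powr_powr)
      also have "real k * (1 - t) = - real (s - k)" using k ks by (simp add: t_def field_simps of_nat_diff)
      also have "real P powr - real (s - k) = 1 / real P ^ (s - k)" using P1 by (simp only: powr_minus_divide) (simp add: powr_realpow)
      finally show ?thesis by simp
    qed
    finally have JW: "norm (J - W) \<le> c2 * (real P ^ (s - k) * real Q powr (- (t - 1)))" .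
    have "norm ((\<Sum>i\<in>farey Q. S i) * W - J * (\<Sum>i\<in>farey Q. S i)) = norm (\<Sum>i\<in>farey Q. S i) * norm (J - W)"
      by (simp only: mult.commute[of J] right_diff_distrib [symmetric] norm_mult norm_minus_commute)
    also have "\<dots> \<le> B * (c2 * (real P ^ (s - k) * real Q powr (- (t - 1))))"
      by (intro mult_mono S_le JW B) auto
    finally have e3: "norm ((\<Sum>i\<in>farey Q. S i) * W - J * (\<Sum>i\<in>farey Q. S i)) \<le> B * (c2 * (real P ^ (s - k) * real Q powr (- (t - 1))))" .
    have mono: "real Q powr (- x) \<le> real Q powr (- \<kappa>)" if "\<kappa> \<le> x" for x
      using that Q2 by (intro powr_mono) auto
    have "norm (integral {2 * \<eta>..1 + 2 * \<eta>} g - J * (\<Sum>i\<in>farey Q. S i)) \<le>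
        K * real P ^ (s - k) * real Q powr (- \<kappa>0) + c1 * real P ^ (s - k) * real Q powr (- 5) + B * (c2 * (real P ^ (s - k) * real Q powr (- (t - 1))))"
      using norm_triangle_mono[OF norm_triangle_mono[OF e1 e2] e3] by simp
    also have "\<dots> \<le> K * real P ^ (s - k) * real Q powr (- \<kappa>) + c1 * real P ^ (s - k) * real Q powr (- \<kappa>) + B * (c2 * (real P ^ (s - k) * real Q powr (- \<kappa>)))"
      using K c1 c2 B by (intro add_mono mult_left_mono mono) (auto simp: \<kappa>_def)
    also have "\<dots> = (K + c1 + B * c2) * real P ^ (s - k) * real Q powr (- \<kappa>)" by (simp add: algebra_simps)
    finally show ?thesis unfolding R S_sum J_def .
  qed
  moreover have "0 \<le> K + c1 + B * c2" using K c1 c2 B by simp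
  moreover have "0 < \<kappa>" using \<kappa>0 t by (simp add: \<kappa>_def)
  ultimately show ?thesis
    by (intro exI[of _ "K + c1 + B * c2"] conjI exI[of _ \<kappa>] exI[of _ "max Q1 2"]) auto
qed

section \<open>Passage to the limit\<close>

lemma floor_root_function:
  assumes k: "1 \<le> k"
  obtains r :: "nat \<Rightarrow> nat" where "\<And>n. r n ^ k \<le> n" "\<And>n. n < (r n + 1) ^ k" "filterlim r at_top sequentially"
proof -
  have "\<exists>y. y ^ k \<le> n \<and> n < (y + 1) ^ k" for n :: nat
  proof -
    have "n < (n + 1) ^ k" using k self_le_power[of "n + 1" k] by linarith
    then show ?thesis by (rule nat_root_bracket[OF k]) blast
  qed
  then have "\<forall>n::nat. \<exists>y. y ^ k \<le> n \<and> n < (y + 1) ^ k" by blast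
  from choice[OF this] obtain r :: "nat \<Rightarrow> nat" where r: "\<And>n. r n ^ k \<le> n" "\<And>n. n < (r n + 1) ^ k" by blast
  have "filterlim r at_top sequentially"
    unfolding filterlim_at_top eventually_sequentially
  proof (intro allI exI impI)
    fix Z n :: nat assume "Z ^ k \<le> n"
    then have "Z ^ k < (r n + 1) ^ k" using r(2)[of n] by linarith
    then have "Z < r n + 1" by (rule power_less_imp_less_base) simp
    then show "Z \<le> r n" by simp
  qed
  then show ?thesis using r that by blast
qed

theorem asymptotic_formula_large_s:
  assumes k: "2 \<le> k" and s: "2 * tri k < s"
  shows "asymptotic_formula s k"
proof -
  have k1: "1 \<le> k" using k by simp
  have ks: "k < s"
  proof -
    have "k \<le> 2 * tri k" by (simp add: two_tri)
    then show ?thesis using s by simp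
  qed
  define t where "t = real s / real k"
  have t: "1 < t" using ks k by (simp add: t_def)
  have summ: "summable (\<lambda>q. gauss_moment s k (Suc q))" by (rule summable_gauss_moment[OF k s])
  have summ_st: "summable (\<lambda>q. singular_term s k n (Suc q))" for n
    by (rule summable_comparison_test'[OF summ, where N = 0]) (rule norm_singular_term_le)
  define B where "B = (\<Sum>q. gauss_moment s k (Suc q))"
  define \<tau> where "\<tau> Q = (\<Sum>q. gauss_moment s k (Suc (q + Q)))" for Q
  have tail: "norm (singular_series s k n - (\<Sum>q=1..Q. singular_term s k n q)) \<le> \<tau> Q" for n Q
  proof -
    have "(\<Sum>q=1..Q. singular_term s k n q) = (\<Sum>q<Q. singular_term s k n (Suc q))"
      by (rule sum.reindex_bij_witness[of _ Suc "\<lambda>q. q - 1"]) auto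
    then have "singular_series s k n - (\<Sum>q=1..Q. singular_term s k n q) = (\<Sum>q. singular_term s k n (Suc (q + Q)))"
      unfolding singular_series_def suminf_split_initial_segment[OF summ_st, of n Q] by simp
    also have "norm \<dots> \<le> \<tau> Q"
      unfolding \<tau>_def
      by (intro norm_suminf_le norm_singular_term_le summable_ignore_initial_segment[OF summ])
    finally show ?thesis .
  qed
  have series_le: "norm (singular_series s k n) \<le> B" for n
    unfolding singular_series_def B_def by (intro norm_suminf_le norm_singular_term_le summ)
  have \<tau>_lim: "\<tau> \<longlonglongrightarrow> 0"
    unfolding \<tau>_def using suminf_exist_split2[OF summ] by simp
  obtain C \<kappa> Q0 where C: "C \<ge> 0" and \<kappa>: "\<kappa> > 0" and Q0: "Q0 \<ge> 1" and est: "\<And>n P Q. Q0 \<le> Q \<Longrightarrow> P ^ k \<le> n \<Longrightarrow> n < (P + 1) ^ k \<Longrightarrow> Q ^ 10 \<le> P \<Longrightarrow> P < (Q + 1) ^ 10 \<Longrightarrow>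
    norm (of_nat (rep_count s k n) - of_real (sing_int s k n) * (\<Sum>q=1..Q. singular_term s k n q))
      \<le> C * real P ^ (s - k) * real Q powr (- \<kappa>)"
    using circle_estimate[OF k s] by blast
  obtain P where P: "\<And>n. P n ^ k \<le> n" "\<And>n. n < (P n + 1) ^ k" "filterlim P at_top sequentially"
    using floor_root_function[OF k1] by blast
  obtain r where r: "\<And>n. r n ^ 10 \<le> n" "\<And>n. n < (r n + 1) ^ 10" "filterlim r at_top sequentially"
    using floor_root_function[of 10] by auto
  \<comment> \<open>The integral part of the tenth root of P; as it tends to infinity, negative
    powers of Q and tails beyond Q tend to 0.\<close>
  define Q where "Q n = r (P n)" for n
  have Q: "filterlim Q at_top sequentially" unfolding Q_def by (rule filterlim_compose[OF r(3) P(3)])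
  define M where "M n = real n powr (t - 1)" for n
  define L where "L = Gamma (1 + 1 / real k) ^ s / Gamma t"
  have ratio: "(\<lambda>n. sing_int s k n / M n) \<longlonglongrightarrow> L"
  proof -
    have "(\<lambda>n. Gamma (1 + 1 / real k) ^ s * (pochhammer t n / fact n / real n powr (t - 1))) \<longlonglongrightarrow> Gamma (1 + 1 / real k) ^ s * (1 / Gamma t)"
      using t by (intro tendsto_mult_left pochhammer_div_fact_asymp) simp
    then show ?thesis by (simp add: sing_int_def M_def L_def t_def)
  qed
  \<comment> \<open>The three terms are the error of \<open>circle_estimate\<close>, the tail of the
    singular series beyond Q, and the deviation of the exact singular integral from its asymptotic
    value.\<close>
  define u where "u n = C * real (Q n) powr (- \<kappa>) + \<bar>sing_int s k n / M n\<bar> * \<tau> (Q n) + \<bar>sing_int s k n / M n - L\<bar> * B" for n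
  have "u \<longlonglongrightarrow> C * 0 + \<bar>L\<bar> * 0 + \<bar>L - L\<bar> * B"
    unfolding u_def
  proof (intro tendsto_add tendsto_mult tendsto_const tendsto_rabs tendsto_diff ratio)
    show "(\<lambda>n. real (Q n) powr (- \<kappa>)) \<longlonglongrightarrow> 0"
      using \<kappa> by (intro tendsto_neg_powr filterlim_compose[OF filterlim_real_sequentially Q]) simp
    show "(\<lambda>n. \<tau> (Q n)) \<longlonglongrightarrow> 0" by (rule filterlim_compose[OF \<tau>_lim Q])
  qed
  then have u: "u \<longlonglongrightarrow> 0" by simp
  define err where "err n = of_nat (rep_count s k n) - of_real L * singular_series s k n * of_real (M n)" for n
  have err_le: "\<forall>\<^sub>F n in sequentially. norm (err n) \<le> u n * M n"
    using filterlim_at_top[THEN iffD1, OF Q, rule_format, of Q0] eventually_gt_at_top[of 0]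
  proof eventually_elim
    case (elim n)
    define \<Sigma> where "\<Sigma> = (\<Sum>q=1..Q n. singular_term s k n q)"
    have M0: "0 < M n" using elim by (simp add: M_def)
    have PM: "real (P n) ^ (s - k) \<le> M n"
    proof (cases "P n = 0")
      case True
      then show ?thesis using ks M0 by (simp add: power_0_left)
    next
      case False
      have "real k * (t - 1) = real (s - k)" using k ks by (simp add: t_def right_diff_distrib of_nat_diff)
      then have "real (P n) ^ (s - k) = real (P n) powr (real k * (t - 1))"
        using False by (simp only: powr_realpow of_nat_0_less_iff gr0_conv_Suc) (simp add: powr_realpow)
      also have "\<dots> = (real (P n ^ k)) powr (t - 1)" using False by (simp add: powr_realpow [symmetric] powr_powr)
      also have "\<dots> \<le> M n" unfolding M_def using P(1)[of n] t by (intro powr_mono2 of_nat_mono) auto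
      finally show ?thesis .
    qed
    have "norm (of_nat (rep_count s k n) - of_real (sing_int s k n) * \<Sigma>) \<le> C * real (P n) ^ (s - k) * real (Q n) powr (- \<kappa>)"
      unfolding \<Sigma>_def by (rule est[OF elim(1) P(1,2)]) (simp_all only: Q_def r(1,2))
    also have "\<dots> \<le> C * M n * real (Q n) powr (- \<kappa>)" using C PM by (intro mult_right_mono mult_left_mono) auto
    finally have a1: "norm (of_nat (rep_count s k n) - of_real (sing_int s k n) * \<Sigma>) \<le> C * M n * real (Q n) powr (- \<kappa>)" .
    have "norm (of_real (sing_int s k n) * \<Sigma> - of_real (sing_int s k n) * singular_series s k n) = \<bar>sing_int s k n\<bar> * norm (singular_series s k n - \<Sigma>)"
      by (simp only: right_diff_distrib [symmetric] norm_mult norm_of_real norm_minus_commute)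
    also have "\<dots> \<le> \<bar>sing_int s k n\<bar> * \<tau> (Q n)" unfolding \<Sigma>_def by (intro mult_left_mono tail) auto
    finally have a2: "norm (of_real (sing_int s k n) * \<Sigma> - of_real (sing_int s k n) * singular_series s k n) \<le> \<bar>sing_int s k n\<bar> * \<tau> (Q n)" .
    have "of_real (sing_int s k n) * singular_series s k n - of_real L * singular_series s k n * of_real (M n) =
        of_real (sing_int s k n - L * M n) * singular_series s k n"
      by (simp add: algebra_simps)
    then have "norm (of_real (sing_int s k n) * singular_series s k n - of_real L * singular_series s k n * of_real (M n)) =
        \<bar>sing_int s k n - L * M n\<bar> * norm (singular_series s k n)"
      by (simp only: norm_mult norm_of_real)
    also have "\<dots> \<le> \<bar>sing_int s k n - L * M n\<bar> * B" by (intro mult_left_mono series_le) auto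
    finally have a3: "norm (of_real (sing_int s k n) * singular_series s k n - of_real L * singular_series s k n * of_real (M n)) \<le> \<bar>sing_int s k n - L * M n\<bar> * B" .
    have "norm (err n) \<le> C * M n * real (Q n) powr (- \<kappa>) + \<bar>sing_int s k n\<bar> * \<tau> (Q n) + \<bar>sing_int s k n - L * M n\<bar> * B"
      using norm_triangle_mono[OF norm_triangle_mono[OF a1 a2] a3] by (simp add: err_def)
    also have "\<dots> = u n * M n"
    proof -
      have "\<bar>sing_int s k n\<bar> = \<bar>sing_int s k n / M n\<bar> * M n" using M0 by (simp add: abs_mult abs_divide)
      moreover have "sing_int s k n - L * M n = (sing_int s k n / M n - L) * M n" using M0 by (simp add: field_simps)
      then have "\<bar>sing_int s k n - L * M n\<bar> = \<bar>sing_int s k n / M n - L\<bar> * M n" using M0 by (simp only: abs_mult abs_of_pos)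
      ultimately show ?thesis unfolding u_def by (simp only: distrib_left distrib_right mult_ac)
    qed
    finally show ?case .
  qed
  have "err \<in> o[sequentially](\<lambda>n. complex_of_real (M n))"
  proof (rule landau_o.smallI)
    fix c :: real assume c: "c > 0"
    show "\<forall>\<^sub>F n in sequentially. norm (err n) \<le> c * norm (complex_of_real (M n))"
      using err_le order_tendstoD(2)[OF u c]
    proof eventually_elim
      case (elim n)
      have "u n * M n \<le> c * M n" using elim(2) by (intro mult_right_mono) (auto simp: M_def)
      then show ?case using elim(1) by (simp add: M_def)
    qed
  qed
  then show ?thesis
    unfolding asymptotic_formula_def err_def M_def L_def t_def using summ_st by simp
qed

section \<open>The bound for \<open>Gtilde\<close> and the numerical constants\<close>

theorem Gtilde_le:
  assumes k: "2 \<le> k"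
  shows "Gtilde_admissible k (k ^ 2 + k + 1)" "Gtilde k \<le> k ^ 2 + k + 1"
proof -
  have "2 * tri k = k ^ 2 + k" by (simp add: two_tri power2_eq_square)
  then show adm: "Gtilde_admissible k (k ^ 2 + k + 1)"
    unfolding Gtilde_admissible_def using asymptotic_formula_large_s[OF k] by auto
  then show "Gtilde k \<le> k ^ 2 + k + 1" unfolding Gtilde_def by (rule Least_le)
qed

theorem theorem1p3:
  fixes \<xi> C :: real
  assumes "20 * \<xi> ^ 3 + 4 * \<xi> ^ 2 - 1 = 0"
    and "C = (19 + 75 * \<xi> - 12 * \<xi> ^ 2) / (8 + 60 * \<xi>)"
  shows "(0.312383 \<le> \<xi> \<and> \<xi> < 0.312384) \<and>
         (1.542749 \<le> C \<and> C < 1.542750) \<and>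
         (\<exists>(A::real) (k0::nat). \<forall>k\<ge>k0.
            (\<exists>t. Gtilde_admissible k t) \<and> real (Gtilde k) < C * real k ^ 2 + A * real k)"
proof -
  have mono: "20 * u ^ 3 + 4 * u ^ 2 < 20 * v ^ 3 + 4 * v ^ 2" if "0 \<le> u" "u < v" for u v :: real
    using that power_strict_mono[of u v 3] power_strict_mono[of u v 2] by simp
  have nonneg: "0 \<le> \<xi>"
  proof (rule ccontr)
    assume neg: "\<not> 0 \<le> \<xi>"
    \<comment> \<open>For negative \<xi> this decomposition shows a value of at most -24/25, so the
      root is nonnegative.\<close>
    have "20 * \<xi> ^ 3 + 4 * \<xi> ^ 2 - 1 = 20 * (\<xi> * (\<xi> + 1 / 5)\<^sup>2) - 4 * (\<xi> + 1 / 10)\<^sup>2 - 24 / 25"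
      by (simp add: power2_eq_square power3_eq_cube field_simps)
    moreover have "\<xi> * (\<xi> + 1 / 5)\<^sup>2 \<le> 0" using neg by (intro mult_nonpos_nonneg) auto
    ultimately show False using assms(1) zero_le_power2[of "\<xi> + 1 / 10"] by linarith
  qed
  \<comment> \<open>A finer bracket than the claimed one is required for C: at \<xi> = 0.312384 the
    quotient has already dropped below 1.542749.\<close>
  have lower: "0.3123831 \<le> \<xi>"
  proof (rule ccontr)
    assume "\<not> 0.3123831 \<le> \<xi>"
    then have "20 * \<xi> ^ 3 + 4 * \<xi> ^ 2 < 20 * 0.3123831 ^ 3 + 4 * 0.3123831 ^ 2" using nonneg by (intro mono) auto
    also have "\<dots> < (1::real)" by (simp add: power2_eq_square power3_eq_cube)
    finally show False using assms(1) by simp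
  qed
  have upper: "\<xi> \<le> 0.3123832"
  proof (rule ccontr)
    assume "\<not> \<xi> \<le> 0.3123832"
    then have "20 * 0.3123832 ^ 3 + 4 * 0.3123832 ^ 2 < 20 * \<xi> ^ 3 + 4 * \<xi> ^ 2" by (intro mono) auto
    moreover have "(1::real) < 20 * 0.3123832 ^ 3 + 4 * 0.3123832 ^ 2" by (simp add: power2_eq_square power3_eq_cube)
    ultimately show False using assms(1) by simp
  qed
  have sq: "0.3123831 ^ 2 \<le> \<xi> ^ 2" "\<xi> ^ 2 \<le> 0.3123832 ^ 2" using lower upper nonneg by (auto intro!: power_mono)
  have den: "8 + 60 * \<xi> > 0" using nonneg by simp
  have C_lower: "1.542749 \<le> C"
    unfolding assms(2) using den sq lower upper by (simp add: le_divide_eq power2_eq_square)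
  have C_upper: "C < 1.542750"
    unfolding assms(2) using den sq lower upper by (simp add: divide_less_eq power2_eq_square)
  have "(\<exists>t. Gtilde_admissible k t) \<and> real (Gtilde k) < C * real k ^ 2 + 2 * real k" if k: "2 \<le> k" for k
  proof (intro conjI exI)
    show "Gtilde_admissible k (k ^ 2 + k + 1)" by (rule Gtilde_le[OF k])
    have "real (Gtilde k) \<le> real (k ^ 2 + k + 1)" using Gtilde_le(2)[OF k] by (simp only: of_nat_le_iff)
    \<comment> \<open>k \<ge> 2 gives k + 1 < 2k, whence the choice A = 2.\<close>
    also have "\<dots> < 1 * real k ^ 2 + 2 * real k" using k by simp
    also have "\<dots> \<le> C * real k ^ 2 + 2 * real k" using C_lower by (intro add_right_mono mult_right_mono) auto
    finally show "real (Gtilde k) < C * real k ^ 2 + 2 * real k" .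
  qed
  then have "\<exists>(A::real) (k0::nat). \<forall>k\<ge>k0.
      (\<exists>t. Gtilde_admissible k t) \<and> real (Gtilde k) < C * real k ^ 2 + A * real k"
    by (intro exI[of _ 2] allI impI)
  then show ?thesis using lower upper C_lower C_upper by simp
qed

end
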